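(* Let $M_\nu^{m+1}$ be a connected semi-Riemannian manifold with $m\geq2$. Then $M_\nu^{m+1}$ is a space form (i.e., has constant sectional curvature) if and only if every sufficiently small geodesic sphere in $M_\nu^{m+1}$ is totally umbilical.
   Context: $M_\nu^{m+1}$ is an $(m+1)$-dimensional semi-Riemannian manifold with metric $\langle\cdot,\cdot\rangle_\nu$ of index $\nu$ and Levi-Civita connection $\nabla$; the sectional curvature is defined only for nondegenerate tangent planes. A geodesic sphere with center $p$ and radius $R>0$ is a (non-lightlike) hypersurface formed by points $\exp_p(RV)$, where $V\in T_pM$ is unit spacelike ($\langle V,V\rangle_\nu=1$) or unit timelike ($\langle V,V\rangle_\nu=-1$), taken inside a normal neighborhood of $p$. "Sufficiently small" means that each $p$ has a normal neighborhood $U=\exp_p(\tilde U)$ such that the condition is imposed on the geodesic spheres $\exp_p(\{x\in\tilde U:\langle x,x\rangle_\nu=R^2\})$ and $\exp_p(\{x\in\tilde U:\langle x,x\rangle_\nu=-R^2\})$, $R>0$. With $\xi$ a unit normal field of a non-lightlike hypersurface $\Sigma$, the shape operator is $S_p(X)=-(\nabla_X\xi)(p)$; $\Sigma$ is totally umbilical if at each point every non-lightlike tangent vector is an eigenvector of $S_p$ (equivalently, $S_p$ is a multiple of the identity). *)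

theory Defs
  imports "HOL-Analysis.Analysis"
begin

subsection \<open>Smooth functions\<close>

(* Only used on open sets S of finite-dimensional spaces, where it is the usual C^k. *)
primrec C_k_on :: "nat \<Rightarrow> 'a::real_normed_vector set \<Rightarrow> ('a \<Rightarrow> 'b::real_normed_vector) \<Rightarrow> bool" where
  "C_k_on 0 S f \<longleftrightarrow> continuous_on S f"
| "C_k_on (Suc k) S f \<longleftrightarrow>
     (\<forall>x\<in>S. f differentiable (at x)) \<and> (\<forall>v. C_k_on k S (\<lambda>x. frechet_derivative f (at x) v))"

definition smooth_on :: "'a::real_normed_vector set \<Rightarrow> ('a \<Rightarrow> 'b::real_normed_vector) \<Rightarrow> bool" where
  "smooth_on S f \<longleftrightarrow> (\<forall>k. C_k_on k S f)"

subsection \<open>Smooth manifolds\<close>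

(* The manifold is the whole type 'a; a chart is its domain together with its coordinate map,
   whose values outside the domain are irrelevant. *)
type_synonym ('a, 'e) chart = "'a set \<times> ('a \<Rightarrow> 'e)"

definition chart_dom :: "('a, 'e) chart \<Rightarrow> 'a set" where
  "chart_dom c = fst c"

definition chart_map :: "('a, 'e) chart \<Rightarrow> 'a \<Rightarrow> 'e" where
  "chart_map c = snd c"

definition chart_ran :: "('a, 'e) chart \<Rightarrow> 'e set" where
  "chart_ran c = chart_map c ` chart_dom c"

definition chart_inv :: "('a, 'e) chart \<Rightarrow> 'e \<Rightarrow> 'a" where
  "chart_inv c = inv_into (chart_dom c) (chart_map c)"

definition transition :: "('a, 'e) chart \<Rightarrow> ('a, 'e) chart \<Rightarrow> 'e \<Rightarrow> 'e" where
  "transition c d = chart_map d \<circ> chart_inv c"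

locale smooth_manifold =
  fixes A :: "('a::{t2_space, second_countable_topology}, 'e::euclidean_space) chart set"
  assumes chart_dom_open: "c \<in> A \<Longrightarrow> open (chart_dom c)"
    and chart_ran_open: "c \<in> A \<Longrightarrow> open (chart_ran c)"
    and chart_homeomorphism:
      "c \<in> A \<Longrightarrow> homeomorphism (chart_dom c) (chart_ran c) (chart_map c) (chart_inv c)"
    and charts_cover: "(\<Union>c\<in>A. chart_dom c) = UNIV"
    and transition_smooth:
      "c \<in> A \<Longrightarrow> d \<in> A \<Longrightarrow>
        smooth_on (chart_map c ` (chart_dom c \<inter> chart_dom d)) (transition c d)"

subsection \<open>Semi-Riemannian metrics\<close>

text \<open>
  A tangent vector at p is represented, with respect to a chart c around p, by its coordinate
  vector in the model space.  Below, \<open>h x u v\<close> is the value of a metric, expressed in one chart,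
  on the coordinate vectors u, v at the point with coordinates x, and a metric on the manifold
  assigns to every chart c such a local expression \<open>g c\<close>, subject to the transformation law of a
  covariant 2-tensor.  All notions introduced below are independent of the chart that is used to
  represent tangent vectors.
\<close>

definition form_nondegenerate_on :: "'e::real_vector set \<Rightarrow> ('e \<Rightarrow> 'e \<Rightarrow> real) \<Rightarrow> bool" where
  "form_nondegenerate_on P b \<longleftrightarrow> (\<forall>u\<in>P. (\<forall>v\<in>P. b u v = 0) \<longrightarrow> u = 0)"

definition form_index :: "('e::euclidean_space \<Rightarrow> 'e \<Rightarrow> real) \<Rightarrow> nat" where
  "form_index b = Max {dim W | W. subspace W \<and> (\<forall>w\<in>W. w \<noteq> 0 \<longrightarrow> b w w < 0)}"

locale semi_riemannian_manifold = smooth_manifold A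
  for A :: "('a::{t2_space, second_countable_topology}, 'e::euclidean_space) chart set" +
  fixes g :: "('a, 'e) chart \<Rightarrow> 'e \<Rightarrow> 'e \<Rightarrow> 'e \<Rightarrow> real" and \<nu> :: nat
  assumes metric_smooth: "c \<in> A \<Longrightarrow> smooth_on (chart_ran c) (\<lambda>x. g c x u v)"
    and metric_bilinear: "c \<in> A \<Longrightarrow> x \<in> chart_ran c \<Longrightarrow> bilinear (g c x)"
    and metric_sym: "c \<in> A \<Longrightarrow> x \<in> chart_ran c \<Longrightarrow> g c x u v = g c x v u"
    and metric_nondegenerate:
      "c \<in> A \<Longrightarrow> x \<in> chart_ran c \<Longrightarrow> form_nondegenerate_on UNIV (g c x)"
    and metric_index: "c \<in> A \<Longrightarrow> x \<in> chart_ran c \<Longrightarrow> form_index (g c x) = \<nu>"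
    and metric_transformation:
      "c \<in> A \<Longrightarrow> d \<in> A \<Longrightarrow> x \<in> chart_map c ` (chart_dom c \<inter> chart_dom d) \<Longrightarrow>
        g c x u v = g d (transition c d x)
          (frechet_derivative (transition c d) (at x) u)
          (frechet_derivative (transition c d) (at x) v)"

subsection \<open>The Levi-Civita connection in a chart\<close>

(* The connection whose Christoffel form is B at x has nabla_u v = B u v for coordinate-constant
   fields u, v.  The two conditions say that it is torsion-free and metric,
   and levi_civita_form_unique below shows that they determine B. *)
definition is_levi_civita_form ::
  "('e::euclidean_space \<Rightarrow> 'e \<Rightarrow> 'e \<Rightarrow> real) \<Rightarrow> 'e \<Rightarrow> ('e \<Rightarrow> 'e \<Rightarrow> 'e) \<Rightarrow> bool" where
  "is_levi_civita_form h x B \<longleftrightarrow>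
     bilinear B \<and> (\<forall>u v. B u v = B v u) \<and>
     (\<forall>u v w. frechet_derivative (\<lambda>y. h y v w) (at x) u = h x (B u v) w + h x v (B u w))"

definition christoffel ::
  "('e::euclidean_space \<Rightarrow> 'e \<Rightarrow> 'e \<Rightarrow> real) \<Rightarrow> 'e \<Rightarrow> 'e \<Rightarrow> 'e \<Rightarrow> 'e" where
  "christoffel h x = (THE B. is_levi_civita_form h x B)"

definition nabla ::
  "('e::euclidean_space \<Rightarrow> 'e \<Rightarrow> 'e \<Rightarrow> real) \<Rightarrow> ('e \<Rightarrow> 'e) \<Rightarrow> ('e \<Rightarrow> 'e) \<Rightarrow> 'e \<Rightarrow> 'e" where
  "nabla h X Y x = frechet_derivative Y (at x) (X x) + christoffel h x (X x) (Y x)"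

definition lie_bracket :: "('e::euclidean_space \<Rightarrow> 'e) \<Rightarrow> ('e \<Rightarrow> 'e) \<Rightarrow> 'e \<Rightarrow> 'e" where
  "lie_bracket X Y x = frechet_derivative Y (at x) (X x) - frechet_derivative X (at x) (Y x)"

lemma levi_civita_form_unique:
  fixes h :: "'e::euclidean_space \<Rightarrow> 'e \<Rightarrow> 'e \<Rightarrow> real"
  assumes S: "open S" "x \<in> S"
    and bil: "\<And>y. y \<in> S \<Longrightarrow> bilinear (h y)"
    and sym: "\<And>y u v. y \<in> S \<Longrightarrow> h y u v = h y v u"
    and nd: "form_nondegenerate_on UNIV (h x)"
    and diff: "\<And>u v. (\<lambda>y. h y u v) differentiable (at x)"
  shows "\<exists>!B. is_levi_civita_form h x B"
proof -
  define D where "D u v w = frechet_derivative (\<lambda>y. h y v w) (at x) u" for u v w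
  have der: "((\<lambda>y. h y v w) has_derivative (\<lambda>u. D u v w)) (at x)" for v w
    using diff frechet_derivative_works unfolding D_def by fastforce
  have D_eq: "D u v w = F u"
    if "((\<lambda>y. f y) has_derivative F) (at x)" "\<And>y. y \<in> S \<Longrightarrow> f y = h y v w" for f F u v w
  proof -
    have "((\<lambda>y. h y v w) has_derivative F) (at x)"
      using has_derivative_transform_within_open[OF that(1) S] that(2) by auto
    then show ?thesis
      using has_derivative_unique[OF der] by metis
  qed
  have D_sym: "D u v w = D u w v" for u v w
    by (rule D_eq[OF der]) (simp add: sym)
  have D_add1: "D (u + u') v w = D u v w + D u' v w"
    and D_scale1: "D (r *\<^sub>R u) v w = r * D u v w" for u u' v w r
    using linear_add[OF has_derivative_linear[OF der]] linear_scale[OF has_derivative_linear[OF der]]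
    by auto
  have D_add2: "D u (v + v') w = D u v w + D u v' w" for u v v' w
    by (rule D_eq[OF has_derivative_add[OF der der]]) (simp add: bil bilinear_ladd)
  have D_scale2: "D u (r *\<^sub>R v) w = r * D u v w" for u v w r
    by (rule D_eq[OF has_derivative_mult_right[OF der]]) (simp add: bil bilinear_lmul)
  have D_add3: "D u v (w + w') = D u v w + D u v w'" for u v w w'
    using D_add2 D_sym by metis
  have D_scale3: "D u v (r *\<^sub>R w) = r * D u v w" for u v w r
    using D_scale2 D_sym by metis
  define K where "K u v w = (D u v w + D v w u - D w u v) / 2" for u v w
  note bx = bil[OF S(2)]
  have inj: "z = z'" if "\<And>w. h x z w = h x z' w" for z z'
  proof -
    have "\<forall>w. h x (z - z') w = 0"
      using that by (simp add: bilinear_lsub[OF bx])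
    then show ?thesis
      using nd unfolding form_nondegenerate_on_def by auto
  qed
  have lin_h: "linear (h x z)" for z
    using bx unfolding bilinear_def by auto
  have lin_K: "linear (K u v)" for u v
    by (rule linearI) (simp_all add: K_def D_add1 D_scale1 D_add2 D_scale2 D_add3 D_scale3 field_simps)
  have riesz: "\<exists>z. \<forall>w. h x z w = f w" if f: "linear f" for f :: "'e \<Rightarrow> real"
  proof -
    define \<phi> where "\<phi> z = (\<Sum>b\<in>Basis. h x z b *\<^sub>R b)" for z
    have \<phi>_b: "\<phi> z \<bullet> b = h x z b" if "b \<in> Basis" for z b
      using that unfolding \<phi>_def by simp
    have lin: "linear \<phi>"
      by (rule linearI)
        (simp_all add: \<phi>_def bilinear_ladd[OF bx] bilinear_lmul[OF bx]
          scaleR_left_distrib sum.distrib scaleR_sum_right)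
    have "inj \<phi>"
    proof (rule injI)
      fix z z' assume "\<phi> z = \<phi> z'"
      then have "\<And>b. b \<in> Basis \<Longrightarrow> h x z b = h x z' b"
        using \<phi>_b by metis
      then have "h x z = h x z'"
        using linear_eq_stdbasis[OF lin_h lin_h] by blast
      then show "z = z'"
        using inj by simp
    qed
    then have "surj \<phi>"
      using linear_injective_imp_surjective[OF lin] by simp
    then obtain z where z: "\<phi> z = (\<Sum>b\<in>Basis. f b *\<^sub>R b)"
      by (metis surjD)
    have "h x z b = f b" if "b \<in> Basis" for b
      using \<phi>_b[OF that, of z] that unfolding z by simp
    then have "h x z = f"
      using linear_eq_stdbasis[OF lin_h f] by blast
    then show ?thesis by auto
  qed
  obtain B where B: "\<And>u v w. h x (B u v) w = K u v w"
    using riesz[OF lin_K] by metis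
  show ?thesis
  proof (rule ex1I[of _ B])
    have "bilinear B"
      unfolding bilinear_def
      by (intro allI conjI linearI; rule inj)
        (simp_all add: B bilinear_ladd[OF bx] bilinear_lmul[OF bx]
          K_def D_add1 D_scale1 D_add2 D_scale2 D_add3 D_scale3 field_simps)
    moreover have "B u v = B v u" for u v
    proof (rule inj)
      fix w
      show "h x (B u v) w = h x (B v u) w"
        unfolding B K_def using D_sym[of u v w] D_sym[of v w u] D_sym[of w u v] by simp
    qed
    moreover have "D u v w = h x (B u v) w + h x v (B u w)" for u v w
      unfolding sym[OF S(2), of v] B K_def
      using D_sym[of u v w] D_sym[of v w u] D_sym[of w u v] by (simp add: field_simps)
    ultimately show "is_levi_civita_form h x B"
      unfolding is_levi_civita_form_def D_def by blast
  next
    fix C assume C: "is_levi_civita_form h x C"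
    have Cs: "C u v = C v u" for u v
      using C unfolding is_levi_civita_form_def by blast
    have CD: "D u v w = h x (C u v) w + h x v (C u w)" for u v w
      using C unfolding is_levi_civita_form_def D_def by blast
    have "h x (C u v) w = K u v w" for u v w
      unfolding K_def CD using Cs[of u v] Cs[of v w] Cs[of u w]
        sym[OF S(2), of v "C u w"] sym[OF S(2), of w "C u v"] sym[OF S(2), of u "C v w"] by simp
    then show "C = B"
      by (intro ext inj) (simp add: B)
  qed
qed

subsection \<open>Sectional curvature\<close>

definition curvature ::
  "('e::euclidean_space \<Rightarrow> 'e \<Rightarrow> 'e \<Rightarrow> real) \<Rightarrow> ('e \<Rightarrow> 'e) \<Rightarrow> ('e \<Rightarrow> 'e) \<Rightarrow> ('e \<Rightarrow> 'e) \<Rightarrow> 'e \<Rightarrow> 'e" where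
  "curvature h X Y Z x =
     nabla h X (nabla h Y Z) x - nabla h Y (nabla h X Z) x - nabla h (lie_bracket X Y) Z x"

definition nondegenerate_plane :: "('e::euclidean_space \<Rightarrow> 'e \<Rightarrow> real) \<Rightarrow> 'e \<Rightarrow> 'e \<Rightarrow> bool" where
  "nondegenerate_plane b v w \<longleftrightarrow>
     v \<noteq> w \<and> independent {v, w} \<and> form_nondegenerate_on (span {v, w}) b"

(* The tangent vectors v, w are extended to coordinate-constant fields; by tensoriality the
   choice of the extension does not matter. *)
definition sectional_curvature ::
  "('e::euclidean_space \<Rightarrow> 'e \<Rightarrow> 'e \<Rightarrow> real) \<Rightarrow> 'e \<Rightarrow> 'e \<Rightarrow> 'e \<Rightarrow> real" where
  "sectional_curvature h x v w =
     h x (curvature h (\<lambda>_. v) (\<lambda>_. w) (\<lambda>_. w) x) v / (h x v v * h x w w - (h x v w)\<^sup>2)"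

definition constant_sectional_curvature ::
  "('a, 'e::euclidean_space) chart set \<Rightarrow> (('a, 'e) chart \<Rightarrow> 'e \<Rightarrow> 'e \<Rightarrow> 'e \<Rightarrow> real) \<Rightarrow> bool" where
  "constant_sectional_curvature A g \<longleftrightarrow>
     (\<exists>K. \<forall>c\<in>A. \<forall>p\<in>chart_dom c. \<forall>v w.
        nondegenerate_plane (g c (chart_map c p)) v w \<longrightarrow>
        sectional_curvature (g c) (chart_map c p) v w = K)"

subsection \<open>Geodesics and the exponential map\<close>

definition velocity :: "('a, 'e::euclidean_space) chart \<Rightarrow> (real \<Rightarrow> 'a) \<Rightarrow> real \<Rightarrow> 'e" where
  "velocity c \<gamma> t = vector_derivative (\<lambda>s. chart_map c (\<gamma> s)) (at t)"

definition geodesic_on ::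
  "('a::topological_space, 'e::euclidean_space) chart set \<Rightarrow>
     (('a, 'e) chart \<Rightarrow> 'e \<Rightarrow> 'e \<Rightarrow> 'e \<Rightarrow> real) \<Rightarrow> real set \<Rightarrow> (real \<Rightarrow> 'a) \<Rightarrow> bool" where
  "geodesic_on A g I \<gamma> \<longleftrightarrow>
     open I \<and> is_interval I \<and> continuous_on I \<gamma> \<and>
     (\<forall>t\<in>I. \<forall>c\<in>A. \<gamma> t \<in> chart_dom c \<longrightarrow>
        (\<forall>\<^sub>F s in nhds t. (\<lambda>s. chart_map c (\<gamma> s)) differentiable (at s)) \<and>
        (velocity c \<gamma> has_vector_derivative
           - christoffel (g c) (chart_map c (\<gamma> t)) (velocity c \<gamma> t) (velocity c \<gamma> t)) (at t))"

(* gamma is the geodesic with initial point p and initial velocity v (v in the chart c). *)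
definition is_exp_geodesic ::
  "('a::topological_space, 'e::euclidean_space) chart set \<Rightarrow>
     (('a, 'e) chart \<Rightarrow> 'e \<Rightarrow> 'e \<Rightarrow> 'e \<Rightarrow> real) \<Rightarrow> ('a, 'e) chart \<Rightarrow> 'a \<Rightarrow> 'e \<Rightarrow> (real \<Rightarrow> 'a) \<Rightarrow> bool" where
  "is_exp_geodesic A g c p v \<gamma> \<longleftrightarrow>
     (\<exists>I. geodesic_on A g I \<gamma> \<and> {0..1} \<subseteq> I) \<and> \<gamma> 0 = p \<and> velocity c \<gamma> 0 = v"

definition exp_domain ::
  "('a::topological_space, 'e::euclidean_space) chart set \<Rightarrow>
     (('a, 'e) chart \<Rightarrow> 'e \<Rightarrow> 'e \<Rightarrow> 'e \<Rightarrow> real) \<Rightarrow> ('a, 'e) chart \<Rightarrow> 'a \<Rightarrow> 'e set" where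
  "exp_domain A g c p = {v. \<exists>\<gamma>. is_exp_geodesic A g c p v \<gamma>}"

definition exp_map ::
  "('a::topological_space, 'e::euclidean_space) chart set \<Rightarrow>
     (('a, 'e) chart \<Rightarrow> 'e \<Rightarrow> 'e \<Rightarrow> 'e \<Rightarrow> real) \<Rightarrow> ('a, 'e) chart \<Rightarrow> 'a \<Rightarrow> 'e \<Rightarrow> 'a" where
  "exp_map A g c p v = (THE q. \<exists>\<gamma>. is_exp_geodesic A g c p v \<gamma> \<and> q = \<gamma> 1)"

definition diffeomorphism_onto_image ::
  "('a::topological_space, 'e::euclidean_space) chart set \<Rightarrow> 'e set \<Rightarrow> ('e \<Rightarrow> 'a) \<Rightarrow> bool" where
  "diffeomorphism_onto_image A T F \<longleftrightarrow>
     (\<exists>G. homeomorphism T (F ` T) F G \<and>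
       (\<forall>d\<in>A. smooth_on (T \<inter> F -` chart_dom d) (chart_map d \<circ> F) \<and>
              smooth_on (chart_map d ` (F ` T \<inter> chart_dom d)) (G \<circ> chart_inv d)))"

(* T is a set of tangent vectors at p (in the chart c), and the neighbourhood is exp_p(T). *)
definition normal_neighborhood ::
  "('a::topological_space, 'e::euclidean_space) chart set \<Rightarrow>
     (('a, 'e) chart \<Rightarrow> 'e \<Rightarrow> 'e \<Rightarrow> 'e \<Rightarrow> real) \<Rightarrow> ('a, 'e) chart \<Rightarrow> 'a \<Rightarrow> 'e set \<Rightarrow> bool" where
  "normal_neighborhood A g c p T \<longleftrightarrow>
     open T \<and> 0 \<in> T \<and> (\<forall>v\<in>T. closed_segment 0 v \<subseteq> T) \<and> T \<subseteq> exp_domain A g c p \<and>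
     open (exp_map A g c p ` T) \<and> diffeomorphism_onto_image A T (exp_map A g c p)"

(* For r = R^2 and r = - R^2 these are the geodesic spheres with centre p and radius R formed by
   the points exp_p(R V) of the normal neighbourhood exp_p(T) with V unit spacelike and
   unit timelike, respectively. *)
definition geodesic_sphere ::
  "('a::topological_space, 'e::euclidean_space) chart set \<Rightarrow>
     (('a, 'e) chart \<Rightarrow> 'e \<Rightarrow> 'e \<Rightarrow> 'e \<Rightarrow> real) \<Rightarrow> ('a, 'e) chart \<Rightarrow> 'a \<Rightarrow> 'e set \<Rightarrow> real \<Rightarrow> 'a set" where
  "geodesic_sphere A g c p T r = exp_map A g c p ` {x \<in> T. g c (chart_map c p) x x = r}"

subsection \<open>Totally umbilical hypersurfaces\<close>

(* The tangent space at the point with coordinates x of a hypersurface \<Sigma>,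
   as the set of velocities of smooth curves in \<Sigma>. *)
definition tangent_space :: "('a, 'e::euclidean_space) chart \<Rightarrow> 'a set \<Rightarrow> 'e \<Rightarrow> 'e set" where
  "tangent_space c \<Sigma> x =
     {v. \<exists>\<alpha> :: real \<Rightarrow> 'e. \<exists>\<delta>>0. smooth_on {-\<delta><..<\<delta>} \<alpha> \<and>
           \<alpha> ` {-\<delta><..<\<delta>} \<subseteq> chart_map c ` (\<Sigma> \<inter> chart_dom c) \<and>
           \<alpha> 0 = x \<and> (\<alpha> has_vector_derivative v) (at 0)}"

(* A unit normal field of the part of \<Sigma> with coordinates in V, given as the restriction
   of a smooth field on V. *)
definition unit_normal_field ::
  "('e::euclidean_space \<Rightarrow> 'e \<Rightarrow> 'e \<Rightarrow> real) \<Rightarrow> ('a, 'e) chart \<Rightarrow> 'a set \<Rightarrow> 'e set \<Rightarrow> ('e \<Rightarrow> 'e) \<Rightarrow> bool" where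
  "unit_normal_field h c \<Sigma> V \<xi> \<longleftrightarrow>
     open V \<and> V \<subseteq> chart_ran c \<and> smooth_on V \<xi> \<and>
     (\<forall>x \<in> V \<inter> chart_map c ` (\<Sigma> \<inter> chart_dom c).
        \<bar>h x (\<xi> x) (\<xi> x)\<bar> = 1 \<and> (\<forall>X\<in>tangent_space c \<Sigma> x. h x (\<xi> x) X = 0))"

definition shape_operator ::
  "('e::euclidean_space \<Rightarrow> 'e \<Rightarrow> 'e \<Rightarrow> real) \<Rightarrow> ('e \<Rightarrow> 'e) \<Rightarrow> 'e \<Rightarrow> 'e \<Rightarrow> 'e" where
  "shape_operator h \<xi> x X = - nabla h (\<lambda>_. X) \<xi> x"

(* \<Sigma> is a non-lightlike hypersurface.  Its unit normal field is unique up to sign, so the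
   condition does not depend on the choice of \<xi>. *)
definition totally_umbilical ::
  "('a, 'e::euclidean_space) chart set \<Rightarrow> (('a, 'e) chart \<Rightarrow> 'e \<Rightarrow> 'e \<Rightarrow> 'e \<Rightarrow> real) \<Rightarrow> 'a set \<Rightarrow> bool" where
  "totally_umbilical A g \<Sigma> \<longleftrightarrow>
     (\<forall>q\<in>\<Sigma>. \<forall>c\<in>A. q \<in> chart_dom c \<longrightarrow>
        (\<exists>V \<xi>. unit_normal_field (g c) c \<Sigma> V \<xi> \<and> chart_map c q \<in> V \<and>
           (\<forall>X\<in>tangent_space c \<Sigma> (chart_map c q). g c (chart_map c q) X X \<noteq> 0 \<longrightarrow>
              (\<exists>\<kappa>. shape_operator (g c) \<xi> (chart_map c q) X = \<kappa> *\<^sub>R X))))"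

end

theory Submission
  imports Defs
begin

text \<open>
  In normal coordinates around p the metric h has a Christoffel form \<open>\<Gamma>\<close> with \<open>\<Gamma>\<^sub>x(x, x) = 0\<close>, and by
  the Gauss lemma the position vector x is normal to the geodesic sphere through x.  Hence the
  shape operator of that sphere is a multiple of \<open>w \<mapsto> w + \<Gamma>\<^sub>x(w, x)\<close>, and the sphere is umbilical
  iff \<open>\<Gamma>\<^sub>x(w, x)\<close> is a multiple of w for all tangent vectors w.  Along the ray \<open>t x\<close> the field \<open>t w\<close> is
  a Jacobi field; in constant curvature comparing it with the scalar solution of the Jacobi equation
  shows umbilicity.  Conversely, differentiating the umbilicity condition at the centre shows that
  \<open>R(x, w) x\<close> is a multiple of w for orthogonal non-null x, w, which by Cartan's argument makes all
  sectional curvatures at p equal, and Schur's lemma (dimension at least 3) makes the common value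
  locally constant.
\<close>

section \<open>Calculus of smooth functions\<close>

text \<open>Umbilicity is assumed for whole spheres, but since every point is a centre, only radii
  near zero are exploited, and the curvature tensor is determined at each point separately.
  Indefinite signature is the obstacle in the algebra: null vectors and degenerate planes carry no
  hypothesis. Identities are proved for non-null vectors first and then extended along lines such as
  \<open>u + s f\<close>, on which only finitely many \<open>s\<close> are exceptional. Coordinates
  are the second obstacle. Spheres are defined by an exponential map at one point, umbilicity is to
  be checked in every chart, and the converse is handed a normal neighbourhood that it did not
  construct. All of this goes through one notion, a smooth map that pulls one metric back to
  another: a chart transition, the exponential map read in a chart, or their composite. Connection
  and curvature are natural under such maps. The forward direction must also produce a normal
  neighbourhood. This rests on smooth dependence of solutions of differential equations on their
  initial values, derived here from a contraction argument and Gronwall estimates.\<close>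

abbreviation fder :: "('a::real_normed_vector \<Rightarrow> 'b::real_normed_vector) \<Rightarrow> 'a \<Rightarrow> 'a \<Rightarrow> 'b" where
  "fder f x \<equiv> frechet_derivative f (at x)"

lemma fder_eqI: "(f has_derivative f') (at x) \<Longrightarrow> fder f x = f'"
  using frechet_derivative_at by metis

lemma has_fder: "f differentiable (at x) \<Longrightarrow> (f has_derivative fder f x) (at x)"
  using frechet_derivative_works by blast

lemma differentiable_cong_open:
  assumes "open S" "x \<in> S" "\<And>y. y \<in> S \<Longrightarrow> f y = g y"
  shows "f differentiable (at x) \<longleftrightarrow> g differentiable (at x)"
  using has_derivative_transform_within_open[OF _ assms(1,2)] assms(3)
  unfolding differentiable_def by metis

text \<open>Functions that agree near \<open>x\<close> have the same derivatives there, and the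
  choice that defines \<open>frechet_derivative\<close> depends on that set of derivatives alone; so
  the equality also holds at points of non-differentiability.\<close>

lemma fder_cong_open:
  assumes "open S" "x \<in> S" "\<And>y. y \<in> S \<Longrightarrow> f y = g y"
  shows "fder f x = fder g x"
proof (cases "f differentiable (at x)")
  case True
  then show ?thesis
    using frechet_derivative_transform_within_open[OF _ assms(1,2)] assms(3) by metis
next
  case False
  have "(f has_derivative D) (at x) \<longleftrightarrow> (g has_derivative D) (at x)" for D
    using has_derivative_transform_within_open[OF _ assms(1,2)] assms(3) by metis
  then show ?thesis
    unfolding frechet_derivative_def by simp
qed

section \<open>Functions of class C^k\<close>

lemma C_k_on_subset: "C_k_on k S f \<Longrightarrow> T \<subseteq> S \<Longrightarrow> C_k_on k T f"
  by (induction k arbitrary: f) (auto intro: continuous_on_subset)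

lemma C_k_on_cong:
  assumes "open S" "\<And>x. x \<in> S \<Longrightarrow> f x = g x" "C_k_on k S f"
  shows "C_k_on k S g"
  using assms(2,3)
proof (induction k arbitrary: f g)
  case 0
  then show ?case
    using continuous_on_cong by (metis C_k_on.simps(1))
next
  case (Suc k)
  have "C_k_on k S (\<lambda>x. fder g x v)" for v
  proof (rule Suc.IH)
    show "C_k_on k S (\<lambda>x. fder f x v)" using Suc.prems by simp
    show "fder f x v = fder g x v" if "x \<in> S" for x
      using fder_cong_open[OF assms(1) that] Suc.prems(1) by metis
  qed
  moreover have "\<forall>x\<in>S. g differentiable (at x)"
    using differentiable_cong_open[OF assms(1)] Suc.prems by (metis C_k_on.simps(2))
  ultimately show ?case by simp
qed

text \<open>Lets any formula \<open>f'\<close> for the differential stand in for the choice term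
  \<open>frechet_derivative\<close> of the definition.\<close>

lemma C_k_on_SucI:
  assumes "open S" "\<And>x. x \<in> S \<Longrightarrow> (f has_derivative f' x) (at x)" "\<And>v. C_k_on k S (\<lambda>x. f' x v)"
  shows "C_k_on (Suc k) S f"
proof -
  have "C_k_on k S (\<lambda>x. fder f x v)" for v
    by (rule C_k_on_cong[OF assms(1) _ assms(3)]) (simp add: fder_eqI[OF assms(2)])
  then show ?thesis
    using assms(2) by (auto simp: differentiable_def)
qed

lemma C_k_on_Suc_has_derivative:
  "C_k_on (Suc k) S f \<Longrightarrow> x \<in> S \<Longrightarrow> (f has_derivative fder f x) (at x)"
  by (auto intro: has_fder)

lemma C_k_on_SucD: "C_k_on (Suc k) S f \<Longrightarrow> C_k_on k S f"
proof (induction k arbitrary: f)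
  case 0
  then show ?case
    by (auto intro!: continuous_at_imp_continuous_on differentiable_imp_continuous_within)
next
  case (Suc k)
  have "\<forall>x\<in>S. f differentiable (at x)" "C_k_on (Suc k) S (\<lambda>x. fder f x v)" for v
    using Suc.prems C_k_on.simps(2)[of "Suc k"] by blast+
  then show ?case using Suc.IH by simp
qed

text \<open>Serves wherever a regularity step works only after shrinking, for instance to a shorter
  time interval or to the set where a denominator is nonzero.\<close>

lemma C_k_on_local:
  assumes "\<And>x. x \<in> S \<Longrightarrow> \<exists>T. open T \<and> x \<in> T \<and> C_k_on k T f"
  shows "C_k_on k S f"
  using assms
proof (induction k arbitrary: f)
  case 0
  have "isCont f x" if "x \<in> S" for x
  proof -
    obtain T where "open T" "x \<in> T" "continuous_on T f" using 0[OF \<open>x \<in> S\<close>] by auto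
    then show ?thesis by (simp add: continuous_on_eq_continuous_at)
  qed
  then show ?case
    by (simp add: continuous_at_imp_continuous_on)
next
  case (Suc k)
  have "C_k_on k S (\<lambda>x. fder f x v)" for v
  proof (rule Suc.IH)
    fix x assume "x \<in> S"
    then obtain T where "open T" "x \<in> T" "C_k_on (Suc k) T f" using Suc.prems by blast
    then show "\<exists>T. open T \<and> x \<in> T \<and> C_k_on k T (\<lambda>x. fder f x v)" by (intro exI[of _ T]) simp
  qed
  moreover have "f differentiable (at x)" if "x \<in> S" for x
    using Suc.prems[OF that] by auto
  ultimately show ?case by simp
qed

lemma C_k_on_const: "C_k_on k S (\<lambda>x. c)"
  by (induction k arbitrary: c) auto

lemma C_k_on_bounded_linear:
  assumes "open S" "bounded_linear f"
  shows "C_k_on k S f"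
proof (cases k)
  case 0
  then show ?thesis using linear_continuous_on[OF assms(2)] by simp
next
  case (Suc j)
  show ?thesis
    unfolding Suc
    by (rule C_k_on_SucI[of _ _ "\<lambda>x. f"])
      (simp_all add: assms C_k_on_const bounded_linear_imp_has_derivative)
qed

lemma C_k_on_add:
  "open S \<Longrightarrow> C_k_on k S f \<Longrightarrow> C_k_on k S g \<Longrightarrow> C_k_on k S (\<lambda>x. f x + g x)"
proof (induction k arbitrary: f g)
  case (Suc k)
  have "C_k_on k S (\<lambda>x. fder f x v + fder g x v)" for v
    by (rule Suc.IH) (use Suc.prems in simp_all)
  moreover have "((\<lambda>x. f x + g x) has_derivative (\<lambda>v. fder f x v + fder g x v)) (at x)" if "x \<in> S" for x
    by (intro has_derivative_add has_fder) (use Suc.prems that in auto)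
  ultimately show ?case by (intro C_k_on_SucI Suc.prems(1))
qed (auto intro: continuous_on_add)

lemma C_k_on_linear_comp:
  "open S \<Longrightarrow> bounded_linear L \<Longrightarrow> C_k_on k S f \<Longrightarrow> C_k_on k S (\<lambda>x. L (f x))"
proof (induction k arbitrary: f)
  case (Suc k)
  have "C_k_on k S (\<lambda>x. L (fder f x v))" for v
    by (rule Suc.IH) (use Suc.prems in simp_all)
  moreover have "((\<lambda>x. L (f x)) has_derivative (\<lambda>v. L (fder f x v))) (at x)" if "x \<in> S" for x
    by (intro bounded_linear.has_derivative[OF Suc.prems(2)] has_fder) (use Suc.prems that in auto)
  ultimately show ?case by (intro C_k_on_SucI Suc.prems(1))
qed (auto intro: bounded_linear.continuous_on)

text \<open>The product rule gives two summands of the same shape, with one of the factors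
  differentiated; this is why the induction varies both \<open>f\<close> and
  \<open>g\<close>.\<close>

lemma C_k_on_bilinear:
  assumes "bounded_bilinear B" "open S"
  shows "C_k_on k S f \<Longrightarrow> C_k_on k S g \<Longrightarrow> C_k_on k S (\<lambda>x. B (f x) (g x))"
proof (induction k arbitrary: f g)
  case 0
  then show ?case using bounded_bilinear.continuous_on[OF assms(1)] by auto
next
  case (Suc k)
  have "C_k_on k S f" "C_k_on k S g"
    using Suc.prems C_k_on_SucD by blast+
  moreover have "C_k_on k S (\<lambda>x. fder f x v)" "C_k_on k S (\<lambda>x. fder g x v)" for v
    using Suc.prems by simp_all
  ultimately have "C_k_on k S (\<lambda>x. B (f x) (fder g x v) + B (fder f x v) (g x))" for v
    by (intro C_k_on_add assms(2) Suc.IH)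
  moreover have "((\<lambda>x. B (f x) (g x)) has_derivative (\<lambda>v. B (f x) (fder g x v) + B (fder f x v) (g x))) (at x)"
    if "x \<in> S" for x
    by (intro bounded_bilinear.FDERIV[OF assms(1)] has_fder) (use Suc.prems that in auto)
  ultimately show ?case by (intro C_k_on_SucI assms(2))
qed

lemma C_k_on_minus: "open S \<Longrightarrow> C_k_on k S f \<Longrightarrow> C_k_on k S (\<lambda>x. - f x)"
  by (rule C_k_on_linear_comp[OF _ bounded_linear_minus[OF bounded_linear_ident]])

lemma C_k_on_diff:
  "open S \<Longrightarrow> C_k_on k S f \<Longrightarrow> C_k_on k S g \<Longrightarrow> C_k_on k S (\<lambda>x. f x - g x)"
  using C_k_on_add[of S k f "\<lambda>x. - g x"] C_k_on_minus by auto

lemmas C_k_on_scaleR = C_k_on_bilinear[OF bounded_bilinear_scaleR]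
lemmas C_k_on_mult = C_k_on_bilinear[OF bounded_bilinear_mult]

lemma C_k_on_sum:
  "open S \<Longrightarrow> (\<And>i. i \<in> I \<Longrightarrow> C_k_on k S (f i)) \<Longrightarrow> C_k_on k S (\<lambda>x. \<Sum>i\<in>I. f i x)"
proof (induction I rule: infinite_finite_induct)
  case (insert i I)
  then show ?case by (simp add: C_k_on_add)
qed (auto intro: C_k_on_const)

lemma C_k_on_Pair:
  assumes "open S" "C_k_on k S f" "C_k_on k S g"
  shows "C_k_on k S (\<lambda>x. (f x, g x))"
proof -
  have "bounded_linear (\<lambda>u. (u, 0))" "bounded_linear (\<lambda>u. (0, u))"
    by (intro bounded_linear_Pair bounded_linear_ident bounded_linear_zero)+
  from C_k_on_add[OF assms(1) C_k_on_linear_comp[OF assms(1) this(1) assms(2)]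
      C_k_on_linear_comp[OF assms(1) this(2) assms(3)]]
  show ?thesis by simp
qed

section \<open>Linear maps depending on a parameter\<close>

lemma linear_Basis_expand:
  fixes L :: "'a::euclidean_space \<Rightarrow> 'b::real_vector"
  assumes "linear L"
  shows "L z = (\<Sum>b\<in>Basis. (z \<bullet> b) *\<^sub>R L b)"
proof -
  have "L z = L (\<Sum>b\<in>Basis. (z \<bullet> b) *\<^sub>R b)" by (simp add: euclidean_representation)
  then show ?thesis
    by (simp add: linear_sum[OF assms] linear_scale[OF assms])
qed

text \<open>Regularity of \<open>L\<close> is asked for each fixed argument only. The basis
  expansion turns \<open>L x (z x)\<close> into a finite sum of products, so no topology on a space
  of operators enters.\<close>

lemma C_k_on_linear_family:
  fixes z :: "'a::real_normed_vector \<Rightarrow> 'c::euclidean_space" and L :: "'a \<Rightarrow> 'c \<Rightarrow> 'b::real_normed_vector"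
  assumes S: "open S" and L: "\<And>x. x \<in> S \<Longrightarrow> linear (L x)"
    and "\<And>u. C_k_on k S (\<lambda>x. L x u)" "C_k_on k S z"
  shows "C_k_on k S (\<lambda>x. L x (z x))"
proof (rule C_k_on_cong[OF S])
  show "(\<Sum>b\<in>Basis. (z x \<bullet> b) *\<^sub>R L x b) = L x (z x)" if "x \<in> S" for x
    by (rule linear_Basis_expand[OF L[OF that], symmetric])
  show "C_k_on k S (\<lambda>x. \<Sum>b\<in>Basis. (z x \<bullet> b) *\<^sub>R L x b)"
    by (intro C_k_on_sum C_k_on_scaleR S assms(3)
        C_k_on_linear_comp[OF S bounded_linear_inner_left assms(4)])
qed

lemma has_derivative_linear_family:
  fixes z :: "'a::real_normed_vector \<Rightarrow> 'c::euclidean_space" and L :: "'a \<Rightarrow> 'c \<Rightarrow> 'b::real_normed_vector"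
  assumes S: "open S" "x \<in> S" and L: "\<And>y. y \<in> S \<Longrightarrow> linear (L y)"
    and L': "\<And>u. ((\<lambda>y. L y u) has_derivative (\<lambda>v. L' v u)) (at x)"
    and z: "(z has_derivative z') (at x)"
  shows "((\<lambda>y. L y (z y)) has_derivative (\<lambda>v. L' v (z x) + L x (z' v))) (at x)"
proof -
  \<comment> \<open>Linearity of \<open>L' v\<close> in its second argument is derived here: it
    comes from the linearity of \<open>L\<close> by uniqueness of derivatives.\<close>
  have sum1: "(\<Sum>b\<in>Basis. (u \<bullet> b) *\<^sub>R L' v b) = L' v u" for u v
  proof -
    have "((\<lambda>y. \<Sum>b\<in>Basis. (u \<bullet> b) *\<^sub>R L y b) has_derivative (\<lambda>v. \<Sum>b\<in>Basis. (u \<bullet> b) *\<^sub>R L' v b)) (at x)"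
      by (intro has_derivative_sum has_derivative_scaleR_right L')
    then have "((\<lambda>y. L y u) has_derivative (\<lambda>v. \<Sum>b\<in>Basis. (u \<bullet> b) *\<^sub>R L' v b)) (at x)"
      by (rule has_derivative_transform_within_open[OF _ S]) (use linear_Basis_expand[OF L] in simp)
    from has_derivative_unique[OF this L'] show ?thesis by metis
  qed
  have sum2: "(\<Sum>b\<in>Basis. (u \<bullet> b) *\<^sub>R L x b) = L x u" for u
    using linear_Basis_expand[OF L[OF S(2)]] by metis
  have "((\<lambda>y. \<Sum>b\<in>Basis. (z y \<bullet> b) *\<^sub>R L y b) has_derivative
      (\<lambda>v. \<Sum>b\<in>Basis. (z x \<bullet> b) *\<^sub>R L' v b + (z' v \<bullet> b) *\<^sub>R L x b)) (at x)"
    by (intro has_derivative_sum has_derivative_scaleR L' has_derivative_inner_left z)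
  then have "((\<lambda>y. L y (z y)) has_derivative
      (\<lambda>v. \<Sum>b\<in>Basis. (z x \<bullet> b) *\<^sub>R L' v b + (z' v \<bullet> b) *\<^sub>R L x b)) (at x)"
    by (rule has_derivative_transform_within_open[OF _ S]) (use linear_Basis_expand[OF L] in simp)
  then show ?thesis by (simp add: sum.distrib sum1 sum2)
qed

text \<open>The derivative \<open>fder f (g x) (fder g x v)\<close> is a linear family applied to a
  vector field, so the induction runs over the directional derivatives of \<open>f\<close> while
  \<open>g\<close> stays fixed.\<close>

lemma C_k_on_compose:
  fixes g :: "'a::real_normed_vector \<Rightarrow> 'b::euclidean_space" and f :: "'b \<Rightarrow> 'c::real_normed_vector"
  assumes "open U" "open V" "g ` U \<subseteq> V"
  shows "C_k_on k V f \<Longrightarrow> C_k_on k U g \<Longrightarrow> C_k_on k U (\<lambda>x. f (g x))"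
proof (induction k arbitrary: f)
  case 0
  then show ?case using assms(3) by (auto intro: continuous_on_compose2)
next
  case (Suc k)
  have df: "(f has_derivative fder f y) (at y)" if "y \<in> V" for y
    using Suc.prems that by (auto intro: has_fder)
  have dg: "(g has_derivative fder g x) (at x)" if "x \<in> U" for x
    using Suc.prems that by (auto intro: has_fder)
  show ?case
  proof (rule C_k_on_SucI[OF assms(1)])
    show "((\<lambda>x. f (g x)) has_derivative (\<lambda>v. fder f (g x) (fder g x v))) (at x)" if "x \<in> U" for x
      using diff_chain_at[OF dg[OF that] df] assms(3) that by (auto simp: o_def image_subset_iff)
    show "C_k_on k U (\<lambda>x. fder f (g x) (fder g x v))" for v
    proof (rule C_k_on_linear_family[OF assms(1)])
      show "linear (fder f (g x))" if "x \<in> U" for x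
        using df assms(3) that by (auto intro!: has_derivative_linear)
      show "C_k_on k U (\<lambda>x. fder f (g x) u)" for u
        using Suc C_k_on_SucD[OF Suc.prems(2)] by (intro Suc.IH) auto
      show "C_k_on k U (\<lambda>x. fder g x v)"
        using Suc.prems by simp
    qed
  qed
qed

text \<open>Injectivity is an open condition with a uniform constant: near \<open>x0\<close> the
  maps \<open>L x\<close> are bounded below by half the constant of \<open>L x0\<close>.\<close>

lemma continuous_on_solve_linear:
  fixes L :: "'a::real_normed_vector \<Rightarrow> 'c::euclidean_space \<Rightarrow> 'c"
  assumes S: "open S" and lin: "\<And>x. x \<in> S \<Longrightarrow> linear (L x)" and inj: "\<And>x. x \<in> S \<Longrightarrow> inj (L x)"
    and cL: "\<And>u. continuous_on S (\<lambda>x. L x u)" and x0: "x0 \<in> S"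
  obtains d e where "d > 0" "e > 0" "ball x0 d \<subseteq> S" "\<And>x u. x \<in> ball x0 d \<Longrightarrow> norm (L x u) \<ge> e * norm u"
proof -
  obtain B where B: "B > 0" "\<And>u. norm (L x0 u) \<ge> B * norm u"
    using linear_inj_bounded_below_pos[OF lin[OF x0] inj[OF x0]] by blast
  \<comment> \<open>Each basis vector may contribute an error \<open>e * norm u\<close>; all of them
    together contribute \<open>B / 2 * norm u\<close>.\<close>
  define e where "e = B / (2 * (of_nat DIM('c)))"
  have e: "e > 0" using B by (simp add: e_def)
  have "\<forall>\<^sub>F x in at x0. norm (L x b - L x0 b) < e" for b
  proof -
    have "isCont (\<lambda>x. L x b) x0"
      using cL[of b] x0 by (simp add: continuous_on_eq_continuous_at[OF S])
    then have "((\<lambda>x. norm (L x b - L x0 b)) \<longlongrightarrow> norm (L x0 b - L x0 b)) (at x0)"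
      by (intro tendsto_norm tendsto_diff tendsto_const) (simp add: isCont_def)
    then show ?thesis using e by (auto dest: order_tendstoD(2))
  qed
  then have "\<forall>\<^sub>F x in at x0. \<forall>b\<in>Basis. norm (L x b - L x0 b) < e"
    by (simp add: eventually_ball_finite)
  moreover have "\<forall>\<^sub>F x in at x0. x \<in> S"
    by (rule eventually_at_in_open'[OF S x0])
  ultimately have "\<forall>\<^sub>F x in at x0. x \<in> S \<and> (\<forall>b\<in>Basis. norm (L x b - L x0 b) < e)"
    by (intro eventually_conj)
  then obtain d where d: "d > 0" "\<And>x. x \<in> ball x0 d \<Longrightarrow> x \<noteq> x0 \<Longrightarrow> x \<in> S \<and> (\<forall>b\<in>Basis. norm (L x b - L x0 b) < e)"
    unfolding eventually_at by (auto simp: dist_commute)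
  have d': "x \<in> S \<and> (\<forall>b\<in>Basis. norm (L x b - L x0 b) < e)" if "x \<in> ball x0 d" for x
    using d(2)[OF that] x0 e by (cases "x = x0") auto
  show ?thesis
  proof
    show "d > 0" "B / 2 > 0" using d B by auto
    show "ball x0 d \<subseteq> S" using d' by auto
    fix x u assume x: "x \<in> ball x0 d"
    have "L x u - L x0 u = (\<Sum>b\<in>Basis. (u \<bullet> b) *\<^sub>R (L x b - L x0 b))"
      using linear_Basis_expand[OF lin[OF x0], of u] linear_Basis_expand[OF lin, of x u] d' x
      by (simp add: scaleR_right_diff_distrib sum_subtractf)
    also have "norm \<dots> \<le> (\<Sum>b\<in>(Basis::'c set). norm u * e)"
    proof (rule sum_norm_le)
      fix b :: 'c assume "b \<in> Basis"
      then have "\<bar>u \<bullet> b\<bar> \<le> norm u" "norm (L x b - L x0 b) \<le> e"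
        using d'[OF x] Basis_le_norm[of b u] by (auto intro: less_imp_le)
      then show "norm ((u \<bullet> b) *\<^sub>R (L x b - L x0 b)) \<le> norm u * e"
        by (simp add: mult_mono)
    qed
    also have "\<dots> = B / 2 * norm u" by (simp add: e_def)
    finally have "norm (L x u - L x0 u) \<le> B / 2 * norm u" .
    moreover have "norm (L x0 u) \<le> norm (L x u) + norm (L x u - L x0 u)"
      using norm_triangle_ineq4[of "L x u" "L x u - L x0 u"] by simp
    ultimately show "norm (L x u) \<ge> B / 2 * norm u" using B(2)[of u] by simp
  qed
qed

text \<open>Implicit differentiation of \<open>L x (z x) = w x\<close>. The uniform lower bound on
  \<open>L x\<close> turns smallness of \<open>L x\<close> applied to the remainder of
  \<open>z\<close> into smallness of that remainder.\<close>

lemma solve_linear_has_derivative: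
  fixes L :: "'a::real_normed_vector \<Rightarrow> 'c::euclidean_space \<Rightarrow> 'c"
  assumes S: "open S" and lin: "\<And>x. x \<in> S \<Longrightarrow> linear (L x)" and inj: "\<And>x. x \<in> S \<Longrightarrow> inj (L x)"
    and cL: "\<And>u. continuous_on S (\<lambda>x. L x u)" and x0: "x0 \<in> S"
    and eq: "\<And>x. x \<in> S \<Longrightarrow> L x (z x) = w x"
    and L': "\<And>u. ((\<lambda>x. L x u) has_derivative (\<lambda>v. L' v u)) (at x0)"
    and w: "(w has_derivative w') (at x0)"
    and d: "\<And>v. L x0 (d v) = w' v - L' v (z x0)"
  shows "(z has_derivative d) (at x0)"
proof -
  note lx = lin[OF x0]
  have cancel: "u = u'" if "L x0 u = L x0 u'" for u u'
    using inj[OF x0] that by (auto dest: injD)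
  have lw: "linear w'" using w has_derivative_linear by blast
  have lL': "linear (\<lambda>v. L' v u)" for u using L' has_derivative_linear by blast
  obtain \<delta> e where de: "\<delta> > 0" "e > 0" "ball x0 \<delta> \<subseteq> S" "\<And>x u. x \<in> ball x0 \<delta> \<Longrightarrow> norm (L x u) \<ge> e * norm u"
    by (rule continuous_on_solve_linear[OF S lin inj cL x0]) simp_all
  have bl: "bounded_linear d"
  proof -
    obtain B where B: "\<And>v. norm (w' v - L' v (z x0)) \<le> norm v * B"
      using bounded_linear.bounded[OF bounded_linear_sub[OF has_derivative_bounded_linear[OF w]
            has_derivative_bounded_linear[OF L'[of "z x0"]]]] by blast
    have "norm (d v) \<le> norm v * (B / e)" for v
    proof -
      have "e * norm (d v) \<le> norm (L x0 (d v))" using de by simp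
      also have "\<dots> \<le> norm v * B" using B d by simp
      finally show ?thesis using de(2) by (simp add: field_simps)
    qed
    moreover have "d (u + v) = d u + d v" for u v
      by (rule cancel) (simp add: d linear_add[OF lx] linear_add[OF lw] linear_add[OF lL', of u v])
    moreover have "d (r *\<^sub>R v) = r *\<^sub>R d v" for r v
      by (rule cancel) (simp add: d linear_scale[OF lx] linear_scale[OF lw] linear_scale[OF lL', of r v] scaleR_diff_right)
    ultimately show ?thesis by (intro bounded_linear_intro)
  qed
  \<comment> \<open>\<open>L x\<close> maps the remainder of \<open>z\<close> to the remainder of
    \<open>w\<close>, minus the remainder of \<open>L\<close> at the fixed vector
    \<open>z x0\<close>, minus the change of \<open>L\<close> on the increment
    \<open>d (x - x0)\<close>.\<close>
  have ident: "L x (z x - z x0 - d (x - x0)) =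
      (w x - w x0 - w' (x - x0)) - (L x (z x0) - L x0 (z x0) - L' (x - x0) (z x0))
      - (L x (d (x - x0)) - L x0 (d (x - x0)))" if "x \<in> S" for x
    using eq[OF that] eq[OF x0] d[of "x - x0"] by (simp add: linear_diff[OF lin[OF that]])
  let ?n = "\<lambda>x. norm (x - x0)"
  have inS: "\<forall>\<^sub>F x in at x0. x \<in> S"
    by (rule eventually_at_in_open'[OF S x0])
  have lim1: "((\<lambda>x. norm (w x - w x0 - w' (x - x0)) / ?n x) \<longlongrightarrow> 0) (at x0)"
    using w unfolding has_derivative_iff_norm by blast
  have lim2: "((\<lambda>x. norm (L x (z x0) - L x0 (z x0) - L' (x - x0) (z x0)) / ?n x) \<longlongrightarrow> 0) (at x0)"
    using L'[of "z x0"] unfolding has_derivative_iff_norm by blast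
  \<comment> \<open>The increment \<open>d (x - x0)\<close> is of order \<open>?n x\<close>, and
    \<open>L x - L x0\<close> tends to 0 on each basis vector.\<close>
  have lim3: "((\<lambda>x. norm (L x (d (x - x0)) - L x0 (d (x - x0))) / ?n x) \<longlongrightarrow> 0) (at x0)"
  proof -
    obtain D where D: "\<And>v. norm (d v) \<le> norm v * D" and "D > 0"
      using bounded_linear.pos_bounded[OF bl] by blast
    have "((\<lambda>x. \<Sum>b\<in>Basis. D * norm (L x b - L x0 b)) \<longlongrightarrow> (\<Sum>b\<in>(Basis::'c set). D * norm (L x0 b - L x0 b))) (at x0)"
      using cL x0 by (intro tendsto_sum tendsto_mult tendsto_norm tendsto_diff tendsto_const)
        (simp add: continuous_on_eq_continuous_at[OF S] isCont_def)
    then have *: "((\<lambda>x. \<Sum>b\<in>Basis. D * norm (L x b - L x0 b)) \<longlongrightarrow> 0) (at x0)" by simp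
    have "\<forall>\<^sub>F x in at x0. norm (norm (L x (d (x - x0)) - L x0 (d (x - x0))) / ?n x) \<le>
       (\<Sum>b\<in>Basis. D * norm (L x b - L x0 b))"
      using inS
    proof eventually_elim
      case (elim x)
      let ?u = "d (x - x0)"
      have "L x ?u - L x0 ?u = (\<Sum>b\<in>Basis. (?u \<bullet> b) *\<^sub>R (L x b - L x0 b))"
        using linear_Basis_expand[OF lx, of ?u] linear_Basis_expand[OF lin[OF elim], of ?u]
        by (simp add: scaleR_right_diff_distrib sum_subtractf)
      also have "norm \<dots> \<le> (\<Sum>b\<in>(Basis::'c set). (?n x * D) * norm (L x b - L x0 b))"
      proof (rule sum_norm_le)
        fix b :: 'c assume "b \<in> Basis"
        then have "\<bar>?u \<bullet> b\<bar> \<le> ?n x * D" using Basis_le_norm D order_trans by blast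
        then show "norm ((?u \<bullet> b) *\<^sub>R (L x b - L x0 b)) \<le> (?n x * D) * norm (L x b - L x0 b)"
          by (simp add: mult_right_mono)
      qed
      also have "\<dots> = ?n x * (\<Sum>b\<in>Basis. D * norm (L x b - L x0 b))"
        by (simp add: sum_distrib_left mult.assoc)
      finally show ?case
        using \<open>D > 0\<close> by (cases "x = x0") (simp_all add: divide_le_eq mult.commute)
    qed
    then show ?thesis by (rule Lim_null_comparison[OF _ *])
  qed
  have lim: "((\<lambda>x. (norm (w x - w x0 - w' (x - x0)) / ?n x
      + norm (L x (z x0) - L x0 (z x0) - L' (x - x0) (z x0)) / ?n x
      + norm (L x (d (x - x0)) - L x0 (d (x - x0))) / ?n x) / e) \<longlongrightarrow> (0 + 0 + 0) / e) (at x0)"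
    by (intro tendsto_divide tendsto_add lim1 lim2 lim3 tendsto_const) (use de in simp)
  have "((\<lambda>x. norm (z x - z x0 - d (x - x0)) / ?n x) \<longlongrightarrow> 0) (at x0)"
  proof (rule Lim_null_comparison[OF _ lim[simplified]])
    have "\<forall>\<^sub>F x in at x0. x \<in> ball x0 \<delta>"
      by (rule eventually_at_in_open') (use de(1) in simp_all)
    then show "\<forall>\<^sub>F x in at x0. norm (norm (z x - z x0 - d (x - x0)) / ?n x) \<le>
      (norm (w x - w x0 - w' (x - x0)) / ?n x
      + norm (L x (z x0) - L x0 (z x0) - L' (x - x0) (z x0)) / ?n x
      + norm (L x (d (x - x0)) - L x0 (d (x - x0))) / ?n x) / e"
    proof eventually_elim
      case (elim x)
      then have xS: "x \<in> S" using de(3) by blast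
      have "e * norm (z x - z x0 - d (x - x0)) \<le> norm (L x (z x - z x0 - d (x - x0)))"
        by (rule de(4)[OF elim])
      also have "\<dots> \<le> norm (w x - w x0 - w' (x - x0)) + norm (L x (z x0) - L x0 (z x0) - L' (x - x0) (z x0))
        + norm (L x (d (x - x0)) - L x0 (d (x - x0)))"
        unfolding ident[OF xS] by (intro order_trans[OF norm_triangle_ineq4] add_right_mono norm_triangle_ineq4)
      finally have "e * norm (z x - z x0 - d (x - x0)) / ?n x \<le> \<dots> / ?n x"
        by (rule divide_right_mono) simp
      then show ?case
        using de(2) unfolding add_divide_distrib[symmetric] pos_le_divide_eq[OF de(2)]
        by (simp add: mult.commute)
    qed
  qed
  then show ?thesis using bl unfolding has_derivative_iff_norm by blast
qed

lemma continuous_on_linear_solution: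
  fixes L :: "'a::real_normed_vector \<Rightarrow> 'c::euclidean_space \<Rightarrow> 'c"
  assumes S: "open S" and lin: "\<And>x. x \<in> S \<Longrightarrow> linear (L x)" and inj: "\<And>x. x \<in> S \<Longrightarrow> inj (L x)"
    and cL: "\<And>u. continuous_on S (\<lambda>x. L x u)"
    and eq: "\<And>x. x \<in> S \<Longrightarrow> L x (z x) = w x" and w: "continuous_on S w"
  shows "continuous_on S z"
proof (rule continuous_at_imp_continuous_on, rule ballI)
  fix x0 assume x0: "x0 \<in> S"
  obtain \<delta> e where de: "\<delta> > 0" "e > 0" "ball x0 \<delta> \<subseteq> S" "\<And>x u. x \<in> ball x0 \<delta> \<Longrightarrow> norm (L x u) \<ge> e * norm u"
    by (rule continuous_on_solve_linear[OF S lin inj cL x0]) simp_all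
  have "isCont w x0" "isCont (\<lambda>x. L x (z x0)) x0"
    using cL[of "z x0"] w x0 by (simp_all add: continuous_on_eq_continuous_at[OF S])
  then have "((\<lambda>x. norm (w x - L x (z x0)) / e) \<longlongrightarrow> norm (w x0 - L x0 (z x0)) / e) (at x0)"
    using de(2) unfolding isCont_def by (intro tendsto_divide tendsto_norm tendsto_diff tendsto_const) auto
  then have *: "((\<lambda>x. norm (w x - L x (z x0)) / e) \<longlongrightarrow> 0) (at x0)" using eq x0 by simp
  have "((\<lambda>x. z x - z x0) \<longlongrightarrow> 0) (at x0)"
  proof (rule Lim_null_comparison[OF _ *])
    have "\<forall>\<^sub>F x in at x0. x \<in> ball x0 \<delta>"
      by (rule eventually_at_in_open') (use de(1) in simp_all)
    then show "\<forall>\<^sub>F x in at x0. norm (z x - z x0) \<le> norm (w x - L x (z x0)) / e"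
    proof eventually_elim
      case (elim x)
      have "x \<in> S" using elim de(3) by blast
      then have "L x (z x - z x0) = w x - L x (z x0)" by (simp add: eq linear_diff[OF lin])
      then show ?case
        using de(4)[OF elim, of "z x - z x0"] unfolding pos_le_divide_eq[OF de(2)] by (simp add: mult.commute)
    qed
  qed
  then show "isCont z x0" unfolding isCont_def using LIM_zero_iff by blast
qed

text \<open>The derivative of \<open>z\<close> solves a linear system with the same \<open>L\<close>
  and a right side that is C^k because \<open>z\<close> is, so regularity bootstraps. Smoothness of
  Christoffel forms and of inverse maps rests on this.\<close>

lemma C_k_on_linear_solution:
  fixes L :: "'a::real_normed_vector \<Rightarrow> 'c::euclidean_space \<Rightarrow> 'c"
  assumes S: "open S" and lin: "\<And>x. x \<in> S \<Longrightarrow> linear (L x)" and inj: "\<And>x. x \<in> S \<Longrightarrow> inj (L x)"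
  shows "(\<And>u. C_k_on k S (\<lambda>x. L x u)) \<Longrightarrow> C_k_on k S w \<Longrightarrow>
    (\<And>x. x \<in> S \<Longrightarrow> L x (z x) = w x) \<Longrightarrow> C_k_on k S z"
proof (induction k arbitrary: w z)
  case 0
  show ?case
    unfolding C_k_on.simps
    by (rule continuous_on_linear_solution[OF S lin inj _ 0(3)]) (use 0(1,2) in simp_all)
next
  case (Suc k)
  have cL: "C_k_on k S (\<lambda>x. L x u)" for u by (rule C_k_on_SucD[OF Suc.prems(1)])
  have zk: "C_k_on k S z" by (rule Suc.IH[OF cL C_k_on_SucD[OF Suc.prems(2)] Suc.prems(3)])
  define L' where "L' x v u = fder (\<lambda>y. L y u) x v" for x v u
  have L': "((\<lambda>x. L x u) has_derivative (\<lambda>v. L' x v u)) (at x)" if "x \<in> S" for x u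
    using C_k_on_Suc_has_derivative[OF Suc.prems(1) that, of u] unfolding L'_def by simp
  have linL': "linear (L' x v)" if x: "x \<in> S" for x v
  proof
    show "L' x v (u + u') = L' x v u + L' x v u'" for u u'
    proof -
      have "((\<lambda>x. L x (u + u')) has_derivative (\<lambda>v. L' x v u + L' x v u')) (at x)"
        by (rule has_derivative_transform_within_open[OF has_derivative_add[OF L'[OF x] L'[OF x]] S x])
          (simp add: linear_add[OF lin])
      from has_derivative_unique[OF L'[OF x] this] show ?thesis by (rule fun_cong)
    qed
    show "L' x v (r *\<^sub>R u) = r *\<^sub>R L' x v u" for u r
    proof -
      have "((\<lambda>x. L x (r *\<^sub>R u)) has_derivative (\<lambda>v. r *\<^sub>R L' x v u)) (at x)"
        by (rule has_derivative_transform_within_open[OF has_derivative_scaleR_right[OF L'[OF x]] S x])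
          (simp add: linear_scale[OF lin])
      from has_derivative_unique[OF L'[OF x] this] show ?thesis by (rule fun_cong)
    qed
  qed
  have w': "(w has_derivative fder w x) (at x)" if "x \<in> S" for x
    using C_k_on_Suc_has_derivative[OF Suc.prems(2) that] .
  define d where "d x v = inv (L x) (fder w x v - L' x v (z x))" for x v
  have d: "L x (d x v) = fder w x v - L' x v (z x)" if "x \<in> S" for x v
  proof -
    have "surj (L x)"
      by (rule linear_injective_imp_surjective) (simp_all add: lin inj that)
    then show ?thesis unfolding d_def by (rule surj_f_inv_f)
  qed
  have cL0: "continuous_on S (\<lambda>x. L x u)" for u
    by (intro continuous_at_imp_continuous_on ballI has_derivative_continuous[OF L'])
  show ?case
  proof (rule C_k_on_SucI[OF S])
    show "(z has_derivative d x) (at x)" if "x \<in> S" for x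
      by (rule solve_linear_has_derivative[OF S lin inj cL0 that Suc.prems(3) L'[OF that] w'[OF that] d[OF that]])
    show "C_k_on k S (\<lambda>x. d x v)" for v
    proof (rule Suc.IH[OF cL _ d])
      have 1: "C_k_on k S (\<lambda>x. fder w x v)" and 2: "\<And>u. C_k_on k S (\<lambda>x. L' x v u)"
        using Suc.prems(1,2) unfolding L'_def by simp_all
      show "C_k_on k S (\<lambda>x. fder w x v - L' x v (z x))"
        by (rule C_k_on_diff[OF S 1 C_k_on_linear_family[OF S linL' 2 zk]])
    qed
  qed
qed

section \<open>Smooth functions\<close>

lemma smooth_onD: "smooth_on S f \<Longrightarrow> C_k_on k S f"
  by (simp add: smooth_on_def)

lemma smooth_on_subset: "smooth_on S f \<Longrightarrow> T \<subseteq> S \<Longrightarrow> smooth_on T f"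
  unfolding smooth_on_def by (intro allI C_k_on_subset[of _ S f T]) simp_all

lemma smooth_on_cong:
  assumes "open S" "\<And>x. x \<in> S \<Longrightarrow> f x = g x" "smooth_on S f"
  shows "smooth_on S g"
  unfolding smooth_on_def by (intro allI C_k_on_cong[OF assms(1,2) smooth_onD[OF assms(3)]])

lemma smooth_on_local:
  assumes "\<And>x. x \<in> S \<Longrightarrow> \<exists>T. open T \<and> x \<in> T \<and> smooth_on T f"
  shows "smooth_on S f"
  unfolding smooth_on_def
proof
  show "C_k_on k S f" for k
    by (rule C_k_on_local) (use assms smooth_onD in blast)
qed

lemma smooth_on_has_derivative: "smooth_on S f \<Longrightarrow> x \<in> S \<Longrightarrow> (f has_derivative fder f x) (at x)"
  by (rule C_k_on_Suc_has_derivative[OF smooth_onD])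

lemma smooth_on_imp_continuous_on: "smooth_on S f \<Longrightarrow> continuous_on S f"
  using smooth_onD[of S f 0] by simp

lemma smooth_on_fder: "smooth_on S f \<Longrightarrow> smooth_on S (\<lambda>x. fder f x v)"
  unfolding smooth_on_def using C_k_on.simps(2) by blast

lemma smooth_on_const: "smooth_on S (\<lambda>x. c)"
  by (simp add: smooth_on_def C_k_on_const)

lemma smooth_on_bounded_linear: "open S \<Longrightarrow> bounded_linear f \<Longrightarrow> smooth_on S f"
  by (simp add: smooth_on_def C_k_on_bounded_linear)

lemma smooth_on_ident: "open S \<Longrightarrow> smooth_on S (\<lambda>x. x)"
  by (simp add: smooth_on_bounded_linear bounded_linear_ident)

lemma smooth_on_add:
  "open S \<Longrightarrow> smooth_on S f \<Longrightarrow> smooth_on S g \<Longrightarrow> smooth_on S (\<lambda>x. f x + g x)"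
  by (simp add: smooth_on_def C_k_on_add)

lemma smooth_on_diff:
  "open S \<Longrightarrow> smooth_on S f \<Longrightarrow> smooth_on S g \<Longrightarrow> smooth_on S (\<lambda>x. f x - g x)"
  by (simp add: smooth_on_def C_k_on_diff)

lemma smooth_on_minus: "open S \<Longrightarrow> smooth_on S f \<Longrightarrow> smooth_on S (\<lambda>x. - f x)"
  by (simp add: smooth_on_def C_k_on_minus)

lemma smooth_on_linear_comp:
  "open S \<Longrightarrow> bounded_linear L \<Longrightarrow> smooth_on S f \<Longrightarrow> smooth_on S (\<lambda>x. L (f x))"
  by (simp add: smooth_on_def C_k_on_linear_comp)

lemma smooth_on_bilinear:
  "bounded_bilinear B \<Longrightarrow> open S \<Longrightarrow> smooth_on S f \<Longrightarrow> smooth_on S g \<Longrightarrow> smooth_on S (\<lambda>x. B (f x) (g x))"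
  by (simp add: smooth_on_def C_k_on_bilinear)

lemmas smooth_on_scaleR = smooth_on_bilinear[OF bounded_bilinear_scaleR]
lemmas smooth_on_mult = smooth_on_bilinear[OF bounded_bilinear_mult]

lemma smooth_on_ray_derivative:
  fixes f :: "'a::real_normed_vector \<Rightarrow> 'b::real_normed_vector"
  assumes "smooth_on B f" "t *\<^sub>R v \<in> B"
  shows "((\<lambda>s. f (s *\<^sub>R v)) has_vector_derivative fder f (t *\<^sub>R v) v) (at t)"
proof -
  have "((\<lambda>t. t *\<^sub>R v) has_derivative (\<lambda>s. s *\<^sub>R v)) (at t)"
    by (auto intro!: derivative_eq_intros)
  from has_derivative_compose[OF this smooth_on_has_derivative[OF assms]]
  show ?thesis
    unfolding has_vector_derivative_def
    using linear_scale[OF has_derivative_linear[OF smooth_on_has_derivative[OF assms]]] by simp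
qed

lemma smooth_on_sum:
  "open S \<Longrightarrow> (\<And>i. i \<in> I \<Longrightarrow> smooth_on S (f i)) \<Longrightarrow> smooth_on S (\<lambda>x. \<Sum>i\<in>I. f i x)"
  by (simp add: smooth_on_def C_k_on_sum)

lemma smooth_on_Pair:
  "open S \<Longrightarrow> smooth_on S f \<Longrightarrow> smooth_on S g \<Longrightarrow> smooth_on S (\<lambda>x. (f x, g x))"
  by (simp add: smooth_on_def C_k_on_Pair)

lemma smooth_on_linear_family:
  fixes z :: "'a::real_normed_vector \<Rightarrow> 'c::euclidean_space" and L :: "'a \<Rightarrow> 'c \<Rightarrow> 'b::real_normed_vector"
  assumes "open S" "\<And>x. x \<in> S \<Longrightarrow> linear (L x)" "\<And>u. smooth_on S (\<lambda>x. L x u)" "smooth_on S z"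
  shows "smooth_on S (\<lambda>x. L x (z x))"
  unfolding smooth_on_def
  by (intro allI C_k_on_linear_family[OF assms(1,2) smooth_onD[OF assms(3)] smooth_onD[OF assms(4)]])

lemma smooth_on_compose:
  fixes g :: "'a::real_normed_vector \<Rightarrow> 'b::euclidean_space" and f :: "'b \<Rightarrow> 'c::real_normed_vector"
  assumes "open U" "open V" "g ` U \<subseteq> V" "smooth_on V f" "smooth_on U g"
  shows "smooth_on U (\<lambda>x. f (g x))"
  unfolding smooth_on_def
  by (intro allI C_k_on_compose[OF assms(1-3) smooth_onD[OF assms(4)] smooth_onD[OF assms(5)]])

lemma smooth_on_linear_solution:
  fixes L :: "'a::real_normed_vector \<Rightarrow> 'c::euclidean_space \<Rightarrow> 'c"
  assumes "open S" "\<And>x. x \<in> S \<Longrightarrow> linear (L x)" "\<And>x. x \<in> S \<Longrightarrow> inj (L x)"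
    and "\<And>u. smooth_on S (\<lambda>x. L x u)" "smooth_on S w" "\<And>x. x \<in> S \<Longrightarrow> L x (z x) = w x"
  shows "smooth_on S z"
  unfolding smooth_on_def
  by (intro allI C_k_on_linear_solution[OF assms(1-3) smooth_onD[OF assms(4)] smooth_onD[OF assms(5)] assms(6)])

lemma smooth_on_fder_family:
  fixes f :: "'a::euclidean_space \<Rightarrow> 'b::real_normed_vector" and z :: "'a \<Rightarrow> 'a"
  assumes "open S" "smooth_on S f" "smooth_on S z"
  shows "smooth_on S (\<lambda>x. fder f x (z x))"
  by (rule smooth_on_linear_family[OF assms(1) _ smooth_on_fder[OF assms(2)] assms(3)])
    (rule has_derivative_linear[OF smooth_on_has_derivative[OF assms(2)]])

text \<open>The derivative of the reciprocal is a product of reciprocals, so the induction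
  hypothesis applies to it.\<close>

lemma smooth_on_inverse_real: "smooth_on {x::real. x \<noteq> 0} inverse"
proof -
  have op: "open {x::real. x \<noteq> 0}"
    using open_Compl[of "{0::real}"] by (simp add: Compl_eq)
  have "C_k_on k {x::real. x \<noteq> 0} inverse" for k
  proof (induction k)
    case 0
    show ?case by (auto intro!: continuous_intros)
  next
    case (Suc k)
    show ?case
    proof (rule C_k_on_SucI[OF op])
      show "(inverse has_derivative (\<lambda>v. - (inverse x * v * inverse x))) (at x)"
        if "x \<in> {x::real. x \<noteq> 0}" for x
        using has_derivative_inverse'[of x UNIV] that by simp
      show "C_k_on k {x::real. x \<noteq> 0} (\<lambda>x. - (inverse x * v * inverse x))" for v
        by (intro C_k_on_minus C_k_on_mult C_k_on_const op Suc)
    qed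
  qed
  then show ?thesis by (simp add: smooth_on_def)
qed

lemma smooth_on_divide:
  fixes f g :: "'a::real_normed_vector \<Rightarrow> real"
  assumes "open S" "smooth_on S f" "smooth_on S g" "\<And>x. x \<in> S \<Longrightarrow> g x \<noteq> 0"
  shows "smooth_on S (\<lambda>x. f x / g x)"
proof -
  have "open {x::real. x \<noteq> 0}"
    using open_Compl[of "{0::real}"] by (simp add: Compl_eq)
  then have "smooth_on S (\<lambda>x. inverse (g x))"
    by (intro smooth_on_compose[OF assms(1) _ _ smooth_on_inverse_real assms(3)]) (use assms(4) in auto)
  then show ?thesis
    unfolding divide_inverse by (intro smooth_on_mult assms)
qed

text \<open>The derivative of the root is half its reciprocal, a composite of \<open>inverse\<close>
  with the root itself.\<close>

lemma smooth_on_sqrt: "smooth_on {0<..} sqrt"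
proof -
  have "C_k_on k {0<..} sqrt" for k
  proof (induction k)
    case 0
    show ?case by (auto intro!: continuous_intros)
  next
    case (Suc k)
    have nz: "open {x::real. x \<noteq> 0}"
      using open_Compl[of "{0::real}"] by (simp add: Compl_eq)
    have op: "open {(0::real)<..}" by simp
    show ?case
    proof (rule C_k_on_SucI[OF op])
      show "(sqrt has_derivative (\<lambda>v. v * (inverse (sqrt x) / 2))) (at x)" if "x \<in> {0<..}" for x
        using DERIV_real_sqrt[of x] that
        unfolding has_field_derivative_def by (simp add: mult.commute[of _ "inverse (sqrt x) / 2"] del: times_divide_eq_right times_divide_eq_left)
      have 1: "C_k_on k {0<..} (\<lambda>x. inverse (sqrt x))"
        by (rule C_k_on_compose[OF op nz _ smooth_onD[OF smooth_on_inverse_real] Suc]) auto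
      show "C_k_on k {0<..} (\<lambda>x. v * (inverse (sqrt x) / 2))" for v
        unfolding divide_inverse
        by (rule C_k_on_mult[OF op C_k_on_const C_k_on_mult[OF op 1 C_k_on_const]])
    qed
  qed
  then show ?thesis by (simp add: smooth_on_def)
qed

text \<open>The mean value theorem twice: for the difference in direction \<open>v\<close> as a
  function of the step \<open>s\<close> along \<open>u\<close>, then for the derivative in direction
  \<open>u\<close> as a function of the step \<open>t\<close> along \<open>v\<close>.\<close>

lemma second_difference_mvt:
  fixes f :: "'a::real_normed_vector \<Rightarrow> real"
  assumes h: "h > 0"
    and S: "\<And>s t. s \<in> {0..h} \<Longrightarrow> t \<in> {0..h} \<Longrightarrow> x + s *\<^sub>R u + t *\<^sub>R v \<in> S"
    and f: "C_k_on 2 S f"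
  obtains s t where "s \<in> {0<..<h}" "t \<in> {0<..<h}"
    "f (x + h *\<^sub>R u + h *\<^sub>R v) - f (x + h *\<^sub>R u) - f (x + h *\<^sub>R v) + f x
      = h * h * fder (\<lambda>y. fder f y u) (x + s *\<^sub>R u + t *\<^sub>R v) v"
proof -
  have df: "(f has_derivative fder f y) (at y)" if "y \<in> S" for y
    using f that by (auto simp: numeral_2_eq_2 intro: has_fder)
  have ddf: "((\<lambda>y. fder f y u) has_derivative fder (\<lambda>y. fder f y u) y) (at y)" if "y \<in> S" for y
    using f that by (auto simp: numeral_2_eq_2 intro: has_fder)
  define G where "G s = f (x + s *\<^sub>R u + h *\<^sub>R v) - f (x + s *\<^sub>R u)" for s
  define G' where "G' s r = r * (fder f (x + s *\<^sub>R u + h *\<^sub>R v) u - fder f (x + s *\<^sub>R u) u)" for s r :: real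
  have G: "(G has_derivative G' s) (at s within {0..h})" if "s \<in> {0..h}" for s
  proof -
    have in1: "x + s *\<^sub>R u + h *\<^sub>R v \<in> S" and in2: "x + s *\<^sub>R u \<in> S"
      using S[OF that, of h] S[OF that, of 0] h by auto
    have "((\<lambda>s. x + s *\<^sub>R u + h *\<^sub>R v) has_derivative (\<lambda>r. r *\<^sub>R u)) (at s within {0..h})"
      "((\<lambda>s. x + s *\<^sub>R u) has_derivative (\<lambda>r. r *\<^sub>R u)) (at s within {0..h})"
      by (auto intro!: derivative_eq_intros)
    from has_derivative_diff[OF has_derivative_compose[OF this(1) df[OF in1]] has_derivative_compose[OF this(2) df[OF in2]]]
    show ?thesis
      unfolding G_def G'_def
      using linear_scale[OF has_derivative_linear[OF df[OF in1]]] linear_scale[OF has_derivative_linear[OF df[OF in2]]]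
      by (simp add: right_diff_distrib)
  qed
  obtain s where s: "s \<in> {0<..<h}" "G h - G 0 = G' s (h - 0)"
    using mvt_simple[OF h G] by (metis greaterThanLessThan_iff atLeastAtMost_iff)
  define H where "H t = fder f (x + s *\<^sub>R u + t *\<^sub>R v) u" for t
  define H' where "H' t r = r * fder (\<lambda>y. fder f y u) (x + s *\<^sub>R u + t *\<^sub>R v) v" for t r :: real
  have H: "(H has_derivative H' t) (at t within {0..h})" if "t \<in> {0..h}" for t
  proof -
    have in1: "x + s *\<^sub>R u + t *\<^sub>R v \<in> S" using S[OF _ that, of s] s by auto
    have "((\<lambda>t. x + s *\<^sub>R u + t *\<^sub>R v) has_derivative (\<lambda>r. r *\<^sub>R v)) (at t within {0..h})"
      by (auto intro!: derivative_eq_intros)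
    from has_derivative_compose[OF this ddf[OF in1]]
    show ?thesis
      unfolding H_def H'_def
      using linear_scale[OF has_derivative_linear[OF ddf[OF in1]]] by simp
  qed
  obtain t where t: "t \<in> {0<..<h}" "H h - H 0 = H' t (h - 0)"
    using mvt_simple[OF h H] by (metis greaterThanLessThan_iff atLeastAtMost_iff)
  show ?thesis
    by (rule that[OF s(1) t(1)]) (use s(2) t(2) in \<open>simp add: G_def G'_def H_def H'_def algebra_simps\<close>)
qed

text \<open>The second difference over a parallelogram is symmetric in \<open>u\<close> and
  \<open>v\<close>, while the preceding lemma expresses it by either mixed derivative at a nearby
  point; continuity at \<open>x\<close> does the rest.\<close>

lemma fder_commute_real:
  fixes f :: "'a::real_normed_vector \<Rightarrow> real"
  assumes "open S" "x \<in> S" "C_k_on 2 S f"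
  shows "fder (\<lambda>y. fder f y u) x v = fder (\<lambda>y. fder f y v) x u"
proof (rule ccontr)
  let ?A = "\<lambda>y. fder (\<lambda>y. fder f y u) y v" and ?B = "\<lambda>y. fder (\<lambda>y. fder f y v) y u"
  assume ne: "?A x \<noteq> ?B x"
  \<comment> \<open>Half the gap: a number cannot be closer than \<open>e\<close> to both
    sides.\<close>
  define e where "e = \<bar>?A x - ?B x\<bar> / 2"
  have e: "e > 0" using ne by (simp add: e_def)
  have "continuous_on S ?A" "continuous_on S ?B"
    using assms(3) by (simp_all add: numeral_2_eq_2)
  then have "isCont ?A x" "isCont ?B x"
    using assms(2) by (simp_all only: continuous_on_eq_continuous_at[OF assms(1)])
  then have "(?A \<longlongrightarrow> ?A x) (nhds x)" "(?B \<longlongrightarrow> ?B x) (nhds x)"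
    unfolding isCont_def tendsto_at_iff_tendsto_nhds[of ?A x] tendsto_at_iff_tendsto_nhds[of ?B x] .
  then have "\<forall>\<^sub>F y in nhds x. dist (?A y) (?A x) < e" "\<forall>\<^sub>F y in nhds x. dist (?B y) (?B x) < e"
    using tendstoD[OF _ e] by blast+
  moreover have "\<forall>\<^sub>F y in nhds x. y \<in> S"
    using eventually_nhds_in_open[OF assms(1,2)] .
  ultimately have "\<forall>\<^sub>F y in nhds x. y \<in> S \<and> dist (?A y) (?A x) < e \<and> dist (?B y) (?B x) < e"
    by eventually_elim simp
  then obtain d where d: "d > 0" "\<And>y. dist y x < d \<Longrightarrow> y \<in> S \<and> dist (?A y) (?A x) < e \<and> dist (?B y) (?B x) < e"
    unfolding eventually_nhds_metric by blast
  define N where "N = norm u + norm v + 1"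
  \<comment> \<open>The parallelogram with steps up to \<open>h\<close> stays inside the ball of
    radius \<open>d\<close>; the summand 1 in \<open>N\<close> covers
    \<open>u = v = 0\<close>.\<close>
  define h where "h = d / N / 2"
  have nn: "N > 0" unfolding N_def by (intro add_nonneg_pos add_nonneg_nonneg) auto
  then have h: "h > 0" using d by (simp add: h_def)
  have near: "dist (x + s *\<^sub>R w + t *\<^sub>R z) x < d"
    if "s \<in> {0..h}" "t \<in> {0..h}" "norm w + norm z = norm u + norm v" for s t w z
  proof -
    have "dist (x + s *\<^sub>R w + t *\<^sub>R z) x = norm (s *\<^sub>R w + t *\<^sub>R z)" by (simp add: dist_norm)
    also have "\<dots> \<le> s * norm w + t * norm z"
      using norm_triangle_ineq[of "s *\<^sub>R w" "t *\<^sub>R z"] that by simp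
    also have "\<dots> \<le> h * norm w + h * norm z"
      using that by (intro add_mono mult_right_mono) auto
    also have "\<dots> = h * (norm u + norm v)" using that(3) by (simp flip: distrib_left)
    also have "\<dots> < 2 * h * N"
      using h nn unfolding N_def by (simp add: field_simps add_strict_increasing)
    also have "\<dots> = d" unfolding h_def using nn by simp
    finally show ?thesis .
  qed
  obtain s t where st: "s \<in> {0<..<h}" "t \<in> {0<..<h}"
    "f (x + h *\<^sub>R u + h *\<^sub>R v) - f (x + h *\<^sub>R u) - f (x + h *\<^sub>R v) + f x = h * h * ?A (x + s *\<^sub>R u + t *\<^sub>R v)"
    by (rule second_difference_mvt[OF h _ assms(3), of x u v]) (use near d in auto)
  obtain s' t' where st': "s' \<in> {0<..<h}" "t' \<in> {0<..<h}"
    "f (x + h *\<^sub>R v + h *\<^sub>R u) - f (x + h *\<^sub>R v) - f (x + h *\<^sub>R u) + f x = h * h * ?B (x + s' *\<^sub>R v + t' *\<^sub>R u)"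
    by (rule second_difference_mvt[OF h _ assms(3), of x v u]) (use near d in auto)
  have "h * h * ?A (x + s *\<^sub>R u + t *\<^sub>R v) = h * h * ?B (x + s' *\<^sub>R v + t' *\<^sub>R u)"
  proof -
    have "f (x + h *\<^sub>R v + h *\<^sub>R u) = f (x + h *\<^sub>R u + h *\<^sub>R v)" by (simp add: algebra_simps)
    then show ?thesis using st(3) st'(3) by linarith
  qed
  then have "?A (x + s *\<^sub>R u + t *\<^sub>R v) = ?B (x + s' *\<^sub>R v + t' *\<^sub>R u)" using h by simp
  moreover have "dist (?A (x + s *\<^sub>R u + t *\<^sub>R v)) (?A x) < e"
    using d(2) near[of s t u v] st by auto
  moreover have "dist (?B (x + s' *\<^sub>R v + t' *\<^sub>R u)) (?B x) < e"
    using d(2) near[of s' t' v u] st' by auto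
  ultimately show False unfolding e_def dist_real_def by (simp add: abs_if split: if_splits)
qed

lemma fder_commute:
  fixes f :: "'a::real_normed_vector \<Rightarrow> 'b::real_inner"
  assumes S: "open S" "x \<in> S" and f: "smooth_on S f"
  shows "fder (\<lambda>y. fder f y u) x v = fder (\<lambda>y. fder f y v) x u"
proof -
  have inner_fder: "fder (\<lambda>y. k y \<bullet> w) y r = fder k y r \<bullet> w"
    if "smooth_on S k" "y \<in> S" for k :: "'a \<Rightarrow> 'b" and w y r
    by (subst fder_eqI[OF has_derivative_inner_left[OF smooth_on_has_derivative[OF that]]]) simp
  have inner_fder2: "fder (\<lambda>y. fder (\<lambda>y. f y \<bullet> w) y r) x r' = fder (\<lambda>y. fder f y r) x r' \<bullet> w" for w r r'
    using fder_cong_open[OF S, of "\<lambda>y. fder (\<lambda>y. f y \<bullet> w) y r" "\<lambda>y. fder f y r \<bullet> w"]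
      inner_fder[OF f] inner_fder[OF smooth_on_fder[OF f] S(2)] by simp
  have "smooth_on S (\<lambda>y. f y \<bullet> w)" for w
    by (intro smooth_on_linear_comp[OF S(1) bounded_linear_inner_left f])
  then have "fder (\<lambda>y. fder (\<lambda>y. f y \<bullet> w) y u) x v = fder (\<lambda>y. fder (\<lambda>y. f y \<bullet> w) y v) x u" for w
    by (intro fder_commute_real[OF S] smooth_onD)
  then have "fder (\<lambda>y. fder f y u) x v \<bullet> w = fder (\<lambda>y. fder f y v) x u \<bullet> w" for w
    by (simp add: inner_fder2)
  then show ?thesis using vector_eq_rdot by blast
qed

section \<open>Bilinear maps depending on a parameter\<close>

lemma bilinear_linear_left: "bilinear B \<Longrightarrow> linear (\<lambda>u. B u v)"
  and bilinear_linear_right: "bilinear B \<Longrightarrow> linear (B u)"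
  by (simp_all add: bilinear_def)

lemma has_derivative_bilinear_family:
  fixes B :: "'p::real_normed_vector \<Rightarrow> 'a::euclidean_space \<Rightarrow> 'b::euclidean_space \<Rightarrow> 'c::real_normed_vector"
  assumes S: "open S" "x \<in> S" and B: "\<And>y. y \<in> S \<Longrightarrow> bilinear (B y)"
    and B': "\<And>u v. ((\<lambda>y. B y u v) has_derivative (\<lambda>w. B' w u v)) (at x)"
    and X: "(X has_derivative X') (at x)" and Y: "(Y has_derivative Y') (at x)"
  shows "((\<lambda>y. B y (X y) (Y y)) has_derivative
    (\<lambda>w. B' w (X x) (Y x) + B x (X' w) (Y x) + B x (X x) (Y' w))) (at x)"
proof -
  have 1: "((\<lambda>y. B y (X y) v) has_derivative (\<lambda>w. B' w (X x) v + B x (X' w) v)) (at x)" for v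
    by (rule has_derivative_linear_family[OF S bilinear_linear_left[OF B] B' X])
  show ?thesis
    by (rule has_derivative_linear_family[OF S bilinear_linear_right[OF B] 1 Y])
qed

lemma smooth_on_bilinear_family:
  fixes B :: "'p::real_normed_vector \<Rightarrow> 'a::euclidean_space \<Rightarrow> 'b::euclidean_space \<Rightarrow> 'c::real_normed_vector"
  assumes S: "open S" and B: "\<And>y. y \<in> S \<Longrightarrow> bilinear (B y)"
    and B': "\<And>u v. smooth_on S (\<lambda>y. B y u v)"
    and X: "smooth_on S X" and Y: "smooth_on S Y"
  shows "smooth_on S (\<lambda>y. B y (X y) (Y y))"
proof -
  have 1: "smooth_on S (\<lambda>y. B y (X y) v)" for v
    by (rule smooth_on_linear_family[OF S bilinear_linear_left[OF B] B' X])
  show ?thesis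
    by (rule smooth_on_linear_family[OF S bilinear_linear_right[OF B] 1 Y])
qed

section \<open>Metrics on open sets\<close>

text \<open>Abstracts from charts: the instances are chart ranges, overlaps of charts, and subsets
  of a tangent space with the metric pulled back along an exponential map.\<close>

locale local_metric =
  fixes S :: "'e::euclidean_space set" and h :: "'e \<Rightarrow> 'e \<Rightarrow> 'e \<Rightarrow> real"
  assumes open_S: "open S"
    and h_smooth: "smooth_on S (\<lambda>x. h x u v)"
    and h_bilinear: "x \<in> S \<Longrightarrow> bilinear (h x)"
    and h_sym: "x \<in> S \<Longrightarrow> h x u v = h x v u"
    and h_nondegenerate: "x \<in> S \<Longrightarrow> form_nondegenerate_on UNIV (h x)"
begin

abbreviation \<Gamma> :: "'e \<Rightarrow> 'e \<Rightarrow> 'e \<Rightarrow> 'e" where "\<Gamma> \<equiv> christoffel h"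

lemma h_has_derivative: "x \<in> S \<Longrightarrow> ((\<lambda>y. h y u v) has_derivative fder (\<lambda>y. h y u v) x) (at x)"
  by (rule smooth_on_has_derivative[OF h_smooth])

lemma levi_civita_ex1:
  assumes "x \<in> S"
  shows "\<exists>!B. is_levi_civita_form h x B"
  by (rule levi_civita_form_unique[where h = h, OF open_S assms h_bilinear h_sym h_nondegenerate[OF assms]])
    (simp_all add: differentiableI[OF h_has_derivative[OF assms]])

lemma \<Gamma>_levi_civita: "x \<in> S \<Longrightarrow> is_levi_civita_form h x (\<Gamma> x)"
  unfolding christoffel_def by (rule theI'[OF levi_civita_ex1])

lemma \<Gamma>_unique: "x \<in> S \<Longrightarrow> is_levi_civita_form h x B \<Longrightarrow> \<Gamma> x = B"
  using levi_civita_ex1 \<Gamma>_levi_civita by blast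

lemma \<Gamma>_bilinear: "x \<in> S \<Longrightarrow> bilinear (\<Gamma> x)"
  and \<Gamma>_sym: "x \<in> S \<Longrightarrow> \<Gamma> x u v = \<Gamma> x v u"
  and \<Gamma>_metric: "x \<in> S \<Longrightarrow> fder (\<lambda>y. h y v w) x u = h x (\<Gamma> x u v) w + h x v (\<Gamma> x u w)"
  using \<Gamma>_levi_civita unfolding is_levi_civita_form_def by blast+

lemma h_cancel:
  assumes "x \<in> S" "\<And>w. h x z w = h x z' w"
  shows "z = z'"
proof -
  have "\<forall>w. h x (z - z') w = 0"
    using assms by (simp add: bilinear_lsub[OF h_bilinear])
  then show ?thesis
    using h_nondegenerate[OF assms(1)] unfolding form_nondegenerate_on_def by auto
qed

text \<open>Two instances of metric compatibility minus the third leave a single Christoffel term,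
  twice. The formula exhibits \<open>\<Gamma>\<close> as the solution of a linear system with smooth
  right side.\<close>

lemma koszul:
  assumes "x \<in> S"
  shows "h x (\<Gamma> x u v) w =
    (fder (\<lambda>y. h y v w) x u + fder (\<lambda>y. h y w u) x v - fder (\<lambda>y. h y u v) x w) / 2"
  unfolding \<Gamma>_metric[OF assms]
  using \<Gamma>_sym[OF assms, of u v] \<Gamma>_sym[OF assms, of v w] \<Gamma>_sym[OF assms, of u w]
    h_sym[OF assms, of v "\<Gamma> x u w"] h_sym[OF assms, of w "\<Gamma> x u v"] h_sym[OF assms, of u "\<Gamma> x v w"]
  by simp

lemma \<Gamma>_smooth: "smooth_on S (\<lambda>x. \<Gamma> x u v)"
proof -
  \<comment> \<open>\<open>L x z\<close> lists the numbers \<open>h x z b\<close>, so the Koszul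
    formula reads \<open>L x (\<Gamma> x u v) = w x\<close>, and nondegeneracy of \<open>h x\<close>
    is injectivity of \<open>L x\<close>.\<close>
  define L where "L x z = (\<Sum>b\<in>Basis. h x z b *\<^sub>R b)" for x z :: 'e
  have Lb: "L x z \<bullet> b = h x z b" if "b \<in> Basis" for x z b
    unfolding L_def using that by simp
  define w where "w x = (\<Sum>b\<in>Basis. ((fder (\<lambda>y. h y v b) x u + fder (\<lambda>y. h y b u) x v - fder (\<lambda>y. h y u v) x b) / 2) *\<^sub>R b)" for x
  show ?thesis
  proof (rule smooth_on_linear_solution[OF open_S])
    fix x assume x: "x \<in> S"
    show lin: "linear (L x)"
      by (rule linearI)
        (simp_all add: L_def bilinear_ladd[OF h_bilinear[OF x]] bilinear_lmul[OF h_bilinear[OF x]]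
          scaleR_left_distrib sum.distrib scaleR_sum_right)
    show "inj (L x)"
    proof (rule injI)
      fix z z' assume eq: "L x z = L x z'"
      have "h x z = h x z'"
        by (rule linear_eq_stdbasis[OF bilinear_linear_right[OF h_bilinear[OF x]] bilinear_linear_right[OF h_bilinear[OF x]]])
          (use Lb eq in metis)
      then show "z = z'"
        using h_cancel[OF x] by simp
    qed
    show "L x (\<Gamma> x u v) = w x"
      unfolding L_def w_def koszul[OF x] ..
  next
    show "smooth_on S (\<lambda>x. L x z)" for z
      unfolding L_def by (intro smooth_on_sum smooth_on_scaleR smooth_on_const h_smooth open_S)
    show "smooth_on S w"
      unfolding w_def divide_inverse
      by (intro smooth_on_sum smooth_on_scaleR smooth_on_mult smooth_on_add smooth_on_diff smooth_on_const
          smooth_on_fder[OF h_smooth] open_S)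
  qed
qed

lemma \<Gamma>_has_derivative: "x \<in> S \<Longrightarrow> ((\<lambda>y. \<Gamma> y u v) has_derivative fder (\<lambda>y. \<Gamma> y u v) x) (at x)"
  by (rule smooth_on_has_derivative[OF \<Gamma>_smooth])

lemma h_along_smooth:
  fixes \<psi> X Y :: "'p::euclidean_space \<Rightarrow> 'e"
  assumes T: "open T" "smooth_on T \<psi>" "\<psi> ` T \<subseteq> S" and X: "smooth_on T X" and Y: "smooth_on T Y"
  shows "smooth_on T (\<lambda>x. h (\<psi> x) (X x) (Y x))"
proof (rule smooth_on_bilinear_family[OF T(1) _ _ X Y])
  show "bilinear (h (\<psi> y))" if "y \<in> T" for y using h_bilinear T(3) that by blast
  show "smooth_on T (\<lambda>y. h (\<psi> y) u v)" for u v
    by (rule smooth_on_compose[OF T(1) open_S T(3) h_smooth T(2)])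
qed

lemma \<Gamma>_along_smooth:
  fixes \<psi> X Y :: "'p::euclidean_space \<Rightarrow> 'e"
  assumes T: "open T" "smooth_on T \<psi>" "\<psi> ` T \<subseteq> S" and X: "smooth_on T X" and Y: "smooth_on T Y"
  shows "smooth_on T (\<lambda>x. \<Gamma> (\<psi> x) (X x) (Y x))"
proof (rule smooth_on_bilinear_family[OF T(1) _ _ X Y])
  show "bilinear (\<Gamma> (\<psi> y))" if "y \<in> T" for y using \<Gamma>_bilinear T(3) that by blast
  show "smooth_on T (\<lambda>y. \<Gamma> (\<psi> y) u v)" for u v
    by (rule smooth_on_compose[OF T(1) open_S T(3) \<Gamma>_smooth T(2)])
qed

text \<open>The covariant derivative of a vector field \<open>U\<close> along a map \<open>\<psi>\<close>, in the direction \<open>a\<close>.\<close>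

definition cov :: "('p::real_normed_vector \<Rightarrow> 'e) \<Rightarrow> ('p \<Rightarrow> 'e) \<Rightarrow> 'p \<Rightarrow> 'p \<Rightarrow> 'e" where
  "cov \<psi> U x a = fder U x a + \<Gamma> (\<psi> x) (fder \<psi> x a) (U x)"

text \<open>Metric compatibility along a map: the derivative of \<open>h\<close> itself supplies
  exactly the Christoffel terms that complete \<open>X'\<close> and \<open>Y'\<close> to covariant
  derivatives.\<close>

lemma has_derivative_h_along:
  fixes \<psi> X Y :: "'p::real_normed_vector \<Rightarrow> 'e"
  assumes x: "\<psi> x \<in> S" and T: "open T" "x \<in> T" "\<psi> ` T \<subseteq> S"
    and \<psi>: "(\<psi> has_derivative \<psi>') (at x)"
    and X: "(X has_derivative X') (at x)" and Y: "(Y has_derivative Y') (at x)"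
  shows "((\<lambda>y. h (\<psi> y) (X y) (Y y)) has_derivative (\<lambda>a.
    h (\<psi> x) (X' a + \<Gamma> (\<psi> x) (\<psi>' a) (X x)) (Y x) + h (\<psi> x) (X x) (Y' a + \<Gamma> (\<psi> x) (\<psi>' a) (Y x)))) (at x)"
proof -
  note bh = h_bilinear[OF x]
  have 1: "((\<lambda>y. h (\<psi> y) u v) has_derivative (\<lambda>a. fder (\<lambda>y. h y u v) (\<psi> x) (\<psi>' a))) (at x)" for u v
    by (rule has_derivative_compose[OF \<psi> h_has_derivative[OF x]])
  have "((\<lambda>y. h (\<psi> y) (X y) (Y y)) has_derivative (\<lambda>a.
    fder (\<lambda>y. h y (X x) (Y x)) (\<psi> x) (\<psi>' a) + h (\<psi> x) (X' a) (Y x) + h (\<psi> x) (X x) (Y' a))) (at x)"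
    by (rule has_derivative_bilinear_family[OF T(1,2) h_bilinear 1 X Y]) (use T in auto)
  then show ?thesis
    by (rule has_derivative_eq_rhs)
      (simp add: \<Gamma>_metric[OF x] bilinear_ladd[OF bh] bilinear_radd[OF bh] algebra_simps fun_eq_iff)
qed

lemma fder_h_along:
  fixes \<psi> X Y :: "'p::real_normed_vector \<Rightarrow> 'e"
  assumes T: "open T" "x \<in> T" "\<psi> ` T \<subseteq> S" and s: "smooth_on T \<psi>" "smooth_on T X" "smooth_on T Y"
  shows "fder (\<lambda>y. h (\<psi> y) (X y) (Y y)) x a = h (\<psi> x) (cov \<psi> X x a) (Y x) + h (\<psi> x) (X x) (cov \<psi> Y x a)"
proof -
  have x: "\<psi> x \<in> S" using T by blast
  show ?thesis
    unfolding cov_def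
    by (subst fder_eqI[OF has_derivative_h_along[OF x T s[THEN smooth_on_has_derivative[OF _ T(2)]]]]) (rule refl)
qed

lemma cov_smooth:
  fixes \<psi> U :: "'p::euclidean_space \<Rightarrow> 'e"
  assumes T: "open T" "smooth_on T \<psi>" "\<psi> ` T \<subseteq> S" and U: "smooth_on T U"
  shows "smooth_on T (\<lambda>x. cov \<psi> U x a)"
  unfolding cov_def
  by (rule smooth_on_add[OF T(1) smooth_on_fder[OF U] \<Gamma>_along_smooth[OF T smooth_on_fder[OF T(2)] U]])

lemma cov_cong:
  assumes "open T" "x \<in> T" "\<And>y. y \<in> T \<Longrightarrow> U y = V y"
  shows "cov \<psi> U x a = cov \<psi> V x a"
  unfolding cov_def using fder_cong_open[OF assms] assms by simp

text \<open>Symmetry of \<open>\<Gamma>\<close> together with symmetry of the second derivative of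
  \<open>\<psi>\<close>.\<close>

lemma cov_torsion_free:
  fixes \<psi> :: "'p::euclidean_space \<Rightarrow> 'e"
  assumes T: "open T" "x \<in> T" "smooth_on T \<psi>" "\<psi> ` T \<subseteq> S"
  shows "cov \<psi> (\<lambda>x. fder \<psi> x b) x a = cov \<psi> (\<lambda>x. fder \<psi> x a) x b"
proof -
  have x: "\<psi> x \<in> S" using T by blast
  show ?thesis
    unfolding cov_def using fder_commute[OF T(1-3)] \<Gamma>_sym[OF x] by metis
qed

lemma cov_scaleR:
  assumes "\<psi> x \<in> S" "f differentiable (at x)" "X differentiable (at x)"
  shows "cov \<psi> (\<lambda>x. f x *\<^sub>R X x) x a = fder f x a *\<^sub>R X x + f x *\<^sub>R cov \<psi> X x a"
  unfolding cov_def
  by (subst fder_eqI[OF has_derivative_scaleR[OF has_fder[OF assms(2)] has_fder[OF assms(3)]]])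
    (simp add: bilinear_rmul[OF \<Gamma>_bilinear[OF assms(1)]] scaleR_right_distrib)

text \<open>R(u,v)w, with the sign for which R(u,v) is the commutator of the covariant derivatives
  in the directions u and v; for coordinate-constant fields the Lie bracket term vanishes.\<close>

definition Rm :: "'e \<Rightarrow> 'e \<Rightarrow> 'e \<Rightarrow> 'e \<Rightarrow> 'e" where
  "Rm x u v w = fder (\<lambda>y. \<Gamma> y v w) x u - fder (\<lambda>y. \<Gamma> y u w) x v + \<Gamma> x u (\<Gamma> x v w) - \<Gamma> x v (\<Gamma> x u w)"

lemma curvature_eq_Rm:
  assumes x: "x \<in> S"
  shows "curvature h (\<lambda>_. u) (\<lambda>_. v) (\<lambda>_. w) x = Rm x u v w"
proof -
  have *: "nabla h (\<lambda>_. a) (\<lambda>_. b) = (\<lambda>x. \<Gamma> x a b)" for a b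
    by (simp add: nabla_def fun_eq_iff)
  show ?thesis
    unfolding curvature_def *
    by (simp add: nabla_def lie_bracket_def Rm_def bilinear_lzero[OF \<Gamma>_bilinear[OF x]])
qed

text \<open>In the difference the second derivatives of \<open>\<psi>\<close> and of
  \<open>U\<close> cancel by symmetry. Having the identity along an arbitrary map makes it yield the
  skewness of \<open>Rm\<close>, its naturality under isometries and the second Bianchi
  identity.\<close>

lemma cov_commutator:
  fixes \<psi> U :: "'p::euclidean_space \<Rightarrow> 'e"
  assumes T: "open T" "x \<in> T" "smooth_on T \<psi>" "\<psi> ` T \<subseteq> S" and U: "smooth_on T U"
  shows "cov \<psi> (\<lambda>x. cov \<psi> U x b) x a - cov \<psi> (\<lambda>x. cov \<psi> U x a) x b
    = Rm (\<psi> x) (fder \<psi> x a) (fder \<psi> x b) (U x)"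
proof -
  have x: "\<psi> x \<in> S" using T by blast
  note b = \<Gamma>_bilinear[OF x]
  have D1: "((\<lambda>y. \<Gamma> (\<psi> y) u v) has_derivative (\<lambda>r. fder (\<lambda>y. \<Gamma> y u v) (\<psi> x) (fder \<psi> x r))) (at x)" for u v
    by (rule has_derivative_compose[OF smooth_on_has_derivative[OF T(3,2)] \<Gamma>_has_derivative[OF x]])
  have D2: "((\<lambda>y. \<Gamma> (\<psi> y) (fder \<psi> y c) (U y)) has_derivative (\<lambda>r.
      fder (\<lambda>y. \<Gamma> y (fder \<psi> x c) (U x)) (\<psi> x) (fder \<psi> x r)
      + \<Gamma> (\<psi> x) (fder (\<lambda>y. fder \<psi> y c) x r) (U x) + \<Gamma> (\<psi> x) (fder \<psi> x c) (fder U x r))) (at x)" for c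
    by (rule has_derivative_bilinear_family[OF T(1,2) \<Gamma>_bilinear D1
          smooth_on_has_derivative[OF smooth_on_fder[OF T(3)] T(2)] smooth_on_has_derivative[OF U T(2)]])
      (use T in auto)
  have D3: "fder (\<lambda>x. cov \<psi> U x c) x r = fder (\<lambda>x. fder U x c) x r +
     (fder (\<lambda>y. \<Gamma> y (fder \<psi> x c) (U x)) (\<psi> x) (fder \<psi> x r)
      + \<Gamma> (\<psi> x) (fder (\<lambda>y. fder \<psi> y c) x r) (U x) + \<Gamma> (\<psi> x) (fder \<psi> x c) (fder U x r))" for c r
    unfolding cov_def
    by (subst fder_eqI[OF has_derivative_add[OF smooth_on_has_derivative[OF smooth_on_fder[OF U] T(2)] D2]]) (rule refl)
  show ?thesis
    unfolding cov_def[of \<psi> "\<lambda>x. cov \<psi> U x b"] cov_def[of \<psi> "\<lambda>x. cov \<psi> U x a"] D3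
    unfolding cov_def Rm_def
    using fder_commute[OF T(1,2) U, of a b] fder_commute[OF T(1-3), of a b]
    by (simp add: bilinear_radd[OF b])
qed

text \<open>\<open>\<Gamma>\<close> is bilinear at the points of \<open>S\<close>; as
  \<open>S\<close> is open, its derivative at a point of \<open>S\<close> inherits this.\<close>

lemma fder_\<Gamma>_linear:
  assumes x: "x \<in> S"
  shows "fder (\<lambda>y. \<Gamma> y (p + q) w) x a = fder (\<lambda>y. \<Gamma> y p w) x a + fder (\<lambda>y. \<Gamma> y q w) x a"
    and "fder (\<lambda>y. \<Gamma> y (r *\<^sub>R p) w) x a = r *\<^sub>R fder (\<lambda>y. \<Gamma> y p w) x a"
    and "fder (\<lambda>y. \<Gamma> y w (p + q)) x a = fder (\<lambda>y. \<Gamma> y w p) x a + fder (\<lambda>y. \<Gamma> y w q) x a"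
    and "fder (\<lambda>y. \<Gamma> y w (r *\<^sub>R p)) x a = r *\<^sub>R fder (\<lambda>y. \<Gamma> y w p) x a"
    and "fder (\<lambda>y. \<Gamma> y p w) x (c + d) = fder (\<lambda>y. \<Gamma> y p w) x c + fder (\<lambda>y. \<Gamma> y p w) x d"
    and "fder (\<lambda>y. \<Gamma> y p w) x (r *\<^sub>R c) = r *\<^sub>R fder (\<lambda>y. \<Gamma> y p w) x c"
proof -
  note b = \<Gamma>_bilinear
  show a1: "fder (\<lambda>y. \<Gamma> y (p + q) w) x a = fder (\<lambda>y. \<Gamma> y p w) x a + fder (\<lambda>y. \<Gamma> y q w) x a" for p q w a
    by (subst fder_cong_open[OF open_S x, of _ "\<lambda>y. \<Gamma> y p w + \<Gamma> y q w"])
      (simp_all add: bilinear_ladd[OF b] fder_eqI[OF has_derivative_add[OF \<Gamma>_has_derivative[OF x] \<Gamma>_has_derivative[OF x]]])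
  show s1: "fder (\<lambda>y. \<Gamma> y (r *\<^sub>R p) w) x a = r *\<^sub>R fder (\<lambda>y. \<Gamma> y p w) x a" for p w a r
    by (subst fder_cong_open[OF open_S x, of _ "\<lambda>y. r *\<^sub>R \<Gamma> y p w"])
      (simp_all add: bilinear_lmul[OF b] fder_eqI[OF has_derivative_scaleR_right[OF \<Gamma>_has_derivative[OF x]]])
  have c: "fder (\<lambda>y. \<Gamma> y p w) x a = fder (\<lambda>y. \<Gamma> y w p) x a" for p w a
    by (subst fder_cong_open[OF open_S x, of _ "\<lambda>y. \<Gamma> y w p"]) (simp_all add: \<Gamma>_sym)
  show "fder (\<lambda>y. \<Gamma> y w (p + q)) x a = fder (\<lambda>y. \<Gamma> y w p) x a + fder (\<lambda>y. \<Gamma> y w q) x a"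
    using a1 c by metis
  show "fder (\<lambda>y. \<Gamma> y w (r *\<^sub>R p)) x a = r *\<^sub>R fder (\<lambda>y. \<Gamma> y w p) x a"
    using s1 c by metis
  have lin: "linear (fder (\<lambda>y. \<Gamma> y p w) x)"
    by (rule has_derivative_linear[OF \<Gamma>_has_derivative[OF x]])
  show "fder (\<lambda>y. \<Gamma> y p w) x (c + d) = fder (\<lambda>y. \<Gamma> y p w) x c + fder (\<lambda>y. \<Gamma> y p w) x d"
    "fder (\<lambda>y. \<Gamma> y p w) x (r *\<^sub>R c) = r *\<^sub>R fder (\<lambda>y. \<Gamma> y p w) x c"
    by (rule linear_add[OF lin], rule linear_scale[OF lin])
qed

section \<open>Symmetries of the curvature tensor\<close>

lemma Rm_linear:
  assumes x: "x \<in> S"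
  shows "linear (\<lambda>u. Rm x u v w)" "linear (\<lambda>v. Rm x u v w)" "linear (\<lambda>w. Rm x u v w)"
proof -
  note b = \<Gamma>_bilinear[OF x]
  note simps = Rm_def fder_\<Gamma>_linear[OF x] bilinear_ladd[OF b] bilinear_lmul[OF b]
    bilinear_radd[OF b] bilinear_rmul[OF b] algebra_simps
  show "linear (\<lambda>u. Rm x u v w)" "linear (\<lambda>v. Rm x u v w)" "linear (\<lambda>w. Rm x u v w)"
    by (rule linearI; simp add: simps)+
qed

lemma Rm_antisym: "Rm x u v w = - Rm x v u w"
  by (simp add: Rm_def)

lemma Rm_bianchi:
  assumes x: "x \<in> S"
  shows "Rm x u v w + Rm x v w u + Rm x w u v = 0"
proof -
  have c: "fder (\<lambda>y. \<Gamma> y p w) x a = fder (\<lambda>y. \<Gamma> y w p) x a" for p w a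
    by (subst fder_cong_open[OF open_S x, of _ "\<lambda>y. \<Gamma> y w p"]) (simp_all add: \<Gamma>_sym)
  show ?thesis
    unfolding Rm_def c[of w u] c[of v u] c[of w v] \<Gamma>_sym[OF x, of w u] \<Gamma>_sym[OF x, of v u] \<Gamma>_sym[OF x, of w v]
    by simp
qed

text \<open>The second derivatives of the function \<open>h y w z\<close> commute. Expanding both
  orders by metric compatibility, the products of first covariant derivatives are symmetric in the
  two directions and drop out, and only two curvature terms remain.\<close>

lemma Rm_skew:
  assumes x: "x \<in> S"
  shows "h x (Rm x u v w) z = - h x (Rm x u v z) w"
proof -
  let ?id = "\<lambda>x::'e. x"
  have T: "open S" "smooth_on S ?id" "?id ` S \<subseteq> S" using open_S smooth_on_ident by auto
  let ?C = "\<lambda>c w y. cov ?id (\<lambda>_. w) y c"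
  have smC: "smooth_on S (?C c w)" for c w
    by (rule cov_smooth[OF T smooth_on_const])
  have 1: "fder (\<lambda>y. h y w z) y c = h y (?C c w y) z + h y w (?C c z y)" if "y \<in> S" for y c
    using fder_h_along[OF T(1) that T(3,2) smooth_on_const smooth_on_const, of w z c] by simp
  have 2: "fder (\<lambda>y. fder (\<lambda>y. h y w z) y c) x d =
    (h x (cov ?id (?C c w) x d) z + h x (?C c w x) (?C d z x)) + (h x (?C d w x) (?C c z x) + h x w (cov ?id (?C c z) x d))" for c d
  proof -
    have "fder (\<lambda>y. fder (\<lambda>y. h y w z) y c) x d = fder (\<lambda>y. h y (?C c w y) z + h y w (?C c z y)) x d"
      using fder_cong_open[OF open_S x, of "\<lambda>y. fder (\<lambda>y. h y w z) y c"] 1 by simp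
    also have "\<dots> = fder (\<lambda>y. h y (?C c w y) z) x d + fder (\<lambda>y. h y w (?C c z y)) x d"
      by (subst fder_eqI[OF has_derivative_add[OF
            smooth_on_has_derivative[OF h_along_smooth[OF T smC smooth_on_const] x]
            smooth_on_has_derivative[OF h_along_smooth[OF T smooth_on_const smC] x]]]) (rule refl)
    finally show ?thesis
      using fder_h_along[OF T(1) x T(3,2) smC[of w c] smooth_on_const, of z d]
        fder_h_along[OF T(1) x T(3,2) smooth_on_const smC[of z c], of w d] by simp
  qed
  have 3: "cov ?id (?C v w) x u - cov ?id (?C u w) x v = Rm x u v w" for w
    using cov_commutator[OF T(1) x T(2,3) smooth_on_const, of w v u] by simp
  have "fder (\<lambda>y. fder (\<lambda>y. h y w z) y v) x u = fder (\<lambda>y. fder (\<lambda>y. h y w z) y u) x v"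
    by (rule fder_commute[OF open_S x h_smooth])
  then have "h x (cov ?id (?C v w) x u) z - h x (cov ?id (?C u w) x v) z
     + (h x w (cov ?id (?C v z) x u) - h x w (cov ?id (?C u z) x v)) = 0"
    unfolding 2 by simp
  then show ?thesis
    unfolding 3[symmetric]
    by (simp add: bilinear_lsub[OF h_bilinear[OF x]] bilinear_rsub[OF h_bilinear[OF x]] h_sym[OF x, of w])
qed

end

subsection \<open>Isometric maps\<close>

text \<open>The isometry condition concerns differentials, so chart transitions and exponential maps
  are both covered. Source and target have the same model space and the source metric is
  nondegenerate, so every differential is bijective.\<close>

locale local_isometry = M1: local_metric S1 h1 + M2: local_metric S2 h2
  for S1 :: "'e::euclidean_space set" and h1 and S2 :: "'e set" and h2 +
  fixes \<psi> :: "'e \<Rightarrow> 'e"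
  assumes \<psi>_smooth: "smooth_on S1 \<psi>" and \<psi>_image: "\<psi> ` S1 \<subseteq> S2"
    and isometric: "x \<in> S1 \<Longrightarrow> h1 x u v = h2 (\<psi> x) (fder \<psi> x u) (fder \<psi> x v)"
begin

lemma \<psi>_linear: "x \<in> S1 \<Longrightarrow> linear (fder \<psi> x)"
  by (rule has_derivative_linear[OF smooth_on_has_derivative[OF \<psi>_smooth]])

lemma \<psi>_inj:
  assumes x: "x \<in> S1"
  shows "inj (fder \<psi> x)"
proof (rule injI)
  fix u v assume "fder \<psi> x u = fder \<psi> x v"
  then show "u = v" by (intro M1.h_cancel[OF x]) (simp add: isometric[OF x])
qed

lemma \<psi>_surj: "x \<in> S1 \<Longrightarrow> surj (fder \<psi> x)"
  using linear_injective_imp_surjective[OF \<psi>_linear \<psi>_inj] by blast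

text \<open>Pulling the covariant derivative back through the bijective \<open>fder \<psi> x\<close>
  gives a bilinear, symmetric and metric-compatible form; uniqueness of the Levi-Civita form
  identifies it.\<close>

lemma christoffel_transform:
  assumes x: "x \<in> S1"
  shows "fder \<psi> x (christoffel h1 x u v) = M2.cov \<psi> (\<lambda>x. fder \<psi> x v) x u"
proof -
  have x2: "\<psi> x \<in> S2" using x \<psi>_image by blast
  note T = M1.open_S x \<psi>_smooth \<psi>_image
  define B where "B u v = inv (fder \<psi> x) (M2.cov \<psi> (\<lambda>x. fder \<psi> x v) x u)" for u v
  have B: "fder \<psi> x (B u v) = M2.cov \<psi> (\<lambda>x. fder \<psi> x v) x u" for u v
    unfolding B_def by (rule surj_f_inv_f[OF \<psi>_surj[OF x]])
  have cancel: "u = v" if "fder \<psi> x u = fder \<psi> x v" for u v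
    using \<psi>_inj[OF x] that by (rule injD)
  have Bs: "B u v = B v u" for u v
    by (rule cancel) (simp only: B M2.cov_torsion_free[OF T])
  have linc: "linear (M2.cov \<psi> U x)" if "smooth_on S1 U" for U
  proof -
    have "linear (fder U x)"
      by (rule has_derivative_linear[OF smooth_on_has_derivative[OF that x]])
    from linear_add[OF this] linear_scale[OF this] show ?thesis
      by (intro linearI)
        (simp_all add: M2.cov_def linear_add[OF \<psi>_linear[OF x]] linear_scale[OF \<psi>_linear[OF x]]
          bilinear_ladd[OF M2.\<Gamma>_bilinear[OF x2]] bilinear_lmul[OF M2.\<Gamma>_bilinear[OF x2]] scaleR_add_right)
  qed
  have lin1: "linear (\<lambda>u. B u v)" for v
    by (intro linearI; rule cancel)
      (simp_all add: B linear_add[OF \<psi>_linear[OF x]] linear_scale[OF \<psi>_linear[OF x]]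
        linear_add[OF linc[OF smooth_on_fder[OF \<psi>_smooth]]] linear_scale[OF linc[OF smooth_on_fder[OF \<psi>_smooth]]])
  have lin2: "linear (B u)" for u
    using lin1[of u] by (simp only: Bs[of _ u])
  have "bilinear B" unfolding bilinear_def using lin1 lin2 by blast
  moreover have "fder (\<lambda>y. h1 y v w) x u = h1 x (B u v) w + h1 x v (B u w)" for u v w
  proof -
    have "fder (\<lambda>y. h1 y v w) x u = fder (\<lambda>y. h2 (\<psi> y) (fder \<psi> y v) (fder \<psi> y w)) x u"
      using fder_cong_open[OF M1.open_S x, of "\<lambda>y. h1 y v w"] isometric by simp
    also have "\<dots> = h2 (\<psi> x) (M2.cov \<psi> (\<lambda>x. fder \<psi> x v) x u) (fder \<psi> x w)
      + h2 (\<psi> x) (fder \<psi> x v) (M2.cov \<psi> (\<lambda>x. fder \<psi> x w) x u)"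
      by (rule M2.fder_h_along[OF M1.open_S x \<psi>_image \<psi>_smooth smooth_on_fder[OF \<psi>_smooth] smooth_on_fder[OF \<psi>_smooth]])
    finally show ?thesis by (simp add: isometric[OF x] B)
  qed
  ultimately have "christoffel h1 x = B"
    by (intro M1.\<Gamma>_unique[OF x]) (simp add: is_levi_civita_form_def Bs)
  then show ?thesis by (simp add: B)
qed

text \<open>The preceding lemma is the case of constant \<open>Y\<close>. The general case serves
  for the position vector, whose image is the radial field of geodesic spheres.\<close>

lemma cov_transform:
  assumes x: "x \<in> S1" and T: "open T" "x \<in> T" "T \<subseteq> S1" and Y: "smooth_on T Y"
  shows "M2.cov \<psi> (\<lambda>x. fder \<psi> x (Y x)) x u = fder \<psi> x (fder Y x u + christoffel h1 x u (Y x))"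
proof -
  have "((\<lambda>x. fder \<psi> x (Y x)) has_derivative
      (\<lambda>u. fder (\<lambda>x. fder \<psi> x (Y x0)) x u + fder \<psi> x (fder Y x u))) (at x)" if "x0 = x" for x0
    unfolding that
    by (rule has_derivative_linear_family[OF T(1,2) \<psi>_linear
          smooth_on_has_derivative[OF smooth_on_fder[OF \<psi>_smooth] x] smooth_on_has_derivative[OF Y T(2)]])
      (use T in auto)
  from fder_eqI[OF this[OF refl]]
  have "M2.cov \<psi> (\<lambda>x. fder \<psi> x (Y x)) x u = fder (\<lambda>y. fder \<psi> y (Y x)) x u + fder \<psi> x (fder Y x u)
     + christoffel h2 (\<psi> x) (fder \<psi> x u) (fder \<psi> x (Y x))"
    by (simp add: M2.cov_def)
  also have "\<dots> = fder \<psi> x (fder Y x u + christoffel h1 x u (Y x))"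
    using christoffel_transform[OF x, of u "Y x"]
    by (simp add: M2.cov_def linear_add[OF \<psi>_linear[OF x]])
  finally show ?thesis .
qed

text \<open>The commutator identity along \<open>\<psi>\<close> for the field
  \<open>fder \<psi> x w\<close>, whose iterated covariant derivatives are the images of those taken
  in the source.\<close>

lemma Rm_transform:
  assumes x: "x \<in> S1"
  shows "M2.Rm (\<psi> x) (fder \<psi> x u) (fder \<psi> x v) (fder \<psi> x w) = fder \<psi> x (M1.Rm x u v w)"
proof -
  have *: "M2.cov \<psi> (\<lambda>x. M2.cov \<psi> (\<lambda>x. fder \<psi> x w) x b) x a
     = fder \<psi> x (fder (\<lambda>y. christoffel h1 y b w) x a + christoffel h1 x a (christoffel h1 x b w))" for a b
  proof -
    have "M2.cov \<psi> (\<lambda>x. M2.cov \<psi> (\<lambda>x. fder \<psi> x w) x b) x a = M2.cov \<psi> (\<lambda>x. fder \<psi> x (christoffel h1 x b w)) x a"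
      by (rule M2.cov_cong[OF M1.open_S x]) (simp add: christoffel_transform)
    also have "\<dots> = fder \<psi> x (fder (\<lambda>y. christoffel h1 y b w) x a + christoffel h1 x a (christoffel h1 x b w))"
      by (rule cov_transform[OF x M1.open_S x order_refl M1.\<Gamma>_smooth])
    finally show ?thesis .
  qed
  show ?thesis
    using M2.cov_commutator[OF M1.open_S x \<psi>_smooth \<psi>_image smooth_on_fder[OF \<psi>_smooth], of w v u]
    unfolding * by (simp add: M1.Rm_def linear_diff[OF \<psi>_linear[OF x]] linear_add[OF \<psi>_linear[OF x]] algebra_simps)
qed

end

section \<open>Curvature tensors at a point\<close>

locale metric_form =
  fixes b :: "'e::euclidean_space \<Rightarrow> 'e \<Rightarrow> real"
  assumes b_bilinear: "bilinear b" and b_sym: "b u v = b v u"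
    and b_nondegenerate: "form_nondegenerate_on UNIV b"
begin

lemmas b_simps = bilinear_ladd[OF b_bilinear] bilinear_radd[OF b_bilinear]
  bilinear_lmul[OF b_bilinear] bilinear_rmul[OF b_bilinear]
  bilinear_lsub[OF b_bilinear] bilinear_rsub[OF b_bilinear]
  bilinear_lneg[OF b_bilinear] bilinear_rneg[OF b_bilinear]
  bilinear_lzero[OF b_bilinear] bilinear_rzero[OF b_bilinear]

lemma b_eq_0: "(\<And>v. b u v = 0) \<Longrightarrow> u = 0"
  using b_nondegenerate unfolding form_nondegenerate_on_def by blast

lemma polarization_zero:
  assumes "b (u + v) (u + v) = 0" "b u u = 0" "b v v = 0"
  shows "b u v = 0"
  using assms by (simp add: b_simps b_sym[of v u])

lemma exists_nonnull: "\<exists>e. b e e \<noteq> 0"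
proof (rule ccontr)
  assume "\<nexists>e. b e e \<noteq> 0"
  then have "b u v = 0" for u v using polarization_zero by blast
  then have "u = 0" for u using b_eq_0 by blast
  then show False using nonempty_Basis nonzero_Basis by blast
qed

lemma perp_decomposition:
  assumes "b e e \<noteq> 0"
  obtains \<alpha> u where "w = \<alpha> *\<^sub>R e + u" "b e u = 0"
proof
  show "w = (b e w / b e e) *\<^sub>R e + (w - (b e w / b e e) *\<^sub>R e)" by simp
  show "b e (w - (b e w / b e e) *\<^sub>R e) = 0" using assms by (simp add: b_simps)
qed

text \<open>If all vectors orthogonal to \<open>e\<close> were null, polarization would put them
  into the kernel of \<open>b\<close>, and the line of \<open>e\<close> would be the whole
  space.\<close>

lemma exists_nonnull_perp:
  assumes dim: "DIM('e) \<ge> 2" and e: "b e e \<noteq> 0"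
  shows "\<exists>f. b e f = 0 \<and> b f f \<noteq> 0"
proof (rule ccontr)
  assume "\<not> ?thesis"
  then have null: "b f f = 0" if "b e f = 0" for f using that by blast
  have "u = 0" if u: "b e u = 0" for u
  proof (rule b_eq_0)
    fix w
    obtain \<alpha> z where w: "w = \<alpha> *\<^sub>R e + z" "b e z = 0" using perp_decomposition[OF e] by blast
    have "b (u + z) (u + z) = 0" by (rule null) (simp add: b_simps u w(2))
    then have "b u z = 0"
      by (rule polarization_zero) (simp_all add: null u w(2))
    then show "b u w = 0" using w(1) u by (simp add: b_simps b_sym[of u e])
  qed
  then have "w \<in> span {e}" for w
    using perp_decomposition[OF e, of w] by (metis add_0_right rangeI span_singleton)
  then have "(UNIV :: 'e set) \<subseteq> span {e}" by blast
  then have "dim (UNIV :: 'e set) \<le> card {e}"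
    by (intro dim_le_card) auto
  then show False using dim by simp
qed

lemma nondegenerate_plane_iff:
  "nondegenerate_plane b v w \<longleftrightarrow> b v v * b w w - (b v w)\<^sup>2 \<noteq> 0"
proof
  assume nd: "nondegenerate_plane b v w"
  then have vw: "v \<noteq> w" and ind: "independent {v, w}"
    and n: "\<And>u. u \<in> span {v, w} \<Longrightarrow> (\<forall>z\<in>span {v, w}. b u z = 0) \<Longrightarrow> u = 0"
    unfolding nondegenerate_plane_def form_nondegenerate_on_def by blast+
  have w0: "w \<noteq> 0" and v_w: "v \<notin> span {w}"
    using ind vw by (auto simp: independent_insert)
  have sp: "z \<in> span {v, w} \<Longrightarrow> \<exists>x y. z = x *\<^sub>R v + y *\<^sub>R w" for z
    by (auto simp: span_breakdown_eq[of _ v] span_singleton algebra_simps) blast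
  have in_sp: "x *\<^sub>R v + y *\<^sub>R w \<in> span {v, w}" for x y
    by (intro span_add span_scale span_base) auto
  have n': "u = 0" if "u \<in> span {v, w}" "b u v = 0" "b u w = 0" for u
    by (rule n[OF that(1)]) (use sp that in \<open>auto simp: b_simps dest!: sp\<close>)
  have zero: "x = 0 \<and> y = 0" if "x *\<^sub>R v + y *\<^sub>R w = 0" for x y
  proof -
    have "x = 0"
    proof (rule ccontr)
      assume x: "x \<noteq> 0"
      have "v = (1 / x) *\<^sub>R (x *\<^sub>R v)" using x by simp
      also have "x *\<^sub>R v = (- y) *\<^sub>R w" using that by (simp add: eq_neg_iff_add_eq_0)
      finally have "v = (1 / x * - y) *\<^sub>R w" by simp
      then show False using v_w span_singleton by (metis rangeI)
    qed
    then show ?thesis using that w0 by simp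
  qed
  show "b v v * b w w - (b v w)\<^sup>2 \<noteq> 0"
  proof
    assume D: "b v v * b w w - (b v w)\<^sup>2 = 0"
    \<comment> \<open>The coefficients come from the adjugate of the Gram matrix: when the
      determinant vanishes, this combination is orthogonal to the whole plane, and so is the one
      below.\<close>
    have "b w w *\<^sub>R v + (- b v w) *\<^sub>R w = 0"
      by (rule n'[OF in_sp]) (use D in \<open>simp_all add: b_simps b_sym[of w v] power2_eq_square algebra_simps\<close>)
    from zero[OF this] have 1: "b w w = 0" "b v w = 0" by simp_all
    have "(- b v w) *\<^sub>R v + b v v *\<^sub>R w = 0"
      by (rule n'[OF in_sp]) (use D in \<open>simp_all add: b_simps b_sym[of w v] power2_eq_square algebra_simps\<close>)
    from zero[OF this] have 2: "b v v = 0" by simp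
    have "v = 0" by (rule n'[OF span_base]) (simp_all add: 1 2)
    then show False using v_w span_zero by blast
  qed
next
  assume D: "b v v * b w w - (b v w)\<^sup>2 \<noteq> 0"
  have w0: "w \<noteq> 0" using D by (auto simp: b_simps)
  have v_w: "v \<notin> span {w}"
    using D by (auto simp: span_singleton b_simps power2_eq_square)
  then have vw: "v \<noteq> w" by (auto intro: span_base)
  have "u = 0" if u: "u \<in> span {v, w}" and z: "\<forall>z\<in>span {v, w}. b u z = 0" for u
  proof -
    obtain x y where uxy: "u = x *\<^sub>R v + y *\<^sub>R w"
      using u by (auto simp: span_breakdown_eq[of _ v] span_singleton algebra_simps)
    have "b u v = 0" "b u w = 0" using z by (auto intro: span_base)
    then have e: "x * b v v + y * b v w = 0" "x * b v w + y * b w w = 0"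
      unfolding uxy by (simp_all add: b_simps b_sym[of w v])
    \<comment> \<open>Cramer's rule for the two orthogonality equations \<open>e\<close>.\<close>
    have "x * (b v v * b w w - (b v w)\<^sup>2) = (x * b v v + y * b v w) * b w w - (x * b v w + y * b w w) * b v w"
      "y * (b v v * b w w - (b v w)\<^sup>2) = (x * b v w + y * b w w) * b v v - (x * b v v + y * b v w) * b v w"
      by (simp_all add: power2_eq_square algebra_simps)
    then have "x = 0" "y = 0" using D unfolding e by auto
    then show ?thesis using uxy by simp
  qed
  then show "nondegenerate_plane b v w"
    unfolding nondegenerate_plane_def form_nondegenerate_on_def
    using vw w0 v_w by (simp add: independent_insert)
qed

end

text \<open>With \<open>a = b f f\<close>, \<open>c = b w w\<close> and \<open>d = b w f\<close> the
  two expressions are \<open>b\<close> of \<open>w + s f\<close> with itself and with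
  \<open>f\<close>. Only finitely many \<open>s\<close> make one of them vanish.\<close>

lemma quadratic_generic:
  fixes a c d :: real
  assumes "a \<noteq> 0"
  shows "\<exists>s. c + 2 * s * d + s * s * a \<noteq> 0 \<and> d + s * a \<noteq> 0"
proof -
  let ?p = "[:c, 2 * d, a:] * [:d, a:]"
  have "[:c, 2 * d, a:] \<noteq> 0" "[:d, a:] \<noteq> 0" using assms by auto
  then have "?p \<noteq> 0" by (simp only: mult_eq_0_iff) simp
  then have "finite {s. poly ?p s = 0}" by (rule poly_roots_finite)
  then obtain s where "s \<notin> {s. poly ?p s = 0}" using ex_new_if_finite[OF infinite_UNIV_char_0] by blast
  then have "poly [:c, 2 * d, a:] s \<noteq> 0" "poly [:d, a:] s \<noteq> 0"
    by (simp_all only: mem_Collect_eq poly_mult mult_eq_0_iff) simp_all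
  then show ?thesis by (intro exI[of _ s]) (simp add: algebra_simps)
qed

locale curvature_form = metric_form b for b :: "'e::euclidean_space \<Rightarrow> 'e \<Rightarrow> real" +
  fixes R :: "'e \<Rightarrow> 'e \<Rightarrow> 'e \<Rightarrow> 'e"
  assumes R_linear: "linear (\<lambda>u. R u v w)" "linear (\<lambda>v. R u v w)" "linear (\<lambda>w. R u v w)"
    and R_antisym: "R u v w = - R v u w"
    and R_bianchi: "R u v w + R v w u + R w u v = 0"
    and R_skew: "b (R u v w) z = - b (R u v z) w"
begin

lemmas R_simps = linear_add[OF R_linear(1)] linear_add[OF R_linear(2)] linear_add[OF R_linear(3)]
  linear_scale[OF R_linear(1)] linear_scale[OF R_linear(2)] linear_scale[OF R_linear(3)]

lemma R_same: "R u u w = 0"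
proof -
  have "(2::real) *\<^sub>R R u u w = R u u w + R u u w" by (rule scaleR_2)
  also have "\<dots> = 0" using R_antisym[of u u w] by (metis add.right_inverse)
  finally show ?thesis by simp
qed

text \<open>The octahedron argument: the cyclic identity for the four rotations of the arguments,
  combined with both skew symmetries.\<close>

lemma R_pair_sym: "b (R u v w) z = b (R w z u) v"
proof -
  have B: "b (R u v w) z + b (R v w u) z + b (R w u v) z = 0" for u v w z
    by (simp only: b_simps(1)[symmetric] R_bianchi b_simps(9))
  have A: "b (R u v w) z = - b (R v u w) z" for u v w z
    by (subst R_antisym) (simp add: b_simps)
  show ?thesis
    using B[of u v w z] B[of v w z u] B[of w z u v] B[of z u v w]
      R_skew[of u v w z] R_skew[of v w z u] R_skew[of w z u v] R_skew[of z u v w]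
      R_skew[of u w v z] R_skew[of v z w u] R_skew[of w u v z] R_skew[of z v w u]
      A[of u v w z] A[of v w u z] A[of w u v z] A[of v w z u] A[of w z v u] A[of z v w u] A[of w z u v]
      A[of z u w v] A[of u w z v] A[of z u v w] A[of u v z w] A[of v z u w]
    by linarith
qed

text \<open>Polarizing the hypothesis makes \<open>b (R v w u) z\<close> change sign under exchange
  of its first and fourth argument. With the known skew symmetries it is invariant under cyclic
  permutation of the first three, and the cyclic identity says that three times it is 0.\<close>

lemma R_zero:
  assumes sec: "\<And>v w. b (R v w w) v = 0"
  shows "R u v w = 0"
proof (rule b_eq_0)
  fix z
  have 1: "b (R v w u) v = 0" for v w u
  proof -
    have "b (R v (w + u) (w + u)) v = 0" "b (R v w w) v = 0" "b (R v u u) v = 0" by (rule sec)+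
    then have "b (R v w u) v + b (R v u w) v = 0" by (simp add: R_simps b_simps)
    moreover have "b (R v u w) v = b (R v w u) v"
      by (simp only: R_pair_sym[of v u w v] R_antisym[of w v v] b_simps R_skew[of v w v u])
    ultimately show ?thesis by simp
  qed
  have a14: "b (R v w u) z = - b (R z w u) v" for v w u z
    using 1[of "v + z" w u] 1[of v w u] 1[of z w u] by (simp add: R_simps b_simps)
  have a12: "b (R v w u) z = - b (R w v u) z" for v w u z
    by (subst R_antisym) (simp add: b_simps)
  have a13: "b (R v w u) z = - b (R u w v) z" for v w u z
    using R_skew[of v w u z] a14[of v w z u] R_skew[of u w z v] by simp
  have cyc: "b (R v w u) z = b (R u v w) z" for v w u z
    using a12[of v w u z] a13[of w v u z] by simp
  have "b (R u v w) z + b (R v w u) z + b (R w u v) z = 0"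
    by (simp only: b_simps(1)[symmetric] R_bianchi b_simps(9))
  then show "b (R u v w) z = 0"
    using cyc[of u v w z] cyc[of w u v z] by simp
qed

text \<open>The tensor of constant curvature \<open>K\<close> has all the symmetries required;
  subtracting it reduces statements about the value \<open>K\<close> to the value 0.\<close>

lemma minus_constant_curvature:
  "curvature_form b (\<lambda>u v w. R u v w - K *\<^sub>R (b v w *\<^sub>R u - b u w *\<^sub>R v))"
proof (intro curvature_form.intro curvature_form_axioms.intro metric_form_axioms)
  show "linear (\<lambda>u. R u v w - K *\<^sub>R (b v w *\<^sub>R u - b u w *\<^sub>R v))" for v w
    by (rule linearI) (simp_all add: R_simps b_simps algebra_simps)
  show "linear (\<lambda>v. R u v w - K *\<^sub>R (b v w *\<^sub>R u - b u w *\<^sub>R v))" for u w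
    by (rule linearI) (simp_all add: R_simps b_simps algebra_simps)
  show "linear (\<lambda>w. R u v w - K *\<^sub>R (b v w *\<^sub>R u - b u w *\<^sub>R v))" for u v
    by (rule linearI) (simp_all add: R_simps b_simps algebra_simps)
  show "R u v w - K *\<^sub>R (b v w *\<^sub>R u - b u w *\<^sub>R v) = - (R v u w - K *\<^sub>R (b u w *\<^sub>R v - b v w *\<^sub>R u))" for u v w
    using R_antisym[of u v w] by (simp add: algebra_simps)
  show "R u v w - K *\<^sub>R (b v w *\<^sub>R u - b u w *\<^sub>R v) + (R v w u - K *\<^sub>R (b w u *\<^sub>R v - b v u *\<^sub>R w))
     + (R w u v - K *\<^sub>R (b u v *\<^sub>R w - b w v *\<^sub>R u)) = 0" for u v w
    using R_bianchi[of u v w] b_sym[of u v] b_sym[of v w] b_sym[of u w] by (simp add: algebra_simps)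
  show "b (R u v w - K *\<^sub>R (b v w *\<^sub>R u - b u w *\<^sub>R v)) z = - b (R u v z - K *\<^sub>R (b v z *\<^sub>R u - b u z *\<^sub>R v)) w" for u v w z
    using R_skew[of u v w z] by (simp add: b_simps algebra_simps)
qed

text \<open>By pair symmetry \<open>w \<mapsto> R v w v\<close> is self-adjoint, so an eigenvector
  that is not orthogonal to the kernel vector \<open>f\<close> has eigenvalue 0. Adding a generic
  multiple of \<open>f\<close> to a vector orthogonal to \<open>v\<close> makes it non-null and not
  orthogonal to \<open>f\<close>; the vector \<open>v\<close> itself is killed by
  \<open>R_same\<close>.\<close>

lemma R_eigen_zero:
  assumes v: "b v v \<noteq> 0" and f: "b f f \<noteq> 0" "b v f = 0" "R v f v = 0"
    and eig: "\<And>w. b v w = 0 \<Longrightarrow> b w w \<noteq> 0 \<Longrightarrow> \<exists>\<mu>. R v w v = \<mu> *\<^sub>R w"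
  shows "R v w v = 0"
proof -
  have 1: "R v w v = 0" if w: "b v w = 0" "b w w \<noteq> 0" "b w f \<noteq> 0" for w
  proof -
    obtain \<mu> where \<mu>: "R v w v = \<mu> *\<^sub>R w" using eig w by blast
    have "\<mu> * b w f = b (R v w v) f" by (simp add: \<mu> b_simps)
    also have "\<dots> = b (R v f v) w" by (rule R_pair_sym)
    also have "\<dots> = 0" by (simp add: f b_simps)
    finally show ?thesis using w \<mu> by simp
  qed
  have 2: "R v w v = 0" if w: "b v w = 0" for w
  proof -
    obtain s where s: "b w w + 2 * s * b w f + s * s * b f f \<noteq> 0" "b w f + s * b f f \<noteq> 0"
      using quadratic_generic[OF f(1)] by blast
    have "R v (w + s *\<^sub>R f) v = 0"
      by (rule 1) (use s w f(2) in \<open>simp_all add: b_simps b_sym[of f w] algebra_simps\<close>)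
    then show ?thesis by (simp add: R_simps f)
  qed
  obtain \<alpha> u where w: "w = \<alpha> *\<^sub>R v + u" "b v u = 0" using perp_decomposition[OF v] by blast
  show ?thesis unfolding w(1) by (simp add: R_simps R_same 2[OF w(2)])
qed

text \<open>Cartan's criterion.  The vectors \<open>R v w v\<close> are sectional curvatures times \<open>w\<close>; subtracting the
  constant curvature tensor that agrees with \<open>R\<close> on one plane reduces the claim to \<open>R = 0\<close>.\<close>

lemma constant_curvature_of_eigen:
  assumes dim: "DIM('e) \<ge> 2"
    and eig: "\<And>v w. b v v \<noteq> 0 \<Longrightarrow> b w w \<noteq> 0 \<Longrightarrow> b v w = 0 \<Longrightarrow> \<exists>\<mu>. R v w v = \<mu> *\<^sub>R w"
  shows "\<exists>K. \<forall>u v w. R u v w = K *\<^sub>R (b v w *\<^sub>R u - b u w *\<^sub>R v)"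
proof -
  obtain e where e: "b e e \<noteq> 0" using exists_nonnull by blast
  obtain f where f: "b e f = 0" "b f f \<noteq> 0" using exists_nonnull_perp[OF dim e] by blast
  obtain \<mu> where \<mu>: "R e f e = \<mu> *\<^sub>R f" using eig[OF e f(2,1)] by blast
  \<comment> \<open>For \<open>w\<close> orthogonal to \<open>e\<close> the tensor of constant
    curvature \<open>K\<close> sends \<open>(e, w, e)\<close> to
    \<open>- (K * b e e) *\<^sub>R w\<close>; this choice makes it agree with \<open>R\<close> at
    \<open>w = f\<close>.\<close>
  define K where "K = - \<mu> / b e e"
  define R' where "R' u v w = R u v w - K *\<^sub>R (b v w *\<^sub>R u - b u w *\<^sub>R v)" for u v w
  have R'_form: "curvature_form b R'"
    unfolding R'_def by (rule minus_constant_curvature)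
  interpret R': curvature_form b R' by (rule R'_form)
  have eig': "\<exists>\<mu>. R' v w v = \<mu> *\<^sub>R w" if vw: "b v v \<noteq> 0" "b w w \<noteq> 0" "b v w = 0" for v w
  proof -
    obtain \<mu> where "R v w v = \<mu> *\<^sub>R w" using eig[OF vw] by blast
    then have "R' v w v = (\<mu> + K * b v v) *\<^sub>R w"
      using vw b_sym[of w v] by (simp add: R'_def scaleR_left_distrib)
    then show ?thesis by blast
  qed
  have R'ef: "R' e f e = 0" using e f b_sym[of f e] by (simp add: R'_def \<mu> K_def)
  have R'e: "R' e w e = 0" for w
    by (rule R'.R_eigen_zero[OF e f(2,1) R'ef]) (use eig' e in blast)
  \<comment> \<open>The symmetries carry \<open>R' e v e = 0\<close> over to
    \<open>R' v e v = 0\<close>, so for every non-null \<open>v\<close> orthogonal to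
    \<open>e\<close> the vector \<open>e\<close> now plays the part of the kernel vector.\<close>
  have R'v: "R' v w v = 0" if v: "b v v \<noteq> 0" "b e v = 0" for v w
  proof -
    obtain \<mu> where \<mu>: "R' v e v = \<mu> *\<^sub>R e" using eig'[OF v(1) e] v(2) b_sym by metis
    have "\<mu> * b e e = b (R' v e v) e" by (simp add: \<mu> b_simps)
    also have "\<dots> = - b (R' e v v) e" by (subst R'.R_antisym) (simp add: b_simps)
    also have "\<dots> = b (R' e v e) v" using R'.R_skew[of e v v e] by simp
    also have "\<dots> = 0" by (simp add: R'e b_simps)
    finally have 0: "R' v e v = 0" using e \<mu> by simp
    have "b v e = 0" using v(2) b_sym[of v e] by simp
    then show ?thesis
      by (rule R'.R_eigen_zero[OF v(1) e _ 0]) (rule eig'[OF v(1)])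
  qed
  \<comment> \<open>About null \<open>u\<close> the eigenvector hypothesis is silent. But
    \<open>u + s f\<close> is non-null for all but finitely many \<open>s\<close>, and an expression
    affine in \<open>s\<close> that vanishes at two values has vanishing constant term.\<close>
  have R'u: "R' u w u = 0" if u: "b e u = 0" for u w
  proof -
    let ?A = "R' u w u" and ?B = "R' u w f + R' f w u"
    have *: "?A + s *\<^sub>R ?B = 0" if "b u u + 2 * s * b u f + s * s * b f f \<noteq> 0" for s
    proof -
      have "R' (u + s *\<^sub>R f) w (u + s *\<^sub>R f) = 0"
        by (rule R'v) (use that u f in \<open>simp_all add: b_simps b_sym[of f u] algebra_simps\<close>)
      moreover have "R' f w f = 0" by (rule R'v[OF f(2,1)])
      ultimately show ?thesis by (simp add: R'.R_simps algebra_simps)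
    qed
    let ?p = "[:b u u, 2 * b u f, b f f:]"
    have "?p \<noteq> 0" using f by simp
    then have fin: "finite {s. poly ?p s = 0}" by (rule poly_roots_finite)
    then obtain s where s: "s \<notin> {s. poly ?p s = 0}"
      using ex_new_if_finite[OF infinite_UNIV_char_0] by blast
    obtain t where t: "t \<notin> insert s {s. poly ?p s = 0}"
      using ex_new_if_finite[OF infinite_UNIV_char_0, of "insert s {s. poly ?p s = 0}"] fin by blast
    have "b u u + 2 * s * b u f + s * s * b f f \<noteq> 0" "b u u + 2 * t * b u f + t * t * b f f \<noteq> 0"
      using s t by (auto simp: algebra_simps)
    then have "?A + s *\<^sub>R ?B = 0" "?A + t *\<^sub>R ?B = 0" using * by blast+
    then have "(s - t) *\<^sub>R ?B = 0" unfolding scaleR_left_diff_distrib by (metis add_left_cancel right_minus_eq)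
    then have "?B = 0" using t by simp
    then show ?thesis using \<open>?A + s *\<^sub>R ?B = 0\<close> by simp
  qed
  \<comment> \<open>After \<open>v\<close> and \<open>w\<close> are split along \<open>e\<close>,
    the symmetries bring every term to the form \<open>b (R' y p y) q\<close> with \<open>y\<close>
    equal to \<open>e\<close> or orthogonal to it.\<close>
  have "b (R' v w w) v = 0" for v w
  proof -
    obtain \<alpha> u where v: "v = \<alpha> *\<^sub>R e + u" "b e u = 0" using perp_decomposition[OF e] by blast
    obtain \<beta> z where w: "w = \<beta> *\<^sub>R e + z" "b e z = 0" using perp_decomposition[OF e] by blast
    let ?q = "\<lambda>a b' c d. b (R' a b' c) d"
    have A: "?q p q r s = - ?q q p r s" for p q r s by (subst R'.R_antisym) (simp add: b_simps)
    note P = R'.R_pair_sym and S = R'.R_skew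
    have ee: "?q e p e q = 0" for p q by (simp add: R'e b_simps)
    have uu: "?q u p u q = 0" for p q by (simp add: R'u[OF v(2)] b_simps)
    have zz: "?q z p z q = 0" for p q by (simp add: R'u[OF w(2)] b_simps)
    have "R' v w w = \<alpha> *\<^sub>R R' e z w - \<beta> *\<^sub>R R' e u w + R' u z w"
      unfolding v w(1)
      by (simp add: R'.R_simps R'.R_same R'.R_antisym[of u e] algebra_simps)
    then have "?q v w w v = \<alpha> * ?q e z w v - \<beta> * ?q e u w v + ?q u z w v"
      by (simp add: b_simps)
    moreover have "?q p q w v = \<beta> * ?q p q e u - \<alpha> * ?q p q e z + ?q p q z u" for p q
      unfolding v w(1)
      using S[of p q e e] S[of p q z e] by (simp add: R'.R_simps b_simps algebra_simps)
    moreover have "?q e z e u = 0" "?q e z e z = 0" "?q e u e u = 0" "?q e u e z = 0" by (rule ee)+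
    moreover have "?q e z z u = 0"
      using A[of e z z u] P[of z e z u] zz by simp
    moreover have "?q e u z u = 0"
      using A[of e u z u] S[of u e z u] uu by simp
    moreover have "?q u z e u = 0"
      using P[of u z e u] \<open>?q e u z u = 0\<close> P[of e u u z] S[of e u z u] by simp
    moreover have "?q u z e z = 0"
      using P[of u z e z] P[of e z u z] A[of e z u z] S[of z e u z] zz by simp
    moreover have "?q u z z u = 0" using S[of u z z u] uu by simp
    ultimately show ?thesis by simp
  qed
  then have "R' u v w = 0" for u v w by (rule R'.R_zero)
  then show ?thesis unfolding R'_def by (intro exI[of _ K]) (simp add: algebra_simps)
qed

text \<open>A degenerate plane is a limit of nondegenerate ones, so by continuity the numerator of
  the sectional curvature, after subtraction of the model tensor, vanishes on all pairs, and
  \<open>R_zero\<close> applies.\<close>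

lemma sectional_constant_iff:
  assumes dim: "DIM('e) \<ge> 2"
  shows "(\<forall>v w. nondegenerate_plane b v w \<longrightarrow> b (R v w w) v / (b v v * b w w - (b v w)\<^sup>2) = K)
    \<longleftrightarrow> (\<forall>u v w. R u v w = K *\<^sub>R (b v w *\<^sub>R u - b u w *\<^sub>R v))"
    (is "?L \<longleftrightarrow> ?R")
proof
  assume R: ?R
  have "b (R v w w) v = K * (b v v * b w w - (b v w)\<^sup>2)" for v w
    unfolding R[rule_format] by (simp add: b_simps b_sym[of w v] power2_eq_square algebra_simps)
  then show ?L by (simp add: nondegenerate_plane_iff)
next
  assume L: ?L
  define R' where "R' u v w = R u v w - K *\<^sub>R (b v w *\<^sub>R u - b u w *\<^sub>R v)" for u v w
  have R'_form: "curvature_form b R'"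
    unfolding R'_def by (rule minus_constant_curvature)
  interpret R': curvature_form b R' by (rule R'_form)
  define D where "D v w = b v v * b w w - (b v w)\<^sup>2" for v w
  have sec: "b (R' v w w) v = 0" if "D v w \<noteq> 0" for v w
  proof -
    have "b (R v w w) v / D v w = K"
      using L that unfolding nondegenerate_plane_iff D_def by blast
    then have "b (R v w w) v = K * D v w" using that by (simp add: field_simps)
    then show ?thesis
      unfolding R'_def D_def by (simp add: b_simps b_sym[of w v] power2_eq_square algebra_simps)
  qed
  obtain e where e: "b e e \<noteq> 0" using exists_nonnull by blast
  obtain f where f: "b e f = 0" "b f f \<noteq> 0" using exists_nonnull_perp[OF dim e] by blast
  have "b (R' v w w) v = 0" for v w
  proof -
    \<comment> \<open>The Gram determinant of the pair moved along \<open>e\<close> and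
      \<open>f\<close>. As \<open>b e f = 0\<close>, its coefficient of degree 4 is
      \<open>b e e * b f f\<close>, so it has finitely many roots.\<close>
    define p where "p = [:b v v, 2 * b v e, b e e:] * [:b w w, 2 * b w f, b f f:]
      - [:b v w, b v f + b e w:] * [:b v w, b v f + b e w:]"
    have p: "poly p s = D (v + s *\<^sub>R e) (w + s *\<^sub>R f)" for s
      unfolding p_def D_def using f(1)
      by (simp add: b_simps b_sym[of e v] b_sym[of f w] power2_eq_square algebra_simps)
    have "coeff p 4 = b e e * b f f"
      unfolding p_def by (simp add: numeral_eq_Suc)
    then have "p \<noteq> 0" using e f by auto
    then have fin: "finite {s. poly p s = 0}" by (rule poly_roots_finite)
    define r where "r s = b (R' (v + s *\<^sub>R e) (w + s *\<^sub>R f) (w + s *\<^sub>R f)) (v + s *\<^sub>R e)" for s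
    have "isCont r 0"
      unfolding r_def by (simp only: R'.R_simps b_simps) (intro continuous_intros)
    then have lim: "(r \<longlongrightarrow> r 0) (at 0)" by (simp add: isCont_def)
    \<comment> \<open>The value 0 is kept although it may be a root, since a neighbourhood of 0 is
      wanted; the limit looks at nonzero \<open>s\<close> only.\<close>
    have "open (- ({s. poly p s = 0} - {0}))"
      using fin by (intro open_Compl finite_imp_closed) auto
    then have "\<forall>\<^sub>F s in at 0. s \<in> - ({s. poly p s = 0} - {0})"
      by (rule eventually_at_in_open') simp
    moreover have "\<forall>\<^sub>F s in at (0::real). s \<noteq> 0"
      by (simp add: eventually_at_filter)
    ultimately have "\<forall>\<^sub>F s in at 0. r s = 0"
      by eventually_elim (auto simp: r_def p intro: sec)
    then have "(r \<longlongrightarrow> 0) (at 0)" by (rule tendsto_eventually)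
    from tendsto_unique[OF _ lim this] have "r 0 = 0" by simp
    then show ?thesis by (simp add: r_def)
  qed
  then have "R' u v w = 0" for u v w by (rule R'.R_zero)
  then show ?R unfolding R'_def by simp
qed

end

section \<open>Constant curvature and Schur's lemma\<close>

context local_metric
begin

lemma metric_form_at: "x \<in> S \<Longrightarrow> metric_form (h x)"
  by unfold_locales (simp_all add: h_bilinear h_sym h_nondegenerate)

lemma curvature_form_at:
  assumes x: "x \<in> S"
  shows "curvature_form (h x) (Rm x)"
  by (intro curvature_form.intro curvature_form_axioms.intro metric_form_at x Rm_linear Rm_antisym
      Rm_bianchi Rm_skew)

text \<open>Stated for the full tensor, so that it can be differentiated and carried over by
  isometries; in dimension at least 2 it amounts to all nondegenerate planes at \<open>x\<close>
  having sectional curvature \<open>K\<close>.\<close>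

definition constant_curvature_at :: "real \<Rightarrow> 'e \<Rightarrow> bool" where
  "constant_curvature_at K x \<longleftrightarrow> (\<forall>u v w. Rm x u v w = K *\<^sub>R (h x v w *\<^sub>R u - h x u w *\<^sub>R v))"

lemma sectional_curvature_constant_iff:
  assumes "DIM('e) \<ge> 2" "x \<in> S"
  shows "(\<forall>v w. nondegenerate_plane (h x) v w \<longrightarrow> sectional_curvature h x v w = K)
    \<longleftrightarrow> constant_curvature_at K x"
  using curvature_form.sectional_constant_iff[OF curvature_form_at[OF assms(2)] assms(1), of K]
  unfolding sectional_curvature_def curvature_eq_Rm[OF assms(2)] constant_curvature_at_def .

lemma Rm_smooth: "smooth_on S (\<lambda>x. Rm x u v w)"
  unfolding Rm_def
  by (intro smooth_on_add smooth_on_diff open_S smooth_on_fder \<Gamma>_smooth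
      \<Gamma>_along_smooth[OF open_S smooth_on_ident[OF open_S]] smooth_on_const) auto

text \<open>Near \<open>x\<close> a fixed pair \<open>e\<close>, \<open>f\<close> keeps spanning a
  nondegenerate plane, and there \<open>K\<close> is the sectional curvature of this plane, a
  quotient of smooth functions.\<close>

lemma constant_curvature_smooth:
  assumes dim: "DIM('e) \<ge> 2" and K: "\<And>x. x \<in> S \<Longrightarrow> constant_curvature_at (K x) x"
  shows "smooth_on S K"
proof (rule smooth_on_local)
  fix x assume x: "x \<in> S"
  interpret m: metric_form "h x" by (rule metric_form_at[OF x])
  obtain e where e: "h x e e \<noteq> 0" using m.exists_nonnull by blast
  obtain f where f: "h x e f = 0" "h x f f \<noteq> 0" using m.exists_nonnull_perp[OF dim e] by blast
  define D where "D y = h y e e * h y f f - (h y e f)\<^sup>2" for y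
  define T where "T = {y \<in> S. D y \<noteq> 0}"
  have smD: "smooth_on S D"
    unfolding D_def power2_eq_square by (intro smooth_on_diff smooth_on_mult h_smooth open_S)
  have "T = S \<inter> D -` (- {0})" by (auto simp: T_def)
  then have "open T"
    using continuous_open_preimage[OF smooth_on_imp_continuous_on[OF smD] open_S, of "- {0}"] by auto
  moreover have "x \<in> T" using x e f by (simp add: T_def D_def)
  moreover have "smooth_on T K"
  proof (rule smooth_on_cong[OF \<open>open T\<close>])
    have TS: "T \<subseteq> S" by (auto simp: T_def)
    show "h y (Rm y e f f) e / D y = K y" if "y \<in> T" for y
    proof -
      have y: "y \<in> S" "D y \<noteq> 0" using that by (auto simp: T_def)
      interpret my: metric_form "h y" by (rule metric_form_at[OF y(1)])
      have R: "Rm y e f f = K y *\<^sub>R (h y f f *\<^sub>R e - h y e f *\<^sub>R f)"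
        using K[OF y(1)] unfolding constant_curvature_at_def by blast
      have "h y (Rm y e f f) e = K y * D y"
        unfolding R D_def by (simp add: my.b_simps my.b_sym[of f e] power2_eq_square algebra_simps)
      then show ?thesis using y by simp
    qed
    have "smooth_on S (\<lambda>y. h y (Rm y e f f) e)"
      by (rule h_along_smooth[OF open_S smooth_on_ident[OF open_S] _ Rm_smooth smooth_on_const]) simp
    then show "smooth_on T (\<lambda>y. h y (Rm y e f f) e / D y)"
      using smD smooth_on_subset[OF _ TS] by (intro smooth_on_divide \<open>open T\<close>) (auto simp: T_def)
  qed
  ultimately show "\<exists>T. open T \<and> x \<in> T \<and> smooth_on T K" by blast
qed

text \<open>The second Bianchi identity is the Jacobi identity for the operators \<open>\<nabla>\<^bsub>u\<^esub>\<close> in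
  coordinate directions; applied to \<open>R = K \<cdot> R\<^sub>1\<close> it gives a linear relation for the
  differential of \<open>K\<close>.\<close>

lemma constant_curvature_bianchi:
  assumes x: "x \<in> S" and K: "\<And>x. x \<in> S \<Longrightarrow> constant_curvature_at (K x) x" and smK: "smooth_on S K"
  defines "dK \<equiv> fder K x"
  shows "dK u *\<^sub>R (h x w W *\<^sub>R v - h x v W *\<^sub>R w) + dK v *\<^sub>R (h x u W *\<^sub>R w - h x w W *\<^sub>R u)
    + dK w *\<^sub>R (h x v W *\<^sub>R u - h x u W *\<^sub>R v) = 0"
proof -
  let ?id = "\<lambda>x::'e. x"
  define P where "P c U = (\<lambda>y. cov ?id U y c)" for c U
  have I: "open S" "smooth_on S ?id" "?id ` S \<subseteq> S" using open_S smooth_on_ident by auto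
  have smP: "smooth_on S (P c U)" if "smooth_on S U" for c U
    unfolding P_def by (rule cov_smooth[OF I that])
  have smW: "smooth_on S (\<lambda>_. W)" by (rule smooth_on_const)
  have dif: "U differentiable (at x)" if "smooth_on S U" for U :: "'e \<Rightarrow> 'e"
    using smooth_on_has_derivative[OF that x] differentiableI by blast
  have comm: "P a (P c U) y - P c (P a U) y = Rm y a c (U y)" if "y \<in> S" "smooth_on S U" for a c U y
    using cov_commutator[OF I(1) that(1) I(2,3) that(2)] unfolding P_def by simp
  have P_diff: "P c (\<lambda>y. U y - V y) x = P c U x - P c V x" if "smooth_on S U" "smooth_on S V" for c U V
    unfolding P_def cov_def
    by (subst fder_eqI[OF has_derivative_diff[OF has_fder[OF dif[OF that(1)]] has_fder[OF dif[OF that(2)]]]])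
      (simp add: bilinear_rsub[OF \<Gamma>_bilinear[OF x]])
  \<comment> \<open>The commutator of the covariant derivative in direction \<open>a\<close> with
    the operator R(c,d), applied to the constant field \<open>W\<close>.\<close>
  define T where "T a c d = P a (\<lambda>y. Rm y c d W) x - Rm x c d (P a (\<lambda>_. W) x)" for a c d
  have T1: "T a c d = P a (P c (P d (\<lambda>_. W))) x - P a (P d (P c (\<lambda>_. W))) x
      - (P c (P d (P a (\<lambda>_. W))) x - P d (P c (P a (\<lambda>_. W))) x)" for a c d
  proof -
    have "P a (\<lambda>y. Rm y c d W) x = P a (\<lambda>y. P c (P d (\<lambda>_. W)) y - P d (P c (\<lambda>_. W)) y) x"
      unfolding P_def[of a] by (rule cov_cong[OF open_S x]) (simp add: comm smW)
    also have "\<dots> = P a (P c (P d (\<lambda>_. W))) x - P a (P d (P c (\<lambda>_. W))) x"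
      by (intro P_diff smP smW)
    finally show ?thesis unfolding T_def by (simp add: comm[OF x smP[OF smW]])
  qed
  have sum0: "T u v w + T v w u + T w u v = 0" unfolding T1 by simp
  \<comment> \<open>The terms with factor \<open>K x\<close> contain only values of
    \<open>\<Gamma>\<close> and cancel in the cyclic sum by symmetry of \<open>\<Gamma>\<close>;
    what survives is the differential of \<open>K\<close>.\<close>
  have T2: "T a c d = dK a *\<^sub>R (h x d W *\<^sub>R c - h x c W *\<^sub>R d)
     + K x *\<^sub>R (h x (\<Gamma> x a d) W *\<^sub>R c + h x d W *\<^sub>R \<Gamma> x a c - h x (\<Gamma> x a c) W *\<^sub>R d - h x c W *\<^sub>R \<Gamma> x a d)" for a c d
  proof -
    define f where "f z y = K y * h y z W" for z y
    have smf: "smooth_on S (f z)" for z unfolding f_def by (intro smooth_on_mult open_S smK h_smooth)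
    have df: "fder (f z) x a = dK a * h x z W + K x * (h x (\<Gamma> x a z) W + h x z (\<Gamma> x a W))" for z
      unfolding f_def
      by (subst fder_eqI[OF has_derivative_mult[OF smooth_on_has_derivative[OF smK x] h_has_derivative[OF x]]])
        (simp add: \<Gamma>_metric[OF x] dK_def)
    have dfd: "f z differentiable (at x)" for z
      using smooth_on_has_derivative[OF smf x] differentiableI by blast
    have Pf: "P a (\<lambda>y. f z y *\<^sub>R r) x = fder (f z) x a *\<^sub>R r + f z x *\<^sub>R \<Gamma> x a r" for z r
      unfolding P_def
      using cov_scaleR[where \<psi> = "\<lambda>x. x" and f = "f z" and X = "\<lambda>_. r", OF x dfd] by (simp add: cov_def)
    have "P a (\<lambda>y. Rm y c d W) x = P a (\<lambda>y. f d y *\<^sub>R c - f c y *\<^sub>R d) x"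
      unfolding P_def
      by (rule cov_cong[OF open_S x])
        (use K in \<open>simp add: constant_curvature_at_def f_def scaleR_diff_right\<close>)
    also have "\<dots> = P a (\<lambda>y. f d y *\<^sub>R c) x - P a (\<lambda>y. f c y *\<^sub>R d) x"
      by (intro P_diff smooth_on_scaleR open_S smf smooth_on_const)
    finally have "P a (\<lambda>y. Rm y c d W) x = fder (f d) x a *\<^sub>R c + f d x *\<^sub>R \<Gamma> x a c
       - (fder (f c) x a *\<^sub>R d + f c x *\<^sub>R \<Gamma> x a d)"
      unfolding Pf .
    note 1 = this
    have 2: "Rm x c d (P a (\<lambda>_. W) x) = K x *\<^sub>R (h x d (\<Gamma> x a W) *\<^sub>R c - h x c (\<Gamma> x a W) *\<^sub>R d)"
      using K[OF x] unfolding constant_curvature_at_def P_def by (simp add: cov_def)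
    show ?thesis
      unfolding T_def 1 2 df f_def by (simp add: algebra_simps)
  qed
  show ?thesis
    using sum0 unfolding T2
    by (simp add: \<Gamma>_sym[OF x, of v u] \<Gamma>_sym[OF x, of w u] \<Gamma>_sym[OF x, of w v] algebra_simps)
qed

text \<open>Two linear equations in at least three unknowns. Schur's lemma owes its dimension bound
  to this.\<close>

lemma exists_perp2:
  assumes "DIM('e) \<ge> 3" "x \<in> S"
  obtains W where "W \<noteq> 0" "h x u W = 0" "h x v W = 0"
proof -
  define L where "L W = (h x u W, h x v W)" for W
  have "linear L"
    unfolding L_def
    by (rule linearI) (simp_all add: bilinear_radd[OF h_bilinear[OF assms(2)]] bilinear_rmul[OF h_bilinear[OF assms(2)]])
  moreover have "\<not> inj L"
  proof
    assume "inj L"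
    then have "dim (range L) = DIM('e)"
      using dim_image_eq[OF \<open>linear L\<close>, of UNIV] by simp
    moreover have "dim (range L) \<le> DIM(real \<times> real)" by (rule dim_subset_UNIV)
    ultimately show False using assms(1) by simp
  qed
  ultimately obtain W where "L W = 0" "W \<noteq> 0"
    using linear_injective_0 by blast
  then show ?thesis using that by (auto simp: L_def zero_prod_def)
qed

text \<open>For \<open>W\<close> orthogonal to \<open>u\<close> and \<open>v\<close> but not to
  \<open>w\<close>, the Bianchi relation says that \<open>dK u\<close> times \<open>v\<close> equals
  \<open>dK v\<close> times \<open>u\<close>; if \<open>v\<close> is not a multiple of
  \<open>u\<close>, then \<open>dK u = 0\<close>.\<close>

lemma schur:
  assumes dim: "DIM('e) \<ge> 3" and x: "x \<in> S" and K: "\<And>x. x \<in> S \<Longrightarrow> constant_curvature_at (K x) x"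
  shows "(K has_derivative (\<lambda>_. 0)) (at x)"
proof -
  have smK: "smooth_on S K" using constant_curvature_smooth[OF _ K] dim by simp
  have "fder K x u = 0" for u
  proof (cases "u = 0")
    case True
    then show ?thesis
      using linear_0[OF has_derivative_linear[OF smooth_on_has_derivative[OF smK x]]] by simp
  next
    case False
    have "span {u} \<noteq> UNIV"
    proof
      assume "span {u} = UNIV"
      then have "dim (UNIV :: 'e set) \<le> card {u}" by (intro dim_le_card) auto
      then show False using dim by simp
    qed
    then obtain v where v: "v \<notin> span {u}" by blast
    obtain W where W: "W \<noteq> 0" "h x u W = 0" "h x v W = 0" using exists_perp2[OF dim x] by blast
    obtain w where "h x W w \<noteq> 0"
      using h_nondegenerate[OF x] W(1) unfolding form_nondegenerate_on_def by blast
    then have w: "h x w W \<noteq> 0" by (simp add: h_sym[OF x, of w])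
    have "h x w W *\<^sub>R (fder K x u *\<^sub>R v - fder K x v *\<^sub>R u) = 0"
      using constant_curvature_bianchi[OF x K smK, of u w W v] W by (simp add: algebra_simps)
    then have eq: "fder K x u *\<^sub>R v = fder K x v *\<^sub>R u" using w by simp
    show ?thesis
    proof (rule ccontr)
      assume nz: "fder K x u \<noteq> 0"
      have "v = (1 / fder K x u) *\<^sub>R (fder K x u *\<^sub>R v)" using nz by simp
      also have "\<dots> = (fder K x v / fder K x u) *\<^sub>R u" unfolding eq by simp
      finally show False using v span_singleton by (metis rangeI)
    qed
  qed
  then have "fder K x = (\<lambda>_. 0)" by blast
  then show ?thesis using smooth_on_has_derivative[OF smK x] by simp
qed

end

context local_isometry
begin

lemma constant_curvature_at_iff:
  assumes x: "x \<in> S1"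
  shows "M2.constant_curvature_at K (\<psi> x) \<longleftrightarrow> M1.constant_curvature_at K x"
proof -
  note lin = \<psi>_linear[OF x]
  have eq: "K *\<^sub>R (h2 (\<psi> x) (fder \<psi> x v) (fder \<psi> x w) *\<^sub>R fder \<psi> x u - h2 (\<psi> x) (fder \<psi> x u) (fder \<psi> x w) *\<^sub>R fder \<psi> x v)
     = fder \<psi> x (K *\<^sub>R (h1 x v w *\<^sub>R u - h1 x u w *\<^sub>R v))" for u v w
    by (simp add: isometric[OF x] linear_scale[OF lin] linear_diff[OF lin])
  show ?thesis
  proof
    assume 2: "M2.constant_curvature_at K (\<psi> x)"
    have "fder \<psi> x (M1.Rm x u v w) = fder \<psi> x (K *\<^sub>R (h1 x v w *\<^sub>R u - h1 x u w *\<^sub>R v))" for u v w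
      using 2 unfolding Rm_transform[OF x, symmetric] M2.constant_curvature_at_def eq[symmetric] by blast
    then show "M1.constant_curvature_at K x"
      using \<psi>_inj[OF x] unfolding M1.constant_curvature_at_def by (auto dest: injD)
  next
    assume 1: "M1.constant_curvature_at K x"
    show "M2.constant_curvature_at K (\<psi> x)"
      unfolding M2.constant_curvature_at_def
    proof (intro allI)
      fix u' v' w'
      obtain u v w where "u' = fder \<psi> x u" "v' = fder \<psi> x v" "w' = fder \<psi> x w"
        using \<psi>_surj[OF x] by (metis surjD)
      then show "M2.Rm (\<psi> x) u' v' w' = K *\<^sub>R (h2 (\<psi> x) v' w' *\<^sub>R u' - h2 (\<psi> x) u' w' *\<^sub>R v')"
        using 1 by (simp only: Rm_transform[OF x] eq M1.constant_curvature_at_def)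
    qed
  qed
qed

end

section \<open>Growth estimates\<close>

text \<open>The squared norm is used because the norm is not differentiable at 0. In the rate
  \<open>2 * L + 1\<close> the part \<open>2 * L\<close> comes from the linear bound, and 1 from
  estimating the cross term \<open>2 * norm (u s) * \<epsilon>\<close> by the sum of the
  squares.\<close>

lemma gronwall_norm_sq:
  fixes u :: "real \<Rightarrow> 'z::real_inner"
  assumes cont: "continuous_on {0..T} u"
    and der: "\<And>t. 0 < t \<Longrightarrow> t < T \<Longrightarrow> (u has_vector_derivative u' t) (at t)"
    and bound: "\<And>t. 0 < t \<Longrightarrow> t < T \<Longrightarrow> norm (u' t) \<le> L * norm (u t) + \<epsilon>"
    and L: "L \<ge> 0" and \<epsilon>: "\<epsilon> \<ge> 0" and t: "t \<in> {0..T}"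
  shows "(norm (u t))\<^sup>2 + \<epsilon>\<^sup>2 \<le> ((norm (u 0))\<^sup>2 + \<epsilon>\<^sup>2) * exp ((2 * L + 1) * t)"
proof (cases "t = 0")
  case True
  then show ?thesis by simp
next
  case False
  define c where "c = 2 * L + 1"
  define f where "f t = (u t \<bullet> u t + \<epsilon>\<^sup>2) * exp (- (c * t))" for t
  have "f t \<le> f 0"
  proof (rule DERIV_nonpos_imp_decreasing_open[where f = f])
    show "0 \<le> t" using t by simp
    show "continuous_on {0..t} f"
      unfolding f_def using t
      by (intro continuous_intros continuous_on_subset[OF cont]) auto
    fix s assume s: "0 < s" "s < t"
    then have s': "0 < s" "s < T" using t by auto
    have d: "(u has_derivative (\<lambda>h. h *\<^sub>R u' s)) (at s)"
      using der[OF s'] unfolding has_vector_derivative_def .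
    have 1: "((\<lambda>t. u t \<bullet> u t) has_real_derivative 2 * (u s \<bullet> u' s)) (at s)"
      using has_derivative_inner[OF d d] unfolding has_field_derivative_def
      by (rule has_derivative_eq_rhs) (simp add: fun_eq_iff inner_commute)
    have "(f has_real_derivative (2 * (u s \<bullet> u' s) * exp (- (c * s)) + (u s \<bullet> u s + \<epsilon>\<^sup>2) * (exp (- (c * s)) * (- c)))) (at s)"
      unfolding f_def by (rule derivative_eq_intros 1 refl | simp)+
    moreover have "2 * (u s \<bullet> u' s) * exp (- (c * s)) + (u s \<bullet> u s + \<epsilon>\<^sup>2) * (exp (- (c * s)) * (- c)) \<le> 0"
    proof -
      have "u s \<bullet> u' s \<le> norm (u s) * norm (u' s)" by (rule norm_cauchy_schwarz)
      also have "\<dots> \<le> norm (u s) * (L * norm (u s) + \<epsilon>)"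
        by (intro mult_left_mono bound s') simp
      finally have "2 * (u s \<bullet> u' s) \<le> 2 * L * (norm (u s))\<^sup>2 + 2 * norm (u s) * \<epsilon>"
        by (simp add: power2_eq_square algebra_simps)
      also have "2 * norm (u s) * \<epsilon> \<le> (norm (u s))\<^sup>2 + \<epsilon>\<^sup>2"
        by (rule sum_squares_bound)
      also have "2 * L * (norm (u s))\<^sup>2 + ((norm (u s))\<^sup>2 + \<epsilon>\<^sup>2) \<le> c * (u s \<bullet> u s + \<epsilon>\<^sup>2)"
        unfolding c_def power2_norm_eq_inner using L by (simp add: algebra_simps)
      finally have "2 * (u s \<bullet> u' s) - c * (u s \<bullet> u s + \<epsilon>\<^sup>2) \<le> 0" by simp
      then have "(2 * (u s \<bullet> u' s) - c * (u s \<bullet> u s + \<epsilon>\<^sup>2)) * exp (- (c * s)) \<le> 0"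
        by (simp add: mult_nonpos_nonneg)
      then show ?thesis by (simp add: algebra_simps)
    qed
    ultimately show "\<exists>y. (f has_real_derivative y) (at s) \<and> y \<le> 0" by blast
  qed
  then have "(u t \<bullet> u t + \<epsilon>\<^sup>2) * exp (- (c * t)) \<le> u 0 \<bullet> u 0 + \<epsilon>\<^sup>2" by (simp add: f_def)
  then have "(u t \<bullet> u t + \<epsilon>\<^sup>2) * exp (- (c * t)) * exp (c * t) \<le> (u 0 \<bullet> u 0 + \<epsilon>\<^sup>2) * exp (c * t)"
    by (rule mult_right_mono) simp
  then show ?thesis
    by (simp add: power2_norm_eq_inner c_def mult.assoc flip: exp_add)
qed

lemma gronwall_zero:
  fixes u :: "real \<Rightarrow> 'z::real_inner"
  assumes "continuous_on {0..T} u"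
    and "\<And>t. 0 < t \<Longrightarrow> t < T \<Longrightarrow> (u has_vector_derivative u' t) (at t)"
    and "\<And>t. 0 < t \<Longrightarrow> t < T \<Longrightarrow> norm (u' t) \<le> L * norm (u t)"
    and "L \<ge> 0" "u 0 = 0" "t \<in> {0..T}"
  shows "u t = 0"
proof -
  have "(norm (u t))\<^sup>2 + 0\<^sup>2 \<le> ((norm (u 0))\<^sup>2 + 0\<^sup>2) * exp ((2 * L + 1) * t)"
    by (rule gronwall_norm_sq[OF assms(1,2) _ assms(4) _ assms(6)]) (use assms(3) in auto)
  then show ?thesis using assms(5) by simp
qed

text \<open>Compactness bounds the images of the finitely many basis vectors, and these control the
  operator norm.\<close>

lemma linear_family_bounded:
  fixes A :: "'p::topological_space \<Rightarrow> 'c::euclidean_space \<Rightarrow> 'b::real_normed_vector"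
  assumes "compact C" and lin: "\<And>p. p \<in> C \<Longrightarrow> linear (A p)" and cont: "\<And>u. continuous_on C (\<lambda>p. A p u)"
  obtains M where "M \<ge> 0" "\<And>p u. p \<in> C \<Longrightarrow> norm (A p u) \<le> M * norm u"
proof -
  have "\<exists>M. \<forall>p\<in>C. norm (A p u) \<le> M" for u
    using compact_imp_bounded[OF compact_continuous_image[OF cont assms(1)], of u]
    unfolding bounded_iff by auto
  then obtain M where M: "\<And>u p. p \<in> C \<Longrightarrow> norm (A p u) \<le> M u" by metis
  show ?thesis
  proof
    show "(\<Sum>b\<in>Basis. \<bar>M b\<bar>) \<ge> 0" by (simp add: sum_nonneg)
    fix p u assume p: "p \<in> C"
    have "norm (A p u) = norm (\<Sum>b\<in>Basis. (u \<bullet> b) *\<^sub>R A p b)"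
      by (simp flip: linear_Basis_expand[OF lin[OF p]])
    also have "\<dots> \<le> (\<Sum>b\<in>Basis. \<bar>M b\<bar> * norm u)"
    proof (rule sum_norm_le)
      fix b :: 'c assume "b \<in> Basis"
      then have "\<bar>u \<bullet> b\<bar> \<le> norm u" by (rule Basis_le_norm)
      moreover have "norm (A p b) \<le> \<bar>M b\<bar>" using M[OF p, of b] by simp
      ultimately have "\<bar>u \<bullet> b\<bar> * norm (A p b) \<le> norm u * \<bar>M b\<bar>" by (intro mult_mono) auto
      then show "norm ((u \<bullet> b) *\<^sub>R A p b) \<le> \<bar>M b\<bar> * norm u" by (simp add: mult.commute)
    qed
    finally show "norm (A p u) \<le> (\<Sum>b\<in>Basis. \<bar>M b\<bar>) * norm u" by (simp add: sum_distrib_right)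
  qed
qed

lemma eventually_at_rightI_at: "\<forall>\<^sub>F t in at (a::real). P t \<Longrightarrow> \<forall>\<^sub>F t in at_right a. P t"
  using filter_leD[OF at_le[of "{a<..}" UNIV a]] by simp

text \<open>The difference quotients from the right lie in \<open>V\<close>, which is closed in
  finite dimension. The hypothesis is one-sided because along a ray from the centre the relevant
  membership is known for positive times only.\<close>

lemma has_vector_derivative_in_subspace:
  fixes f :: "real \<Rightarrow> 'a::euclidean_space"
  assumes f: "(f has_vector_derivative D) (at 0)" "f 0 = 0" and V: "subspace V"
    and ev: "\<forall>\<^sub>F t in at_right 0. f t \<in> V"
  shows "D \<in> V"
proof -
  have "((\<lambda>t. norm (f t - t *\<^sub>R D) / norm t) \<longlongrightarrow> 0) (at 0)"
    using f unfolding has_vector_derivative_def has_derivative_iff_norm by simp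
  moreover have "\<forall>\<^sub>F t in at (0::real). norm (f t - t *\<^sub>R D) / norm t = norm (f t /\<^sub>R t - D)"
    unfolding eventually_at_filter
  proof (rule always_eventually, intro allI impI)
    fix t :: real assume "t \<noteq> 0"
    then have "f t /\<^sub>R t - D = (f t - t *\<^sub>R D) /\<^sub>R t" by (simp add: scaleR_diff_right)
    then show "norm (f t - t *\<^sub>R D) / norm t = norm (f t /\<^sub>R t - D)"
      by (simp add: divide_inverse_commute)
  qed
  ultimately have "((\<lambda>t. norm (f t /\<^sub>R t - D)) \<longlongrightarrow> 0) (at 0)"
    by (rule Lim_transform_eventually)
  then have "((\<lambda>t. f t /\<^sub>R t) \<longlongrightarrow> D) (at 0)"
    by (simp add: tendsto_norm_zero_iff LIM_zero_iff)
  then have "((\<lambda>t. f t /\<^sub>R t) \<longlongrightarrow> D) (at_right 0)"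
    by (rule filterlim_mono) (simp_all add: at_le)
  moreover have "\<forall>\<^sub>F t in at_right 0. f t /\<^sub>R t \<in> V"
    using ev by eventually_elim (rule subspace_scale[OF V])
  ultimately show ?thesis
    by (intro Lim_in_closed_set[OF closed_subspace[OF V]]) auto
qed

text \<open>The scalar Jacobi equation, solved by \<open>t\<close>, a sine or a hyperbolic sine
  according to the sign of \<open>\<kappa>\<close>. The last clause later permits division by
  \<open>s 1\<close>.\<close>

lemma oscillator:
  "\<exists>s s' :: real \<Rightarrow> real. s 0 = 0 \<and> s' 0 = 1 \<and> (\<forall>t. (s has_real_derivative s' t) (at t)) \<and>
    (\<forall>t. (s' has_real_derivative - \<kappa> * s t) (at t)) \<and> (s 1 \<noteq> 0 \<or> s' 1 \<noteq> 0)"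
proof -
  have that: ?thesis if "s 0 = 0" "s' 0 = 1" "\<And>t. (s has_real_derivative s' t) (at t)"
    "\<And>t. (s' has_real_derivative - \<kappa> * s t) (at t)" "s 1 \<noteq> 0 \<or> s' 1 \<noteq> 0" for s s' :: "real \<Rightarrow> real"
    using that by blast
  consider "\<kappa> = 0" | "\<kappa> > 0" | "\<kappa> < 0" by linarith
  then show ?thesis
  proof cases
    case 1
    show ?thesis by (rule that[of "\<lambda>t. t" "\<lambda>t. 1"]) (auto simp: 1)
  next
    case 2
    define r where "r = sqrt \<kappa>"
    have r: "r > 0" "r * r = \<kappa>" using 2 by (simp_all add: r_def)
    show ?thesis
    proof (rule that[of "\<lambda>t. sin (r * t) / r" "\<lambda>t. cos (r * t)"])
      show "((\<lambda>t. sin (r * t) / r) has_real_derivative cos (r * t)) (at t)" for t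
        using r by (auto intro!: derivative_eq_intros)
      show "((\<lambda>t. cos (r * t)) has_real_derivative - \<kappa> * (sin (r * t) / r)) (at t)" for t
        using r by (auto intro!: derivative_eq_intros simp flip: r(2))
      show "sin (r * 1) / r \<noteq> 0 \<or> cos (r * 1) \<noteq> 0"
        using r sin_zero_abs_cos_one[of r] by auto
    qed auto
  next
    case 3
    define r where "r = sqrt (- \<kappa>)"
    have r: "r > 0" "r * r = - \<kappa>" using 3 by (simp_all add: r_def)
    show ?thesis
    proof (rule that[of "\<lambda>t. sinh (r * t) / r" "\<lambda>t. cosh (r * t)"])
      show "((\<lambda>t. sinh (r * t) / r) has_real_derivative cosh (r * t)) (at t)" for t
        using r(1) by (auto intro!: derivative_eq_intros)
      show "((\<lambda>t. cosh (r * t)) has_real_derivative - \<kappa> * (sinh (r * t) / r)) (at t)" for t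
        unfolding r(2)[symmetric] using r(1) by (auto intro!: derivative_eq_intros)
    qed auto
  qed
qed

section \<open>Normal coordinates\<close>

text \<open>\<open>radial\<close> is the geodesic equation of the ray \<open>t x\<close> at time 1;
  letting \<open>x\<close> vary over the star-shaped \<open>U\<close> covers the other positive
  times.\<close>

locale normal_coordinates = local_metric U h
  for U :: "'e::euclidean_space set" and h +
  assumes U_0: "0 \<in> U" and U_star: "x \<in> U \<Longrightarrow> 0 \<le> t \<Longrightarrow> t \<le> 1 \<Longrightarrow> t *\<^sub>R x \<in> U"
    and radial: "x \<in> U \<Longrightarrow> \<Gamma> x x x = 0"
begin

text \<open>Tensor identities at the centre are homogeneous, so they may be tested on multiples
  small enough to lie in \<open>U\<close>.\<close>

lemma scaled_into_U: obtains \<epsilon> where "\<epsilon> > 0" "\<epsilon> *\<^sub>R v \<in> U"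
proof -
  obtain d where d: "d > 0" "ball 0 d \<subseteq> U" using open_S U_0 open_contains_ball by blast
  have "norm ((d / (2 * (norm v + 1))) *\<^sub>R v) < d"
  proof -
    have "d * norm v < d * (2 * (norm v + 1))"
      using d by (intro mult_strict_left_mono) (auto simp: add_nonneg_pos add_strict_increasing)
    moreover have "2 * (norm v + 1) > 0" by (simp add: add_nonneg_pos)
    ultimately show ?thesis using d by (simp add: pos_divide_less_eq)
  qed
  then show ?thesis
    using that[of "d / (2 * (norm v + 1))"] d by (simp add: add_nonneg_pos subset_iff)
qed

lemma ray_continuous:
  assumes "x \<in> U" "smooth_on U f"
  shows "continuous_on {0..1} (\<lambda>t. f (t *\<^sub>R x))"
  by (rule continuous_on_compose2[OF smooth_on_imp_continuous_on[OF assms(2)]])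
    (auto intro!: continuous_intros U_star assms(1))

text \<open>Homogeneity settles positive \<open>t\<close>; at the centre itself the radial condition
  says nothing about \<open>x\<close>, and continuity along the ray is used.\<close>

lemma \<Gamma>_ray:
  assumes x: "x \<in> U" and t: "0 \<le> t" "t \<le> 1"
  shows "\<Gamma> (t *\<^sub>R x) x x = 0"
proof -
  have pos: "\<Gamma> (s *\<^sub>R x) x x = 0" if "0 < s" "s \<le> 1" for s
  proof -
    have sx: "s *\<^sub>R x \<in> U" using U_star[OF x] that by simp
    show ?thesis
      using radial[OF sx] that by (simp add: bilinear_lmul[OF \<Gamma>_bilinear[OF sx]] bilinear_rmul[OF \<Gamma>_bilinear[OF sx]])
  qed
  show ?thesis
  proof (cases "t = 0")
    case True
    have "((\<lambda>s. \<Gamma> (s *\<^sub>R x) x x) \<longlongrightarrow> \<Gamma> (0 *\<^sub>R x) x x) (at 0)"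
      using has_vector_derivative_continuous[OF smooth_on_ray_derivative[OF \<Gamma>_smooth, of 0 x x x]] U_0
      by (simp add: isCont_def)
    then have "((\<lambda>s. \<Gamma> (s *\<^sub>R x) x x) \<longlongrightarrow> \<Gamma> (0 *\<^sub>R x) x x) (at_right 0)"
      by (rule filterlim_mono) (auto simp: at_le)
    moreover have "\<forall>\<^sub>F s in at_right (0::real). \<Gamma> (s *\<^sub>R x) x x = 0"
      by (rule eventually_at_rightI[of 0 1]) (auto intro: pos)
    then have "((\<lambda>s. \<Gamma> (s *\<^sub>R x) x x) \<longlongrightarrow> 0) (at_right 0)" by (rule tendsto_eventually)
    ultimately have "\<Gamma> (0 *\<^sub>R x) x x = 0" using tendsto_unique[OF trivial_limit_at_right_real] by blast
    then show ?thesis using True by simp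
  next
    case False
    then show ?thesis using pos t by simp
  qed
qed

text \<open>At the centre all directions are radial, so the quadratic form of
  \<open>\<Gamma>\<close> vanishes there, and \<open>\<Gamma>\<close> is symmetric.\<close>

lemma \<Gamma>_origin: "\<Gamma> 0 u v = 0"
proof -
  note b = \<Gamma>_bilinear[OF U_0]
  have q: "\<Gamma> 0 v v = 0" for v
  proof -
    obtain \<epsilon> where "\<epsilon> > 0" "\<epsilon> *\<^sub>R v \<in> U" by (rule scaled_into_U)
    then show ?thesis
      using \<Gamma>_ray[of "\<epsilon> *\<^sub>R v" 0] by (simp add: bilinear_lmul[OF b] bilinear_rmul[OF b])
  qed
  have "\<Gamma> 0 (u + v) (u + v) = \<Gamma> 0 u u + \<Gamma> 0 v v + 2 *\<^sub>R \<Gamma> 0 u v"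
    unfolding scaleR_2 bilinear_ladd[OF b] bilinear_radd[OF b] \<Gamma>_sym[OF U_0, of v u] by simp
  then have "(2::real) *\<^sub>R \<Gamma> 0 u v = 0" by (simp add: q)
  then show ?thesis by simp
qed

section \<open>The Gauss lemma\<close>

lemma gauss_radial:
  assumes x: "x \<in> U"
  shows "h x x x = h 0 x x"
proof -
  have "(\<lambda>t. h (t *\<^sub>R x) x x) 1 = (\<lambda>t. h (t *\<^sub>R x) x x) 0"
  proof (rule DERIV_isconst_end[where f = "\<lambda>t. h (t *\<^sub>R x) x x"])
    show "continuous_on {0..1} (\<lambda>t. h (t *\<^sub>R x) x x)" by (rule ray_continuous[OF x h_smooth])
    show "((\<lambda>t. h (t *\<^sub>R x) x x) has_real_derivative 0) (at t)" if "0 < t" "t < 1" for t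
    proof -
      have tx: "t *\<^sub>R x \<in> U" using U_star[OF x] that by simp
      show ?thesis
        using smooth_on_ray_derivative[OF h_smooth tx, of x x] \<Gamma>_ray[OF x, of t] that
        by (simp add: \<Gamma>_metric[OF tx] has_real_derivative_iff_has_vector_derivative
            bilinear_lzero[OF h_bilinear[OF tx]] bilinear_rzero[OF h_bilinear[OF tx]])
    qed
  qed simp
  then show ?thesis by simp
qed

lemma gauss_differentiated:
  assumes y: "y \<in> U"
  shows "h y (\<Gamma> y w y) y + h y y w = h 0 y w"
proof -
  have 1: "((\<lambda>y. h y y y) has_derivative (\<lambda>a. h y (a + \<Gamma> y a y) y + h y y (a + \<Gamma> y a y))) (at y)"
    by (rule has_derivative_h_along[where \<psi> = "\<lambda>y. y" and x = y, OF y open_S y]) auto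
  have "((\<lambda>y. h 0 y y) has_derivative (\<lambda>a. h 0 y a + h 0 a y)) (at y)"
    using bounded_bilinear.FDERIV[OF bilinear_conv_bounded_bilinear[THEN iffD1, OF h_bilinear[OF U_0]]
        has_derivative_ident has_derivative_ident] .
  then have "((\<lambda>y. h y y y) has_derivative (\<lambda>a. h 0 y a + h 0 a y)) (at y)"
    by (rule has_derivative_transform_within_open[OF _ open_S y]) (simp add: gauss_radial)
  from has_derivative_unique[OF 1 this]
  have "h y (w + \<Gamma> y w y) y + h y y (w + \<Gamma> y w y) = h 0 y w + h 0 w y" by metis
  then show ?thesis
    using h_sym[OF y, of w y] h_sym[OF y, of y "\<Gamma> y w y"] h_sym[OF U_0, of w y]
    by (simp add: bilinear_ladd[OF h_bilinear[OF y]] bilinear_radd[OF h_bilinear[OF y]])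
qed

text \<open>\<open>gauss_differentiated\<close> at the point \<open>t x\<close>, divided by
  \<open>t\<close>, says that \<open>?F\<close> has derivative 0. The factor \<open>t\<close> in
  \<open>?F\<close> makes it vanish at the centre.\<close>

lemma gauss_lemma:
  assumes x: "x \<in> U"
  shows "h x x w = h 0 x w"
proof -
  let ?F = "\<lambda>t. t * (h (t *\<^sub>R x) x w - h 0 x w)"
  have "?F 1 = ?F 0"
  proof (rule DERIV_isconst_end[where f = ?F])
    show "continuous_on {0..1} ?F"
      by (intro continuous_intros ray_continuous[OF x h_smooth])
    show "(?F has_real_derivative 0) (at t)" if t: "0 < t" "t < 1" for t
    proof -
      have tx: "t *\<^sub>R x \<in> U" using U_star[OF x] t by simp
      note b = h_bilinear[OF tx] \<Gamma>_bilinear[OF tx] h_bilinear[OF U_0]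
      have d: "((\<lambda>t. h (t *\<^sub>R x) x w) has_real_derivative h (t *\<^sub>R x) x (\<Gamma> (t *\<^sub>R x) x w)) (at t)"
        using smooth_on_ray_derivative[OF h_smooth tx, of x w] \<Gamma>_ray[OF x, of t] t
        by (simp add: \<Gamma>_metric[OF tx] has_real_derivative_iff_has_vector_derivative bilinear_lzero[OF b(1)])
      have "(?F has_real_derivative (h (t *\<^sub>R x) x w - h 0 x w) + h (t *\<^sub>R x) x (\<Gamma> (t *\<^sub>R x) x w) * t) (at t)"
        by (rule derivative_eq_intros d refl | simp)+
      moreover have "(h (t *\<^sub>R x) x w - h 0 x w) + h (t *\<^sub>R x) x (\<Gamma> (t *\<^sub>R x) x w) * t = 0"
      proof -
        have "t * ((h (t *\<^sub>R x) x w - h 0 x w) + h (t *\<^sub>R x) x (\<Gamma> (t *\<^sub>R x) x w) * t) = 0"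
          using gauss_differentiated[OF tx, of w] \<Gamma>_sym[OF tx, of w x] h_sym[OF tx, of "\<Gamma> (t *\<^sub>R x) x w" x]
          by (simp add: bilinear_lmul[OF b(1)] bilinear_rmul[OF b(1)] bilinear_rmul[OF b(2)] bilinear_lmul[OF b(3)] algebra_simps)
        then show ?thesis using t by simp
      qed
      ultimately show ?thesis by simp
    qed
  qed simp
  then show ?thesis by simp
qed

section \<open>First derivatives of the Christoffel form in normal coordinates\<close>

lemma fder_\<Gamma>_radial:
  assumes x: "x \<in> U"
  shows "fder (\<lambda>y. \<Gamma> y x x) x w = - 2 *\<^sub>R \<Gamma> x w x"
proof -
  have "((\<lambda>y. \<Gamma> y y y) has_derivative (\<lambda>w. fder (\<lambda>y. \<Gamma> y x x) x w + \<Gamma> x w x + \<Gamma> x x w)) (at x)"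
    by (rule has_derivative_bilinear_family[OF open_S x \<Gamma>_bilinear \<Gamma>_has_derivative[OF x] has_derivative_ident has_derivative_ident])
  then have 1: "((\<lambda>y. 0) has_derivative (\<lambda>w. fder (\<lambda>y. \<Gamma> y x x) x w + \<Gamma> x w x + \<Gamma> x x w)) (at x)"
    by (rule has_derivative_transform_within_open[OF _ open_S x]) (simp add: radial)
  have "fder (\<lambda>y. \<Gamma> y x x) x w + \<Gamma> x w x + \<Gamma> x x w = 0"
    using has_derivative_unique[OF 1 has_derivative_const] by metis
  then show ?thesis
    unfolding \<Gamma>_sym[OF x, of x w] by (simp add: scaleR_2 add_eq_0_iff2 algebra_simps)
qed

text \<open>The linear Taylor term of \<open>\<Gamma>\<close> at the centre gives a cubic form
  \<open>?T y y y\<close>, which vanishes by the radial equation. Hence its symmetrization vanishes,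
  and two of the three summands agree by symmetry of \<open>\<Gamma>\<close>.\<close>

lemma fder_\<Gamma>_origin: "fder (\<lambda>y. \<Gamma> y x x) 0 w = - 2 *\<^sub>R fder (\<lambda>y. \<Gamma> y w x) 0 x"
proof -
  let ?T = "\<lambda>a b c. fder (\<lambda>y. \<Gamma> y b c) 0 a"
  note lin = fder_\<Gamma>_linear[OF U_0]
  have cubic: "?T y y y = 0" for y
  proof -
    obtain \<epsilon> where \<epsilon>: "\<epsilon> > 0" "\<epsilon> *\<^sub>R y \<in> U" by (rule scaled_into_U)
    let ?x = "\<epsilon> *\<^sub>R y"
    have 1: "((\<lambda>t. \<Gamma> (t *\<^sub>R ?x) ?x ?x) has_vector_derivative ?T ?x ?x ?x) (at 0)"
      using smooth_on_ray_derivative[OF \<Gamma>_smooth, of 0 ?x ?x ?x] U_0 by simp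
    have "?T ?x ?x ?x \<in> {0}"
    proof (rule has_vector_derivative_in_subspace[OF 1 _ subspace_single_0])
      show "\<Gamma> (0 *\<^sub>R ?x) ?x ?x = 0" by (rule \<Gamma>_ray[OF \<epsilon>(2)]) simp_all
      show "\<forall>\<^sub>F t in at_right 0. \<Gamma> (t *\<^sub>R ?x) ?x ?x \<in> {0}"
        by (rule eventually_at_rightI[of 0 1]) (simp_all del: scaleR_scaleR add: \<Gamma>_ray[OF \<epsilon>(2)])
    qed
    then show ?thesis using \<epsilon>(1) by (simp add: lin)
  qed
  have sym: "?T a b c = ?T a c b" for a b c
    by (subst fder_cong_open[OF open_S U_0, of _ "\<lambda>y. \<Gamma> y c b"]) (simp_all add: \<Gamma>_sym)
  define T1 where "T1 = ?T w x x + ?T x w x + ?T x x w"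
  define T2 where "T2 = ?T w w x + ?T w x w + ?T x w w"
  have "s *\<^sub>R T1 + (s * s) *\<^sub>R T2 = 0" for s
    using cubic[of "x + s *\<^sub>R w"] cubic[of x] cubic[of w]
    by (simp add: lin T1_def T2_def algebra_simps)
  \<comment> \<open>The values at 1 and -1 separate the part linear in \<open>s\<close> from the
    quadratic one.\<close>
  from this[of 1] this[of "-1"] have "T1 + T2 = 0" "T2 = T1" by (simp_all add: add_eq_0_iff2)
  then have "T1 = 0" by (simp flip: scaleR_2)
  then show ?thesis
    unfolding T1_def sym[of x w x] scaleR_minus_left scaleR_2 eq_neg_iff_add_eq_0 add.assoc .
qed

text \<open>At the centre \<open>R(x, w) x\<close> is three times the radial derivative of \<open>\<Gamma> (w, x)\<close>, and that
  derivative lies on the line of \<open>w\<close> when the spheres around the centre are umbilical.\<close>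

lemma umbilical_imp_constant_curvature:
  assumes dim: "DIM('e) \<ge> 2"
    and umb: "\<And>x X. x \<in> U \<Longrightarrow> h 0 x x \<noteq> 0 \<Longrightarrow> h 0 x X = 0 \<Longrightarrow> h x X X \<noteq> 0 \<Longrightarrow> \<exists>\<mu>. \<Gamma> x X x = \<mu> *\<^sub>R X"
  shows "\<exists>K. constant_curvature_at K 0"
  unfolding constant_curvature_at_def
proof (rule curvature_form.constant_curvature_of_eigen[OF curvature_form_at[OF U_0] dim])
  fix v w assume v: "h 0 v v \<noteq> 0" and w: "h 0 w w \<noteq> 0" and vw: "h 0 v w = 0"
  obtain \<epsilon> where \<epsilon>: "\<epsilon> > 0" "\<epsilon> *\<^sub>R v \<in> U" by (rule scaled_into_U)
  define x where "x = \<epsilon> *\<^sub>R v"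
  have x: "x \<in> U" "h 0 x x \<noteq> 0" "h 0 x w = 0"
    using \<epsilon> v vw by (simp_all add: x_def bilinear_lmul[OF h_bilinear[OF U_0]] bilinear_rmul[OF h_bilinear[OF U_0]])
  define D where "D = fder (\<lambda>y. \<Gamma> y w x) 0 x"
  have "((\<lambda>t. \<Gamma> (t *\<^sub>R x) w x) has_vector_derivative D) (at 0)"
    using smooth_on_ray_derivative[OF \<Gamma>_smooth, of 0 x w x] U_0 by (simp add: D_def)
  then have "D \<in> span {w}"
  proof (rule has_vector_derivative_in_subspace[OF _ _ subspace_span])
    show "\<Gamma> (0 *\<^sub>R x) w x = 0" by (simp add: \<Gamma>_origin)
    \<comment> \<open>Umbilicity speaks about non-null tangent vectors; \<open>w\<close> is non-null
      at the centre and stays so on an initial piece of the ray.\<close>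
    have "((\<lambda>t. h (t *\<^sub>R x) w w) \<longlongrightarrow> h 0 w w) (at 0)"
      using has_vector_derivative_continuous[OF smooth_on_ray_derivative[OF h_smooth, of 0 x w w]] U_0
      by (simp add: isCont_def)
    then have "\<forall>\<^sub>F t in at 0. h (t *\<^sub>R x) w w \<noteq> 0"
      by (rule tendsto_imp_eventually_ne[OF _ w])
    then have "\<forall>\<^sub>F t in at_right 0. h (t *\<^sub>R x) w w \<noteq> 0"
      by (rule eventually_at_rightI_at)
    moreover have "\<forall>\<^sub>F t in at_right (0::real). 0 < t \<and> t < 1"
      by (rule eventually_at_rightI[of 0 1]) auto
    ultimately show "\<forall>\<^sub>F t in at_right 0. \<Gamma> (t *\<^sub>R x) w x \<in> span {w}"
    proof eventually_elim
      case (elim t)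
      have tx: "t *\<^sub>R x \<in> U" using U_star[OF x(1)] elim by simp
      note b = h_bilinear[OF U_0] \<Gamma>_bilinear[OF tx]
      obtain \<mu> where "\<Gamma> (t *\<^sub>R x) w (t *\<^sub>R x) = \<mu> *\<^sub>R w"
        using umb[OF tx, of w] x elim by (auto simp: bilinear_lmul[OF b(1)] bilinear_rmul[OF b(1)])
      then have "t *\<^sub>R \<Gamma> (t *\<^sub>R x) w x = \<mu> *\<^sub>R w" by (simp add: bilinear_rmul[OF b(2)])
      then have "\<Gamma> (t *\<^sub>R x) w x = (\<mu> / t) *\<^sub>R w" using elim by (simp add: eq_vector_fraction_iff)
      then show ?case by (simp add: span_scale span_base)
    qed
  qed
  then obtain \<mu> where \<mu>: "D = \<mu> *\<^sub>R w" by (auto simp: span_singleton)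
  \<comment> \<open>The second derivative term of \<open>Rm\<close> is \<open>-2\<close> times the
    first by \<open>fder_\<Gamma>_origin\<close>, and the quadratic terms vanish since
    \<open>\<Gamma>\<close> is 0 at the centre.\<close>
  have "Rm 0 x w x = D - (- 2 *\<^sub>R D)"
    by (simp add: Rm_def fder_\<Gamma>_origin \<Gamma>_origin D_def)
  also have "\<dots> = (3 * \<mu>) *\<^sub>R w" unfolding \<mu> by (simp flip: scaleR_left_distrib)
  finally have "(\<epsilon> * \<epsilon>) *\<^sub>R Rm 0 v w v = (3 * \<mu>) *\<^sub>R w"
    unfolding x_def by (simp add: linear_scale[OF Rm_linear(1)[OF U_0]] linear_scale[OF Rm_linear(3)[OF U_0]])
  then have "Rm 0 v w v = (3 * \<mu> / (\<epsilon> * \<epsilon>)) *\<^sub>R w" using \<epsilon>(1) by (simp add: eq_vector_fraction_iff)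
  then show "\<exists>\<mu>. Rm 0 v w v = \<mu> *\<^sub>R w" by blast
qed


text \<open>\<open>J(t) = t w\<close> is a Jacobi field along the ray \<open>t x\<close>.  In constant curvature \<open>J'' = - \<kappa> J\<close>, so
  \<open>Y = s J' - s' J\<close> is parallel for \<open>s'' = - \<kappa> s\<close>, \<open>s(0) = 0\<close>; it vanishes at the centre, hence
  everywhere.\<close>

lemma constant_curvature_imp_umbilical:
  assumes K: "\<And>y. y \<in> U \<Longrightarrow> constant_curvature_at K y"
    and x: "x \<in> U" and xw: "h 0 x w = 0"
  shows "\<exists>\<mu>. \<Gamma> x w x = \<mu> *\<^sub>R w"
proof (cases "w = 0")
  case True
  then have "\<Gamma> x w x = 0 *\<^sub>R w" using bilinear_lzero[OF \<Gamma>_bilinear[OF x]] by simp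
  then show ?thesis by blast
next
  case False
  \<comment> \<open>\<open>h 0 x x\<close> is the constant square of the velocity of the ray, so
    this is the coefficient of the Jacobi equation.\<close>
  define \<kappa> where "\<kappa> = K * h 0 x x"
  obtain s s' where s: "s 0 = 0" "s' 0 = 1" "\<And>t. (s has_real_derivative s' t) (at t)"
    "\<And>t. (s' has_real_derivative - \<kappa> * s t) (at t)" "s 1 \<noteq> 0 \<or> s' 1 \<noteq> 0"
    using oscillator[of \<kappa>] by blast
  define B where "B t u = \<Gamma> (t *\<^sub>R x) u x" for t u
  define b' where "b' t = fder (\<lambda>y. \<Gamma> y w x) (t *\<^sub>R x) x" for t
  have tx: "t *\<^sub>R x \<in> U" if "0 \<le> t" "t \<le> 1" for t using U_star[OF x] that .
  have linB: "linear (B t)" if "t \<in> {0..1}" for t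
    unfolding B_def by (rule bilinear_linear_left[OF \<Gamma>_bilinear[OF tx]]) (use that in auto)
  obtain M where M: "M \<ge> 0" "\<And>t u. t \<in> {0..1} \<Longrightarrow> norm (B t u) \<le> M * norm u"
  proof (rule linear_family_bounded[OF compact_Icc linB])
    show "continuous_on {0..1} (\<lambda>t. B t u)" for u
      unfolding B_def by (rule ray_continuous[OF x \<Gamma>_smooth])
  qed auto
  have db: "((\<lambda>t. B t w) has_vector_derivative b' t) (at t)" if "0 < t" "t < 1" for t
    unfolding B_def b'_def by (rule smooth_on_ray_derivative[OF \<Gamma>_smooth tx]) (use that in auto)
  \<comment> \<open>The left side is the second covariant derivative of \<open>t w\<close> along the
    ray, the first one being \<open>w + t *\<^sub>R B t w\<close>. Multiplication by
    \<open>t\<close> clears the singular coefficient \<open>2 / t\<close> that the curvature formula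
    produces.\<close>
  have riccati: "t *\<^sub>R b' t + 2 *\<^sub>R B t w + t *\<^sub>R B t (B t w) = - (t * \<kappa>) *\<^sub>R w" if t: "0 < t" "t < 1" for t
  proof -
    have y: "t *\<^sub>R x \<in> U" using tx t by simp
    note bi = \<Gamma>_bilinear[OF y] h_bilinear[OF y] h_bilinear[OF U_0]
    have "t * h (t *\<^sub>R x) x u = t * h 0 x u" for u
      using gauss_lemma[OF y, of u] by (simp add: bilinear_lmul[OF bi(2)] bilinear_lmul[OF bi(3)])
    then have g: "h (t *\<^sub>R x) x u = h 0 x u" for u using t by simp
    have rad: "\<Gamma> (t *\<^sub>R x) x x = 0" using \<Gamma>_ray[OF x] t by simp
    have "Rm (t *\<^sub>R x) x w x = K *\<^sub>R (h (t *\<^sub>R x) w x *\<^sub>R x - h (t *\<^sub>R x) x x *\<^sub>R w)"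
      using K[OF y] unfolding constant_curvature_at_def by blast
    also have "\<dots> = - \<kappa> *\<^sub>R w"
      using h_sym[OF y, of w x] by (simp add: g xw \<kappa>_def)
    finally have R: "Rm (t *\<^sub>R x) x w x = - \<kappa> *\<^sub>R w" .
    have "(t * t) *\<^sub>R fder (\<lambda>y. \<Gamma> y x x) (t *\<^sub>R x) w = (t * t) *\<^sub>R (- (2 / t) *\<^sub>R B t w)"
      using fder_\<Gamma>_radial[OF y, of w] t
      by (simp add: fder_\<Gamma>_linear[OF y] bilinear_rmul[OF bi(1)] B_def)
    then have D: "fder (\<lambda>y. \<Gamma> y x x) (t *\<^sub>R x) w = - (2 / t) *\<^sub>R B t w"
      using t unfolding scaleR_cancel_left by simp
    have "b' t + (2 / t) *\<^sub>R B t w + B t (B t w) = - \<kappa> *\<^sub>R w"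
      using R unfolding Rm_def D rad b'_def B_def
      by (simp add: bilinear_rzero[OF bi(1)] \<Gamma>_sym[OF y, of x "\<Gamma> (t *\<^sub>R x) w x"] \<Gamma>_sym[OF y, of x w])
    then have "t *\<^sub>R (b' t + (2 / t) *\<^sub>R B t w + B t (B t w)) = t *\<^sub>R (- \<kappa> *\<^sub>R w)" by simp
    then show ?thesis using t by (simp add: scaleR_add_right)
  qed
  define Y where "Y t = s t *\<^sub>R (w + t *\<^sub>R B t w) - (s' t * t) *\<^sub>R w" for t
  \<comment> \<open>\<open>Y' + B Y = 0\<close> is the equation of parallel transport along the ray;
    its coefficients are bounded up to the centre, as Gronwall's estimate demands.\<close>
  define Y' where "Y' t = - B t (Y t)" for t
  have "Y 1 = 0"
  proof (rule gronwall_zero[where u = Y and u' = Y' and L = M and T = 1])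
    show "continuous_on {0..1} Y"
      unfolding Y_def B_def
      by (intro continuous_intros ray_continuous[OF x \<Gamma>_smooth] DERIV_continuous_on[OF DERIV_subset[OF s(3)]]
          DERIV_continuous_on[OF DERIV_subset[OF s(4)]]) auto
    show "Y 0 = 0" by (simp add: Y_def s)
    show "norm (Y' t) \<le> M * norm (Y t)" if "0 < t" "t < 1" for t
      unfolding Y'_def using M(2)[of t "Y t"] that by simp
    show "(Y has_vector_derivative Y' t) (at t)" if t: "0 < t" "t < 1" for t
    proof -
      have "(Y has_vector_derivative (s t *\<^sub>R (t *\<^sub>R b' t + B t w) + s' t *\<^sub>R (w + t *\<^sub>R B t w))
         - (s' t + - \<kappa> * s t * t) *\<^sub>R w) (at t)"
      proof -
        note d2 = has_vector_derivative_add[OF has_vector_derivative_const[of w]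
            has_vector_derivative_scaleR[OF DERIV_ident db[OF t]]]
        note d5 = has_vector_derivative_scaleR[OF DERIV_mult[OF s(4) DERIV_ident] has_vector_derivative_const[of w]]
        show ?thesis
          unfolding Y_def
          by (rule has_vector_derivative_eq_rhs[OF has_vector_derivative_diff[OF has_vector_derivative_scaleR[OF s(3) d2] d5]])
            simp
      qed
      moreover have "Y' t = (s t *\<^sub>R (t *\<^sub>R b' t + B t w) + s' t *\<^sub>R (w + t *\<^sub>R B t w)) - (s' t + - \<kappa> * s t * t) *\<^sub>R w"
      proof -
        have lin: "linear (B t)" using linB t by simp
        have "(s t *\<^sub>R (t *\<^sub>R b' t + B t w) + s' t *\<^sub>R (w + t *\<^sub>R B t w)) - (s' t + - \<kappa> * s t * t) *\<^sub>R w - Y' t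
          = s t *\<^sub>R ((t *\<^sub>R b' t + 2 *\<^sub>R B t w + t *\<^sub>R B t (B t w)) - (- (t * \<kappa>) *\<^sub>R w))"
          unfolding Y'_def Y_def
          by (simp add: linear_diff[OF lin] linear_add[OF lin] linear_scale[OF lin] algebra_simps scaleR_2)
        also have "\<dots> = 0" unfolding riccati[OF t] by simp
        finally show ?thesis by simp
      qed
      ultimately show ?thesis by simp
    qed
  qed (use M in auto)
  then have eq: "s 1 *\<^sub>R \<Gamma> x w x = (s' 1 - s 1) *\<^sub>R w"
    by (simp add: Y_def B_def algebra_simps)
  \<comment> \<open>If \<open>s 1\<close> were 0, then \<open>eq\<close> would read
    \<open>s' 1 *\<^sub>R w = 0\<close> with \<open>s' 1\<close> and \<open>w\<close> both
    nonzero.\<close>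
  have "s 1 \<noteq> 0" using eq s(5) False by auto
  then have "\<Gamma> x w x = ((s' 1 - s 1) / s 1) *\<^sub>R w" using eq by (simp add: eq_vector_fraction_iff)
  then show ?thesis by blast
qed

end

section \<open>Ordinary differential equations\<close>

text \<open>Banach's fixed point theorem on bounded continuous functions. The factor 3 stems from
  the two integrals in \<open>y0 + I u t - I u 0\<close>: both start at \<open>-s\<close>, and their
  intervals have length at most \<open>2 * s\<close> and \<open>s\<close>.\<close>

lemma picard_exists:
  fixes F :: "real \<Rightarrow> 'z::euclidean_space \<Rightarrow> 'z"
  assumes s: "s > 0" and L: "L \<ge> 0" "3 * s * L < 1"
    and cont: "continuous_on ({-s..s} \<times> UNIV) (\<lambda>(t, y). F t y)"
    and lip: "\<And>t y y'. t \<in> {-s..s} \<Longrightarrow> norm (F t y - F t y') \<le> L * norm (y - y')"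
  shows "\<exists>y. y 0 = y0 \<and> (\<forall>t\<in>{-s..s}. (y has_vector_derivative F t (y t)) (at t within {-s..s}))"
proof -
  \<comment> \<open>Clamping time to the interval turns functions on it into bounded continuous
    functions on the whole line, a complete space.\<close>
  define cl where "cl t = max (- s) (min s t)" for t
  have cl: "cl t \<in> {-s..s}" for t using s by (auto simp: cl_def)
  have cl_id: "cl t = t" if "t \<in> {-s..s}" for t using that by (auto simp: cl_def)
  have cont_cl: "continuous_on UNIV cl" unfolding cl_def by (intro continuous_intros)
  define f where "f u \<tau> = F \<tau> (apply_bcontfun u \<tau>)" for u :: "real \<Rightarrow>\<^sub>C 'z" and \<tau>
  have cf: "continuous_on {-s..s} (f u)" for u
  proof -
    have "continuous_on {-s..s} (\<lambda>\<tau>. (\<lambda>(t, y). F t y) (\<tau>, apply_bcontfun u \<tau>))"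
      by (rule continuous_on_compose2[OF cont]) (auto intro!: continuous_intros)
    then show ?thesis by (simp add: f_def)
  qed
  \<comment> \<open>Integrals from the left end are always positively oriented; the subtraction of
    \<open>I u 0\<close> below restores the initial condition at time 0.\<close>
  define I where "I u t = integral {-s..t} (f u)" for u t
  have dI: "(I u has_vector_derivative f u t) (at t within {-s..s})" if "t \<in> {-s..s}" for u t
    unfolding I_def by (rule integral_has_vector_derivative[OF cf that])
  have cI: "continuous_on {-s..s} (I u)" for u
    by (rule continuous_on_vector_derivative[OF dI])
  define T0 where "T0 u t = y0 + I u (cl t) - I u 0" for u t
  have cT0: "continuous_on UNIV (T0 u)" for u
    unfolding T0_def
    by (intro continuous_intros continuous_on_compose2[OF cI cont_cl]) (use cl in auto)
  obtain M where M: "\<And>u t. t \<in> {-s..s} \<Longrightarrow> norm (I u t) \<le> M u"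
    using compact_imp_bounded[OF compact_continuous_image[OF cI compact_Icc]]
    unfolding bounded_iff by (metis imageI)
  have T0_in: "T0 u \<in> bcontfun" for u
  proof (rule bcontfun_normI[OF cT0])
    fix t
    have "norm (T0 u t) \<le> norm (y0 + I u (cl t)) + norm (I u 0)"
      unfolding T0_def by (rule norm_triangle_ineq4)
    also have "norm (y0 + I u (cl t)) \<le> norm y0 + norm (I u (cl t))" by (rule norm_triangle_ineq)
    finally show "norm (T0 u t) \<le> norm y0 + M u + M u" using M[OF cl, of u t] M[of 0 u] s by simp
  qed
  define T where "T u = Bcontfun (T0 u)" for u
  have T: "apply_bcontfun (T u) = T0 u" for u
    unfolding T_def by (rule Bcontfun_inverse[OF T0_in])
  have diffI: "norm (I u t - I v t) \<le> L * dist u v * (t + s)" if t: "t \<in> {-s..s}" for u v t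
  proof -
    have sub: "{-s..t} \<subseteq> {-s..s}" using t by auto
    have c: "continuous_on {-s..t} (f u)" "continuous_on {-s..t} (f v)"
      by (rule continuous_on_subset[OF cf sub])+
    have "I u t - I v t = integral {-s..t} (\<lambda>\<tau>. f u \<tau> - f v \<tau>)"
      unfolding I_def by (rule integral_diff[symmetric]; rule integrable_continuous_real[OF c(1)] integrable_continuous_real[OF c(2)])
    also have "norm \<dots> \<le> L * dist u v * (t - (- s))"
    proof (rule integral_bound)
      show "- s \<le> t" using t by simp
      show "continuous_on {-s..t} (\<lambda>\<tau>. f u \<tau> - f v \<tau>)" by (intro continuous_on_diff c)
      fix \<tau> assume "\<tau> \<in> {-s..t}"
      then have "norm (f u \<tau> - f v \<tau>) \<le> L * norm (apply_bcontfun u \<tau> - apply_bcontfun v \<tau>)"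
        unfolding f_def by (intro lip) (use t in auto)
      also have "\<dots> \<le> L * dist u v"
        by (intro mult_left_mono L) (use dist_bounded[of u \<tau> v] in \<open>simp add: dist_norm\<close>)
      finally show "norm (f u \<tau> - f v \<tau>) \<le> L * dist u v" .
    qed
    finally show ?thesis by simp
  qed
  have "dist (T u) (T v) \<le> (3 * s * L) * dist u v" for u v
  proof (rule dist_bound)
    fix t
    have "dist (T0 u t) (T0 v t) = norm ((I u (cl t) - I v (cl t)) - (I u 0 - I v 0))"
      unfolding T0_def dist_norm by (simp add: algebra_simps)
    also have "\<dots> \<le> norm (I u (cl t) - I v (cl t)) + norm (I u 0 - I v 0)" by (rule norm_triangle_ineq4)
    also have "\<dots> \<le> L * dist u v * (cl t + s) + L * dist u v * (0 + s)"
      by (intro add_mono diffI cl) (use s in auto)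
    also have "\<dots> \<le> L * dist u v * (s + s) + L * dist u v * (0 + s)"
      by (intro add_mono mult_left_mono) (use cl[of t] L s in auto)
    also have "\<dots> = (3 * s * L) * dist u v" by (simp add: algebra_simps)
    finally show "dist (apply_bcontfun (T u) t) (apply_bcontfun (T v) t) \<le> (3 * s * L) * dist u v" unfolding T .
  qed
  then have "\<exists>!u. T u = u" using L s by (intro banach_fix_type[of "3 * s * L"]) auto
  then obtain u where "T u = u" by blast
  then have u: "apply_bcontfun u t = T0 u t" for t using T by metis
  define y where "y = apply_bcontfun u"
  have "y 0 = y0" using s cl_id[of 0] by (simp add: y_def u T0_def)
  moreover have "(y has_vector_derivative F t (y t)) (at t within {-s..s})" if t: "t \<in> {-s..s}" for t
  proof -
    have "((\<lambda>t. y0 + I u t - I u 0) has_vector_derivative (0 + f u t - 0)) (at t within {-s..s})"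
      by (intro has_vector_derivative_diff has_vector_derivative_add has_vector_derivative_const dI t)
    then have "(y has_vector_derivative (0 + f u t - 0)) (at t within {-s..s})"
      by (rule has_vector_derivative_transform[OF t, rotated]) (simp add: y_def u T0_def cl_id)
    then show ?thesis by (simp add: f_def y_def)
  qed
  ultimately show ?thesis by blast
qed

lemma picard_exists_at:
  fixes F :: "real \<Rightarrow> 'z::euclidean_space \<Rightarrow> 'z"
  assumes "s > 0" "L \<ge> 0" "3 * s * L < 1"
    and "continuous_on ({-s..s} \<times> UNIV) (\<lambda>(t, y). F t y)"
    and "\<And>t y y'. t \<in> {-s..s} \<Longrightarrow> norm (F t y - F t y') \<le> L * norm (y - y')"
  shows "\<exists>y. y 0 = y0 \<and> (\<forall>t. \<bar>t\<bar> < s \<longrightarrow> (y has_vector_derivative F t (y t)) (at t))"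
proof -
  obtain y where y: "y 0 = y0" "\<And>t. t \<in> {-s..s} \<Longrightarrow> (y has_vector_derivative F t (y t)) (at t within {-s..s})"
    using picard_exists[OF assms, of y0] by blast
  have "(y has_vector_derivative F t (y t)) (at t)" if "\<bar>t\<bar> < s" for t
  proof -
    have "-s < t" "t < s" using that by auto
    then show ?thesis using y(2)[of t] by (simp add: at_within_Icc_at)
  qed
  then show ?thesis using y(1) by blast
qed

text \<open>Negative times are reached by reversing time with the sign
  \<open>\<sigma>\<close>.\<close>

lemma gronwall_two_sided:
  fixes u :: "real \<Rightarrow> 'z::real_inner"
  assumes der: "\<And>t. \<bar>t\<bar> < a \<Longrightarrow> (u has_vector_derivative u' t) (at t)"
    and bound: "\<And>t. \<bar>t\<bar> \<le> \<bar>t1\<bar> \<Longrightarrow> norm (u' t) \<le> L * norm (u t) + \<epsilon>"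
    and L: "L \<ge> 0" and \<epsilon>: "\<epsilon> \<ge> 0" and t1: "\<bar>t1\<bar> < a"
  shows "(norm (u t1))\<^sup>2 + \<epsilon>\<^sup>2 \<le> ((norm (u 0))\<^sup>2 + \<epsilon>\<^sup>2) * exp ((2 * L + 1) * \<bar>t1\<bar>)"
proof -
  define \<sigma> :: real where "\<sigma> = (if t1 \<ge> 0 then 1 else -1)"
  have \<sigma>: "\<bar>\<sigma>\<bar> = 1" "\<sigma> * \<bar>t1\<bar> = t1" by (auto simp: \<sigma>_def)
  have d: "((\<lambda>t. u (\<sigma> * t)) has_vector_derivative \<sigma> *\<^sub>R u' (\<sigma> * t)) (at t)" if "\<bar>t\<bar> < a" for t
  proof -
    have "((\<lambda>t. \<sigma> * t) has_vector_derivative \<sigma>) (at t)"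
      by (auto intro!: derivative_eq_intros)
    moreover have "(u has_vector_derivative u' (\<sigma> * t)) (at (\<sigma> * t))"
      by (rule der) (use that \<sigma> in \<open>simp add: abs_mult\<close>)
    ultimately show ?thesis by (rule vector_diff_chain_at[unfolded o_def])
  qed
  have "(norm (u (\<sigma> * \<bar>t1\<bar>)))\<^sup>2 + \<epsilon>\<^sup>2 \<le> ((norm (u (\<sigma> * 0)))\<^sup>2 + \<epsilon>\<^sup>2) * exp ((2 * L + 1) * \<bar>t1\<bar>)"
  proof (rule gronwall_norm_sq[where u = "\<lambda>t. u (\<sigma> * t)" and T = "\<bar>t1\<bar>", OF _ d _ L \<epsilon>])
    show "continuous_on {0..\<bar>t1\<bar>} (\<lambda>t. u (\<sigma> * t))"
      using t1 by (intro continuous_at_imp_continuous_on ballI has_vector_derivative_continuous[OF d]) auto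
    show "norm (\<sigma> *\<^sub>R u' (\<sigma> * t)) \<le> L * norm (u (\<sigma> * t)) + \<epsilon>" if "0 < t" "t < \<bar>t1\<bar>" for t
      using bound[of "\<sigma> * t"] that \<sigma> by (simp add: abs_mult)
  qed (use t1 in auto)
  then show ?thesis using \<sigma> by simp
qed

text \<open>The exponential is at least 1, so it may be squared; this costs sharpness but lets the
  root be taken on both sides.\<close>

lemma gronwall_two_sided_linear:
  fixes u :: "real \<Rightarrow> 'z::real_inner"
  assumes "\<And>t. \<bar>t\<bar> < a \<Longrightarrow> (u has_vector_derivative u' t) (at t)"
    and "\<And>t. \<bar>t\<bar> \<le> \<bar>t1\<bar> \<Longrightarrow> norm (u' t) \<le> L * norm (u t)"
    and "L \<ge> 0" "\<bar>t1\<bar> < a"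
  shows "norm (u t1) \<le> norm (u 0) * exp ((2 * L + 1) * \<bar>t1\<bar>)"
proof -
  have "(norm (u t1))\<^sup>2 + 0\<^sup>2 \<le> ((norm (u 0))\<^sup>2 + 0\<^sup>2) * exp ((2 * L + 1) * \<bar>t1\<bar>)"
    by (rule gronwall_two_sided[OF assms(1) _ assms(3) _ assms(4)]) (use assms(2) in auto)
  also have "\<dots> = (norm (u 0))\<^sup>2 * exp ((2 * L + 1) * \<bar>t1\<bar>)" by simp
  also have "\<dots> \<le> (norm (u 0))\<^sup>2 * (exp ((2 * L + 1) * \<bar>t1\<bar>))\<^sup>2"
  proof (rule mult_left_mono)
    have "1 \<le> exp ((2 * L + 1) * \<bar>t1\<bar>)" using assms(3) by simp
    then show "exp ((2 * L + 1) * \<bar>t1\<bar>) \<le> (exp ((2 * L + 1) * \<bar>t1\<bar>))\<^sup>2"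
      by (simp add: power2_eq_square)
  qed simp
  finally have "(norm (u t1))\<^sup>2 \<le> (norm (u 0) * exp ((2 * L + 1) * \<bar>t1\<bar>))\<^sup>2"
    by (simp add: power_mult_distrib)
  then show ?thesis by (rule power2_le_imp_le) simp
qed

lemma gronwall_two_sided_small:
  fixes u :: "real \<Rightarrow> 'z::real_inner"
  assumes "\<And>t. \<bar>t\<bar> < a \<Longrightarrow> (u has_vector_derivative u' t) (at t)"
    and "\<And>t. \<bar>t\<bar> \<le> \<bar>t1\<bar> \<Longrightarrow> norm (u' t) \<le> L * norm (u t) + \<epsilon>"
    and "L \<ge> 0" "\<epsilon> \<ge> 0" "\<bar>t1\<bar> < a" "u 0 = 0"
  shows "norm (u t1) \<le> \<epsilon> * exp ((2 * L + 1) * \<bar>t1\<bar>)"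
proof -
  have "(norm (u t1))\<^sup>2 + \<epsilon>\<^sup>2 \<le> ((norm (u 0))\<^sup>2 + \<epsilon>\<^sup>2) * exp ((2 * L + 1) * \<bar>t1\<bar>)"
    by (rule gronwall_two_sided[OF assms(1,2,3,4,5)])
  then have "(norm (u t1))\<^sup>2 + \<epsilon>\<^sup>2 \<le> \<epsilon>\<^sup>2 * exp ((2 * L + 1) * \<bar>t1\<bar>)" using assms(6) by simp
  moreover have "0 \<le> \<epsilon>\<^sup>2" by simp
  ultimately have "(norm (u t1))\<^sup>2 \<le> \<epsilon>\<^sup>2 * exp ((2 * L + 1) * \<bar>t1\<bar>)" by linarith
  also have "\<dots> \<le> \<epsilon>\<^sup>2 * (exp ((2 * L + 1) * \<bar>t1\<bar>))\<^sup>2"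
  proof (rule mult_left_mono)
    have "1 \<le> exp ((2 * L + 1) * \<bar>t1\<bar>)" using assms(3) by simp
    then show "exp ((2 * L + 1) * \<bar>t1\<bar>) \<le> (exp ((2 * L + 1) * \<bar>t1\<bar>))\<^sup>2"
      by (simp add: power2_eq_square)
  qed simp
  finally have "(norm (u t1))\<^sup>2 \<le> (\<epsilon> * exp ((2 * L + 1) * \<bar>t1\<bar>))\<^sup>2"
    by (simp add: power_mult_distrib)
  then show ?thesis by (rule power2_le_imp_le) (use assms(4) in simp)
qed

section \<open>Uniform estimates for maps of class C^1\<close>

lemma C1_lipschitz_on_cball:
  fixes f :: "'z::euclidean_space \<Rightarrow> 'w::real_normed_vector"
  assumes \<Omega>: "cball z0 r \<subseteq> \<Omega>" and f: "C_k_on 1 \<Omega> f"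
  obtains L where "L \<ge> 0" "\<And>z v. z \<in> cball z0 r \<Longrightarrow> norm (fder f z v) \<le> L * norm v"
    "\<And>y z. y \<in> cball z0 r \<Longrightarrow> z \<in> cball z0 r \<Longrightarrow> norm (f y - f z) \<le> L * norm (y - z)"
proof -
  have df: "(f has_derivative fder f z) (at z)" if "z \<in> cball z0 r" for z
    by (rule has_fder) (use f subsetD[OF \<Omega> that] in simp)
  have "continuous_on (cball z0 r) (\<lambda>z. fder f z v)" for v
    by (rule continuous_on_subset[OF _ \<Omega>]) (use f in simp)
  note cont = this
  obtain L where L: "L \<ge> 0" "\<And>z v. z \<in> cball z0 r \<Longrightarrow> norm (fder f z v) \<le> L * norm v"
  proof (rule linear_family_bounded[of "cball z0 r" "fder f"])
    show "linear (fder f z)" if "z \<in> cball z0 r" for z by (rule has_derivative_linear[OF df[OF that]])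
  qed (use cont in simp_all)
  have "norm (f y - f z) \<le> L * norm (y - z)" if "y \<in> cball z0 r" "z \<in> cball z0 r" for y z
    by (rule differentiable_bound[OF convex_cball has_derivative_at_withinI[OF df] onorm_le[OF L(2)] that])
  from that[OF L this] show ?thesis .
qed

text \<open>Around each point of \<open>C\<close> there is an open set on which the derivative
  varies little; a Lebesgue number of this cover gives one \<open>\<rho>\<close> for the whole
  compact set.\<close>

lemma C1_uniform_linearization:
  fixes f :: "'z::euclidean_space \<Rightarrow> 'w::real_normed_vector"
  assumes \<Omega>: "open \<Omega>" and f: "C_k_on 1 \<Omega> f" and C: "compact C" "C \<subseteq> \<Omega>" and \<epsilon>: "\<epsilon> > 0"
  obtains \<rho> where "\<rho> > 0" "\<And>z w. z \<in> C \<Longrightarrow> norm w < \<rho> \<Longrightarrow> z + w \<in> \<Omega> \<and> norm (f (z + w) - f z - fder f z w) \<le> \<epsilon> * norm w"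
proof -
  have df: "(f has_derivative fder f z) (at z)" if "z \<in> \<Omega>" for z
    using f that by (auto intro: has_fder)
  have cf: "continuous_on \<Omega> (\<lambda>z. fder f z b)" for b using f by simp
  \<comment> \<open>The oscillation allowed per basis vector, so that the operator norm varies by at
    most \<open>\<epsilon>\<close>.\<close>
  define e where "e = \<epsilon> / real DIM('z)"
  have e: "e > 0" using \<epsilon> by (simp add: e_def)
  define G where "G = {B. open B \<and> B \<subseteq> \<Omega> \<and> (\<forall>x\<in>B. \<forall>y\<in>B. \<forall>b\<in>Basis. norm (fder f x b - fder f y b) \<le> e)}"
  have "C \<subseteq> \<Union>G"
  proof
    fix z assume "z \<in> C"
    then have z: "z \<in> \<Omega>" using C by blast
    have "\<forall>\<^sub>F x in nhds z. \<forall>b\<in>Basis. dist (fder f x b) (fder f z b) < e / 2"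
    proof (rule eventually_ball_finite[OF finite_Basis], rule ballI)
      fix b :: 'z
      have "isCont (\<lambda>x. fder f x b) z" using cf[of b] z by (simp add: continuous_on_eq_continuous_at[OF \<Omega>])
      then have "((\<lambda>x. fder f x b) \<longlongrightarrow> fder f z b) (nhds z)"
        unfolding isCont_def using tendsto_at_iff_tendsto_nhds[of "\<lambda>x. fder f x b" z] by blast
      then show "\<forall>\<^sub>F x in nhds z. dist (fder f x b) (fder f z b) < e / 2" using e by (intro tendstoD) auto
    qed
    moreover have "\<forall>\<^sub>F x in nhds z. x \<in> \<Omega>" by (rule eventually_nhds_in_open[OF \<Omega> z])
    ultimately have "\<forall>\<^sub>F x in nhds z. x \<in> \<Omega> \<and> (\<forall>b\<in>Basis. dist (fder f x b) (fder f z b) < e / 2)"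
      by eventually_elim simp
    then obtain B where B: "open B" "z \<in> B" "\<And>x. x \<in> B \<Longrightarrow> x \<in> \<Omega> \<and> (\<forall>b\<in>Basis. dist (fder f x b) (fder f z b) < e / 2)"
      unfolding eventually_nhds by blast
    have "norm (fder f x b - fder f y b) \<le> e" if "x \<in> B" "y \<in> B" "b \<in> Basis" for x y b
      using B(3)[OF that(1)] B(3)[OF that(2)] that(3) dist_triangle_half_r[of "fder f z b" "fder f x b" e "fder f y b"]
      by (simp add: dist_norm norm_minus_commute less_imp_le)
    then have "B \<in> G" unfolding G_def using B by blast
    then show "z \<in> \<Union>G" using B by blast
  qed
  then obtain \<rho> where \<rho>: "\<rho> > 0" "\<And>z. z \<in> C \<Longrightarrow> \<exists>B\<in>G. ball z \<rho> \<subseteq> B"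
    using Heine_Borel_lemma[OF C(1), of G] unfolding G_def by blast
  show ?thesis
  proof (rule that[OF \<rho>(1)])
    fix z w :: 'z assume z: "z \<in> C" and w: "norm w < \<rho>"
    obtain B where B: "B \<in> G" "ball z \<rho> \<subseteq> B" using \<rho>(2)[OF z] by blast
    have in_ball: "z + t *\<^sub>R w \<in> ball z \<rho>" if "t \<in> {0..1}" for t
    proof -
      have "\<bar>t\<bar> * norm w \<le> 1 * norm w" using that by (intro mult_right_mono) auto
      then show ?thesis using w by (simp add: dist_norm)
    qed
    have BO: "B \<subseteq> \<Omega>" using B by (simp add: G_def)
    have zB: "z \<in> ball z \<rho>" using \<rho> by simp
    have "norm (f (z + w) - f z - fder f z ((z + w) - z)) \<le> norm ((z + w) - z) * \<epsilon>"
    proof (rule differentiable_bound_linearization[where S = "ball z \<rho>"])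
      show "z + t *\<^sub>R (z + w - z) \<in> ball z \<rho>" if "t \<in> {0..1}" for t using in_ball[OF that] by simp
      show "(f has_derivative fder f x) (at x within ball z \<rho>)" if "x \<in> ball z \<rho>" for x
        using df B BO that has_derivative_at_withinI by blast
      show "onorm (fder f x - fder f z) \<le> \<epsilon>" if x: "x \<in> ball z \<rho>" for x
        unfolding fun_diff_def
      proof (rule onorm_le)
        fix v
        have zO: "z \<in> \<Omega>" and xO: "x \<in> \<Omega>" using x zB B BO by blast+
        have "linear (\<lambda>v. fder f x v - fder f z v)"
          by (rule linear_compose_sub[OF has_derivative_linear[OF df[OF xO]] has_derivative_linear[OF df[OF zO]]])
        then have "fder f x v - fder f z v = (\<Sum>b\<in>Basis. (v \<bullet> b) *\<^sub>R (fder f x b - fder f z b))"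
          by (rule linear_Basis_expand)
        also have "norm \<dots> \<le> (\<Sum>b\<in>(Basis::'z set). norm v * e)"
        proof (rule sum_norm_le)
          fix b :: 'z assume b: "b \<in> Basis"
          have "x \<in> B" "z \<in> B" using B(2) x zB by blast+
          then have "norm (fder f x b - fder f z b) \<le> e" using B(1) b unfolding G_def by blast
          moreover have "\<bar>v \<bullet> b\<bar> \<le> norm v" by (rule Basis_le_norm[OF b])
          ultimately show "norm ((v \<bullet> b) *\<^sub>R (fder f x b - fder f z b)) \<le> norm v * e"
            by (simp add: mult_mono)
        qed
        also have "\<dots> = \<epsilon> * norm v" by (simp add: e_def)
        finally show "norm (fder f x v - fder f z v) \<le> \<epsilon> * norm v" .
      qed
    qed (rule zB)
    then have "norm (f (z + w) - f z - fder f z w) \<le> \<epsilon> * norm w" by (simp add: mult.commute)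
    moreover have "z + w \<in> \<Omega>" using in_ball[of 1] B BO by auto
    ultimately show "z + w \<in> \<Omega> \<and> norm (f (z + w) - f z - fder f z w) \<le> \<epsilon> * norm w" by blast
  qed
qed

text \<open>Uniform continuity on a compact box around \<open>x1\<close>; the bound
  \<open>s < a\<close> on time is what makes the box compact.\<close>

lemma continuous_uniform_in_parameter:
  fixes p :: "'p::euclidean_space \<times> real \<Rightarrow> 'w::metric_space"
  assumes p: "continuous_on (U \<times> {-a<..<a}) p" and U: "open U" "x1 \<in> U" and s: "s < a" and \<epsilon>: "\<epsilon> > 0"
  obtains \<delta> where "\<delta> > 0" "ball x1 \<delta> \<subseteq> U" "\<And>x t. x \<in> ball x1 \<delta> \<Longrightarrow> \<bar>t\<bar> \<le> s \<Longrightarrow> dist (p (x, t)) (p (x1, t)) < \<epsilon>"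
proof -
  obtain r where r: "r > 0" "cball x1 r \<subseteq> U" using U open_contains_cball by blast
  have comp: "compact (cball x1 r \<times> {-s..s})" by (intro compact_Times) auto
  have sub: "cball x1 r \<times> {-s..s} \<subseteq> U \<times> {-a<..<a}" using r s by auto
  have "uniformly_continuous_on (cball x1 r \<times> {-s..s}) p"
    by (rule compact_uniformly_continuous[OF continuous_on_subset[OF p sub] comp])
  then obtain d where d: "d > 0" "\<And>q q'. q \<in> cball x1 r \<times> {-s..s} \<Longrightarrow> q' \<in> cball x1 r \<times> {-s..s} \<Longrightarrow>
     dist q' q < d \<Longrightarrow> dist (p q') (p q) < \<epsilon>"
    unfolding uniformly_continuous_on_def using \<epsilon> by meson
  show ?thesis
  proof (rule that[of "min d r"])
    show "min d r > 0" "ball x1 (min d r) \<subseteq> U" using d r by auto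
    fix x t assume x: "x \<in> ball x1 (min d r)" and t: "\<bar>t\<bar> \<le> s"
    show "dist (p (x, t)) (p (x1, t)) < \<epsilon>"
      by (rule d(2)) (use x t r in \<open>auto simp: dist_Pair_Pair dist_commute\<close>)
  qed
qed

text \<open>Continuity keeps both solutions for a while in a ball on which \<open>f\<close> is
  Lipschitz, and there Gronwall's estimate applies to their difference.\<close>

lemma ode_local_unique:
  fixes f :: "'z::euclidean_space \<Rightarrow> 'z"
  assumes \<Omega>: "open \<Omega>" and f: "C_k_on 1 \<Omega> f" and y0: "y1 t0 = y2 t0" "y1 t0 \<in> \<Omega>"
    and y1: "\<forall>\<^sub>F t in nhds t0. (y1 has_vector_derivative f (y1 t)) (at t)"
    and y2: "\<forall>\<^sub>F t in nhds t0. (y2 has_vector_derivative f (y2 t)) (at t)"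
  shows "\<forall>\<^sub>F t in nhds t0. y1 t = y2 t"
proof -
  obtain r where r: "r > 0" "cball (y1 t0) r \<subseteq> \<Omega>" using \<Omega> y0 open_contains_cball by blast
  obtain L where L: "L \<ge> 0"
    "\<And>y z. y \<in> cball (y1 t0) r \<Longrightarrow> z \<in> cball (y1 t0) r \<Longrightarrow> norm (f y - f z) \<le> L * norm (y - z)"
    by (rule C1_lipschitz_on_cball[OF r(2) f]) (rule that)
  have near: "\<forall>\<^sub>F t in nhds t0. y t \<in> cball (y1 t0) r"
    if "\<forall>\<^sub>F t in nhds t0. (y has_vector_derivative f (y t)) (at t)" "y t0 = y1 t0" for y
  proof -
    have "isCont y t0"
      using eventually_nhds_x_imp_x[OF that(1)] by (rule has_vector_derivative_continuous)
    then have "(y \<longlongrightarrow> y t0) (nhds t0)" unfolding isCont_def using tendsto_at_iff_tendsto_nhds by blast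
    then have "\<forall>\<^sub>F t in nhds t0. dist (y t) (y t0) < r" using r by (intro tendstoD)
    then show ?thesis by eventually_elim (simp add: that(2) dist_commute)
  qed
  have "\<forall>\<^sub>F t in nhds t0. ((y1 has_vector_derivative f (y1 t)) (at t) \<and> (y2 has_vector_derivative f (y2 t)) (at t))
    \<and> (y1 t \<in> cball (y1 t0) r \<and> y2 t \<in> cball (y1 t0) r)"
    by (intro eventually_conj y1 y2 near) (simp_all add: y0)
  then obtain d where d: "d > 0" "\<And>t. dist t t0 < d \<Longrightarrow> ((y1 has_vector_derivative f (y1 t)) (at t) \<and> (y2 has_vector_derivative f (y2 t)) (at t))
    \<and> (y1 t \<in> cball (y1 t0) r \<and> y2 t \<in> cball (y1 t0) r)"
    unfolding eventually_nhds_metric by blast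
  define u where "u s = y1 (s + t0) - y2 (s + t0)" for s
  have du: "(u has_vector_derivative f (y1 (s + t0)) - f (y2 (s + t0))) (at s)" if "\<bar>s\<bar> < d" for s
  proof -
    have sh: "((\<lambda>s. s + t0) has_vector_derivative 1) (at s)" by (auto intro!: derivative_eq_intros)
    have "dist (s + t0) t0 < d" using that by (simp add: dist_real_def)
    from d(2)[OF this] have "(y1 has_vector_derivative f (y1 (s + t0))) (at (s + t0))" "(y2 has_vector_derivative f (y2 (s + t0))) (at (s + t0))"
      by blast+
    from has_vector_derivative_diff[OF vector_diff_chain_at[OF sh this(1)] vector_diff_chain_at[OF sh this(2)]]
    show ?thesis unfolding u_def by (simp add: o_def)
  qed
  have "y1 t = y2 t" if t: "dist t t0 < d" for t
  proof -
    have "norm (u (t - t0)) \<le> norm (u 0) * exp ((2 * L + 1) * \<bar>t - t0\<bar>)"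
    proof (rule gronwall_two_sided_linear[OF du _ L(1)])
      fix s assume "\<bar>s\<bar> \<le> \<bar>t - t0\<bar>"
      then have "dist (s + t0) t0 < d" using t by (simp add: dist_real_def)
      from d(2)[OF this] show "norm (f (y1 (s + t0)) - f (y2 (s + t0))) \<le> L * norm (u s)"
        unfolding u_def by (intro L(2)) auto
    qed (use t in \<open>auto simp: dist_real_def\<close>)
    then show ?thesis by (simp add: u_def y0)
  qed
  then show ?thesis unfolding eventually_nhds_metric using d(1) by blast
qed

text \<open>\<open>Z h\<close> solves the variational equation. By Gronwall the difference
  \<open>u\<close> of two solutions is of order \<open>norm h\<close>, so linearizing
  \<open>f\<close> costs an arbitrarily small multiple of \<open>norm h\<close>; a second use of
  Gronwall bounds \<open>u - Z h\<close> by such a multiple.\<close>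

lemma ode_has_derivative_parameter:
  fixes f :: "'z::euclidean_space \<Rightarrow> 'z" and y :: "'p::euclidean_space \<times> real \<Rightarrow> 'z"
  assumes \<Omega>: "open \<Omega>" and f: "C_k_on 1 \<Omega> f" and U: "open U" "x1 \<in> U"
    and cy: "continuous_on (U \<times> {-a<..<a}) y"
    and y: "\<And>x t. x \<in> U \<Longrightarrow> \<bar>t\<bar> < a \<Longrightarrow> y (x, t) \<in> \<Omega> \<and> ((\<lambda>t. y (x, t)) has_vector_derivative f (y (x, t))) (at t)"
    and B: "bounded_linear B" "\<And>x. x \<in> U \<Longrightarrow> y (x, 0) = y (x1, 0) + B (x - x1)"
    and Z: "\<And>h t. \<bar>t\<bar> < a \<Longrightarrow> ((\<lambda>t. Z h t) has_vector_derivative fder f (y (x1, t)) (Z h t)) (at t)"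
      "\<And>h. Z h 0 = B h" "linear (\<lambda>h. Z h t1)" and t1: "\<bar>t1\<bar> < a"
  shows "((\<lambda>x. y (x, t1)) has_derivative (\<lambda>h. Z h t1)) (at x1)"
proof -
  define s where "s = \<bar>t1\<bar>"
  have s: "0 \<le> s" "s < a" using t1 by (auto simp: s_def)
  have df: "(f has_derivative fder f z) (at z)" if "z \<in> \<Omega>" for z
    by (rule has_fder) (use f that in simp)
  define C where "C = (\<lambda>t. y (x1, t)) ` {-s..s}"
  have "continuous_on {-s..s} (\<lambda>t. y (x1, t))"
    by (intro continuous_at_imp_continuous_on ballI has_vector_derivative_continuous[OF conjunct2[OF y]])
      (use U s in auto)
  then have C: "compact C" "C \<subseteq> \<Omega>"
    unfolding C_def using y U s by (auto intro!: compact_continuous_image)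
  have in_C: "y (x1, t) \<in> C" if "\<bar>t\<bar> \<le> s" for t
    unfolding C_def by (rule imageI) (use that in auto)
  obtain L where L: "L \<ge> 0" "\<And>z v. z \<in> C \<Longrightarrow> norm (fder f z v) \<le> L * norm v"
  proof (rule linear_family_bounded[of C "fder f"])
    show "linear (fder f z)" if "z \<in> C" for z by (rule has_derivative_linear[OF df[OF subsetD[OF C(2) that]]])
    show "continuous_on C (\<lambda>z. fder f z v)" for v
      by (rule continuous_on_subset[OF _ C(2)]) (use f in simp)
  qed (use C in simp_all)
  obtain K where K: "K > 0" "\<And>h. norm (B h) \<le> norm h * K" using bounded_linear.pos_bounded[OF B(1)] by blast
  \<comment> \<open>One exponential that dominates both Gronwall factors, for the constants
    \<open>L + 1\<close> and \<open>L\<close>.\<close>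
  define E where "E = exp ((2 * (L + 1) + 1) * s)"
  have E: "E \<ge> 1" using L s by (simp add: E_def)
  have main: "\<exists>d>0. \<forall>h. norm h < d \<longrightarrow> x1 + h \<in> U \<and> norm (y (x1 + h, t1) - y (x1, t1) - Z h t1) \<le> e * norm h" if e: "e > 0" for e
  proof -
    \<comment> \<open>The bound 1 produces the Lipschitz constant \<open>L + 1\<close> for
      \<open>u\<close>; the divisor collects the bound of \<open>B\<close> and the two growth
      factors.\<close>
    define \<epsilon> where "\<epsilon> = min 1 (e / (K * E * E))"
    have \<epsilon>: "0 < \<epsilon>" "\<epsilon> \<le> 1" "\<epsilon> * (K * E * E) \<le> e"
      using e K E by (auto simp: \<epsilon>_def min_def field_simps)
    obtain \<rho> where \<rho>: "\<rho> > 0" "\<And>z w. z \<in> C \<Longrightarrow> norm w < \<rho> \<Longrightarrow> z + w \<in> \<Omega> \<and> norm (f (z + w) - f z - fder f z w) \<le> \<epsilon> * norm w"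
      by (rule C1_uniform_linearization[OF \<Omega> f C \<epsilon>(1)]) (rule that)
    obtain d where d: "d > 0" "ball x1 d \<subseteq> U" "\<And>x t. x \<in> ball x1 d \<Longrightarrow> \<bar>t\<bar> \<le> s \<Longrightarrow> dist (y (x, t)) (y (x1, t)) < \<rho>"
      by (rule continuous_uniform_in_parameter[OF cy U s(2) \<rho>(1)]) (rule that)
    have "x1 + h \<in> U \<and> norm (y (x1 + h, t1) - y (x1, t1) - Z h t1) \<le> e * norm h" if h: "norm h < d" for h
    proof -
      have xb: "x1 + h \<in> ball x1 d" using h by (simp add: dist_norm)
      then have xU: "x1 + h \<in> U" using d by blast
      define u where "u t = y (x1 + h, t) - y (x1, t)" for t
      have u: "norm (u t) < \<rho>" if "\<bar>t\<bar> \<le> s" for t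
        using d(3)[OF xb that] by (simp add: u_def dist_norm)
      have lin: "norm (f (y (x1 + h, t)) - f (y (x1, t)) - fder f (y (x1, t)) (u t)) \<le> \<epsilon> * norm (u t)" if "\<bar>t\<bar> \<le> s" for t
        using \<rho>(2)[OF in_C[OF that] u[OF that]] by (simp add: u_def)
      have u0: "u 0 = B h" using B(2)[OF xU] by (simp add: u_def)
      have du: "(u has_vector_derivative f (y (x1 + h, t)) - f (y (x1, t))) (at t)" if "\<bar>t\<bar> < a" for t
        unfolding u_def
        by (intro has_vector_derivative_diff conjunct2[OF y[OF xU that]] conjunct2[OF y[OF U(2) that]])
      have bu: "norm (u t) \<le> norm h * K * E" if t: "\<bar>t\<bar> \<le> s" for t
      proof -
        have "norm (u t) \<le> norm (u 0) * exp ((2 * (L + 1) + 1) * \<bar>t\<bar>)"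
        proof (rule gronwall_two_sided_linear[OF du])
          fix r assume "\<bar>r\<bar> \<le> \<bar>t\<bar>"
          then have r: "\<bar>r\<bar> \<le> s" using t by simp
          have "norm (f (y (x1 + h, r)) - f (y (x1, r))) \<le> norm (f (y (x1 + h, r)) - f (y (x1, r)) - fder f (y (x1, r)) (u r)) + norm (fder f (y (x1, r)) (u r))"
            using norm_triangle_ineq[of "f (y (x1 + h, r)) - f (y (x1, r)) - fder f (y (x1, r)) (u r)" "fder f (y (x1, r)) (u r)"] by simp
          also have "\<dots> \<le> \<epsilon> * norm (u r) + L * norm (u r)"
            by (intro add_mono lin[OF r] L(2)[OF in_C[OF r]])
          also have "\<dots> \<le> 1 * norm (u r) + L * norm (u r)"
            using \<epsilon> by (intro add_right_mono mult_right_mono) auto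
          finally show "norm (f (y (x1 + h, r)) - f (y (x1, r))) \<le> (L + 1) * norm (u r)"
            by (simp add: algebra_simps)
        qed (use L t s in auto)
        also have "\<dots> \<le> (norm h * K) * E"
        proof (intro mult_mono)
          show "norm (u 0) \<le> norm h * K" unfolding u0 by (rule K(2))
          have "(2 * (L + 1) + 1) * \<bar>t\<bar> \<le> (2 * (L + 1) + 1) * s" using t L by (intro mult_left_mono) auto
          then show "exp ((2 * (L + 1) + 1) * \<bar>t\<bar>) \<le> E" by (simp add: E_def)
        qed (use K(1) in auto)
        finally show ?thesis .
      qed
      define r where "r t = u t - Z h t" for t
      have "norm (r t1) \<le> (\<epsilon> * (norm h * K * E)) * exp ((2 * L + 1) * \<bar>t1\<bar>)"
      proof (rule gronwall_two_sided_small)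
        show "(r has_vector_derivative (f (y (x1 + h, t)) - f (y (x1, t)) - fder f (y (x1, t)) (Z h t))) (at t)" if "\<bar>t\<bar> < a" for t
          unfolding r_def by (rule has_vector_derivative_diff[OF du[OF that] Z(1)[OF that]])
        show "norm (f (y (x1 + h, t)) - f (y (x1, t)) - fder f (y (x1, t)) (Z h t)) \<le> L * norm (r t) + \<epsilon> * (norm h * K * E)" if "\<bar>t\<bar> \<le> \<bar>t1\<bar>" for t
        proof -
          have t: "\<bar>t\<bar> \<le> s" using that by (simp add: s_def)
          have li: "linear (fder f (y (x1, t)))"
            by (rule has_derivative_linear[OF df[OF subsetD[OF C(2) in_C[OF t]]]])
          have "f (y (x1 + h, t)) - f (y (x1, t)) - fder f (y (x1, t)) (Z h t) =
            fder f (y (x1, t)) (r t) + (f (y (x1 + h, t)) - f (y (x1, t)) - fder f (y (x1, t)) (u t))"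
            by (simp add: r_def linear_diff[OF li])
          also have "norm \<dots> \<le> L * norm (r t) + \<epsilon> * norm (u t)"
            by (intro order_trans[OF norm_triangle_ineq] add_mono L(2)[OF in_C[OF t]] lin[OF t])
          also have "\<dots> \<le> L * norm (r t) + \<epsilon> * (norm h * K * E)"
            using \<epsilon> by (intro add_left_mono mult_left_mono bu[OF t]) auto
          finally show ?thesis .
        qed
        show "r 0 = 0" by (simp add: r_def u0 Z(2))
        show "0 \<le> \<epsilon> * (norm h * K * E)" using \<epsilon> K E by simp
      qed (use L t1 in auto)
      also have "\<dots> \<le> (\<epsilon> * (norm h * K * E)) * E"
      proof (rule mult_left_mono)
        have "(2 * L + 1) * \<bar>t1\<bar> \<le> (2 * (L + 1) + 1) * s"
          unfolding s_def by (rule mult_right_mono) auto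
        then show "exp ((2 * L + 1) * \<bar>t1\<bar>) \<le> E" by (simp add: E_def)
      qed (use \<epsilon> K E in simp)
      also have "\<dots> = (\<epsilon> * (K * E * E)) * norm h" by simp
      also have "\<dots> \<le> e * norm h" by (intro mult_right_mono \<epsilon>) simp
      finally show ?thesis using xU by (simp add: r_def u_def)
    qed
    then show ?thesis using d(1) by blast
  qed
  show ?thesis
    unfolding has_derivative_at_alt
  proof (intro conjI allI impI)
    show "bounded_linear (\<lambda>h. Z h t1)" using Z(3) by (simp add: linear_conv_bounded_linear)
    fix e :: real assume "e > 0"
    then obtain d where d: "d > 0" "\<And>h. norm h < d \<Longrightarrow> norm (y (x1 + h, t1) - y (x1, t1) - Z h t1) \<le> e * norm h"
      using main by blast
    show "\<exists>d>0. \<forall>x. norm (x - x1) < d \<longrightarrow> norm (y (x, t1) - y (x1, t1) - Z (x - x1) t1) \<le> e * norm (x - x1)"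
    proof (intro exI[of _ d] conjI allI impI d(1))
      fix x assume "norm (x - x1) < d"
      from d(2)[OF this] show "norm (y (x, t1) - y (x1, t1) - Z (x - x1) t1) \<le> e * norm (x - x1)" by simp
    qed
  qed
qed

section \<open>Joint regularity of solutions in parameter and time\<close>

lemma has_derivative_parameter_time:
  fixes W :: "'p::euclidean_space \<times> real \<Rightarrow> 'w::real_normed_vector"
  assumes U: "open U" "x \<in> U" and t: "\<bar>t\<bar> < a"
    and Wx: "((\<lambda>x. W (x, t)) has_derivative V) (at x)"
    and Wt: "\<And>x t. x \<in> U \<Longrightarrow> \<bar>t\<bar> < a \<Longrightarrow> ((\<lambda>t. W (x, t)) has_vector_derivative W' (x, t)) (at t)"
    and W': "continuous_on (U \<times> {-a<..<a}) W'"
  shows "(W has_derivative (\<lambda>(h, \<tau>). V h + \<tau> *\<^sub>R W' (x, t))) (at (x, t))"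
proof -
  let ?D = "U \<times> {-a<..<a}"
  have op: "open ?D" using U by (intro open_Times) auto
  have inD: "(x, t) \<in> ?D" using U t by auto
  have "((\<lambda>(x, t). W (x, t)) has_derivative (\<lambda>(h, \<tau>). V h + blinfun_apply (blinfun_scaleR_left (W' (x, t))) \<tau>))
      (at (x, t) within ?D)"
  proof (rule has_derivative_partialsI)
    show "((\<lambda>x. W (x, t)) has_derivative V) (at x within U)" by (rule has_derivative_at_withinI[OF Wx])
    show "((\<lambda>t. W (x, t)) has_derivative blinfun_apply (blinfun_scaleR_left (W' (x, t)))) (at t within {-a<..<a})"
      if "x \<in> U" "t \<in> {-a<..<a}" for x t
    proof -
      have "((\<lambda>t. W (x, t)) has_vector_derivative W' (x, t)) (at t within {-a<..<a})"
        by (rule has_vector_derivative_at_within[OF Wt]) (use that in auto)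
      then show ?thesis by (simp add: has_vector_derivative_def)
    qed
    have "continuous_on ?D (\<lambda>q. blinfun_scaleR_left (W' q))"
      by (rule bounded_linear.continuous_on[OF bounded_linear_blinfun_scaleR_left W'])
    then show "continuous (at (x, t) within ?D) (\<lambda>(x, t). blinfun_scaleR_left (W' (x, t)))"
      using inD by (simp add: continuous_on_eq_continuous_within case_prod_beta')
  qed (use t in auto)
  then show ?thesis
    by (simp add: at_within_open[OF inD op] case_prod_beta')
qed

text \<open>The solution at \<open>x1\<close> solves the equation at \<open>x\<close> up to the
  error \<open>p (x, r) - p (x1, r)\<close>, which is uniformly small; both start at
  \<open>w0\<close>, so Gronwall compares them.\<close>

lemma linear_ode_continuous:
  fixes A :: "'p::euclidean_space \<times> real \<Rightarrow> 'w::euclidean_space \<Rightarrow> 'w"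
  assumes U: "open U"
    and A: "\<And>q. q \<in> U \<times> {-a<..<a} \<Longrightarrow> linear (A q)" "\<And>q w. q \<in> U \<times> {-a<..<a} \<Longrightarrow> norm (A q w) \<le> L * norm w"
    and cA: "\<And>w. continuous_on (U \<times> {-a<..<a}) (\<lambda>q. A q w)" and cb: "continuous_on (U \<times> {-a<..<a}) b"
    and W: "\<And>x t. x \<in> U \<Longrightarrow> \<bar>t\<bar> < a \<Longrightarrow> ((\<lambda>t. W (x, t)) has_vector_derivative A (x, t) (W (x, t)) + b (x, t)) (at t)"
    and W0: "\<And>x. x \<in> U \<Longrightarrow> W (x, 0) = w0" and L: "L \<ge> 0"
  shows "continuous_on (U \<times> {-a<..<a}) W"
proof -
  let ?D = "U \<times> {-a<..<a}"
  have op: "open ?D" using U by (intro open_Times) auto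
  have "isCont W (x1, t1)" if q: "x1 \<in> U" "\<bar>t1\<bar> < a" for x1 t1
    unfolding continuous_at_eps_delta
  proof (intro allI impI)
    fix e :: real assume e: "e > 0"
    define s where "s = (\<bar>t1\<bar> + a) / 2"
    have s: "\<bar>t1\<bar> < s" "s < a" using q by (auto simp: s_def)
    define p where "p q = A q (W (x1, snd q)) + b q" for q
    have cW1: "continuous_on {-a<..<a} (\<lambda>t. W (x1, t))"
      by (intro continuous_at_imp_continuous_on ballI has_vector_derivative_continuous[OF W[OF q(1)]]) auto
    have cW1': "continuous_on ?D (\<lambda>q. W (x1, snd q))"
      by (rule continuous_on_compose2[OF cW1 continuous_on_snd[OF continuous_on_id]]) auto
    have "continuous_on ?D (\<lambda>q. A q (W (x1, snd q)))"
      using C_k_on_linear_family[of ?D A 0 "\<lambda>q. W (x1, snd q)", OF op A(1)] cA cW1' by simp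
    then have cp: "continuous_on ?D p" unfolding p_def by (intro continuous_on_add cb)
    define E where "E = exp ((2 * L + 1) * s)"
    have E: "E > 0" by (simp add: E_def)
    \<comment> \<open>Then \<open>\<epsilon> * E\<close> is a quarter of \<open>e\<close>, safely
      below the half left over by the variation in time.\<close>
    define \<epsilon> where "\<epsilon> = e / (4 * E)"
    have \<epsilon>: "\<epsilon> > 0" using e E by (simp add: \<epsilon>_def)
    obtain d where d: "d > 0" "ball x1 d \<subseteq> U" "\<And>x t. x \<in> ball x1 d \<Longrightarrow> \<bar>t\<bar> \<le> s \<Longrightarrow> dist (p (x, t)) (p (x1, t)) < \<epsilon>"
      by (rule continuous_uniform_in_parameter[OF cp U q(1) s(2) \<epsilon>]) (rule that)
    have "isCont (\<lambda>t. W (x1, t)) t1"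
      by (rule has_vector_derivative_continuous[OF W[OF q]])
    then obtain d' where d': "d' > 0" "\<And>t. dist t t1 < d' \<Longrightarrow> dist (W (x1, t)) (W (x1, t1)) < e / 2"
      unfolding continuous_at_eps_delta using e by (meson half_gt_zero)
    show "\<exists>d>0. \<forall>q'. dist q' (x1, t1) < d \<longrightarrow> dist (W q') (W (x1, t1)) < e"
    proof (intro exI[of _ "min d (min d' (s - \<bar>t1\<bar>))"] conjI allI impI)
      show "min d (min d' (s - \<bar>t1\<bar>)) > 0" using d d' s by simp
      fix q' assume q': "dist q' (x1, t1) < min d (min d' (s - \<bar>t1\<bar>))"
      obtain x t where xt: "q' = (x, t)" by (cases q')
      have "dist x x1 \<le> dist q' (x1, t1)" "dist t t1 \<le> dist q' (x1, t1)"
        unfolding xt using dist_fst_le[of "(x, t)" "(x1, t1)"] dist_snd_le[of "(x, t)" "(x1, t1)"] by simp_all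
      then have x: "x \<in> ball x1 d" and t: "dist t t1 < d'" "\<bar>t\<bar> < s"
        using q' by (auto simp: dist_commute dist_real_def)
      have xU: "x \<in> U" using x d by blast
      define u where "u t = W (x, t) - W (x1, t)" for t
      have "norm (u t) \<le> \<epsilon> * exp ((2 * L + 1) * \<bar>t\<bar>)"
      proof (rule gronwall_two_sided_small[OF _ _ L])
        show "(u has_vector_derivative (A (x, r) (W (x, r)) + b (x, r)) - (A (x1, r) (W (x1, r)) + b (x1, r))) (at r)" if "\<bar>r\<bar> < a" for r
          unfolding u_def by (intro has_vector_derivative_diff W xU q that)
        show "norm ((A (x, r) (W (x, r)) + b (x, r)) - (A (x1, r) (W (x1, r)) + b (x1, r))) \<le> L * norm (u r) + \<epsilon>" if "\<bar>r\<bar> \<le> \<bar>t\<bar>" for r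
        proof -
          have r: "\<bar>r\<bar> \<le> s" "\<bar>r\<bar> < a" using that t s by auto
          then have xr: "(x, r) \<in> ?D" using xU by auto
          have "(A (x, r) (W (x, r)) + b (x, r)) - (A (x1, r) (W (x1, r)) + b (x1, r))
             = A (x, r) (u r) + (p (x, r) - p (x1, r))"
            by (simp add: u_def p_def linear_diff[OF A(1)[OF xr]])
          also have "norm \<dots> \<le> L * norm (u r) + \<epsilon>"
            using d(3)[OF x r(1)]
            by (intro order_trans[OF norm_triangle_ineq] add_mono A(2)[OF xr]) (simp add: dist_norm)
          finally show ?thesis .
        qed
        show "u 0 = 0" using W0[OF xU] W0[OF q(1)] by (simp add: u_def)
      qed (use \<epsilon> t s in auto)
      also have "\<dots> \<le> \<epsilon> * E"
        unfolding E_def using \<epsilon> t L by (intro mult_left_mono) (auto intro!: mult_left_mono)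
      also have "\<dots> < e / 2" using e E by (simp add: \<epsilon>_def)
      finally have "dist (W (x, t)) (W (x1, t)) < e / 2" by (simp add: u_def dist_norm)
      moreover have "dist (W (x1, t)) (W (x1, t1)) < e / 2" by (rule d'(2)[OF t(1)])
      ultimately show "dist (W q') (W (x1, t1)) < e"
        unfolding xt using dist_triangle[of "W (x, t)" "W (x1, t1)" "W (x1, t)"] by linarith
    qed
  qed
  then show ?thesis
    by (intro continuous_at_imp_continuous_on) auto
qed

text \<open>The coefficients live on an open interval, the contraction argument works on a closed
  one; hence the step from \<open>a\<close> down to \<open>s\<close>.\<close>

lemma linear_ode_exists:
  fixes A :: "real \<Rightarrow> 'w::euclidean_space \<Rightarrow> 'w"
  assumes A: "\<And>t. \<bar>t\<bar> < a \<Longrightarrow> linear (A t)" "\<And>t w. \<bar>t\<bar> < a \<Longrightarrow> norm (A t w) \<le> L * norm w"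
    and cA: "\<And>w. continuous_on {-a<..<a} (\<lambda>t. A t w)" and cb: "continuous_on {-a<..<a} b"
    and L: "L \<ge> 0" "3 * a * L < 1" and s: "0 < s" "s < a"
  shows "\<exists>y. y 0 = y0 \<and> (\<forall>t. \<bar>t\<bar> < s \<longrightarrow> (y has_vector_derivative A t (y t) + b t) (at t))"
proof (rule picard_exists_at[where F = "\<lambda>t y. A t y + b t"])
  let ?D = "{-a<..<a} \<times> (UNIV :: 'w set)"
  have op: "open ?D" by (intro open_Times) auto
  have "continuous_on ?D (\<lambda>q. A (fst q) (snd q))"
  proof -
    have 1: "C_k_on 0 ?D (\<lambda>q. A (fst q) w)" for w
      unfolding C_k_on.simps
      by (rule continuous_on_compose2[OF cA continuous_on_fst[OF continuous_on_id]]) auto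
    have 2: "C_k_on 0 ?D snd" by (simp add: continuous_on_snd continuous_on_id)
    have 3: "linear (A (fst q))" if "q \<in> ?D" for q using A(1) that by auto
    show ?thesis
      using C_k_on_linear_family[of ?D "\<lambda>q. A (fst q)" 0 snd, OF op 3 1 2] by simp
  qed
  moreover have "continuous_on ?D (\<lambda>q. b (fst q))"
    by (rule continuous_on_compose2[OF cb continuous_on_fst[OF continuous_on_id]]) auto
  ultimately have "continuous_on ?D (\<lambda>q. A (fst q) (snd q) + b (fst q))" by (rule continuous_on_add)
  then show "continuous_on ({-s..s} \<times> UNIV) (\<lambda>(t, y). A t y + b t)"
    unfolding case_prod_beta by (rule continuous_on_subset) (use s in auto)
  show "norm (A t y + b t - (A t y' + b t)) \<le> L * norm (y - y')" if "t \<in> {-s..s}" for t y y'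
  proof -
    have "\<bar>t\<bar> < a" using that s by auto
    then show ?thesis using A(2)[of t "y - y'"] linear_diff[OF A(1)[of t], of y y'] by simp
  qed
  have "3 * s * L \<le> 3 * a * L" using s L by (intro mult_right_mono) auto
  then show "3 * s * L < 1" using L by simp
qed (use s L in auto)

text \<open>By uniqueness: the deviation from additivity or homogeneity solves the homogeneous
  equation with initial value 0.\<close>

lemma linear_ode_solution_linear:
  fixes A :: "real \<Rightarrow> 'w::euclidean_space \<Rightarrow> 'w" and Z :: "'p::real_vector \<Rightarrow> real \<Rightarrow> 'w"
  assumes A: "\<And>t. \<bar>t\<bar> < s \<Longrightarrow> linear (A t)" "\<And>t w. \<bar>t\<bar> < s \<Longrightarrow> norm (A t w) \<le> L * norm w"
    and b: "\<And>t. \<bar>t\<bar> < s \<Longrightarrow> linear (\<lambda>h. b h t)" and B: "linear B" and L: "L \<ge> 0"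
    and Z: "\<And>h t. \<bar>t\<bar> < s \<Longrightarrow> (Z h has_vector_derivative A t (Z h t) + b h t) (at t)" "\<And>h. Z h 0 = B h"
    and t: "\<bar>t\<bar> < s"
  shows "linear (\<lambda>h. Z h t)"
proof -
  have zero: "u t = 0" if u: "\<And>t. \<bar>t\<bar> < s \<Longrightarrow> (u has_vector_derivative A t (u t)) (at t)" "u 0 = 0" for u
  proof -
    have "norm (u t) \<le> norm (u 0) * exp ((2 * L + 1) * \<bar>t\<bar>)"
      by (rule gronwall_two_sided_linear[OF u(1) A(2) L t]) (use t in auto)
    then show ?thesis using u(2) by simp
  qed
  show ?thesis
  proof
    fix h k
    have "(\<lambda>t. Z (h + k) t - (Z h t + Z k t)) t = 0"
    proof (rule zero)
      fix t assume t: "\<bar>t\<bar> < s"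
      have "((\<lambda>t. Z (h + k) t - (Z h t + Z k t)) has_vector_derivative
        (A t (Z (h + k) t) + b (h + k) t) - ((A t (Z h t) + b h t) + (A t (Z k t) + b k t))) (at t)"
        by (intro has_vector_derivative_diff has_vector_derivative_add Z t)
      then show "((\<lambda>t. Z (h + k) t - (Z h t + Z k t)) has_vector_derivative A t (Z (h + k) t - (Z h t + Z k t))) (at t)"
        by (simp add: linear_diff[OF A(1)[OF t]] linear_add[OF A(1)[OF t]] linear_add[OF b[OF t]] algebra_simps)
    qed (simp add: Z(2) linear_add[OF B])
    then show "Z (h + k) t = Z h t + Z k t" by simp
  next
    fix r h
    have "(\<lambda>t. Z (r *\<^sub>R h) t - r *\<^sub>R Z h t) t = 0"
    proof (rule zero)
      fix t assume t: "\<bar>t\<bar> < s"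
      have "((\<lambda>t. Z (r *\<^sub>R h) t - r *\<^sub>R Z h t) has_vector_derivative
        (A t (Z (r *\<^sub>R h) t) + b (r *\<^sub>R h) t) - r *\<^sub>R (A t (Z h t) + b h t)) (at t)"
        by (intro has_vector_derivative_diff bounded_linear.has_vector_derivative[OF bounded_linear_scaleR_right] Z t)
      then show "((\<lambda>t. Z (r *\<^sub>R h) t - r *\<^sub>R Z h t) has_vector_derivative A t (Z (r *\<^sub>R h) t - r *\<^sub>R Z h t)) (at t)"
        by (simp add: linear_diff[OF A(1)[OF t]] linear_scale[OF A(1)[OF t]] linear_scale[OF b[OF t]] algebra_simps)
    qed (simp add: Z(2) linear_scale[OF B])
    then show "Z (r *\<^sub>R h) t = r *\<^sub>R Z h t" by simp
  qed
qed

lemma C_k_on_le: "C_k_on n S f \<Longrightarrow> k \<le> n \<Longrightarrow> C_k_on k S f"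
  by (induction n) (use C_k_on_SucD le_Suc_eq in \<open>auto simp del: C_k_on.simps(2)\<close>)

lemma C_k_on_fder: "C_k_on (Suc k) S f \<Longrightarrow> C_k_on k S (\<lambda>x. fder f x v)"
  by simp

lemma linear_fder_family:
  fixes L :: "'a::real_normed_vector \<Rightarrow> 'c::real_vector \<Rightarrow> 'b::real_normed_vector"
  assumes S: "open S" "x \<in> S" and lin: "\<And>y. y \<in> S \<Longrightarrow> linear (L y)"
    and L': "\<And>u. (\<lambda>y. L y u) differentiable (at x)"
  shows "linear (\<lambda>u. fder (\<lambda>y. L y u) x v)"
proof
  show "fder (\<lambda>y. L y (u + u')) x v = fder (\<lambda>y. L y u) x v + fder (\<lambda>y. L y u') x v" for u u'
    by (subst fder_cong_open[OF S, of _ "\<lambda>y. L y u + L y u'"])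
      (simp_all add: linear_add[OF lin] fder_eqI[OF has_derivative_add[OF has_fder[OF L'] has_fder[OF L']]])
  show "fder (\<lambda>y. L y (r *\<^sub>R u)) x v = r *\<^sub>R fder (\<lambda>y. L y u) x v" for u r
    by (subst fder_cong_open[OF S, of _ "\<lambda>y. r *\<^sub>R L y u"])
      (simp_all add: linear_scale[OF lin] fder_eqI[OF has_derivative_scaleR_right[OF has_fder[OF L']]])
qed

text \<open>The equation becomes autonomous once parameter and time join the state, with derivative
  \<open>(0, 1)\<close>. The parameter is then a part of the initial value, and
  \<open>ode_has_derivative_parameter\<close> applies.\<close>

lemma linear_ode_has_derivative_parameter:
  fixes A :: "'p::euclidean_space \<times> real \<Rightarrow> 'w::euclidean_space \<Rightarrow> 'w"
  assumes U: "open U" "x1 \<in> U" and t1: "\<bar>t1\<bar> < a"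
    and A: "\<And>q. q \<in> U \<times> {-a<..<a} \<Longrightarrow> linear (A q)"
    and cA: "\<And>w. C_k_on 1 (U \<times> {-a<..<a}) (\<lambda>q. A q w)" and cb: "C_k_on 1 (U \<times> {-a<..<a}) b"
    and W: "\<And>x t. x \<in> U \<Longrightarrow> \<bar>t\<bar> < a \<Longrightarrow> ((\<lambda>t. W (x, t)) has_vector_derivative A (x, t) (W (x, t)) + b (x, t)) (at t)"
    and W0: "\<And>x. x \<in> U \<Longrightarrow> W (x, 0) = wi" and cW: "continuous_on (U \<times> {-a<..<a}) W"
    and V: "\<And>h t. \<bar>t\<bar> < a \<Longrightarrow> (V h has_vector_derivative A (x1, t) (V h t) +
       (fder (\<lambda>q. A q (W (x1, t))) (x1, t) (h, 0) + fder b (x1, t) (h, 0))) (at t)"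
      "\<And>h. V h 0 = 0" "linear (\<lambda>h. V h t1)"
  shows "((\<lambda>x. W (x, t1)) has_derivative (\<lambda>h. V h t1)) (at x1)"
proof -
  let ?D = "U \<times> {-a<..<a}"
  have op: "open ?D" using U by (intro open_Times) auto
  let ?\<Omega> = "?D \<times> (UNIV :: 'w set)"
  have op\<Omega>: "open ?\<Omega>" by (intro open_Times op) auto
  define f where "f z = ((0 :: 'p, 1 :: real), A (fst z) (snd z) + b (fst z))" for z
  have fs: "bounded_linear (fst :: ('p \<times> real) \<times> 'w \<Rightarrow> _)" "bounded_linear (snd :: ('p \<times> real) \<times> 'w \<Rightarrow> _)"
    by (rule bounded_linear_fst, rule bounded_linear_snd)
  have A1: "C_k_on 1 ?\<Omega> (\<lambda>z. A (fst z) w)" for w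
    by (rule C_k_on_compose[OF op\<Omega> op _ cA C_k_on_bounded_linear[OF op\<Omega> fs(1)]]) auto
  have A2: "C_k_on 1 ?\<Omega> (\<lambda>z. A (fst z) (snd z))"
    by (rule C_k_on_linear_family[OF op\<Omega> _ A1 C_k_on_bounded_linear[OF op\<Omega> fs(2)]]) (use A in auto)
  have b1: "C_k_on 1 ?\<Omega> (\<lambda>z. b (fst z))"
    by (rule C_k_on_compose[OF op\<Omega> op _ cb C_k_on_bounded_linear[OF op\<Omega> fs(1)]]) auto
  have f1: "C_k_on 1 ?\<Omega> f"
    unfolding f_def by (rule C_k_on_Pair[OF op\<Omega> C_k_on_const C_k_on_add[OF op\<Omega> A2 b1]])
  \<comment> \<open>The differential of the augmented field reproduces, in its last component, the
    right side of the equation assumed for \<open>V\<close>.\<close>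
  have df: "fder f (q, w) (r, v) = (0, (fder (\<lambda>q. A q w) q r + A q v) + fder b q r)" if q: "q \<in> ?D" for q w r v
  proof -
    have z: "(q, w) \<in> ?\<Omega>" using q by simp
    have dA: "((\<lambda>z. A (fst z) u) has_derivative (\<lambda>z. fder (\<lambda>q. A q u) q (fst z))) (at (q, w))" for u
    proof -
      have "((\<lambda>q. A q u) has_derivative fder (\<lambda>q. A q u) q) (at (fst (q, w)))"
        by (simp, rule has_fder) (use cA[of u] q in auto)
      from has_derivative_compose[OF bounded_linear_imp_has_derivative[OF fs(1)] this]
      show ?thesis by simp
    qed
    have db: "((\<lambda>z. b (fst z)) has_derivative (\<lambda>z. fder b q (fst z))) (at (q, w))"
    proof -
      have "(b has_derivative fder b q) (at (fst (q, w)))"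
        by (simp, rule has_fder) (use cb q in auto)
      from has_derivative_compose[OF bounded_linear_imp_has_derivative[OF fs(1)] this]
      show ?thesis by simp
    qed
    have linA: "linear (A (fst z))" if "z \<in> ?\<Omega>" for z using A that by auto
    have dA2: "((\<lambda>z. A (fst z) (snd z)) has_derivative (\<lambda>z. fder (\<lambda>r. A r (snd (q, w))) q (fst z) + A (fst (q, w)) (snd z))) (at (q, w))"
      by (rule has_derivative_linear_family[where L = "\<lambda>z. A (fst z)" and L' = "\<lambda>z u. fder (\<lambda>q. A q u) q (fst z)"
        and z = snd and z' = snd, OF op\<Omega> z linA dA bounded_linear_imp_has_derivative[OF fs(2)]])
    have "(f has_derivative (\<lambda>z. (0, (fder (\<lambda>r. A r (snd (q, w))) q (fst z) + A (fst (q, w)) (snd z)) + fder b q (fst z)))) (at (q, w))"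
      unfolding f_def zero_prod_def[where 'a = 'p and 'b = real]
      by (intro has_derivative_Pair has_derivative_const has_derivative_add dA2 db)
    from fder_eqI[OF this] show ?thesis by simp
  qed
  define y where "y q = (q, W q)" for q
  have "((\<lambda>x. y (x, t1)) has_derivative (\<lambda>h. ((h, 0), V h t1))) (at x1)"
  proof (rule ode_has_derivative_parameter[OF op\<Omega> f1 U])
    show "continuous_on ?D y" unfolding y_def by (intro continuous_on_Pair continuous_on_id cW)
    show "y (x, t) \<in> ?\<Omega> \<and> ((\<lambda>t. y (x, t)) has_vector_derivative f (y (x, t))) (at t)" if "x \<in> U" "\<bar>t\<bar> < a" for x t
    proof
      show "y (x, t) \<in> ?\<Omega>" using that by (auto simp: y_def)
      have "((\<lambda>t. (x, t)) has_vector_derivative (0, 1)) (at t)"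
        by (intro has_vector_derivative_Pair has_vector_derivative_const has_vector_derivative_id)
      then show "((\<lambda>t. y (x, t)) has_vector_derivative f (y (x, t))) (at t)"
        unfolding y_def f_def fst_conv snd_conv by (rule has_vector_derivative_Pair[OF _ W[OF that]])
    qed
    show "bounded_linear (\<lambda>h. ((h, 0 :: real), 0 :: 'w))"
      by (intro bounded_linear_Pair bounded_linear_ident bounded_linear_zero)
    show "y (x, 0) = y (x1, 0) + ((x - x1, 0), 0)" if "x \<in> U" for x
      using W0[OF that] W0[OF U(2)] by (simp add: y_def)
    show "((\<lambda>t. ((h, 0 :: real), V h t)) has_vector_derivative fder f (y (x1, t)) ((h, 0), V h t)) (at t)" if t: "\<bar>t\<bar> < a" for h t
    proof -
      have "(x1, t) \<in> ?D" using t U by auto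
      then have "fder f (y (x1, t)) ((h, 0), V h t) = (0, A (x1, t) (V h t) +
       (fder (\<lambda>q. A q (W (x1, t))) (x1, t) (h, 0) + fder b (x1, t) (h, 0)))"
        by (simp add: y_def df)
      then show ?thesis by (simp only:) (intro has_vector_derivative_Pair has_vector_derivative_const V t)
    qed
    show "linear (\<lambda>h. ((h, 0 :: real), V h t1))"
      using linear_add[OF V(3)] linear_scale[OF V(3)] by (intro linearI) auto
  qed (simp_all add: V(2) t1)
  from has_derivative_snd[OF this] show ?thesis by (simp add: y_def)
qed

text \<open>The parameter derivative of \<open>W\<close> solves a linear equation with the same
  \<open>A\<close> and an inhomogeneity that is C^k because \<open>W\<close> is. So the induction
  varies \<open>b\<close>, \<open>W\<close> and the initial value, and also \<open>a\<close>, since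
  each step gives up a part of the time interval.\<close>

lemma linear_ode_C_k:
  fixes A :: "'p::euclidean_space \<times> real \<Rightarrow> 'w::euclidean_space \<Rightarrow> 'w"
  assumes U: "open U" and L: "L \<ge> 0"
  shows "3 * a * L < 1 \<Longrightarrow> (\<And>q. q \<in> U \<times> {-a<..<a} \<Longrightarrow> linear (A q)) \<Longrightarrow>
    (\<And>q w. q \<in> U \<times> {-a<..<a} \<Longrightarrow> norm (A q w) \<le> L * norm w) \<Longrightarrow>
    (\<And>w. C_k_on k (U \<times> {-a<..<a}) (\<lambda>q. A q w)) \<Longrightarrow> C_k_on k (U \<times> {-a<..<a}) b \<Longrightarrow>
    (\<And>x t. x \<in> U \<Longrightarrow> \<bar>t\<bar> < a \<Longrightarrow> ((\<lambda>t. W (x, t)) has_vector_derivative A (x, t) (W (x, t)) + b (x, t)) (at t)) \<Longrightarrow>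
    (\<And>x. x \<in> U \<Longrightarrow> W (x, 0) = wi) \<Longrightarrow> C_k_on k (U \<times> {-a<..<a}) W"
proof (induction k arbitrary: a b W wi)
  case 0
  show ?case
    unfolding C_k_on.simps
    by (rule linear_ode_continuous[OF U 0(2,3) _ _ 0(6,7) L]) (use 0(4,5) in simp_all)
next
  case (Suc k)
  let ?D = "U \<times> {-a<..<a}"
  have opD: "open ?D" using U by (intro open_Times) auto
  have Ak: "C_k_on k ?D (\<lambda>q. A q w)" for w by (rule C_k_on_SucD[OF Suc.prems(4)])
  have bk: "C_k_on k ?D b" by (rule C_k_on_SucD[OF Suc.prems(5)])
  have Wk: "C_k_on k ?D W" by (rule Suc.IH[OF Suc.prems(1,2,3) Ak bk Suc.prems(6,7)])
  \<comment> \<open>The inhomogeneity in the equation for the derivative of \<open>W\<close> in the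
    parameter direction \<open>h\<close>.\<close>
  define c where "c h q = fder (\<lambda>r. A r (W q)) q (h, 0) + fder b q (h, 0)" for h q
  have A_diff: "(\<lambda>q. A q w) differentiable (at q)" if "q \<in> ?D" for q w
    by (rule differentiableI[OF C_k_on_Suc_has_derivative[OF Suc.prems(4) that]])
  have b_diff: "b differentiable (at q)" if "q \<in> ?D" for q
    by (rule differentiableI[OF C_k_on_Suc_has_derivative[OF Suc.prems(5) that]])
  have ck: "C_k_on k ?D (c h)" for h
  proof -
    have "C_k_on k ?D (\<lambda>q. fder (\<lambda>r. A r (W q)) q (h, 0))"
      by (rule C_k_on_linear_family[OF opD linear_fder_family[OF opD _ Suc.prems(2) A_diff] C_k_on_fder[OF Suc.prems(4)] Wk])
    then show ?thesis unfolding c_def by (rule C_k_on_add[OF opD _ C_k_on_fder[OF Suc.prems(5)]])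
  qed
  have c_lin: "linear (\<lambda>h. c h q)" if q: "q \<in> ?D" for q
  proof -
    have l1: "linear (fder (\<lambda>r. A r (W q)) q)" by (rule linear_frechet_derivative[OF A_diff[OF q]])
    have l2: "linear (fder b q)" by (rule linear_frechet_derivative[OF b_diff[OF q]])
    have add: "(h + k, 0 :: real) = (h, 0) + (k, 0)" and scale: "(r *\<^sub>R h, 0 :: real) = r *\<^sub>R (h, 0)" for h k :: 'p and r by simp_all
    show ?thesis
      by (rule linearI) (simp_all only: c_def add scale linear_add[OF l1] linear_add[OF l2] linear_scale[OF l1] linear_scale[OF l2], simp_all add: algebra_simps)
  qed
  have le: "C_k_on 1 ?D (\<lambda>q. A q w)" "C_k_on 1 ?D b" for w
    by (rule C_k_on_le[OF Suc.prems(4)], simp, rule C_k_on_le[OF Suc.prems(5)], simp)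
  have cW: "continuous_on ?D W" using C_k_on_le[OF Wk, of 0] by simp
  show ?case
  proof (rule C_k_on_local)
    fix q assume "q \<in> ?D"
    then obtain x2 t2 where q: "q = (x2, t2)" "x2 \<in> U" "\<bar>t2\<bar> < a" by auto
    define s where "s = (\<bar>t2\<bar> + a) / 2"
    have s: "\<bar>t2\<bar> < s" "0 < s" "s < a" using q by (auto simp: s_def)
    let ?T = "U \<times> {-s<..<s}"
    have opT: "open ?T" using U by (intro open_Times) auto
    have TD: "?T \<subseteq> ?D" using s by auto
    have sL: "3 * s * L < 1"
    proof -
      have "3 * s * L \<le> 3 * a * L" using s L by (intro mult_right_mono) auto
      then show ?thesis using Suc.prems(1) by simp
    qed
    have "\<exists>y. y 0 = 0 \<and> (\<forall>t. \<bar>t\<bar> < s \<longrightarrow> (y has_vector_derivative A (x, t) (y t) + c h (x, t)) (at t))" if x: "x \<in> U" for h x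
    proof (rule linear_ode_exists[OF _ _ _ _ L Suc.prems(1) s(2,3)])
      have sec: "continuous_on {-a<..<a} (\<lambda>t. g (x, t))" if "continuous_on ?D g" for g :: "'p \<times> real \<Rightarrow> 'w"
        by (rule continuous_on_compose2[OF that]) (auto intro!: continuous_intros x)
      show "linear (A (x, t))" "norm (A (x, t) w) \<le> L * norm w" if "\<bar>t\<bar> < a" for t w
      proof -
        have "(x, t) \<in> ?D" using x that by auto
        then show "linear (A (x, t))" "norm (A (x, t) w) \<le> L * norm w"
          using Suc.prems(2,3) by blast+
      qed
      show "continuous_on {-a<..<a} (\<lambda>t. A (x, t) w)" for w
        by (rule sec) (use C_k_on_le[OF Ak, of 0] in simp)
      show "continuous_on {-a<..<a} (\<lambda>t. c h (x, t))"
        by (rule sec) (use C_k_on_le[OF ck, of 0] in simp)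
    qed
    note ex = this
    \<comment> \<open>A solution is picked separately for each \<open>h\<close> and
      \<open>x\<close>; uniqueness makes it linear in \<open>h\<close>, and the induction hypothesis
      makes it regular in \<open>x\<close> and \<open>t\<close>.\<close>
    define V where "V h x = (SOME y. y 0 = 0 \<and> (\<forall>t. \<bar>t\<bar> < s \<longrightarrow> (y has_vector_derivative A (x, t) (y t) + c h (x, t)) (at t)))" for h x
    have V: "V h x 0 = 0 \<and> (\<forall>t. \<bar>t\<bar> < s \<longrightarrow> (V h x has_vector_derivative A (x, t) (V h x t) + c h (x, t)) (at t))" if "x \<in> U" for h x
      unfolding V_def by (rule someI_ex[OF ex[OF that]])
    then have V: "x \<in> U \<Longrightarrow> V h x 0 = 0"
      "x \<in> U \<Longrightarrow> \<bar>t\<bar> < s \<Longrightarrow> (V h x has_vector_derivative A (x, t) (V h x t) + c h (x, t)) (at t)" for h x t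
      by blast+
    have Vk: "C_k_on k ?T (\<lambda>q. V h (fst q) (snd q))" for h
    proof (rule Suc.IH[where b = "c h" and wi = 0, OF sL])
      show "linear (A q)" "norm (A q w) \<le> L * norm w" if "q \<in> ?T" for q w
        using Suc.prems(2,3) subsetD[OF TD that] by blast+
      show "C_k_on k ?T (\<lambda>q. A q w)" for w by (rule C_k_on_subset[OF Ak TD])
      show "C_k_on k ?T (c h)" by (rule C_k_on_subset[OF ck TD])
      show "((\<lambda>t. V h (fst (x, t)) (snd (x, t))) has_vector_derivative
         A (x, t) (V h (fst (x, t)) (snd (x, t))) + c h (x, t)) (at t)" if "x \<in> U" "\<bar>t\<bar> < s" for x t
        using V(2)[OF that, of h] by simp
      show "V h (fst (x, 0)) (snd (x, 0)) = 0" if "x \<in> U" for x using V(1)[OF that] by simp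
    qed
    have V_lin: "linear (\<lambda>h. V h x t)" if x: "x \<in> U" and t: "\<bar>t\<bar> < s" for x t
    proof (rule linear_ode_solution_linear[where A = "\<lambda>t. A (x, t)" and b = "\<lambda>h t. c h (x, t)" and B = "\<lambda>_. 0" and Z = "\<lambda>h. V h x" and L = L and s = s])
      show "linear (A (x, t))" "norm (A (x, t) w) \<le> L * norm w" "linear (\<lambda>h. c h (x, t))" if "\<bar>t\<bar> < s" for t w
      proof -
        have "(x, t) \<in> ?D" using x that s by auto
        then show "linear (A (x, t))" "norm (A (x, t) w) \<le> L * norm w" "linear (\<lambda>h. c h (x, t))"
          using Suc.prems(2,3) c_lin by blast+
      qed
      show "linear (\<lambda>_ :: 'p. 0 :: 'w)" by (rule linear_zero)
    qed (use V x t L in simp_all)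
    have dWx: "((\<lambda>x. W (x, t)) has_derivative (\<lambda>h. V h x1 t)) (at x1)" if "x1 \<in> U" "\<bar>t\<bar> < s" for x1 t
    proof (rule linear_ode_has_derivative_parameter[OF U that, where A = A and b = b and wi = wi and V = "\<lambda>h. V h x1"])
      show "linear (A q)" if "q \<in> ?T" for q using Suc.prems(2) subsetD[OF TD that] by blast
      show "C_k_on 1 ?T (\<lambda>q. A q w)" for w by (rule C_k_on_subset[OF le(1) TD])
      show "C_k_on 1 ?T b" by (rule C_k_on_subset[OF le(2) TD])
      show "continuous_on ?T W" by (rule continuous_on_subset[OF cW TD])
      show "((\<lambda>t. W (x, t)) has_vector_derivative A (x, t) (W (x, t)) + b (x, t)) (at t)" if "x \<in> U" "\<bar>t\<bar> < s" for x t
        by (rule Suc.prems(6)) (use that s in auto)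
      show "W (x, 0) = wi" if "x \<in> U" for x by (rule Suc.prems(7)[OF that])
      show "(V h x1 has_vector_derivative A (x1, t) (V h x1 t) +
         (fder (\<lambda>q. A q (W (x1, t))) (x1, t) (h, 0) + fder b (x1, t) (h, 0))) (at t)" if "\<bar>t\<bar> < s" for h t
        using V(2)[OF \<open>x1 \<in> U\<close> that] unfolding c_def .
      show "V h x1 0 = 0" for h by (rule V(1)[OF \<open>x1 \<in> U\<close>])
      show "linear (\<lambda>h. V h x1 t)" by (rule V_lin[OF that])
    qed
    define W' where "W' q = A q (W q) + b q" for q
    have W'k: "C_k_on k ?T W'"
      unfolding W'_def
      by (rule C_k_on_subset[OF C_k_on_add[OF opD C_k_on_linear_family[OF opD Suc.prems(2) Ak Wk] bk] TD])
    have dW: "(W has_derivative (\<lambda>(h, \<tau>). V h (fst q) (snd q) + \<tau> *\<^sub>R W' q)) (at q)" if qT: "q \<in> ?T" for q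
    proof -
      obtain x1 t where q: "q = (x1, t)" "x1 \<in> U" "\<bar>t\<bar> < s" using qT by auto
      show ?thesis
        unfolding q(1) fst_conv snd_conv
      proof (rule has_derivative_parameter_time[OF U q(2,3) dWx[OF q(2,3)]])
        show "((\<lambda>t. W (x, t)) has_vector_derivative W' (x, t)) (at t)" if "x \<in> U" "\<bar>t\<bar> < s" for x t
          unfolding W'_def by (rule Suc.prems(6)) (use that s in auto)
        show "continuous_on ?T W'" using C_k_on_le[OF W'k, of 0] by simp
      qed
    qed
    have "C_k_on (Suc k) ?T W"
    proof (rule C_k_on_SucI[OF opT dW])
      show "C_k_on k ?T (\<lambda>q. case v of (h, \<tau>) \<Rightarrow> V h (fst q) (snd q) + \<tau> *\<^sub>R W' q)" for v
        by (cases v) (simp only: prod.case, intro C_k_on_add opT Vk C_k_on_scaleR C_k_on_const W'k)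
    qed
    then show "\<exists>T. open T \<and> q \<in> T \<and> C_k_on (Suc k) T W"
      using opT q s by (intro exI[of _ ?T]) auto
  qed
qed

text \<open>If the flow is C^k, so are the coefficients \<open>fder f (\<phi> q)\<close> of its
  variational equation; then \<open>linear_ode_C_k\<close> makes the derivative of the flow
  C^k.\<close>

lemma flow_C_k:
  fixes f :: "'z::euclidean_space \<Rightarrow> 'z"
  assumes \<Omega>: "open \<Omega>" and f: "smooth_on \<Omega> f" and U: "open U" and L: "L \<ge> 0" "3 * a * L < 1"
    and \<phi>: "\<And>x t. x \<in> U \<Longrightarrow> \<bar>t\<bar> < a \<Longrightarrow> \<phi> (x, t) \<in> \<Omega> \<and> ((\<lambda>t. \<phi> (x, t)) has_vector_derivative f (\<phi> (x, t))) (at t)"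
      "\<And>x. x \<in> U \<Longrightarrow> \<phi> (x, 0) = x" and c\<phi>: "continuous_on (U \<times> {-a<..<a}) \<phi>"
    and bound: "\<And>q v. q \<in> U \<times> {-a<..<a} \<Longrightarrow> norm (fder f (\<phi> q) v) \<le> L * norm v"
  shows "C_k_on k (U \<times> {-a<..<a}) \<phi>"
proof (induction k)
  case 0
  show ?case using c\<phi> by simp
next
  case (Suc k)
  let ?D = "U \<times> {-a<..<a}"
  have opD: "open ?D" using U by (intro open_Times) auto
  have \<phi>\<Omega>: "\<phi> ` ?D \<subseteq> \<Omega>" using \<phi>(1) by auto
  define A where "A q v = fder f (\<phi> q) v" for q v
  have Ak: "C_k_on k ?D (\<lambda>q. A q v)" for v
    unfolding A_def by (rule C_k_on_compose[OF opD \<Omega> \<phi>\<Omega> smooth_onD[OF smooth_on_fder[OF f]] Suc])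
  have A_lin: "linear (A q)" if "q \<in> ?D" for q
    unfolding A_def by (rule has_derivative_linear[OF smooth_on_has_derivative[OF f]]) (use \<phi>\<Omega> that in blast)
  show ?case
  proof (rule C_k_on_local)
    fix q assume "q \<in> ?D"
    then obtain x2 t2 where q: "q = (x2, t2)" "x2 \<in> U" "\<bar>t2\<bar> < a" by auto
    define s where "s = (\<bar>t2\<bar> + a) / 2"
    have s: "\<bar>t2\<bar> < s" "0 < s" "s < a" using q by (auto simp: s_def)
    let ?T = "U \<times> {-s<..<s}"
    have opT: "open ?T" using U by (intro open_Times) auto
    have TD: "?T \<subseteq> ?D" using s by auto
    have sL: "3 * s * L < 1"
    proof -
      have "3 * s * L \<le> 3 * a * L" using s L by (intro mult_right_mono) auto
      then show ?thesis using L by simp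
    qed
    have "\<exists>y. y 0 = h \<and> (\<forall>t. \<bar>t\<bar> < s \<longrightarrow> (y has_vector_derivative A (x, t) (y t) + 0) (at t))" if x: "x \<in> U" for h x
    proof (rule linear_ode_exists[OF _ _ _ _ L s(2,3)])
      show "linear (A (x, t))" "norm (A (x, t) w) \<le> L * norm w" if "\<bar>t\<bar> < a" for t w
      proof -
        have "(x, t) \<in> ?D" using x that by auto
        then show "linear (A (x, t))" "norm (A (x, t) w) \<le> L * norm w"
          using A_lin bound unfolding A_def by blast+
      qed
      have "continuous_on ?D (\<lambda>q. A q w)" for w using C_k_on_le[OF Ak, of 0] by simp
      then show "continuous_on {-a<..<a} (\<lambda>t. A (x, t) w)" for w
        by (rule continuous_on_compose2) (auto intro!: continuous_intros x)
    qed auto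
    note ex = this
    define V where "V h x = (SOME y. y 0 = h \<and> (\<forall>t. \<bar>t\<bar> < s \<longrightarrow> (y has_vector_derivative A (x, t) (y t) + 0) (at t)))" for h x
    have V: "V h x 0 = h \<and> (\<forall>t. \<bar>t\<bar> < s \<longrightarrow> (V h x has_vector_derivative A (x, t) (V h x t) + 0) (at t))" if "x \<in> U" for h x
      unfolding V_def by (rule someI_ex[OF ex[OF that]])
    then have V: "x \<in> U \<Longrightarrow> V h x 0 = h"
      "x \<in> U \<Longrightarrow> \<bar>t\<bar> < s \<Longrightarrow> (V h x has_vector_derivative A (x, t) (V h x t) + 0) (at t)" for h x t
      by blast+
    have Vk: "C_k_on k ?T (\<lambda>q. V h (fst q) (snd q))" for h
    proof (rule linear_ode_C_k[OF U L(1) sL, where A = A and b = "\<lambda>_. 0" and wi = h])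
      show "linear (A q)" "norm (A q w) \<le> L * norm w" if "q \<in> ?T" for q w
        using A_lin bound subsetD[OF TD that] by (auto simp: A_def)
      show "C_k_on k ?T (\<lambda>q. A q w)" for w by (rule C_k_on_subset[OF Ak TD])
      show "((\<lambda>t. V h (fst (x, t)) (snd (x, t))) has_vector_derivative
         A (x, t) (V h (fst (x, t)) (snd (x, t))) + 0) (at t)" if "x \<in> U" "\<bar>t\<bar> < s" for x t
        using V(2)[OF that, of h] by simp
      show "V h (fst (x, 0)) (snd (x, 0)) = h" if "x \<in> U" for x using V(1)[OF that] by simp
    qed (rule C_k_on_const)
    have V_lin: "linear (\<lambda>h. V h x t)" if x: "x \<in> U" and t: "\<bar>t\<bar> < s" for x t
    proof (rule linear_ode_solution_linear[where A = "\<lambda>t. A (x, t)" and b = "\<lambda>h t. 0" and B = "\<lambda>h. h" and Z = "\<lambda>h. V h x" and L = L and s = s])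
      show "linear (A (x, t))" "norm (A (x, t) w) \<le> L * norm w" if "\<bar>t\<bar> < s" for t w
      proof -
        have "(x, t) \<in> ?D" using x that s by auto
        then show "linear (A (x, t))" "norm (A (x, t) w) \<le> L * norm w"
          using A_lin bound unfolding A_def by blast+
      qed
      show "linear (\<lambda>h :: 'z. 0 :: 'z)" by (rule linear_zero)
      show "linear (\<lambda>h :: 'z. h)" by (rule linear_ident)
    qed (use V x t L in simp_all)
    have dx: "((\<lambda>x. \<phi> (x, t)) has_derivative (\<lambda>h. V h x1 t)) (at x1)" if "x1 \<in> U" "\<bar>t\<bar> < s" for x1 t
    proof (rule ode_has_derivative_parameter[OF \<Omega> smooth_onD[OF f] U that(1), where a = s and B = "\<lambda>h. h" and Z = "\<lambda>h. V h x1"])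
      show "continuous_on ?T \<phi>" by (rule continuous_on_subset[OF c\<phi> TD])
      show "\<phi> (x, t) \<in> \<Omega> \<and> ((\<lambda>t. \<phi> (x, t)) has_vector_derivative f (\<phi> (x, t))) (at t)" if "x \<in> U" "\<bar>t\<bar> < s" for x t
        by (rule \<phi>(1)) (use that s in auto)
      show "\<phi> (x, 0) = \<phi> (x1, 0) + (x - x1)" if "x \<in> U" for x
        using \<phi>(2)[OF that] \<phi>(2)[OF \<open>x1 \<in> U\<close>] by simp
      show "(V h x1 has_vector_derivative fder f (\<phi> (x1, t)) (V h x1 t)) (at t)" if "\<bar>t\<bar> < s" for h t
        using V(2)[OF \<open>x1 \<in> U\<close> that] by (simp add: A_def)
      show "V h x1 0 = h" for h by (rule V(1)[OF \<open>x1 \<in> U\<close>])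
      show "linear (\<lambda>h. V h x1 t)" by (rule V_lin[OF that])
    qed (use that in \<open>simp_all add: bounded_linear_ident\<close>)
    define W' where "W' q = f (\<phi> q)" for q
    have W'k: "C_k_on k ?T W'"
      unfolding W'_def
      by (rule C_k_on_subset[OF C_k_on_compose[OF opD \<Omega> \<phi>\<Omega> smooth_onD[OF f] Suc] TD])
    have d\<phi>: "(\<phi> has_derivative (\<lambda>(h, \<tau>). V h (fst q) (snd q) + \<tau> *\<^sub>R W' q)) (at q)" if qT: "q \<in> ?T" for q
    proof -
      obtain x1 t where q: "q = (x1, t)" "x1 \<in> U" "\<bar>t\<bar> < s" using qT by auto
      show ?thesis
        unfolding q(1) fst_conv snd_conv
      proof (rule has_derivative_parameter_time[OF U q(2,3) dx[OF q(2,3)]])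
        show "((\<lambda>t. \<phi> (x, t)) has_vector_derivative W' (x, t)) (at t)" if "x \<in> U" "\<bar>t\<bar> < s" for x t
          unfolding W'_def by (rule conjunct2[OF \<phi>(1)]) (use that s in auto)
        show "continuous_on ?T W'" using C_k_on_le[OF W'k, of 0] by simp
      qed
    qed
    have "C_k_on (Suc k) ?T \<phi>"
    proof (rule C_k_on_SucI[OF opT d\<phi>])
      show "C_k_on k ?T (\<lambda>q. case v of (h, \<tau>) \<Rightarrow> V h (fst q) (snd q) + \<tau> *\<^sub>R W' q)" for v
        by (cases v) (simp only: prod.case, intro C_k_on_add opT Vk C_k_on_scaleR C_k_on_const W'k)
    qed
    then show "\<exists>T. open T \<and> q \<in> T \<and> C_k_on (Suc k) T \<phi>"
      using opT q s by (intro exI[of _ ?T]) auto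
  qed
qed

text \<open>Composing with the nearest-point projection onto a ball makes the vector field globally
  Lipschitz; for short times the solutions do not leave the ball.\<close>

theorem smooth_flow_exists:
  fixes f :: "'z::euclidean_space \<Rightarrow> 'z"
  assumes \<Omega>: "open \<Omega>" and f: "smooth_on \<Omega> f" and z0: "z0 \<in> \<Omega>"
  obtains a r \<phi> where "a > 0" "r > 0" "smooth_on (ball z0 r \<times> {-a<..<a}) \<phi>"
    "\<And>x. x \<in> ball z0 r \<Longrightarrow> \<phi> (x, 0) = x"
    "\<And>x t. x \<in> ball z0 r \<Longrightarrow> \<bar>t\<bar> < a \<Longrightarrow> \<phi> (x, t) \<in> \<Omega> \<and> ((\<lambda>t. \<phi> (x, t)) has_vector_derivative f (\<phi> (x, t))) (at t)"
proof -
  obtain r where r: "r > 0" "cball z0 r \<subseteq> \<Omega>" using \<Omega> z0 open_contains_cball by blast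
  let ?C = "cball z0 r"
  obtain L where L: "L \<ge> 0" "\<And>z v. z \<in> ?C \<Longrightarrow> norm (fder f z v) \<le> L * norm v"
    "\<And>y z. y \<in> ?C \<Longrightarrow> z \<in> ?C \<Longrightarrow> norm (f y - f z) \<le> L * norm (y - z)"
    by (rule C1_lipschitz_on_cball[OF r(2) smooth_onD[OF f]]) (rule that)
  have "compact (f ` ?C)"
    by (intro compact_continuous_image continuous_on_subset[OF smooth_on_imp_continuous_on[OF f] r(2)] compact_cball)
  then obtain M where M: "M > 0" "\<And>z. z \<in> ?C \<Longrightarrow> norm (f z) \<le> M"
    using compact_imp_bounded bounded_pos by (metis imageI)
  define \<pi> where "\<pi> = closest_point ?C"
  have \<pi>: "\<pi> y \<in> ?C" "\<And>y y'. norm (\<pi> y - \<pi> y') \<le> norm (y - y')" for y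
    unfolding \<pi>_def using closest_point_in_set[of ?C] closest_point_lipschitz[of ?C] r(1)
    by (auto simp: dist_norm simp del: mem_cball)
  have \<pi>_id: "\<pi> y = y" if "y \<in> ?C" for y unfolding \<pi>_def by (rule closest_point_self[OF that])
  \<comment> \<open>The first bound gives \<open>3 * a * L < 1\<close> for the contraction, the
    second keeps the drift \<open>M * a\<close> below half the radius.\<close>
  define a where "a = min (1 / (6 * (L + 1))) (r / (4 * M))"
  have a: "a > 0" "3 * a * L < 1" "M * a < r / 2"
  proof -
    show "a > 0" using L M r by (simp add: a_def)
    have "3 * a * L \<le> 3 * (1 / (6 * (L + 1))) * L" using L by (intro mult_right_mono mult_left_mono) (auto simp: a_def)
    also have "\<dots> < 1" using L by (simp add: field_simps)
    finally show "3 * a * L < 1" .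
    have "M * a \<le> M * (r / (4 * M))" using M by (intro mult_left_mono) (auto simp: a_def)
    also have "\<dots> < r / 2" using M r by (simp add: field_simps)
    finally show "M * a < r / 2" .
  qed
  have lip: "norm (f (\<pi> y) - f (\<pi> y')) \<le> L * norm (y - y')" for y y'
    by (rule order_trans[OF L(3)[OF \<pi>(1) \<pi>(1)] mult_left_mono[OF \<pi>(2) L(1)]])
  have "\<exists>y. y 0 = x \<and> (\<forall>t. \<bar>t\<bar> < a \<longrightarrow> (y has_vector_derivative f (\<pi> (y t))) (at t))" for x
  proof (rule picard_exists_at[where F = "\<lambda>t y. f (\<pi> y)", OF a(1) L(1) a(2)])
    have "L-lipschitz_on UNIV (\<lambda>y. f (\<pi> y))"
      by (rule lipschitz_onI) (use lip L in \<open>auto simp: dist_norm\<close>)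
    then have "continuous_on UNIV (\<lambda>y. f (\<pi> y))" by (rule lipschitz_on_continuous_on)
    then show "continuous_on ({-a..a} \<times> UNIV) (\<lambda>(t, y). f (\<pi> y))"
      unfolding case_prod_beta by (rule continuous_on_compose2) (auto intro!: continuous_intros)
  qed (rule lip)
  then obtain Y where Y: "\<And>x. Y x 0 = x" "\<And>x t. \<bar>t\<bar> < a \<Longrightarrow> (Y x has_vector_derivative f (\<pi> (Y x t))) (at t)"
    by metis
  define \<phi> where "\<phi> q = Y (fst q) (snd q)" for q
  \<comment> \<open>Starting in the half ball leaves room for the drift, so the projection
    \<open>\<pi>\<close> acts as the identity along these solutions.\<close>
  let ?U = "ball z0 (r / 2)"
  have drift: "norm (Y x t - Y x t') \<le> M * norm (t - t')" if "\<bar>t\<bar> < a" "\<bar>t'\<bar> < a" for x t t'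
  proof (rule differentiable_bound[where S = "{-a<..<a}" and f = "Y x" and f' = "\<lambda>t h. h *\<^sub>R f (\<pi> (Y x t))"])
    show "(Y x has_derivative (\<lambda>h. h *\<^sub>R f (\<pi> (Y x t)))) (at t within {-a<..<a})" if "t \<in> {-a<..<a}" for t
      using Y(2)[of t x] that by (auto simp: has_vector_derivative_def intro: has_derivative_at_withinI)
    show "onorm (\<lambda>h. h *\<^sub>R f (\<pi> (Y x t))) \<le> M" if "t \<in> {-a<..<a}" for t
    proof (rule onorm_le)
      fix h :: real
      have "\<bar>h\<bar> * norm (f (\<pi> (Y x t))) \<le> \<bar>h\<bar> * M" by (intro mult_left_mono M(2) \<pi>(1)) simp
      then show "norm (h *\<^sub>R f (\<pi> (Y x t))) \<le> M * norm h" by (simp add: mult.commute)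
    qed
  qed (use that in auto)
  have inC: "Y x t \<in> ball z0 r" if "x \<in> ?U" "\<bar>t\<bar> < a" for x t
  proof -
    have "norm (Y x t - Y x 0) \<le> M * norm (t - 0)" by (rule drift) (use that a in auto)
    also have "\<dots> \<le> M * a" using M that by (intro mult_left_mono) auto
    finally have "dist (Y x t) x < r / 2" using a(3) Y(1) by (simp add: dist_norm)
    moreover have "dist z0 x < r / 2" using that by simp
    ultimately show ?thesis using dist_triangle[of z0 "Y x t" x] by (simp add: dist_commute)
  qed
  have ode: "\<phi> (x, t) \<in> \<Omega> \<and> ((\<lambda>t. \<phi> (x, t)) has_vector_derivative f (\<phi> (x, t))) (at t)" if "x \<in> ?U" "\<bar>t\<bar> < a" for x t
  proof -
    have "Y x t \<in> ?C" using inC[OF that] by auto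
    then show ?thesis using Y(2)[OF that(2), of x] \<pi>_id r(2) by (auto simp: \<phi>_def)
  qed
  have c\<phi>: "continuous_on (?U \<times> {-a<..<a}) \<phi>"
  proof -
    define E where "E = exp ((2 * L + 1) * a)"
    have spread: "norm (Y x t - Y x' t) \<le> norm (x - x') * E" if t: "\<bar>t\<bar> < a" for x x' t
    proof -
      have "norm (Y x t - Y x' t) \<le> norm (Y x 0 - Y x' 0) * exp ((2 * L + 1) * \<bar>t\<bar>)"
        by (rule gronwall_two_sided_linear[where u = "\<lambda>t. Y x t - Y x' t", OF has_vector_derivative_diff[OF Y(2) Y(2)] lip L(1) t])
      also have "\<dots> \<le> norm (x - x') * E"
        unfolding Y(1) E_def using t L by (intro mult_left_mono) (auto intro!: mult_left_mono)
      finally show ?thesis .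
    qed
    have "norm (\<phi> q - \<phi> q') \<le> (E + M) * norm (q - q')" if "q \<in> ?U \<times> {-a<..<a}" "q' \<in> ?U \<times> {-a<..<a}" for q q'
    proof -
      have t: "\<bar>snd q\<bar> < a" "\<bar>snd q'\<bar> < a" using that by (auto simp: mem_Times_iff)
      have "norm (\<phi> q - \<phi> q') \<le> norm (Y (fst q) (snd q) - Y (fst q') (snd q)) + norm (Y (fst q') (snd q) - Y (fst q') (snd q'))"
        unfolding \<phi>_def using norm_triangle_ineq[of "Y (fst q) (snd q) - Y (fst q') (snd q)" "Y (fst q') (snd q) - Y (fst q') (snd q')"] by simp
      also have "\<dots> \<le> norm (fst q - fst q') * E + M * norm (snd q - snd q')"
        by (intro add_mono spread drift t)
      also have "\<dots> \<le> norm (q - q') * E + M * norm (q - q')"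
      proof (intro add_mono mult_left_mono mult_right_mono)
        show "norm (fst q - fst q') \<le> norm (q - q')" "norm (snd q - snd q') \<le> norm (q - q')"
          using norm_fst_le[of "fst (q - q')" "snd (q - q')"] norm_snd_le[of "snd (q - q')" "fst (q - q')"]
          unfolding prod.collapse by (simp_all only: fst_diff snd_diff)
      qed (use M in \<open>simp_all add: E_def\<close>)
      finally show ?thesis by (simp add: algebra_simps)
    qed
    then have "(E + M)-lipschitz_on (?U \<times> {-a<..<a}) \<phi>"
      by (intro lipschitz_onI) (use M in \<open>auto simp: dist_norm E_def add_nonneg_nonneg less_imp_le\<close>)
    then show ?thesis by (rule lipschitz_on_continuous_on)
  qed
  show ?thesis
  proof (rule that[OF a(1)])
    show "r / 2 > 0" using r by simp
    show "\<phi> (x, 0) = x" if "x \<in> ?U" for x by (simp add: \<phi>_def Y)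
    show "\<phi> (x, t) \<in> \<Omega> \<and> ((\<lambda>t. \<phi> (x, t)) has_vector_derivative f (\<phi> (x, t))) (at t)" if "x \<in> ?U" "\<bar>t\<bar> < a" for x t
      by (rule ode[OF that])
    show "smooth_on (?U \<times> {-a<..<a}) \<phi>"
      unfolding smooth_on_def
    proof
      show "C_k_on k (?U \<times> {-a<..<a}) \<phi>" for k
      proof (rule flow_C_k[OF \<Omega> f open_ball L(1) a(2) ode _ c\<phi>])
        show "\<phi> (x, 0) = x" for x by (simp add: \<phi>_def Y)
        show "norm (fder f (\<phi> q) v) \<le> L * norm v" if "q \<in> ?U \<times> {-a<..<a}" for q v
        proof (rule L(2))
          have "Y (fst q) (snd q) \<in> ball z0 r" by (rule inC) (use that in \<open>auto simp: mem_Times_iff\<close>)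
          then show "\<phi> q \<in> ?C" by (auto simp: \<phi>_def)
        qed
      qed
    qed
  qed
qed

section \<open>Uniqueness of solutions on an interval\<close>

lemma ode_unique:
  fixes f :: "'z::euclidean_space \<Rightarrow> 'z"
  assumes \<Omega>: "open \<Omega>" and f: "C_k_on 1 \<Omega> f" and I: "open I" "connected I" "t0 \<in> I" "t \<in> I" and eq: "y t0 = z t0"
    and y: "\<And>t. t \<in> I \<Longrightarrow> y t \<in> \<Omega> \<and> (y has_vector_derivative f (y t)) (at t)"
    and z: "\<And>t. t \<in> I \<Longrightarrow> (z has_vector_derivative f (z t)) (at t)"
  shows "y t = z t"
proof -
  define E where "E = {t \<in> I. y t = z t}"
  have "closedin (top_of_set I) E"
  proof -
    have "continuous_on I y" "continuous_on I z"
      by (intro continuous_at_imp_continuous_on ballI has_vector_derivative_continuous[OF conjunct2[OF y]], assumption)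
        (intro continuous_at_imp_continuous_on ballI has_vector_derivative_continuous[OF z], assumption)
    then have "continuous_on I (\<lambda>t. y t - z t)" by (rule continuous_on_diff)
    from continuous_closedin_preimage_constant[OF this, of 0] show ?thesis
      unfolding E_def by simp
  qed
  moreover have "openin (top_of_set I) E"
  proof -
    have "\<exists>T. open T \<and> t \<in> T \<and> T \<subseteq> E" if t: "t \<in> E" for t
    proof -
      have tI: "t \<in> I" "y t = z t" using t by (auto simp: E_def)
      have evI: "\<forall>\<^sub>F s in nhds t. s \<in> I" by (rule eventually_nhds_in_open[OF I(1) tI(1)])
      have "\<forall>\<^sub>F s in nhds t. y s = z s"
      proof (rule ode_local_unique[OF \<Omega> f])
        show "y t \<in> \<Omega>" using y tI by blast
        show "\<forall>\<^sub>F t in nhds t. (y has_vector_derivative f (y t)) (at t)"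
          "\<forall>\<^sub>F t in nhds t. (z has_vector_derivative f (z t)) (at t)"
          using evI by (eventually_elim, use y z in blast)+
      qed (rule tI(2))
      with evI have "\<forall>\<^sub>F s in nhds t. s \<in> E" by eventually_elim (simp add: E_def)
      then show ?thesis unfolding eventually_nhds by blast
    qed
    then have "open E" by (subst open_subopen) blast
    then show ?thesis by (simp add: openin_open_eq[OF I(1)] E_def)
  qed
  moreover have "t0 \<in> E" using I eq by (simp add: E_def)
  ultimately have "E = I" using I(2) unfolding connected_clopen by blast
  then show ?thesis using I(4) unfolding E_def by blast
qed

lemma has_vector_derivative_eventually_cong:
  assumes "(f has_vector_derivative D) (at t)" "\<forall>\<^sub>F s in nhds t. f s = g s"
  shows "(g has_vector_derivative D) (at t)"
proof -
  obtain T where "open T" "t \<in> T" "\<And>s. s \<in> T \<Longrightarrow> f s = g s"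
    using assms(2) unfolding eventually_nhds by blast
  then show ?thesis using has_vector_derivative_transform_within_open[OF assms(1)] by blast
qed

section \<open>The inverse of a smooth map\<close>

text \<open>The derivative of the inverse solves the linear system
  \<open>fder f (g y) (g' y v) = v\<close>, whose coefficients are as regular as \<open>g\<close>;
  this lifts the differentiable inverse to a smooth one.\<close>

lemma smooth_local_inverse:
  fixes f :: "'a::euclidean_space \<Rightarrow> 'a"
  assumes S: "open S" and f: "smooth_on S f" and x0: "x0 \<in> S" and id: "fder f x0 = (\<lambda>v. v)"
  obtains U V g where "open U" "x0 \<in> U" "U \<subseteq> S" "open V" "homeomorphism U V f g" "smooth_on V g"
    "\<And>x. x \<in> U \<Longrightarrow> inj (fder f x)"
proof -
  define f' where "f' x = Blinfun (fder f x)" for x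
  have bl: "bounded_linear (fder f x)" if "x \<in> S" for x
    by (rule has_derivative_bounded_linear[OF smooth_on_has_derivative[OF f that]])
  have f': "blinfun_apply (f' x) = fder f x" if "x \<in> S" for x
    unfolding f'_def by (rule bounded_linear_Blinfun_apply[OF bl[OF that]])
  have 1: "(f has_derivative blinfun_apply (f' x)) (at x)" if "x \<in> S" for x
    using smooth_on_has_derivative[OF f that] by (simp add: f'[OF that])
  have 2: "continuous_on S f'"
  proof (rule continuous_on_blinfun_componentwise)
    fix b :: 'a
    have "continuous_on S (\<lambda>x. fder f x b)" by (rule smooth_on_imp_continuous_on[OF smooth_on_fder[OF f]])
    then show "continuous_on S (\<lambda>x. blinfun_apply (f' x) b)"
      by (rule continuous_on_eq) (simp add: f')
  qed
  have 3: "id_blinfun o\<^sub>L f' x0 = id_blinfun"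
    by (rule blinfun_eqI) (simp add: f'[OF x0] id)
  obtain U V g g' where UV: "open U" "U \<subseteq> S" "x0 \<in> U" "open V" "f x0 \<in> V" "homeomorphism U V f g"
    and g': "\<And>y. y \<in> V \<Longrightarrow> (g has_derivative g' y) (at y)" "\<And>y. y \<in> V \<Longrightarrow> g' y = inv (blinfun_apply (f' (g y)))"
      "\<And>y. y \<in> V \<Longrightarrow> bij (blinfun_apply (f' (g y)))"
    using inverse_function_theorem[OF S 1 2 x0 3] by blast
  have gV: "g ` V \<subseteq> S" "g ` V = U" using UV(2,6) unfolding homeomorphism_def by auto
  have bij: "bij (fder f (g y))" if "y \<in> V" for y using g'(3)[OF that] f' gV that by auto
  have sol: "fder f (g y) (g' y v) = v" if "y \<in> V" for y v
  proof -
    have "g' y = inv (fder f (g y))" using g'(2)[OF that] f' gV that by auto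
    then show ?thesis using surj_f_inv_f[OF bij_is_surj[OF bij[OF that]]] by simp
  qed
  have "C_k_on k V g" for k
  proof (induction k)
    case 0
    show ?case using UV(6) by (simp add: homeomorphism_def)
  next
    case (Suc k)
    show ?case
    proof (rule C_k_on_SucI[OF UV(4) g'(1)])
      show "C_k_on k V (\<lambda>y. g' y v)" for v
      proof (rule C_k_on_linear_solution[OF UV(4)])
        show "linear (fder f (g y))" "inj (fder f (g y))" if "y \<in> V" for y
          using bl[THEN bounded_linear.linear] gV bij_is_inj[OF bij[OF that]] that by blast+
        show "C_k_on k V (\<lambda>y. fder f (g y) u)" for u
          by (rule C_k_on_compose[OF UV(4) S gV(1) smooth_onD[OF smooth_on_fder[OF f]] Suc])
        show "fder f (g y) (g' y v) = v" if "y \<in> V" for y by (rule sol[OF that])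
      qed (rule C_k_on_const)
    qed
  qed
  then have "smooth_on V g" by (simp add: smooth_on_def)
  moreover have "inj (fder f x)" if x: "x \<in> U" for x
  proof -
    obtain y where "y \<in> V" "x = g y" using gV(2) x by blast
    then show ?thesis using bij_is_inj[OF bij] by simp
  qed
  ultimately show ?thesis using that[OF UV(1,3,2,4,6)] by blast
qed

section \<open>Geodesics in coordinates\<close>

context local_metric
begin

text \<open>The geodesic equation as an autonomous first-order system for position and velocity, the
  form to which the flow theorem applies.\<close>

definition spray :: "'e \<times> 'e \<Rightarrow> 'e \<times> 'e" where
  "spray z = (snd z, - \<Gamma> (fst z) (snd z) (snd z))"

lemma spray_smooth: "smooth_on (S \<times> UNIV) spray"
proof -
  have op: "open (S \<times> (UNIV :: 'e set))" by (intro open_Times open_S open_UNIV)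
  have fs: "smooth_on (S \<times> UNIV) (fst :: 'e \<times> 'e \<Rightarrow> 'e)" "smooth_on (S \<times> UNIV) (snd :: 'e \<times> 'e \<Rightarrow> 'e)"
    by (rule smooth_on_bounded_linear[OF op bounded_linear_fst], rule smooth_on_bounded_linear[OF op bounded_linear_snd])
  show ?thesis
    unfolding spray_def
    by (rule smooth_on_Pair[OF op fs(2) smooth_on_minus[OF op \<Gamma>_along_smooth[OF op fs(1) _ fs(2) fs(2)]]]) auto
qed

lemma spray_domain_open: "open (S \<times> (UNIV :: 'e set))"
  by (intro open_Times open_S open_UNIV)

lemma spray_solution_iff:
  "((\<lambda>t. (x t, v t)) has_vector_derivative spray (x t, v t)) (at t) \<longleftrightarrow>
    (x has_vector_derivative v t) (at t) \<and> (v has_vector_derivative - \<Gamma> (x t) (v t) (v t)) (at t)"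
proof
  assume "((\<lambda>t. (x t, v t)) has_vector_derivative spray (x t, v t)) (at t)"
  then have 1: "((\<lambda>t. (x t, v t)) has_vector_derivative (v t, - \<Gamma> (x t) (v t) (v t))) (at t)" by (simp add: spray_def)
  show "(x has_vector_derivative v t) (at t) \<and> (v has_vector_derivative - \<Gamma> (x t) (v t) (v t)) (at t)"
    using bounded_linear.has_vector_derivative[OF bounded_linear_fst 1]
      bounded_linear.has_vector_derivative[OF bounded_linear_snd 1] by simp
next
  assume "(x has_vector_derivative v t) (at t) \<and> (v has_vector_derivative - \<Gamma> (x t) (v t) (v t)) (at t)"
  then show "((\<lambda>t. (x t, v t)) has_vector_derivative spray (x t, v t)) (at t)"
    unfolding spray_def fst_conv snd_conv by (intro has_vector_derivative_Pair) auto
qed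

text \<open>Rescaling time by \<open>\<sigma>\<close> multiplies velocity by \<open>\<sigma>\<close>
  and acceleration by its square, and \<open>\<Gamma>\<close> is quadratic in the velocity.\<close>

lemma spray_scale:
  assumes "x (\<sigma> * t) \<in> S" "((\<lambda>t. (x t, v t)) has_vector_derivative spray (x (\<sigma> * t), v (\<sigma> * t))) (at (\<sigma> * t))"
  shows "((\<lambda>t. (x (\<sigma> * t), \<sigma> *\<^sub>R v (\<sigma> * t))) has_vector_derivative spray (x (\<sigma> * t), \<sigma> *\<^sub>R v (\<sigma> * t))) (at t)"
proof -
  note b = \<Gamma>_bilinear[OF assms(1)]
  have sc: "((\<lambda>t. \<sigma> * t) has_vector_derivative \<sigma>) (at t)" by (auto intro!: derivative_eq_intros)
  have "(x has_vector_derivative v (\<sigma> * t)) (at (\<sigma> * t))"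
    "(v has_vector_derivative - \<Gamma> (x (\<sigma> * t)) (v (\<sigma> * t)) (v (\<sigma> * t))) (at (\<sigma> * t))"
    using assms(2) spray_solution_iff[of x v "\<sigma> * t"] by blast+
  from vector_diff_chain_at[OF sc this(1)] vector_diff_chain_at[OF sc this(2)]
  have 1: "((\<lambda>t. x (\<sigma> * t)) has_vector_derivative \<sigma> *\<^sub>R v (\<sigma> * t)) (at t)"
    and 2: "((\<lambda>t. v (\<sigma> * t)) has_vector_derivative \<sigma> *\<^sub>R (- \<Gamma> (x (\<sigma> * t)) (v (\<sigma> * t)) (v (\<sigma> * t)))) (at t)"
    by (simp_all add: o_def)
  from bounded_linear.has_vector_derivative[OF bounded_linear_scaleR_right 2, of \<sigma>]
  have "((\<lambda>t. \<sigma> *\<^sub>R v (\<sigma> * t)) has_vector_derivative - \<Gamma> (x (\<sigma> * t)) (\<sigma> *\<^sub>R v (\<sigma> * t)) (\<sigma> *\<^sub>R v (\<sigma> * t))) (at t)"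
    by (simp add: bilinear_lmul[OF b] bilinear_rmul[OF b])
  with 1 show ?thesis
    using spray_solution_iff[of "\<lambda>t. x (\<sigma> * t)" "\<lambda>t. \<sigma> *\<^sub>R v (\<sigma> * t)" t] by blast
qed

text \<open>The flow is available for short times only, so the endpoint at time 1 is defined through
  homogeneity: \<open>F u\<close> is the position at the small time \<open>\<tau>\<close> for the
  initial velocity \<open>u /\<^sub>R \<tau>\<close>.\<close>

theorem local_exponential_map:
  assumes x0: "x0 \<in> S"
  obtains r F where "r > 0" "smooth_on (ball 0 r) F" "F 0 = x0" "fder F 0 = (\<lambda>v. v)" "F ` ball 0 r \<subseteq> S"
    "\<And>v t. t *\<^sub>R v \<in> ball 0 r \<Longrightarrow> ((\<lambda>t. fder F (t *\<^sub>R v) v) has_vector_derivative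
       - \<Gamma> (F (t *\<^sub>R v)) (fder F (t *\<^sub>R v) v) (fder F (t *\<^sub>R v) v)) (at t)"
proof -
  let ?\<Omega> = "S \<times> (UNIV :: 'e set)"
  have z0: "(x0, 0) \<in> ?\<Omega>" using x0 by simp
  obtain a r0 \<phi> where a: "a > 0" and r0: "r0 > 0" and \<phi>_smooth: "smooth_on (ball (x0, 0) r0 \<times> {-a<..<a}) \<phi>"
    and \<phi>0: "\<And>z. z \<in> ball (x0, 0) r0 \<Longrightarrow> \<phi> (z, 0) = z"
    and \<phi>: "\<And>z t. z \<in> ball (x0, 0) r0 \<Longrightarrow> \<bar>t\<bar> < a \<Longrightarrow> \<phi> (z, t) \<in> ?\<Omega> \<and> ((\<lambda>t. \<phi> (z, t)) has_vector_derivative spray (\<phi> (z, t))) (at t)"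
    by (rule smooth_flow_exists[OF spray_domain_open spray_smooth z0]) (rule that)
  define x where "x w t = fst (\<phi> ((x0, w), t))" for w t
  define v where "v w t = snd (\<phi> ((x0, w), t))" for w t
  have inb: "(x0, w) \<in> ball (x0, 0) r0 \<longleftrightarrow> norm w < r0" for w
    by (simp add: dist_Pair_Pair dist_norm)
  have xv: "x w t \<in> S" "((\<lambda>t. (x w t, v w t)) has_vector_derivative spray (x w t, v w t)) (at t)"
    if "norm w < r0" "\<bar>t\<bar> < a" for w t
    using \<phi>[of "(x0, w)" t] that inb[of w] unfolding x_def v_def by (auto simp: mem_Times_iff)
  have xv0: "x w 0 = x0" "v w 0 = w" if "norm w < r0" for w
    using \<phi>0[of "(x0, w)"] that inb[of w] unfolding x_def v_def by auto
  \<comment> \<open>Both sides are solutions that start at \<open>x0\<close> with velocity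
    \<open>\<sigma> *\<^sub>R w\<close>.\<close>
  have homog: "x (\<sigma> *\<^sub>R w) t = x w (\<sigma> * t)" if w: "norm w < r0" and \<sigma>: "\<bar>\<sigma>\<bar> \<le> 1" and t: "\<bar>t\<bar> < a" for w \<sigma> t
  proof -
    have sw: "norm (\<sigma> *\<^sub>R w) < r0"
      using mult_right_mono[OF \<sigma> norm_ge_zero[of w]] w by simp
    have st: "\<bar>\<sigma> * t\<bar> < a" if "\<bar>t\<bar> < a" for t
      using mult_right_mono[OF \<sigma> abs_ge_zero[of t]] that by (simp add: abs_mult)
    have "(\<lambda>t. (x (\<sigma> *\<^sub>R w) t, v (\<sigma> *\<^sub>R w) t)) t = (\<lambda>t. (x w (\<sigma> * t), \<sigma> *\<^sub>R v w (\<sigma> * t))) t"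
    proof (rule ode_unique[of ?\<Omega> spray "{-a<..<a}" 0 t "\<lambda>t. (x (\<sigma> *\<^sub>R w) t, v (\<sigma> *\<^sub>R w) t)"
          "\<lambda>t. (x w (\<sigma> * t), \<sigma> *\<^sub>R v w (\<sigma> * t))", OF spray_domain_open smooth_onD[OF spray_smooth]])
      show "(x (\<sigma> *\<^sub>R w) 0, v (\<sigma> *\<^sub>R w) 0) = (x w (\<sigma> * 0), \<sigma> *\<^sub>R v w (\<sigma> * 0))"
        using xv0[OF sw] xv0[OF w] by simp
      show "(x (\<sigma> *\<^sub>R w) t, v (\<sigma> *\<^sub>R w) t) \<in> ?\<Omega> \<and> ((\<lambda>t. (x (\<sigma> *\<^sub>R w) t, v (\<sigma> *\<^sub>R w) t)) has_vector_derivative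
          spray (x (\<sigma> *\<^sub>R w) t, v (\<sigma> *\<^sub>R w) t)) (at t)" if "t \<in> {-a<..<a}" for t
        using xv[OF sw, of t] that by auto
      show "((\<lambda>t. (x w (\<sigma> * t), \<sigma> *\<^sub>R v w (\<sigma> * t))) has_vector_derivative spray (x w (\<sigma> * t), \<sigma> *\<^sub>R v w (\<sigma> * t))) (at t)"
        if "t \<in> {-a<..<a}" for t
        by (rule spray_scale) (use xv[OF w st, of t] that in auto)
    qed (use a t in auto)
    then show ?thesis by simp
  qed
  define \<tau> where "\<tau> = a / 2"
  have \<tau>: "\<tau> > 0" "\<bar>\<tau>\<bar> < a" using a by (auto simp: \<tau>_def)
  define r where "r = r0 * \<tau>"
  define F where "F u = x (u /\<^sub>R \<tau>) \<tau>" for u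
  have small: "norm (u /\<^sub>R \<tau>) < r0" if "u \<in> ball 0 r" for u
    using that \<tau> by (simp add: r_def field_simps)
  have op: "open (ball (x0, 0 :: 'e) r0 \<times> {-a<..<a})" by (intro open_Times) auto
  have smF: "smooth_on (ball 0 r) F"
  proof -
    have "smooth_on (ball 0 r) (\<lambda>u :: 'e. \<phi> ((x0, u /\<^sub>R \<tau>), \<tau>))"
    proof (rule smooth_on_compose[OF open_ball op _ \<phi>_smooth])
      show "smooth_on (ball 0 r) (\<lambda>u :: 'e. ((x0, u /\<^sub>R \<tau>), \<tau>))"
        by (intro smooth_on_Pair open_ball smooth_on_const smooth_on_bounded_linear bounded_linear_scaleR_right)
      show "(\<lambda>u :: 'e. ((x0, u /\<^sub>R \<tau>), \<tau>)) ` ball 0 r \<subseteq> ball (x0, 0) r0 \<times> {-a<..<a}"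
      proof (rule image_subsetI)
        fix u :: 'e assume "u \<in> ball 0 r"
        from small[OF this] have "(x0, u /\<^sub>R \<tau>) \<in> ball (x0, 0) r0" unfolding inb .
        moreover have "\<tau> \<in> {-a<..<a}" using \<tau> by auto
        ultimately show "((x0, u /\<^sub>R \<tau>), \<tau>) \<in> ball (x0, 0) r0 \<times> {-a<..<a}" by (rule SigmaI)
      qed
    qed
    then show ?thesis
      unfolding F_def x_def by (rule smooth_on_linear_comp[OF open_ball bounded_linear_fst])
  qed
  have F0: "F 0 = x0" using homog[of 0 0 \<tau>] xv0(1)[of 0] \<tau> r0 by (simp add: F_def)
  have ray: "\<exists>\<kappa> w. norm w < r0 \<and> w = v' /\<^sub>R \<kappa> \<and> \<kappa> > 0 \<and> \<bar>\<kappa> * t\<bar> < a \<and> (\<forall>\<^sub>F s in nhds t. F (s *\<^sub>R v') = x w (\<kappa> * s))"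
    if tv: "t *\<^sub>R v' \<in> ball 0 r" for v' t
  proof -
    \<comment> \<open>A bound strictly above \<open>\<bar>t\<bar>\<close> makes the formula for
      \<open>F\<close> on the ray valid on a neighbourhood of \<open>t\<close>, so that it can be
      differentiated there.\<close>
    obtain \<sigma> where \<sigma>: "\<sigma> > \<bar>t\<bar>" "norm (\<sigma> *\<^sub>R v') < r"
    proof (cases "v' = 0")
      case True
      show ?thesis by (rule that[of "\<bar>t\<bar> + 1"]) (use True r0 \<tau> in \<open>auto simp: r_def\<close>)
    next
      case False
      then have "\<bar>t\<bar> < r / norm v'" using tv by (simp add: field_simps)
      then obtain \<sigma> where "\<bar>t\<bar> < \<sigma>" "\<sigma> < r / norm v'" using dense by blast
      then show ?thesis using False by (intro that[of \<sigma>]) (auto simp: field_simps)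
    qed
    have \<sigma>0: "\<sigma> > 0" using \<sigma>(1) by linarith
    define w where "w = (\<sigma> *\<^sub>R v') /\<^sub>R \<tau>"
    have w: "norm w < r0" unfolding w_def by (rule small) (use \<sigma> in simp)
    define \<kappa> where "\<kappa> = \<tau> / \<sigma>"
    have \<kappa>: "\<kappa> > 0" "w = v' /\<^sub>R \<kappa>" using \<tau> \<sigma>0 by (simp_all add: \<kappa>_def w_def field_simps)
    have Fs: "F (s *\<^sub>R v') = x w (\<kappa> * s)" if s: "\<bar>s\<bar> < \<sigma>" for s
    proof -
      have "(s *\<^sub>R v') /\<^sub>R \<tau> = (s / \<sigma>) *\<^sub>R w" using \<sigma>0 by (simp add: w_def)
      then have "F (s *\<^sub>R v') = x ((s / \<sigma>) *\<^sub>R w) \<tau>" by (simp add: F_def)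
      also have "\<dots> = x w ((s / \<sigma>) * \<tau>)" by (rule homog[OF w]) (use s \<sigma>0 \<tau> in auto)
      finally show ?thesis by (simp add: \<kappa>_def mult.commute)
    qed
    have "\<kappa> * \<bar>t\<bar> < \<kappa> * \<sigma>" using \<sigma>(1) \<kappa>(1) by (intro mult_strict_left_mono)
    then have "\<bar>\<kappa> * t\<bar> < \<tau>" using \<kappa>(1) \<sigma>0 using \<tau>(1) by (simp add: abs_mult \<kappa>_def abs_of_pos)
    then have "\<bar>\<kappa> * t\<bar> < a" using \<tau> by auto
    moreover have "\<forall>\<^sub>F s in nhds t. \<bar>s\<bar> < \<sigma>"
    proof -
      have "\<forall>\<^sub>F s in nhds t. s \<in> {-\<sigma><..<\<sigma>}" by (rule eventually_nhds_in_open) (use \<sigma> in auto)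
      then show ?thesis by eventually_elim auto
    qed
    then have "\<forall>\<^sub>F s in nhds t. F (s *\<^sub>R v') = x w (\<kappa> * s)" by eventually_elim (rule Fs)
    ultimately show ?thesis using w \<kappa> by blast
  qed
  have geo: "((\<lambda>t. fder F (t *\<^sub>R v') v') has_vector_derivative
       - \<Gamma> (F (t *\<^sub>R v')) (fder F (t *\<^sub>R v') v') (fder F (t *\<^sub>R v') v')) (at t) \<and> F (t *\<^sub>R v') \<in> S \<and> (t = 0 \<longrightarrow> fder F 0 v' = v')"
    if tv: "t *\<^sub>R v' \<in> ball 0 r" for v' t
  proof -
    obtain \<kappa> w where w: "norm w < r0" "w = v' /\<^sub>R \<kappa>" and \<kappa>: "\<kappa> > 0" "\<bar>\<kappa> * t\<bar> < a"
      and ev: "\<forall>\<^sub>F s in nhds t. F (s *\<^sub>R v') = x w (\<kappa> * s)"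
      using ray[OF tv] by blast
    have sol: "((\<lambda>s. x w (\<kappa> * s)) has_vector_derivative \<kappa> *\<^sub>R v w (\<kappa> * s)) (at s)"
      "((\<lambda>s. \<kappa> *\<^sub>R v w (\<kappa> * s)) has_vector_derivative - \<Gamma> (x w (\<kappa> * s)) (\<kappa> *\<^sub>R v w (\<kappa> * s)) (\<kappa> *\<^sub>R v w (\<kappa> * s))) (at s)"
      if "\<bar>\<kappa> * s\<bar> < a" for s
      using spray_solution_iff[THEN iffD1, OF spray_scale[where x = "x w" and v = "v w" and \<sigma> = \<kappa>, OF xv[OF w(1) that]]]
      by (rule conjunct1, rule conjunct2)
    have ev1: "\<forall>\<^sub>F s in nhds t. \<forall>\<^sub>F r in nhds s. x w (\<kappa> * r) = F (r *\<^sub>R v')"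
      using ev by (simp add: eventually_eventually eq_commute)
    have ev2: "\<forall>\<^sub>F s in nhds t. \<bar>\<kappa> * s\<bar> < a"
    proof -
      have "\<forall>\<^sub>F s in nhds t. s \<in> {s. \<bar>\<kappa> * s\<bar> < a}"
        by (rule eventually_nhds_in_open) (use \<kappa> in \<open>auto intro!: open_Collect_less continuous_intros\<close>)
      then show ?thesis by simp
    qed
    have ev3: "\<forall>\<^sub>F s in nhds t. s *\<^sub>R v' \<in> ball 0 r"
    proof -
      have "\<forall>\<^sub>F s in nhds t. s \<in> {s. norm (s *\<^sub>R v') < r}"
        by (rule eventually_nhds_in_open) (use tv in \<open>auto intro!: open_Collect_less continuous_intros\<close>)
      then show ?thesis by simp
    qed
    \<comment> \<open>Agreement on a neighbourhood is needed because the velocity is differentiated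
      once more.\<close>
    have vel: "\<forall>\<^sub>F s in nhds t. \<kappa> *\<^sub>R v w (\<kappa> * s) = fder F (s *\<^sub>R v') v'"
      using ev1 ev2 ev3
    proof eventually_elim
      case (elim s)
      show ?case
        by (rule vector_derivative_unique_at[OF has_vector_derivative_eventually_cong[OF sol(1)[OF elim(2)] elim(1)]
              smooth_on_ray_derivative[OF smF elim(3)]])
    qed
    have Ft: "F (t *\<^sub>R v') = x w (\<kappa> * t)" and vt: "\<kappa> *\<^sub>R v w (\<kappa> * t) = fder F (t *\<^sub>R v') v'"
      using eventually_nhds_x_imp_x[OF ev] eventually_nhds_x_imp_x[OF vel] by blast+
    have "((\<lambda>s. fder F (s *\<^sub>R v') v') has_vector_derivative - \<Gamma> (x w (\<kappa> * t)) (\<kappa> *\<^sub>R v w (\<kappa> * t)) (\<kappa> *\<^sub>R v w (\<kappa> * t))) (at t)"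
      by (rule has_vector_derivative_eventually_cong[OF sol(2)[OF \<kappa>(2)] vel])
    moreover have "F (t *\<^sub>R v') \<in> S" unfolding Ft by (rule xv(1)[OF w(1) \<kappa>(2)])
    moreover have "fder F 0 v' = v'" if "t = 0"
      using vt xv0(2)[OF w(1)] \<kappa>(1) w(2) that by simp
    ultimately show ?thesis unfolding Ft vt by blast
  qed
  show ?thesis
  proof (rule that[OF _ smF F0])
    show "r > 0" using r0 \<tau> by (simp add: r_def)
    show "fder F 0 = (\<lambda>v. v)" using geo[of 0] \<open>r > 0\<close> by auto
    show "F ` ball 0 r \<subseteq> S" using geo[of 1] by auto
    show "((\<lambda>t. fder F (t *\<^sub>R v) v) has_vector_derivative
       - \<Gamma> (F (t *\<^sub>R v)) (fder F (t *\<^sub>R v) v) (fder F (t *\<^sub>R v) v)) (at t)" if "t *\<^sub>R v \<in> ball 0 r" for v t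
      using geo[OF that] by blast
  qed
qed

end

subsection \<open>Pulling back a metric along an exponential map\<close>

text \<open>An exponential map read in one chart. \<open>F_geodesic\<close> states the geodesic
  equation at time 1 for every \<open>x\<close>, in accordance with the radial condition of
  \<open>normal_coordinates\<close>.\<close>

locale radial_geodesic_map = local_metric S2 h2
  for S2 :: "'e::euclidean_space set" and h2 +
  fixes B :: "'e set" and F :: "'e \<Rightarrow> 'e"
  assumes B_open: "open B" and B_0: "0 \<in> B"
    and B_star: "x \<in> B \<Longrightarrow> 0 \<le> t \<Longrightarrow> t \<le> 1 \<Longrightarrow> t *\<^sub>R x \<in> B"
    and F_smooth: "smooth_on B F" and F_image: "F ` B \<subseteq> S2"
    and F_inj: "x \<in> B \<Longrightarrow> inj (fder F x)"
    and F_geodesic: "x \<in> B \<Longrightarrow> ((\<lambda>t. fder F (t *\<^sub>R x) x) has_vector_derivative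
       - christoffel h2 (F x) (fder F x x) (fder F x x)) (at 1)"
begin

definition pullback :: "'e \<Rightarrow> 'e \<Rightarrow> 'e \<Rightarrow> real" where
  "pullback x u v = h2 (F x) (fder F x u) (fder F x v)"

lemma F_linear: "x \<in> B \<Longrightarrow> linear (fder F x)"
  by (rule has_derivative_linear[OF smooth_on_has_derivative[OF F_smooth]])

lemma pullback_metric: "local_metric B pullback"
proof
  fix x u v
  show "open B" by (rule B_open)
  show "smooth_on B (\<lambda>x. pullback x u v)"
    unfolding pullback_def
    by (rule h_along_smooth[OF B_open F_smooth F_image smooth_on_fder[OF F_smooth] smooth_on_fder[OF F_smooth]])
  assume x: "x \<in> B"
  then have Fx: "F x \<in> S2" using F_image by blast
  note lin = F_linear[OF x]
  note b = h_bilinear[OF Fx]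
  show "bilinear (pullback x)"
    unfolding bilinear_def pullback_def
    by (intro conjI allI linearI)
      (simp_all add: linear_add[OF lin] linear_scale[OF lin] bilinear_ladd[OF b] bilinear_radd[OF b]
        bilinear_lmul[OF b] bilinear_rmul[OF b])
  show "pullback x u v = pullback x v u" unfolding pullback_def by (rule h_sym[OF Fx])
  show "form_nondegenerate_on UNIV (pullback x)"
    unfolding form_nondegenerate_on_def
  proof (intro ballI impI)
    fix u assume u: "\<forall>v\<in>UNIV. pullback x u v = 0"
    have "surj (fder F x)" using linear_injective_imp_surjective[OF lin F_inj[OF x]] by simp
    then have "h2 (F x) (fder F x u) w = h2 (F x) 0 w" for w
      using u unfolding pullback_def bilinear_lzero[OF b] by (metis UNIV_I surjD)
    then have "fder F x u = 0" by (rule h_cancel[OF Fx])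
    then show "u = 0" using F_inj[OF x] linear_0[OF lin] by (metis injD)
  qed
qed

sublocale iso: local_isometry B pullback S2 h2 F
  by (intro local_isometry.intro local_isometry_axioms.intro pullback_metric local_metric_axioms)
    (use F_smooth F_image in \<open>simp_all add: pullback_def\<close>)

text \<open>By naturality \<open>fder F x\<close> maps the Christoffel form of the pullback at
  \<open>(x, x)\<close> to the covariant acceleration of the ray's image, which is 0 for a geodesic,
  and \<open>fder F x\<close> is injective.\<close>

sublocale normal: normal_coordinates B pullback
proof (intro normal_coordinates.intro normal_coordinates_axioms.intro pullback_metric)
  show "0 \<in> B" by (rule B_0)
  fix x assume x: "x \<in> B"
  show "t *\<^sub>R x \<in> B" if "0 \<le> t" "t \<le> 1" for t by (rule B_star[OF x that])
  have "((\<lambda>t. fder F (t *\<^sub>R x) x) has_vector_derivative fder (\<lambda>y. fder F y x) (1 *\<^sub>R x) x) (at 1)"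
    by (rule smooth_on_ray_derivative[OF smooth_on_fder[OF F_smooth]]) (simp add: x)
  from vector_derivative_unique_at[OF this F_geodesic[OF x]]
  have "cov F (\<lambda>y. fder F y x) x x = 0" by (simp add: cov_def)
  then have "fder F x (christoffel pullback x x x) = 0"
    using iso.christoffel_transform[OF x, of x x] by simp
  then show "christoffel pullback x x x = 0"
    using F_inj[OF x] linear_0[OF F_linear[OF x]] by (metis injD)
qed

end

section \<open>Charts of a semi-Riemannian manifold\<close>

context smooth_manifold
begin

lemma chart_map_in: "q \<in> chart_dom c \<Longrightarrow> chart_map c q \<in> chart_ran c"
  by (simp add: chart_ran_def)

lemma chart_inv_map: "c \<in> A \<Longrightarrow> q \<in> chart_dom c \<Longrightarrow> chart_inv c (chart_map c q) = q"
  using homeomorphism_apply1[OF chart_homeomorphism] .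

lemma chart_map_inv: "c \<in> A \<Longrightarrow> x \<in> chart_ran c \<Longrightarrow> chart_map c (chart_inv c x) = x"
  using homeomorphism_apply2[OF chart_homeomorphism] .

lemma chart_inv_in: "c \<in> A \<Longrightarrow> x \<in> chart_ran c \<Longrightarrow> chart_inv c x \<in> chart_dom c"
  using homeomorphism_image2[OF chart_homeomorphism] by blast

lemma chart_map_continuous: "c \<in> A \<Longrightarrow> continuous_on (chart_dom c) (chart_map c)"
  using chart_homeomorphism by (simp add: homeomorphism_def)

lemma chart_inv_continuous: "c \<in> A \<Longrightarrow> continuous_on (chart_ran c) (chart_inv c)"
  using chart_homeomorphism by (simp add: homeomorphism_def)

lemma chart_image_open:
  assumes c: "c \<in> A" and W: "open W" "W \<subseteq> chart_dom c"
  shows "open (chart_map c ` W)"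
proof -
  have "chart_map c ` W = chart_ran c \<inter> chart_inv c -` W"
    using W(2) chart_inv_map[OF c] chart_map_inv[OF c] by (force simp: chart_ran_def)
  then show ?thesis
    using continuous_open_preimage[OF chart_inv_continuous[OF c] chart_ran_open[OF c] W(1)] by simp
qed

lemma chart_inv_image_open:
  assumes c: "c \<in> A" and W: "open W" "W \<subseteq> chart_ran c"
  shows "open (chart_inv c ` W)"
proof -
  have "chart_inv c ` W = chart_dom c \<inter> chart_map c -` W"
    using W(2) chart_inv_map[OF c] chart_map_inv[OF c] chart_inv_in[OF c] by force
  then show ?thesis
    using continuous_open_preimage[OF chart_map_continuous[OF c] chart_dom_open[OF c] W(1)] by simp
qed

definition overlap :: "('a, 'e) chart \<Rightarrow> ('a, 'e) chart \<Rightarrow> 'e set" where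
  "overlap c d = chart_map c ` (chart_dom c \<inter> chart_dom d)"

lemma overlap_open: "c \<in> A \<Longrightarrow> d \<in> A \<Longrightarrow> open (overlap c d)"
  unfolding overlap_def by (intro chart_image_open open_Int chart_dom_open) auto

lemma overlap_iff: "c \<in> A \<Longrightarrow> q \<in> chart_dom c \<Longrightarrow> chart_map c q \<in> overlap c d \<longleftrightarrow> q \<in> chart_dom d"
proof
  assume c: "c \<in> A" and q: "q \<in> chart_dom c" and "chart_map c q \<in> overlap c d"
  then obtain q' where q': "q' \<in> chart_dom c" "q' \<in> chart_dom d" "chart_map c q' = chart_map c q"
    unfolding overlap_def by auto
  then show "q \<in> chart_dom d" using chart_inv_map[OF c q] chart_inv_map[OF c q'(1)] by simp
qed (auto simp: overlap_def)

lemma overlap_subset: "overlap c d \<subseteq> chart_ran c"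
  unfolding overlap_def chart_ran_def by blast

lemma transition_smooth': "c \<in> A \<Longrightarrow> d \<in> A \<Longrightarrow> smooth_on (overlap c d) (transition c d)"
  unfolding overlap_def by (rule transition_smooth)

lemma transition_apply: "c \<in> A \<Longrightarrow> q \<in> chart_dom c \<Longrightarrow> transition c d (chart_map c q) = chart_map d q"
  by (simp add: transition_def chart_inv_map)

lemma transition_image: "c \<in> A \<Longrightarrow> d \<in> A \<Longrightarrow> transition c d ` overlap c d = overlap d c"
  unfolding overlap_def image_image
  by (rule image_cong) (auto simp: transition_apply)

lemma exists_chart: "\<exists>c\<in>A. q \<in> chart_dom c"
  using charts_cover by blast

end

context semi_riemannian_manifold
begin

lemma chart_metric: "c \<in> A \<Longrightarrow> local_metric (chart_ran c) (g c)"
  by unfold_locales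
    (simp_all add: chart_ran_open metric_smooth metric_bilinear metric_sym metric_nondegenerate)

lemma restrict_metric:
  assumes "local_metric S h" "open T" "T \<subseteq> S"
  shows "local_metric T h"
proof -
  interpret m: local_metric S h by fact
  show ?thesis
  proof
    show "smooth_on T (\<lambda>x. h x u v)" for u v by (rule smooth_on_subset[OF m.h_smooth assms(3)])
    show "h x u v = h x v u" if "x \<in> T" for x u v using m.h_sym assms(3) that by blast
  qed (use assms m.h_bilinear m.h_nondegenerate in auto)
qed

lemma transition_isometry:
  assumes c: "c \<in> A" and d: "d \<in> A"
  shows "local_isometry (overlap c d) (g c) (chart_ran d) (g d) (transition c d)"
proof (intro local_isometry.intro local_isometry_axioms.intro)
  show "local_metric (overlap c d) (g c)"
    by (rule restrict_metric[OF chart_metric[OF c] overlap_open[OF c d] overlap_subset])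
  show "local_metric (chart_ran d) (g d)" by (rule chart_metric[OF d])
  show "smooth_on (overlap c d) (transition c d)" by (rule transition_smooth'[OF c d])
  show "transition c d ` overlap c d \<subseteq> chart_ran d"
    unfolding transition_image[OF c d] by (rule overlap_subset)
  show "g c x u v = g d (transition c d x) (fder (transition c d) x u) (fder (transition c d) x v)"
    if "x \<in> overlap c d" for x u v
    by (rule metric_transformation[OF c d]) (use that in \<open>simp add: overlap_def\<close>)
qed

section \<open>Geodesics and the exponential map\<close>

text \<open>Puts the definition of a geodesic into the form of a spray equation near
  \<open>t\<close>, for which uniqueness of solutions is available.\<close>

lemma geodesic_in_chart:
  assumes \<gamma>: "geodesic_on A g I \<gamma>" and c: "c \<in> A" and t: "t \<in> I" "\<gamma> t \<in> chart_dom c"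
  shows "\<forall>\<^sub>F s in nhds t. s \<in> I \<and> \<gamma> s \<in> chart_dom c \<and>
     ((\<lambda>s. (chart_map c (\<gamma> s), velocity c \<gamma> s)) has_vector_derivative
       local_metric.spray (g c) (chart_map c (\<gamma> s), velocity c \<gamma> s)) (at s)"
proof -
  interpret m: local_metric "chart_ran c" "g c" by (rule chart_metric[OF c])
  have I: "open I" and cont: "continuous_on I \<gamma>"
    and geo: "\<And>t. t \<in> I \<Longrightarrow> \<gamma> t \<in> chart_dom c \<Longrightarrow>
        (\<forall>\<^sub>F s in nhds t. (\<lambda>s. chart_map c (\<gamma> s)) differentiable (at s)) \<and>
        (velocity c \<gamma> has_vector_derivative
           - christoffel (g c) (chart_map c (\<gamma> t)) (velocity c \<gamma> t) (velocity c \<gamma> t)) (at t)"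
    using \<gamma> c unfolding geodesic_on_def by blast+
  have "open (I \<inter> \<gamma> -` chart_dom c)"
    by (rule continuous_open_preimage[OF cont I chart_dom_open[OF c]])
  then have "\<forall>\<^sub>F s in nhds t. s \<in> I \<inter> \<gamma> -` chart_dom c"
    by (rule eventually_nhds_in_open) (use t in simp)
  then show ?thesis
  proof eventually_elim
    case (elim s)
    then have s: "s \<in> I" "\<gamma> s \<in> chart_dom c" by auto
    have "(\<lambda>s. chart_map c (\<gamma> s)) differentiable (at s)"
      using eventually_nhds_x_imp_x[OF conjunct1[OF geo[OF s]]] .
    then have "((\<lambda>s. chart_map c (\<gamma> s)) has_vector_derivative velocity c \<gamma> s) (at s)"
      unfolding velocity_def by (simp add: vector_derivative_works)
    then show ?case
      using s conjunct2[OF geo[OF s]] m.spray_solution_iff[of "\<lambda>s. chart_map c (\<gamma> s)" "velocity c \<gamma>" s] by simp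
  qed
qed

lemma geodesic_local_unique:
  assumes \<gamma>: "geodesic_on A g I \<gamma>" and \<delta>: "geodesic_on A g J \<delta>" and c: "c \<in> A" and t: "t \<in> I" "t \<in> J" "\<gamma> t \<in> chart_dom c"
    and eq: "\<gamma> t = \<delta> t" "velocity c \<gamma> t = velocity c \<delta> t"
  shows "\<forall>\<^sub>F s in nhds t. \<gamma> s = \<delta> s"
proof -
  interpret m: local_metric "chart_ran c" "g c" by (rule chart_metric[OF c])
  note e1 = geodesic_in_chart[OF \<gamma> c t(1,3)]
  note e2 = geodesic_in_chart[OF \<delta> c t(2) t(3)[unfolded eq(1)]]
  have "\<forall>\<^sub>F s in nhds t. (chart_map c (\<gamma> s), velocity c \<gamma> s) = (chart_map c (\<delta> s), velocity c \<delta> s)"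
  proof (rule ode_local_unique[OF m.spray_domain_open smooth_onD[OF m.spray_smooth]])
    show "(chart_map c (\<gamma> t), velocity c \<gamma> t) = (chart_map c (\<delta> t), velocity c \<delta> t)" using eq by simp
    show "(chart_map c (\<gamma> t), velocity c \<gamma> t) \<in> chart_ran c \<times> UNIV" using chart_map_in t by simp
  qed (use e1 e2 in \<open>auto elim: eventually_mono\<close>)
  with e1 e2 show ?thesis
  proof eventually_elim
    case (elim s)
    then show ?case using chart_inv_map[OF c] by (metis Pair_inject)
  qed
qed

lemma geodesic_unique:
  assumes \<gamma>: "geodesic_on A g I \<gamma>" and \<delta>: "geodesic_on A g J \<delta>" and c: "c \<in> A" and t0: "t0 \<in> I" "t0 \<in> J" "\<gamma> t0 \<in> chart_dom c"
    and eq: "\<gamma> t0 = \<delta> t0" "velocity c \<gamma> t0 = velocity c \<delta> t0" and t: "t \<in> I" "t \<in> J"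
  shows "\<gamma> t = \<delta> t"
proof -
  have IJ: "open (I \<inter> J)" "connected (I \<inter> J)"
    using \<gamma> \<delta> is_interval_connected_1 is_interval_Int unfolding geodesic_on_def by blast+
  \<comment> \<open>Agreement near a time rather than at it makes \<open>E\<close> open and forces
    the velocities to agree too; closedness then follows by passing to the limit in position and
    velocity and invoking local uniqueness.\<close>
  define E where "E = {t \<in> I \<inter> J. \<forall>\<^sub>F s in nhds t. \<gamma> s = \<delta> s}"
  have opE: "open E"
  proof -
    have "\<exists>T. open T \<and> t \<in> T \<and> T \<subseteq> E" if "t \<in> E" for t
    proof -
      have t: "t \<in> I \<inter> J" "\<forall>\<^sub>F s in nhds t. \<gamma> s = \<delta> s" using that by (auto simp: E_def)
      obtain T where T: "open T" "t \<in> T" "\<And>s. s \<in> T \<Longrightarrow> \<gamma> s = \<delta> s"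
        using t(2) unfolding eventually_nhds by blast
      have "T \<inter> (I \<inter> J) \<subseteq> E"
        unfolding E_def using T eventually_nhds by blast
      then show ?thesis using T t IJ(1) by (intro exI[of _ "T \<inter> (I \<inter> J)"]) auto
    qed
    then show ?thesis by (subst open_subopen) blast
  qed
  have "closedin (top_of_set (I \<inter> J)) E"
  proof (rule closedin_limpt[THEN iffD2], intro conjI allI impI)
    show "E \<subseteq> I \<inter> J" by (auto simp: E_def)
    fix t assume "t islimpt E \<and> t \<in> I \<inter> J"
    then have lim: "at t within E \<noteq> bot" and t: "t \<in> I" "t \<in> J" by (auto simp: trivial_limit_within)
    have evE: "\<forall>\<^sub>F s in at t within E. s \<in> E" by (simp add: eventually_at_filter)
    have c\<gamma>: "(\<gamma> \<longlongrightarrow> \<gamma> t) (at t within E)" and c\<delta>: "(\<delta> \<longlongrightarrow> \<delta> t) (at t within E)"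
    proof -
      have "isCont \<gamma> t" "isCont \<delta> t"
        using \<gamma> \<delta> t unfolding geodesic_on_def by (auto simp: continuous_on_eq_continuous_at)
      then show "(\<gamma> \<longlongrightarrow> \<gamma> t) (at t within E)" "(\<delta> \<longlongrightarrow> \<delta> t) (at t within E)"
        unfolding isCont_def by (auto intro: tendsto_within_subset)
    qed
    have "\<forall>\<^sub>F s in at t within E. \<gamma> s = \<delta> s"
      using evE by eventually_elim (auto simp: E_def dest: eventually_nhds_x_imp_x)
    then have "(\<delta> \<longlongrightarrow> \<gamma> t) (at t within E)" by (rule Lim_transform_eventually[OF c\<gamma>])
    then have eqt: "\<gamma> t = \<delta> t" using tendsto_unique[OF lim _ c\<delta>] by blast
    \<comment> \<open>The limit point may lie outside the domain of \<open>c\<close>, so a chart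
      around it is taken.\<close>
    obtain d where d: "d \<in> A" "\<gamma> t \<in> chart_dom d" using exists_chart by blast
    have vel_cont: "isCont (velocity d \<eta>) t" if "geodesic_on A g K \<eta>" "t \<in> K" "\<eta> t \<in> chart_dom d" for \<eta> K
    proof -
      have "isCont (\<lambda>s. (chart_map d (\<eta> s), velocity d \<eta> s)) t"
        using eventually_nhds_x_imp_x[OF geodesic_in_chart[OF that(1) d(1) that(2,3)]]
        by (intro has_vector_derivative_continuous) blast
      from continuous_snd[OF this] show ?thesis by simp
    qed
    have "(velocity d \<gamma> \<longlongrightarrow> velocity d \<gamma> t) (at t within E)" "(velocity d \<delta> \<longlongrightarrow> velocity d \<delta> t) (at t within E)"
      using vel_cont[OF \<gamma> t(1) d(2)] vel_cont[OF \<delta> t(2) d(2)[unfolded eqt]]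
      unfolding isCont_def by (auto intro: tendsto_within_subset)
    moreover have "\<forall>\<^sub>F s in at t within E. velocity d \<gamma> s = velocity d \<delta> s"
      using evE
    proof eventually_elim
      case (elim s)
      then have "\<forall>\<^sub>F r in nhds s. chart_map d (\<gamma> r) = chart_map d (\<delta> r)"
        by (auto simp: E_def elim: eventually_mono)
      then have "\<forall>\<^sub>F r in nhds s. r \<in> UNIV \<longrightarrow> chart_map d (\<gamma> r) = chart_map d (\<delta> r)" by simp
      then show ?case
        unfolding velocity_def by (rule vector_derivative_cong_eq[OF _ refl refl]) simp
    qed
    ultimately have "velocity d \<gamma> t = velocity d \<delta> t"
      using tendsto_unique[OF lim Lim_transform_eventually] by blast
    from geodesic_local_unique[OF \<gamma> \<delta> d(1) t d(2) eqt this]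
    show "t \<in> E" using t by (simp add: E_def)
  qed
  moreover have "openin (top_of_set (I \<inter> J)) E"
    using opE by (simp add: openin_open_eq[OF IJ(1)] E_def subset_iff)
  moreover have "t0 \<in> E"
    using geodesic_local_unique[OF \<gamma> \<delta> c t0 eq] t0 by (simp add: E_def)
  ultimately have "E = I \<inter> J" using IJ(2) unfolding connected_clopen by blast
  then have "t \<in> E" using t by blast
  then show ?thesis unfolding E_def using eventually_nhds_x_imp_x by blast
qed

text \<open>The factor may be any real number; factor 0 produces the constant geodesic that
  determines the exponential of the zero vector.\<close>

lemma geodesic_rescale:
  assumes \<gamma>: "geodesic_on A g I \<gamma>"
  shows "geodesic_on A g ((\<lambda>s. \<sigma> * s) -` I) (\<lambda>s. \<gamma> (\<sigma> * s))"
    and "0 \<in> I \<Longrightarrow> c \<in> A \<Longrightarrow> \<gamma> 0 \<in> chart_dom c \<Longrightarrow> velocity c (\<lambda>s. \<gamma> (\<sigma> * s)) 0 = \<sigma> *\<^sub>R velocity c \<gamma> 0"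
proof -
  have I: "open I" "is_interval I" and cont: "continuous_on I \<gamma>" using \<gamma> unfolding geodesic_on_def by blast+
  have cm: "continuous_on X (\<lambda>s::real. \<sigma> * s)" for X by (intro continuous_intros)
  have ev: "\<forall>\<^sub>F s in nhds t. ((\<lambda>s. chart_map d (\<gamma> (\<sigma> * s))) has_vector_derivative \<sigma> *\<^sub>R velocity d \<gamma> (\<sigma> * s)) (at s) \<and>
      ((\<lambda>s. \<sigma> *\<^sub>R velocity d \<gamma> (\<sigma> * s)) has_vector_derivative
        - christoffel (g d) (chart_map d (\<gamma> (\<sigma> * s))) (\<sigma> *\<^sub>R velocity d \<gamma> (\<sigma> * s)) (\<sigma> *\<^sub>R velocity d \<gamma> (\<sigma> * s))) (at s)"
    if t: "\<sigma> * t \<in> I" "d \<in> A" "\<gamma> (\<sigma> * t) \<in> chart_dom d" for t d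
  proof -
    interpret m: local_metric "chart_ran d" "g d" by (rule chart_metric[OF t(2)])
    have "isCont (\<lambda>s. \<sigma> * s) t" by (intro continuous_intros)
    then have "filterlim (\<lambda>s. \<sigma> * s) (nhds (\<sigma> * t)) (nhds t)"
      unfolding isCont_def tendsto_at_iff_tendsto_nhds[of "\<lambda>s. \<sigma> * s" t] .
    from eventually_compose_filterlim[OF geodesic_in_chart[OF \<gamma> t(2,1,3)] this]
    show ?thesis
    proof eventually_elim
      case (elim s)
      have "((\<lambda>r. (chart_map d (\<gamma> (\<sigma> * r)), \<sigma> *\<^sub>R velocity d \<gamma> (\<sigma> * r))) has_vector_derivative
         m.spray (chart_map d (\<gamma> (\<sigma> * s)), \<sigma> *\<^sub>R velocity d \<gamma> (\<sigma> * s))) (at s)"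
        by (rule m.spray_scale[where x = "\<lambda>s. chart_map d (\<gamma> s)" and v = "velocity d \<gamma>" and \<sigma> = \<sigma>])
          (use elim in \<open>simp_all add: chart_map_in\<close>)
      then show ?case
        unfolding m.spray_solution_iff[of "\<lambda>s. chart_map d (\<gamma> (\<sigma> * s))" "\<lambda>s. \<sigma> *\<^sub>R velocity d \<gamma> (\<sigma> * s)" s] .
    qed
  qed
  have vel: "velocity d (\<lambda>s. \<gamma> (\<sigma> * s)) s = \<sigma> *\<^sub>R velocity d \<gamma> (\<sigma> * s)"
    if "\<sigma> * s \<in> I" "d \<in> A" "\<gamma> (\<sigma> * s) \<in> chart_dom d" for s d
    unfolding velocity_def[of d "\<lambda>s. \<gamma> (\<sigma> * s)"]
    by (rule vector_derivative_at[OF conjunct1[OF eventually_nhds_x_imp_x[OF ev[OF that]]]])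
  show "velocity c (\<lambda>s. \<gamma> (\<sigma> * s)) 0 = \<sigma> *\<^sub>R velocity c \<gamma> 0"
    if "0 \<in> I" "c \<in> A" "\<gamma> 0 \<in> chart_dom c"
    using vel[of 0 c] that by simp
  show "geodesic_on A g ((\<lambda>s. \<sigma> * s) -` I) (\<lambda>s. \<gamma> (\<sigma> * s))"
    unfolding geodesic_on_def
  proof (intro conjI ballI impI)
    show op: "open ((\<lambda>s. \<sigma> * s) -` I)"
      using continuous_open_preimage[OF cm open_UNIV I(1)] by simp
    show "is_interval ((\<lambda>s. \<sigma> * s) -` I)"
      unfolding is_interval_1
    proof (intro ballI allI impI)
      fix a b x assume ab: "a \<in> (\<lambda>s. \<sigma> * s) -` I" "b \<in> (\<lambda>s. \<sigma> * s) -` I" and x: "a \<le> x \<and> x \<le> b"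
      have "\<sigma> * a \<le> \<sigma> * x \<and> \<sigma> * x \<le> \<sigma> * b \<or> \<sigma> * b \<le> \<sigma> * x \<and> \<sigma> * x \<le> \<sigma> * a"
        using x by (cases "\<sigma> \<ge> 0") (auto simp: mult_left_mono mult_left_mono_neg)
      then show "x \<in> (\<lambda>s. \<sigma> * s) -` I"
        using ab mem_is_interval_1_I[OF I(2)] by (metis vimageE vimageI2)
    qed
    show "continuous_on ((\<lambda>s. \<sigma> * s) -` I) (\<lambda>s. \<gamma> (\<sigma> * s))"
      by (rule continuous_on_compose2[OF cont cm]) auto
    fix t d assume t: "t \<in> (\<lambda>s. \<sigma> * s) -` I" and d: "d \<in> A" "\<gamma> (\<sigma> * t) \<in> chart_dom d"
    then have tI: "\<sigma> * t \<in> I" by simp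
    show "\<forall>\<^sub>F s in nhds t. (\<lambda>s. chart_map d (\<gamma> (\<sigma> * s))) differentiable (at s)"
      using ev[OF tI d] by eventually_elim (rule differentiableI_vector[OF conjunct1])
    have "open ((\<lambda>s. \<sigma> * s) -` I \<inter> (\<lambda>s. \<gamma> (\<sigma> * s)) -` chart_dom d)"
      by (rule continuous_open_preimage[OF _ op chart_dom_open[OF d(1)]])
        (rule continuous_on_compose2[OF cont cm], auto)
    then have "\<forall>\<^sub>F s in nhds t. s \<in> (\<lambda>s. \<sigma> * s) -` I \<inter> (\<lambda>s. \<gamma> (\<sigma> * s)) -` chart_dom d"
      by (rule eventually_nhds_in_open) (use t d in simp)
    then have "\<forall>\<^sub>F s in nhds t. \<sigma> *\<^sub>R velocity d \<gamma> (\<sigma> * s) = velocity d (\<lambda>s. \<gamma> (\<sigma> * s)) s"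
      by eventually_elim (simp add: vel d)
    from has_vector_derivative_eventually_cong[OF conjunct2[OF eventually_nhds_x_imp_x[OF ev[OF tI d]]] this]
    show "(velocity d (\<lambda>s. \<gamma> (\<sigma> * s)) has_vector_derivative
           - christoffel (g d) (chart_map d (\<gamma> (\<sigma> * t))) (velocity d (\<lambda>s. \<gamma> (\<sigma> * s)) t) (velocity d (\<lambda>s. \<gamma> (\<sigma> * s)) t)) (at t)"
      unfolding vel[OF tI d] .
  qed
qed

text \<open>Uniqueness of geodesics gives the definite description in \<open>exp_map\<close> its
  value.\<close>

lemma exp_map_eq:
  assumes c: "c \<in> A" "p \<in> chart_dom c" and \<gamma>: "is_exp_geodesic A g c p v \<gamma>"
  shows "exp_map A g c p v = \<gamma> 1"
  unfolding exp_map_def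
proof (rule the_equality)
  show "\<exists>\<gamma>'. is_exp_geodesic A g c p v \<gamma>' \<and> \<gamma> 1 = \<gamma>' 1" using \<gamma> by blast
  fix q assume "\<exists>\<delta>. is_exp_geodesic A g c p v \<delta> \<and> q = \<delta> 1"
  then obtain \<delta> where \<delta>: "is_exp_geodesic A g c p v \<delta>" "q = \<delta> 1" by blast
  obtain I where I: "geodesic_on A g I \<gamma>" "{0..1} \<subseteq> I" "\<gamma> 0 = p" "velocity c \<gamma> 0 = v"
    using \<gamma> unfolding is_exp_geodesic_def by blast
  obtain J where J: "geodesic_on A g J \<delta>" "{0..1} \<subseteq> J" "\<delta> 0 = p" "velocity c \<delta> 0 = v"
    using \<delta> unfolding is_exp_geodesic_def by blast
  have "\<gamma> 1 = \<delta> 1"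
    by (rule geodesic_unique[OF I(1) J(1) c(1), of 0]) (use I J c in auto)
  then show "q = \<gamma> 1" using \<delta>(2) by simp
qed

lemma is_exp_geodesic_rescale:
  assumes c: "c \<in> A" "p \<in> chart_dom c" and \<gamma>: "is_exp_geodesic A g c p v \<gamma>" and t: "t \<in> {0..1}"
  shows "is_exp_geodesic A g c p (t *\<^sub>R v) (\<lambda>s. \<gamma> (t * s))"
proof -
  obtain I where I: "geodesic_on A g I \<gamma>" "{0..1} \<subseteq> I" "\<gamma> 0 = p" "velocity c \<gamma> 0 = v"
    using \<gamma> unfolding is_exp_geodesic_def by blast
  have "{0..1} \<subseteq> (\<lambda>s. t * s) -` I"
  proof
    fix s :: real assume "s \<in> {0..1}"
    then have "t * s \<in> {0..1}" using t by (simp add: mult_le_one)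
    then show "s \<in> (\<lambda>s. t * s) -` I" using I(2) by blast
  qed
  moreover have "velocity c (\<lambda>s. \<gamma> (t * s)) 0 = t *\<^sub>R v"
  proof -
    have "0 \<in> I" using I(2) by auto
    from geodesic_rescale(2)[OF I(1) this c(1), of t] show ?thesis using I(3,4) c(2) by simp
  qed
  ultimately show ?thesis
    unfolding is_exp_geodesic_def using geodesic_rescale(1)[OF I(1), of t] I(3) by auto
qed

text \<open>A coordinate geodesic in one chart is a geodesic in all charts by the transformation law of
  the Christoffel form.\<close>

lemma geodesic_on_chart_inv:
  assumes c: "c \<in> A" and I: "open I" "is_interval I"
    and x: "\<And>t. t \<in> I \<Longrightarrow> x t \<in> chart_ran c" "\<And>t. t \<in> I \<Longrightarrow> (x has_vector_derivative v t) (at t)"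
      "\<And>t. t \<in> I \<Longrightarrow> (v has_vector_derivative - christoffel (g c) (x t) (v t) (v t)) (at t)"
  shows "geodesic_on A g I (\<lambda>t. chart_inv c (x t))"
    and "t \<in> I \<Longrightarrow> velocity c (\<lambda>t. chart_inv c (x t)) t = v t"
proof -
  let ?\<gamma> = "\<lambda>t. chart_inv c (x t)"
  have cx: "continuous_on I x"
    by (intro continuous_at_imp_continuous_on ballI has_vector_derivative_continuous[OF x(2)])
  have c\<gamma>: "continuous_on I ?\<gamma>"
    by (rule continuous_on_compose2[OF chart_inv_continuous[OF c] cx]) (use x(1) in auto)
  have ev: "\<forall>\<^sub>F s in nhds t. s \<in> I \<and> x s \<in> overlap c d" if t: "t \<in> I" "d \<in> A" "?\<gamma> t \<in> chart_dom d" for t d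
  proof -
    have "open (I \<inter> ?\<gamma> -` chart_dom d)" by (rule continuous_open_preimage[OF c\<gamma> I(1) chart_dom_open[OF t(2)]])
    then have "\<forall>\<^sub>F s in nhds t. s \<in> I \<inter> ?\<gamma> -` chart_dom d"
      by (rule eventually_nhds_in_open) (use t in simp)
    then show ?thesis
    proof eventually_elim
      case (elim s)
      then have "chart_map c (?\<gamma> s) \<in> overlap c d"
        using overlap_iff[OF c chart_inv_in[OF c x(1)]] by simp
      then show ?case using elim chart_map_inv[OF c x(1)] by simp
    qed
  qed
  have der: "((\<lambda>s. chart_map d (?\<gamma> s)) has_vector_derivative fder (transition c d) (x s) (v s)) (at s)"
    if s: "s \<in> I" "d \<in> A" "x s \<in> overlap c d" for s d
  proof -
    have "((transition c d) has_derivative fder (transition c d) (x s)) (at (x s))"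
      by (rule smooth_on_has_derivative[OF transition_smooth'[OF c s(2)] s(3)])
    from vector_derivative_diff_chain_within[OF x(2)[OF s(1)] has_derivative_at_withinI[OF this]]
    show ?thesis by (simp add: transition_def o_def)
  qed
  have vel: "velocity d ?\<gamma> s = fder (transition c d) (x s) (v s)" if "s \<in> I" "d \<in> A" "x s \<in> overlap c d" for s d
    unfolding velocity_def by (rule vector_derivative_at[OF der[OF that]])
  show "geodesic_on A g I ?\<gamma>"
    unfolding geodesic_on_def
  proof (intro conjI ballI impI I c\<gamma>)
    fix t d assume t: "t \<in> I" "d \<in> A" "?\<gamma> t \<in> chart_dom d"
    show "\<forall>\<^sub>F s in nhds t. (\<lambda>s. chart_map d (?\<gamma> s)) differentiable (at s)"
      using ev[OF t]     proof eventually_elim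
      case (elim s)
      then show ?case using differentiableI_vector[OF der[OF _ t(2), of s]] by blast
    qed
    have xt: "x t \<in> overlap c d" using eventually_nhds_x_imp_x[OF ev[OF t]] by blast
    interpret iso: local_isometry "overlap c d" "g c" "chart_ran d" "g d" "transition c d"
      by (rule transition_isometry[OF c t(2)])
    let ?\<psi> = "transition c d"
    have "((\<lambda>s. fder ?\<psi> (x s) (v s)) has_vector_derivative
       fder (\<lambda>y. fder ?\<psi> y (v t)) (x t) (v t) + fder ?\<psi> (x t) (- christoffel (g c) (x t) (v t) (v t))) (at t)"
    proof -
      obtain T where T: "open T" "t \<in> T" "\<And>s. s \<in> T \<Longrightarrow> s \<in> I \<and> x s \<in> overlap c d"
        using ev[OF t] unfolding eventually_nhds by blast
      have dx: "(x has_derivative (\<lambda>r. r *\<^sub>R v t)) (at t)" using x(2)[OF t(1)] by (simp add: has_vector_derivative_def)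
      have 1: "((\<lambda>s. fder ?\<psi> (x s) u) has_derivative (\<lambda>r. fder (\<lambda>y. fder ?\<psi> y u) (x t) (r *\<^sub>R v t))) (at t)" for u
        by (rule has_derivative_compose[OF dx smooth_on_has_derivative[OF smooth_on_fder[OF iso.\<psi>_smooth] xt]])
      have 2: "(v has_derivative (\<lambda>r. r *\<^sub>R - christoffel (g c) (x t) (v t) (v t))) (at t)"
        using x(3)[OF t(1)] by (simp only: has_vector_derivative_def)
      have lin: "linear (fder (\<lambda>y. fder ?\<psi> y u) (x t))" for u
        by (rule has_derivative_linear[OF smooth_on_has_derivative[OF smooth_on_fder[OF iso.\<psi>_smooth] xt]])
      have "((\<lambda>s. fder ?\<psi> (x s) (v s)) has_derivative
         (\<lambda>r. fder (\<lambda>y. fder ?\<psi> y (v t)) (x t) (r *\<^sub>R v t) + fder ?\<psi> (x t) (r *\<^sub>R - christoffel (g c) (x t) (v t) (v t)))) (at t)"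
        by (rule has_derivative_linear_family[where L = "\<lambda>s. fder ?\<psi> (x s)" and L' = "\<lambda>r u. fder (\<lambda>y. fder ?\<psi> y u) (x t) (r *\<^sub>R v t)"
              and z = v, OF T(1,2) _ 1 2]) (use T(3) iso.\<psi>_linear in blast)
      then show ?thesis
        unfolding has_vector_derivative_def
        by (simp only: linear_scale[OF lin] linear_scale[OF iso.\<psi>_linear[OF xt]] scaleR_add_right)
    qed
    \<comment> \<open>The second derivative of the transition map is exactly the discrepancy between
      the two Christoffel forms.\<close>
    moreover have "fder (\<lambda>y. fder ?\<psi> y (v t)) (x t) (v t) + fder ?\<psi> (x t) (- christoffel (g c) (x t) (v t) (v t))
       = - christoffel (g d) (?\<psi> (x t)) (fder ?\<psi> (x t) (v t)) (fder ?\<psi> (x t) (v t))"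
      using iso.christoffel_transform[OF xt, of "v t" "v t"]
      by (simp add: linear_neg[OF iso.\<psi>_linear[OF xt]] iso.M2.cov_def)
    ultimately have "((\<lambda>s. fder ?\<psi> (x s) (v s)) has_vector_derivative
       - christoffel (g d) (?\<psi> (x t)) (fder ?\<psi> (x t) (v t)) (fder ?\<psi> (x t) (v t))) (at t)" by simp
    moreover have "\<forall>\<^sub>F s in nhds t. fder ?\<psi> (x s) (v s) = velocity d ?\<gamma> s"
      using ev[OF t] by eventually_elim (simp add: vel t(2))
    ultimately have "(velocity d ?\<gamma> has_vector_derivative
       - christoffel (g d) (?\<psi> (x t)) (fder ?\<psi> (x t) (v t)) (fder ?\<psi> (x t) (v t))) (at t)"
      by (rule has_vector_derivative_eventually_cong)
    moreover have "?\<psi> (x t) = chart_map d (?\<gamma> t)" by (simp add: transition_def)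
    ultimately show "(velocity d ?\<gamma> has_vector_derivative
           - christoffel (g d) (chart_map d (?\<gamma> t)) (velocity d ?\<gamma> t) (velocity d ?\<gamma> t)) (at t)"
      by (simp add: vel[OF t(1,2) xt])
  qed
  show "velocity c ?\<gamma> t = v t" if t: "t \<in> I"
  proof -
    have "\<forall>\<^sub>F s in nhds t. s \<in> I" by (rule eventually_nhds_in_open[OF I(1) t])
    then have "\<forall>\<^sub>F s in nhds t. x s = chart_map c (?\<gamma> s)"
      by eventually_elim (simp add: chart_map_inv[OF c x(1)])
    from has_vector_derivative_eventually_cong[OF x(2)[OF t] this]
    show ?thesis unfolding velocity_def by (rule vector_derivative_at)
  qed
qed

end

section \<open>Geodesic spheres in coordinates\<close>

text \<open>Only the value of \<open>\<xi>\<close> at the point and its derivative in one direction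
  enter. So this serves for the explicit radial field as well as for a unit normal field that is
  controlled along the sphere only.\<close>

lemma (in local_isometry) nabla_radial:
  assumes x: "x \<in> S1" and \<xi>: "\<xi> (\<psi> x) = c *\<^sub>R fder \<psi> x x"
    and d\<xi>: "fder \<xi> (\<psi> x) (fder \<psi> x w) = c *\<^sub>R fder (\<lambda>x. fder \<psi> x x) x w"
  shows "nabla h2 (\<lambda>_. fder \<psi> x w) \<xi> (\<psi> x) = c *\<^sub>R fder \<psi> x (w + christoffel h1 x w x)"
proof -
  have "\<psi> x \<in> S2" using x \<psi>_image by blast
  note b = M2.\<Gamma>_bilinear[OF this]
  have "M2.cov \<psi> (\<lambda>x. fder \<psi> x x) x w = fder \<psi> x (fder (\<lambda>x. x) x w + christoffel h1 x w x)"
    by (rule cov_transform[OF x M1.open_S x order_refl smooth_on_ident[OF M1.open_S]])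
  moreover have "fder (\<lambda>x. x) x w = w"
    by (rule fun_cong[OF fder_eqI[OF has_derivative_ident]])
  ultimately have "fder (\<lambda>x. fder \<psi> x x) x w + M2.\<Gamma> (\<psi> x) (fder \<psi> x w) (fder \<psi> x x)
      = fder \<psi> x (w + christoffel h1 x w x)"
    by (simp add: M2.cov_def)
  from arg_cong[OF this, of "\<lambda>v. c *\<^sub>R v"] show ?thesis
    unfolding nabla_def \<xi> d\<xi> by (simp add: bilinear_rmul[OF b] scaleR_right_distrib)
qed

lemma (in normal_coordinates) level_set_velocity_normal:
  fixes \<beta> :: "real \<Rightarrow> 'e"
  assumes \<beta>: "(\<beta> has_vector_derivative w) (at 0)" and Q: "\<forall>\<^sub>F s in nhds 0. h 0 (\<beta> s) (\<beta> s) = r"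
  shows "h 0 (\<beta> 0) w = 0"
proof -
  have bb: "bounded_bilinear (h 0)"
    using h_bilinear[OF U_0] by (simp add: bilinear_conv_bounded_bilinear)
  have "((\<lambda>s. h 0 (\<beta> s) (\<beta> s)) has_vector_derivative h 0 (\<beta> 0) w + h 0 w (\<beta> 0)) (at 0)"
    by (rule bounded_bilinear.has_vector_derivative[OF bb \<beta> \<beta>])
  from has_vector_derivative_eventually_cong[OF this Q]
  have "((\<lambda>s. r) has_vector_derivative h 0 (\<beta> 0) w + h 0 w (\<beta> 0)) (at 0)" .
  from vector_derivative_unique_at[OF this has_vector_derivative_const]
  show ?thesis using h_sym[OF U_0, of w "\<beta> 0"] by simp
qed

text \<open>A domain of the chart may see only a part of the normal neighbourhood, hence the set S1.\<close>

locale normal_parametrization = local_isometry S1 h1 S2 h2 \<psi> + normal: normal_coordinates U h1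
  for S1 :: "'e::euclidean_space set" and h1 and S2 :: "'e set" and h2 and \<psi> and U +
  fixes G :: "'e \<Rightarrow> 'e"
  assumes S1_subset: "S1 \<subseteq> U" and image_open: "open (\<psi> ` S1)"
    and G_smooth: "smooth_on (\<psi> ` S1) G" and G_inv: "x \<in> S1 \<Longrightarrow> G (\<psi> x) = x"
begin

text \<open>The position vector in normal coordinates, carried over by \<open>\<psi>\<close>. On the
  sphere its square is \<open>r\<close>, which explains the factor; keeping the same factor off the
  sphere gives a smooth field on an open set.\<close>

definition radial_field :: "real \<Rightarrow> 'e \<Rightarrow> 'e" where
  "radial_field r y = (1 / sqrt \<bar>r\<bar>) *\<^sub>R fder \<psi> (G y) (G y)"

lemma radial_field_smooth: "smooth_on (\<psi> ` S1) (radial_field r)"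
proof -
  have "smooth_on S1 (\<lambda>x. (1 / sqrt \<bar>r\<bar>) *\<^sub>R fder \<psi> x x)"
    by (rule smooth_on_linear_comp[OF M1.open_S bounded_linear_scaleR_right
          smooth_on_fder_family[OF M1.open_S \<psi>_smooth smooth_on_ident[OF M1.open_S]]])
  from smooth_on_compose[OF image_open M1.open_S _ this G_smooth] show ?thesis
    unfolding radial_field_def by (simp add: image_subset_iff G_inv)
qed

text \<open>A curve in the sphere is pulled back by \<open>G\<close> to a curve on the quadric
  \<open>h1 0 x x = r\<close>, whose velocity is orthogonal to the position vector at the centre
  metric.\<close>

lemma tangent_vector_of_sphere:
  assumes N: "chart_map c ` (\<Sigma> \<inter> chart_dom c) = \<psi> ` {x \<in> S1. h1 0 x x = r}"
    and x: "x \<in> S1" and X: "X \<in> tangent_space c \<Sigma> (\<psi> x)"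
  obtains w where "X = fder \<psi> x w" "h1 0 x w = 0"
proof -
  obtain \<alpha> \<delta> where \<delta>: "\<delta> > 0" and \<alpha>: "smooth_on {-\<delta><..<\<delta>} \<alpha>" "\<alpha> ` {-\<delta><..<\<delta>} \<subseteq> \<psi> ` {x \<in> S1. h1 0 x x = r}"
      "\<alpha> 0 = \<psi> x" "(\<alpha> has_vector_derivative X) (at 0)"
    using X unfolding tangent_space_def N by blast
  have ev: "\<forall>\<^sub>F s in nhds 0. s \<in> {-\<delta><..<\<delta>}" by (rule eventually_nhds_in_open) (use \<delta> in auto)
  have img: "G (\<alpha> s) \<in> S1 \<and> h1 0 (G (\<alpha> s)) (G (\<alpha> s)) = r \<and> \<psi> (G (\<alpha> s)) = \<alpha> s" if "s \<in> {-\<delta><..<\<delta>}" for s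
  proof -
    have "\<alpha> s \<in> \<psi> ` {x \<in> S1. h1 0 x x = r}" by (rule subsetD[OF \<alpha>(2) imageI[OF that]])
    then show ?thesis by (auto simp: G_inv)
  qed
  define w where "w = fder G (\<psi> x) X"
  have "\<psi> x \<in> \<psi> ` S1" using x by blast
  from smooth_on_has_derivative[OF G_smooth this]
  have "(G has_derivative fder G (\<psi> x)) (at (\<alpha> 0))" by (simp add: \<alpha>(3))
  from vector_derivative_diff_chain_within[OF \<alpha>(4) has_derivative_at_withinI[OF this]]
  have G\<alpha>: "((\<lambda>s. G (\<alpha> s)) has_vector_derivative w) (at 0)" by (simp add: o_def w_def)
  have G\<alpha>0: "G (\<alpha> 0) = x" by (simp add: \<alpha>(3) G_inv x)
  have "(\<psi> has_derivative fder \<psi> x) (at (G (\<alpha> 0)))"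
    unfolding G\<alpha>0 by (rule smooth_on_has_derivative[OF \<psi>_smooth x])
  from vector_derivative_diff_chain_within[OF G\<alpha> has_derivative_at_withinI[OF this]]
  have 1: "((\<lambda>s. \<psi> (G (\<alpha> s))) has_vector_derivative fder \<psi> x w) (at 0)" by (simp add: o_def)
  have 2: "\<forall>\<^sub>F s in nhds 0. \<psi> (G (\<alpha> s)) = \<alpha> s" using ev by eventually_elim (use img in blast)
  have "X = fder \<psi> x w"
    by (rule vector_derivative_unique_at[OF \<alpha>(4) has_vector_derivative_eventually_cong[OF 1 2]])
  moreover have "\<forall>\<^sub>F s in nhds 0. h1 0 (G (\<alpha> s)) (G (\<alpha> s)) = r"
    using ev by eventually_elim (use img in blast)
  from normal.level_set_velocity_normal[OF G\<alpha> this] have "h1 0 x w = 0" by (simp add: G\<alpha>0)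
  ultimately show thesis by (rule that)
qed

text \<open>\<open>gauss_radial\<close> gives the square \<open>r / \<bar>r\<bar>\<close>, so
  spheres of either causal character are treated alike; \<open>gauss_lemma\<close> gives
  orthogonality.\<close>

lemma radial_field_unit_normal:
  assumes N: "chart_map c ` (\<Sigma> \<inter> chart_dom c) = \<psi> ` {x \<in> S1. h1 0 x x = r}"
    and S2: "S2 = chart_ran c" and r: "r \<noteq> 0"
  shows "unit_normal_field h2 c \<Sigma> (\<psi> ` S1) (radial_field r)"
  unfolding unit_normal_field_def N
proof (intro conjI image_open radial_field_smooth ballI)
  show "\<psi> ` S1 \<subseteq> chart_ran c" using \<psi>_image S2 by blast
  fix y assume "y \<in> \<psi> ` S1 \<inter> \<psi> ` {x \<in> S1. h1 0 x x = r}"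
  then obtain x where x: "x \<in> S1" "h1 0 x x = r" "y = \<psi> x" by blast
  note b = M2.h_bilinear[of "\<psi> x"]
  have \<psi>x: "\<psi> x \<in> S2" using x \<psi>_image by blast
  have xU: "x \<in> U" using x S1_subset by blast
  have \<xi>: "radial_field r y = (1 / sqrt \<bar>r\<bar>) *\<^sub>R fder \<psi> x x" by (simp add: radial_field_def x G_inv)
  have "h2 y (radial_field r y) (radial_field r y) = (1 / sqrt \<bar>r\<bar>) * ((1 / sqrt \<bar>r\<bar>) * h1 x x x)"
    unfolding \<xi> isometric[OF x(1)] unfolding x(3) by (simp only: bilinear_lmul[OF b[OF \<psi>x]] bilinear_rmul[OF b[OF \<psi>x]] real_scaleR_def)
  also have "\<dots> = r / \<bar>r\<bar>" by (simp add: normal.gauss_radial[OF xU] x(2))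
  finally show "\<bar>h2 y (radial_field r y) (radial_field r y)\<bar> = 1" using r by simp
  fix X assume "X \<in> tangent_space c \<Sigma> y"
  then obtain w where w: "X = fder \<psi> x w" "h1 0 x w = 0"
    unfolding x(3) by (rule tangent_vector_of_sphere[OF N x(1)])
  have "h2 y (radial_field r y) X = (1 / sqrt \<bar>r\<bar>) * h1 x x w"
    unfolding \<xi> w(1) isometric[OF x(1)] unfolding x(3) by (simp only: bilinear_lmul[OF b[OF \<psi>x]] real_scaleR_def)
  then show "h2 y (radial_field r y) X = 0" by (simp add: normal.gauss_lemma[OF xU] w(2))
qed

text \<open>The covariant derivative of the position vector in direction \<open>w\<close> is
  \<open>w + christoffel h1 x w x\<close>, and \<open>\<psi>\<close> carries it over.\<close>

lemma shape_operator_radial_field: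
  assumes x: "x \<in> S1"
  shows "shape_operator h2 (radial_field r) (\<psi> x) (fder \<psi> x w)
    = - (1 / sqrt \<bar>r\<bar>) *\<^sub>R fder \<psi> x (w + christoffel h1 x w x)"
proof -
  have \<psi>x: "\<psi> x \<in> \<psi> ` S1" using x by blast
  have 1: "((\<lambda>x. radial_field r (\<psi> x)) has_derivative (\<lambda>w. fder (radial_field r) (\<psi> x) (fder \<psi> x w))) (at x)"
    by (rule has_derivative_compose[OF smooth_on_has_derivative[OF \<psi>_smooth x]
          smooth_on_has_derivative[OF radial_field_smooth \<psi>x]])
  have 2: "((\<lambda>x. (1 / sqrt \<bar>r\<bar>) *\<^sub>R fder \<psi> x x) has_derivative (\<lambda>w. (1 / sqrt \<bar>r\<bar>) *\<^sub>R fder (\<lambda>x. fder \<psi> x x) x w)) (at x)"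
    by (rule has_derivative_scaleR_right[OF smooth_on_has_derivative[OF
          smooth_on_fder_family[OF M1.open_S \<psi>_smooth smooth_on_ident[OF M1.open_S]] x]])
  have "((\<lambda>x. radial_field r (\<psi> x)) has_derivative (\<lambda>w. (1 / sqrt \<bar>r\<bar>) *\<^sub>R fder (\<lambda>x. fder \<psi> x x) x w)) (at x)"
    by (rule has_derivative_transform_within_open[OF 2 M1.open_S x]) (simp add: radial_field_def G_inv)
  from has_derivative_unique[OF 1 this]
  have "fder (radial_field r) (\<psi> x) (fder \<psi> x w) = (1 / sqrt \<bar>r\<bar>) *\<^sub>R fder (\<lambda>x. fder \<psi> x x) x w"
    by (rule fun_cong)
  from nabla_radial[OF x _ this] show ?thesis
    by (simp add: shape_operator_def radial_field_def G_inv x)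
qed

lemma sphere_umbilical:
  assumes N: "chart_map c ` (\<Sigma> \<inter> chart_dom c) = \<psi> ` {x \<in> S1. h1 0 x x = r}"
    and K: "\<And>x. x \<in> U \<Longrightarrow> normal.constant_curvature_at K x"
    and x: "x \<in> S1" and X: "X \<in> tangent_space c \<Sigma> (\<psi> x)"
  shows "\<exists>\<kappa>. shape_operator h2 (radial_field r) (\<psi> x) X = \<kappa> *\<^sub>R X"
proof -
  obtain w where w: "X = fder \<psi> x w" "h1 0 x w = 0" by (rule tangent_vector_of_sphere[OF N x X])
  have "x \<in> U" using x S1_subset by blast
  from normal.constant_curvature_imp_umbilical[OF K this w(2)]
  obtain \<mu> where \<mu>: "christoffel h1 x w x = \<mu> *\<^sub>R w" by blast
  have "w + \<mu> *\<^sub>R w = (1 + \<mu>) *\<^sub>R w" by (simp add: scaleR_left_distrib)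
  then have "shape_operator h2 (radial_field r) (\<psi> x) X = (- (1 / sqrt \<bar>r\<bar>) * (1 + \<mu>)) *\<^sub>R X"
    unfolding w(1) shape_operator_radial_field[OF x] \<mu> by (simp add: linear_scale[OF \<psi>_linear[OF x]])
  then show ?thesis by blast
qed

end

section \<open>Geodesic spheres with an arbitrary unit normal field\<close>

context radial_geodesic_map
begin

text \<open>The line \<open>x + s *\<^sub>R w\<close> is scaled back to the quadric. Since
  \<open>w\<close> is orthogonal to \<open>x\<close>, the scaling factor is constant to first order,
  and the velocity at 0 remains \<open>w\<close>.\<close>

lemma normalized_curve:
  assumes x: "x \<in> B" "pullback 0 x x = r" "r \<noteq> 0" and w: "pullback 0 x w = 0"
  obtains \<delta> \<beta> where "\<delta> > 0" "smooth_on {-\<delta><..<\<delta>} \<beta>" "\<beta> 0 = x" "(\<beta> has_vector_derivative w) (at 0)"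
    "\<And>s. s \<in> {-\<delta><..<\<delta>} \<Longrightarrow> \<beta> s \<in> B \<and> pullback 0 (\<beta> s) (\<beta> s) = r"
proof -
  note b = iso.M1.h_bilinear[OF B_0]
  define q where "q s = r + s * s * pullback 0 w w" for s
  have q: "pullback 0 (x + s *\<^sub>R w) (x + s *\<^sub>R w) = q s" for s
    unfolding bilinear_ladd[OF b] bilinear_radd[OF b] bilinear_lmul[OF b] bilinear_rmul[OF b] q_def
      iso.M1.h_sym[OF B_0, of w x] w x(2) by simp
  define \<rho> where "\<rho> s = r / q s" for s
  define \<beta> where "\<beta> s = sqrt (\<rho> s) *\<^sub>R (x + s *\<^sub>R w)" for s
  have qcont: "continuous_on X q" for X unfolding q_def by (intro continuous_intros)
  \<comment> \<open>Where \<open>q s\<close> has the sign of \<open>r\<close>, the quotient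
    \<open>\<rho> s\<close> is positive and its root smooth.\<close>
  define J where "J = {s. r * q s > 0}"
  have J: "open J" unfolding J_def by (intro open_Collect_less continuous_intros qcont)
  have J0: "0 \<in> J" using x(3) by (auto simp: J_def q_def zero_less_mult_iff)
  have \<rho>pos: "\<rho> s > 0" if "s \<in> J" for s
    using that unfolding J_def \<rho>_def by (auto simp: zero_less_mult_iff zero_less_divide_iff)
  have q_smooth: "smooth_on J q"
    unfolding q_def by (intro smooth_on_add smooth_on_mult smooth_on_const smooth_on_ident J)
  have \<rho>_smooth: "smooth_on J \<rho>"
    unfolding \<rho>_def by (rule smooth_on_divide[OF J smooth_on_const q_smooth]) (auto simp: J_def)
  have "smooth_on J (\<lambda>s. sqrt (\<rho> s))"
    by (rule smooth_on_compose[OF J _ _ smooth_on_sqrt \<rho>_smooth]) (use \<rho>pos in auto)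
  then have \<beta>_smooth: "smooth_on J \<beta>"
    unfolding \<beta>_def by (intro smooth_on_scaleR smooth_on_add smooth_on_const smooth_on_ident J)
  have \<beta>0: "\<beta> 0 = x" using x(3) by (simp add: \<beta>_def \<rho>_def q_def)
  have \<rho>0: "\<rho> 0 = 1" using x(3) by (simp add: \<rho>_def q_def)
  have d\<rho>: "(\<rho> has_real_derivative 0) (at 0)"
    unfolding \<rho>_def q_def by (rule derivative_eq_intros | use x(3) in simp)+
  have "((\<lambda>s. sqrt (\<rho> s)) has_real_derivative 0) (at 0)"
    using DERIV_chain2[OF DERIV_real_sqrt d\<rho>] by (simp add: \<rho>0)
  then have d\<beta>: "(\<beta> has_vector_derivative w) (at 0)"
    unfolding \<beta>_def using d\<rho> by (auto intro!: derivative_eq_intros simp: \<rho>0)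
  have "open (J \<inter> \<beta> -` B)"
    by (rule continuous_open_preimage[OF smooth_on_imp_continuous_on[OF \<beta>_smooth] J B_open])
  moreover have "0 \<in> J \<inter> \<beta> -` B" using J0 x(1) \<beta>0 by simp
  ultimately obtain \<delta> where \<delta>: "\<delta> > 0" "ball 0 \<delta> \<subseteq> J \<inter> \<beta> -` B" using open_contains_ball by blast
  have sub: "{-\<delta><..<\<delta>} \<subseteq> J \<inter> \<beta> -` B" using \<delta>(2) by (auto simp: ball_eq_greaterThanLessThan)
  show thesis
  proof (rule that[OF \<delta>(1) _ \<beta>0 d\<beta>])
    show "smooth_on {-\<delta><..<\<delta>} \<beta>" by (rule smooth_on_subset[OF \<beta>_smooth]) (use sub in blast)
    fix s assume "s \<in> {-\<delta><..<\<delta>}"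
    then have s: "s \<in> J" "\<beta> s \<in> B" using sub by auto
    have "pullback 0 (\<beta> s) (\<beta> s) = sqrt (\<rho> s) * (sqrt (\<rho> s) * q s)"
      unfolding \<beta>_def by (simp only: bilinear_lmul[OF b] bilinear_rmul[OF b] q real_scaleR_def)
    also have "\<dots> = \<rho> s * q s" using \<rho>pos[OF s(1)] by simp
    also have "\<dots> = r" using s(1) by (auto simp: J_def \<rho>_def)
    finally show "\<beta> s \<in> B \<and> pullback 0 (\<beta> s) (\<beta> s) = r" using s(2) by simp
  qed
qed

lemma sphere_tangent_vector:
  assumes N: "F ` {x \<in> B. pullback 0 x x = r} \<subseteq> chart_map c ` (\<Sigma> \<inter> chart_dom c)"
    and x: "x \<in> B" "pullback 0 x x = r" "r \<noteq> 0" and w: "pullback 0 x w = 0"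
  shows "fder F x w \<in> tangent_space c \<Sigma> (F x)"
proof -
  obtain \<delta> \<beta> where \<delta>: "\<delta> > 0" and \<beta>: "smooth_on {-\<delta><..<\<delta>} \<beta>" "\<beta> 0 = x" "(\<beta> has_vector_derivative w) (at 0)"
    "\<And>s. s \<in> {-\<delta><..<\<delta>} \<Longrightarrow> \<beta> s \<in> B \<and> pullback 0 (\<beta> s) (\<beta> s) = r"
    by (rule normalized_curve[OF x w]) (rule that)
  have "smooth_on {-\<delta><..<\<delta>} (\<lambda>s. F (\<beta> s))"
    by (rule smooth_on_compose[OF _ B_open _ F_smooth \<beta>(1)]) (use \<beta>(4) in auto)
  moreover have "(\<lambda>s. F (\<beta> s)) ` {-\<delta><..<\<delta>} \<subseteq> chart_map c ` (\<Sigma> \<inter> chart_dom c)"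
    using \<beta>(4) N by blast
  moreover have "((\<lambda>s. F (\<beta> s)) has_vector_derivative fder F x w) (at 0)"
  proof -
    have "(F has_derivative fder F x) (at (\<beta> 0))"
      unfolding \<beta>(2) by (rule smooth_on_has_derivative[OF F_smooth x(1)])
    from vector_derivative_diff_chain_within[OF \<beta>(3) has_derivative_at_withinI[OF this]]
    show ?thesis by (simp add: o_def)
  qed
  ultimately show ?thesis
    unfolding tangent_space_def using \<delta> \<beta>(2) by blast
qed

text \<open>By the Gauss lemma the radial direction is normal to the sphere.\<close>

lemma unit_normal_radial:
  assumes N: "F ` {x \<in> B. pullback 0 x x = r} \<subseteq> chart_map c ` (\<Sigma> \<inter> chart_dom c)"
    and \<xi>: "unit_normal_field h2 c \<Sigma> V \<xi>"
    and x: "x \<in> B" "pullback 0 x x = r" "r \<noteq> 0" "F x \<in> V"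
  defines "k \<equiv> h2 (F x) (\<xi> (F x)) (fder F x x) / r"
  shows "\<xi> (F x) = k *\<^sub>R fder F x x" "k\<^sup>2 = 1 / \<bar>r\<bar>"
proof -
  have Fx: "F x \<in> S2" using F_image x(1) by blast
  note b = h_bilinear[OF Fx] and bp = iso.M1.h_bilinear[OF x(1)] and lin = F_linear[OF x(1)]
  have "F x \<in> V \<inter> chart_map c ` (\<Sigma> \<inter> chart_dom c)" using N x by blast
  then have unit: "\<bar>h2 (F x) (\<xi> (F x)) (\<xi> (F x))\<bar> = 1"
    and normal: "\<And>X. X \<in> tangent_space c \<Sigma> (F x) \<Longrightarrow> h2 (F x) (\<xi> (F x)) X = 0"
    using \<xi> unfolding unit_normal_field_def by blast+
  have xx: "pullback x x x = r" using normal.gauss_radial[OF x(1)] x(2) by simp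
  show eq: "\<xi> (F x) = k *\<^sub>R fder F x x"
  proof (rule h_cancel[OF Fx])
    fix v
    obtain u where u: "v = fder F x u"
      using iso.\<psi>_surj[OF x(1)] by (metis surjD)
    \<comment> \<open>The part of \<open>u\<close> tangent to the sphere; by the Gauss lemma
      orthogonality to \<open>x\<close> is the same at \<open>x\<close> and at the centre.\<close>
    define w where "w = u - (pullback x x u / r) *\<^sub>R x"
    have "pullback x x w = 0"
      using x(3) by (simp add: w_def bilinear_rsub[OF bp] bilinear_rmul[OF bp] xx)
    then have "pullback 0 x w = 0" by (simp add: normal.gauss_lemma[OF x(1)])
    from normal[OF sphere_tangent_vector[OF N x(1-3) this]]
    have 0: "h2 (F x) (\<xi> (F x)) (fder F x w) = 0" .
    have "v = fder F x w + (pullback x x u / r) *\<^sub>R fder F x x"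
      unfolding u w_def by (simp add: linear_diff[OF lin] linear_scale[OF lin])
    then have "h2 (F x) (\<xi> (F x)) v = (pullback x x u / r) * h2 (F x) (\<xi> (F x)) (fder F x x)"
      using 0 by (simp add: bilinear_radd[OF b] bilinear_rmul[OF b])
    also have "\<dots> = k * h2 (F x) (fder F x x) (fder F x u)" by (simp add: k_def pullback_def)
    finally show "h2 (F x) (\<xi> (F x)) v = h2 (F x) (k *\<^sub>R fder F x x) v"
      by (simp add: bilinear_lmul[OF b] u)
  qed
  have "h2 (F x) (\<xi> (F x)) (\<xi> (F x)) = k * (k * pullback x x x)"
    unfolding eq pullback_def by (simp only: bilinear_lmul[OF b] bilinear_rmul[OF b] real_scaleR_def)
  then have "k\<^sup>2 * \<bar>r\<bar> = 1" using unit by (simp add: xx abs_mult power2_eq_square)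
  then show "k\<^sup>2 = 1 / \<bar>r\<bar>" using x(3) by (simp add: field_simps)
qed

text \<open>A unit normal field is determined only on the sphere and up to sign. Continuity fixes
  the sign along a curve in the sphere, so its derivative in the tangent direction \<open>w\<close>
  is that of the scaled radial field, and the umbilicity equation can be pulled back to normal
  coordinates.\<close>

lemma umbilical_sphere_radial:
  assumes N: "F ` {x \<in> B. pullback 0 x x = r} \<subseteq> chart_map c ` (\<Sigma> \<inter> chart_dom c)"
    and \<xi>: "unit_normal_field h2 c \<Sigma> V \<xi>"
    and x: "x \<in> B" "pullback 0 x x = r" "r \<noteq> 0" "F x \<in> V" and w: "pullback 0 x w = 0"
    and umb: "shape_operator h2 \<xi> (F x) (fder F x w) = \<kappa> *\<^sub>R fder F x w"
  shows "\<exists>\<mu>. christoffel pullback x w x = \<mu> *\<^sub>R w"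
proof -
  have V: "open V" "smooth_on V \<xi>" using \<xi> unfolding unit_normal_field_def by blast+
  obtain \<delta> \<beta> where \<delta>: "\<delta> > 0" and \<beta>: "smooth_on {-\<delta><..<\<delta>} \<beta>" "\<beta> 0 = x" "(\<beta> has_vector_derivative w) (at 0)"
    "\<And>s. s \<in> {-\<delta><..<\<delta>} \<Longrightarrow> \<beta> s \<in> B \<and> pullback 0 (\<beta> s) (\<beta> s) = r"
    by (rule normalized_curve[OF x(1-3) w]) (rule that)
  have F\<beta>: "smooth_on {-\<delta><..<\<delta>} (\<lambda>s. F (\<beta> s))"
    by (rule smooth_on_compose[OF _ B_open _ F_smooth \<beta>(1)]) (use \<beta>(4) in auto)
  define J where "J = {-\<delta><..<\<delta>} \<inter> (\<lambda>s. F (\<beta> s)) -` V"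
  have J: "open J"
    unfolding J_def by (rule continuous_open_preimage[OF smooth_on_imp_continuous_on[OF F\<beta>] _ V(1)]) simp
  have J0: "0 \<in> J" using \<delta> \<beta>(2) x(4) by (simp add: J_def)
  have Js: "J \<subseteq> {-\<delta><..<\<delta>}" "\<And>s. s \<in> J \<Longrightarrow> F (\<beta> s) \<in> V" by (auto simp: J_def)
  have \<beta>J: "smooth_on J \<beta>" "\<beta> ` J \<subseteq> B" and F\<beta>J: "smooth_on J (\<lambda>s. F (\<beta> s))" "(\<lambda>s. F (\<beta> s)) ` J \<subseteq> S2"
    using smooth_on_subset[OF \<beta>(1) Js(1)] smooth_on_subset[OF F\<beta> Js(1)] \<beta>(4) Js(1) F_image by blast+
  have P: "smooth_on B (\<lambda>x. fder F x x)"
    by (rule smooth_on_fder_family[OF B_open F_smooth smooth_on_ident[OF B_open]])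
  define k where "k s = h2 (F (\<beta> s)) (\<xi> (F (\<beta> s))) (fder F (\<beta> s) (\<beta> s)) / r" for s
  have kJ: "\<xi> (F (\<beta> s)) = k s *\<^sub>R fder F (\<beta> s) (\<beta> s)" "(k s)\<^sup>2 = 1 / \<bar>r\<bar>" if "s \<in> J" for s
    using unit_normal_radial[OF N \<xi> _ _ x(3) Js(2)[OF that]] \<beta>(4)[of s] Js(1) that unfolding k_def by blast+
  have "smooth_on J (\<lambda>s. h2 (F (\<beta> s)) (\<xi> (F (\<beta> s))) (fder F (\<beta> s) (\<beta> s)))"
  proof (rule h_along_smooth[OF J F\<beta>J])
    show "smooth_on J (\<lambda>s. \<xi> (F (\<beta> s)))"
      by (rule smooth_on_compose[OF J V(1) _ V(2) F\<beta>J(1)]) (use Js(2) in blast)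
    show "smooth_on J (\<lambda>s. fder F (\<beta> s) (\<beta> s))"
      by (rule smooth_on_compose[OF J B_open \<beta>J(2) P \<beta>J(1)])
  qed
  then have "continuous_on J k"
    unfolding k_def by (intro continuous_on_divide smooth_on_imp_continuous_on continuous_on_const) (use x(3) in auto)
  then have "isCont k 0" using J J0 by (simp add: continuous_on_eq_continuous_at)
  then have lim: "(k \<longlongrightarrow> k 0) (nhds 0)" unfolding isCont_def tendsto_at_iff_tendsto_nhds .
  have k0: "k 0 \<noteq> 0" using kJ(2)[OF J0] x(3) by auto
  have evJ: "\<forall>\<^sub>F s in nhds 0. s \<in> J" by (rule eventually_nhds_in_open[OF J J0])
  \<comment> \<open>Since \<open>k s\<close> is \<open>k 0\<close> or \<open>- k 0\<close>, this
    distance rules out the second value.\<close>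
  have "\<forall>\<^sub>F s in nhds 0. dist (k s) (k 0) < \<bar>k 0\<bar>" by (rule tendstoD[OF lim]) (use k0 in simp)
  with evJ have evk: "\<forall>\<^sub>F s in nhds 0. k 0 *\<^sub>R fder F (\<beta> s) (\<beta> s) = \<xi> (F (\<beta> s))"
  proof eventually_elim
    case (elim s)
    have "k s = k 0 \<or> k s = - k 0"
      using kJ(2)[OF elim(1)] kJ(2)[OF J0] by (simp flip: power2_eq_iff)
    then have "k s = k 0" using elim(2) k0 by (auto simp: dist_real_def)
    then show ?case using kJ(1)[OF elim(1)] by simp
  qed
  have Fx\<xi>: "\<xi> (F x) = k 0 *\<^sub>R fder F x x" using kJ(1)[OF J0] \<beta>(2) by simp
  have dP: "((\<lambda>s. k 0 *\<^sub>R fder F (\<beta> s) (\<beta> s)) has_vector_derivative k 0 *\<^sub>R fder (\<lambda>x. fder F x x) x w) (at 0)"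
  proof -
    have "((\<lambda>x. fder F x x) has_derivative fder (\<lambda>x. fder F x x) x) (at (\<beta> 0))"
      unfolding \<beta>(2) by (rule smooth_on_has_derivative[OF P x(1)])
    from vector_derivative_diff_chain_within[OF \<beta>(3) has_derivative_at_withinI[OF this]]
    have "((\<lambda>s. fder F (\<beta> s) (\<beta> s)) has_vector_derivative fder (\<lambda>x. fder F x x) x w) (at 0)" by (simp add: o_def)
    from bounded_linear.has_vector_derivative[OF bounded_linear_scaleR_right this] show ?thesis .
  qed
  have d\<xi>: "((\<lambda>s. \<xi> (F (\<beta> s))) has_vector_derivative fder \<xi> (F x) (fder F x w)) (at 0)"
  proof -
    have "((\<lambda>x. \<xi> (F x)) has_derivative (\<lambda>v. fder \<xi> (F x) (fder F x v))) (at (\<beta> 0))"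
      unfolding \<beta>(2)
      by (rule has_derivative_compose[OF smooth_on_has_derivative[OF F_smooth x(1)] smooth_on_has_derivative[OF V(2) x(4)]])
    from vector_derivative_diff_chain_within[OF \<beta>(3) has_derivative_at_withinI[OF this]]
    show ?thesis by (simp add: o_def)
  qed
  have "fder \<xi> (F x) (fder F x w) = k 0 *\<^sub>R fder (\<lambda>x. fder F x x) x w"
    by (rule vector_derivative_unique_at[OF d\<xi> has_vector_derivative_eventually_cong[OF dP evk]])
  from iso.nabla_radial[OF x(1) Fx\<xi> this]
  have "- (k 0 *\<^sub>R fder F x (w + christoffel pullback x w x)) = \<kappa> *\<^sub>R fder F x w"
    using umb by (simp add: shape_operator_def)
  then have "k 0 *\<^sub>R fder F x (w + christoffel pullback x w x) = k 0 *\<^sub>R ((- \<kappa> / k 0) *\<^sub>R fder F x w)"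
    using k0 by (metis minus_equation_iff scaleR_minus_left scaleR_scaleR nonzero_mult_div_cancel_left times_divide_eq_right)
  then have "fder F x (w + christoffel pullback x w x) = fder F x ((- \<kappa> / k 0) *\<^sub>R w)"
    unfolding linear_scale[OF F_linear[OF x(1)]] using scaleR_left_imp_eq[OF k0] by blast
  then have "w + christoffel pullback x w x = (- \<kappa> / k 0) *\<^sub>R w"
    using F_inj[OF x(1)] by (simp add: inj_eq)
  then have "christoffel pullback x w x = (- \<kappa> / k 0 - 1) *\<^sub>R w"
    by (simp add: algebra_simps)
  then show ?thesis by blast
qed

end

section \<open>Normal neighbourhoods\<close>

text \<open>A normal neighbourhood that is built rather than given: \<open>F\<close> is the
  exponential map read in the chart \<open>c\<close>, and \<open>G\<close> is its smooth
  inverse.\<close>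

locale geodesic_ball = semi_riemannian_manifold A g \<nu> + rad: radial_geodesic_map "chart_ran c" "g c" T F
  for A :: "('a::{t2_space, second_countable_topology}, 'e::euclidean_space) chart set" and g \<nu> c T F +
  fixes p :: 'a and G :: "'e \<Rightarrow> 'e"
  assumes c: "c \<in> A" and p: "p \<in> chart_dom c"
    and F_0: "F 0 = chart_map c p" and fder_F_0: "fder F 0 = (\<lambda>v. v)"
    and exp_geodesic: "v \<in> T \<Longrightarrow> v \<in> exp_domain A g c p \<and> exp_map A g c p v = chart_inv c (F v)"
    and FT_open: "open (F ` T)" and F_homeo: "homeomorphism T (F ` T) F G" and G_smooth: "smooth_on (F ` T) G"

context semi_riemannian_manifold
begin

lemma exists_geodesic_ball:
  assumes c: "c \<in> A" and p: "p \<in> chart_dom c"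
  obtains T F G where "geodesic_ball A g \<nu> c T F p G"
proof -
  interpret m: local_metric "chart_ran c" "g c" by (rule chart_metric[OF c])
  obtain r F where r: "r > 0" and F: "smooth_on (ball 0 r) F" and F0: "F 0 = chart_map c p"
    and dF0: "fder F 0 = (\<lambda>v. v)" and Fim: "F ` ball 0 r \<subseteq> chart_ran c"
    and geo: "\<And>v t. t *\<^sub>R v \<in> ball 0 r \<Longrightarrow> ((\<lambda>t. fder F (t *\<^sub>R v) v) has_vector_derivative
       - christoffel (g c) (F (t *\<^sub>R v)) (fder F (t *\<^sub>R v) v) (fder F (t *\<^sub>R v) v)) (at t)"
    by (rule m.local_exponential_map[OF chart_map_in[OF p]]) (rule that)
  obtain U V G where U: "open U" "0 \<in> U" "U \<subseteq> ball 0 r" and V: "open V" and UV: "homeomorphism U V F G"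
    and G: "smooth_on V G" and inj: "\<And>x. x \<in> U \<Longrightarrow> inj (fder F x)"
    by (rule smooth_local_inverse[OF open_ball F _ dF0]) (use r in simp, rule that)
  obtain \<epsilon> where \<epsilon>: "\<epsilon> > 0" "ball 0 \<epsilon> \<subseteq> U" using U open_contains_ball by blast
  \<comment> \<open>A ball is star-shaped, and this one lies where \<open>F\<close> is
    invertible.\<close>
  define T where "T = ball (0 :: 'e) \<epsilon>"
  have T: "open T" "0 \<in> T" "T \<subseteq> U" "T \<subseteq> ball 0 r" using \<epsilon> U unfolding T_def by auto
  have FT: "F ` T = V \<inter> G -` T"
  proof
    show "F ` T \<subseteq> V \<inter> G -` T"
      using T(3) homeomorphism_image1[OF UV] homeomorphism_apply1[OF UV] by (auto simp: subset_iff)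
    show "V \<inter> G -` T \<subseteq> F ` T"
      using homeomorphism_apply2[OF UV] by (force simp: image_iff)
  qed
  have exp: "v \<in> exp_domain A g c p \<and> exp_map A g c p v = chart_inv c (F v)" if v: "v \<in> T" for v
  proof -
    \<comment> \<open>The exponential map asks for an open interval around [0, 1]; the ball of
      radius \<open>r\<close>, which contains \<open>T\<close>, provides it.\<close>
    define I where "I = {t. t *\<^sub>R v \<in> ball 0 r}"
    have "continuous_on UNIV (\<lambda>t. t *\<^sub>R v)" by (intro continuous_intros)
    from continuous_open_preimage[OF this open_UNIV open_ball, of 0 r]
    have oI: "open I" by (simp only: I_def vimage_def Int_UNIV_left)
    have "convex ((\<lambda>t. t *\<^sub>R v) -` ball 0 r)"
      by (rule convex_linear_vimage) (simp_all add: linear_iff scaleR_left_distrib)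
    then have iI: "is_interval I" by (simp add: I_def vimage_def is_interval_convex_1)
    have sub: "{0..1} \<subseteq> I"
    proof
      fix t :: real assume t: "t \<in> {0..1}"
      have "norm (t *\<^sub>R v) \<le> norm v" using t by (simp add: mult_left_le_one_le)
      moreover have "norm v < r" using v T(4) by auto
      ultimately show "t \<in> I" by (simp add: I_def)
    qed
    have 1: "F (t *\<^sub>R v) \<in> chart_ran c" if "t \<in> I" for t using Fim that by (auto simp: I_def)
    have 2: "((\<lambda>t. F (t *\<^sub>R v)) has_vector_derivative fder F (t *\<^sub>R v) v) (at t)" if "t \<in> I" for t
      by (rule smooth_on_ray_derivative[OF F]) (use that in \<open>simp add: I_def\<close>)
    have 3: "((\<lambda>t. fder F (t *\<^sub>R v) v) has_vector_derivative
       - christoffel (g c) (F (t *\<^sub>R v)) (fder F (t *\<^sub>R v) v) (fder F (t *\<^sub>R v) v)) (at t)" if "t \<in> I" for t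
      by (rule geo) (use that in \<open>simp add: I_def\<close>)
    let ?\<gamma> = "\<lambda>t. chart_inv c (F (t *\<^sub>R v))"
    have "geodesic_on A g I ?\<gamma>"
      by (rule geodesic_on_chart_inv(1)[where x = "\<lambda>t. F (t *\<^sub>R v)" and v = "\<lambda>t. fder F (t *\<^sub>R v) v", OF c oI iI 1 2 3])
    moreover have "velocity c ?\<gamma> 0 = fder F (0 *\<^sub>R v) v"
      by (rule geodesic_on_chart_inv(2)[where x = "\<lambda>t. F (t *\<^sub>R v)" and v = "\<lambda>t. fder F (t *\<^sub>R v) v", OF c oI iI 1 2 3])
        (use sub in auto)
    then have "velocity c ?\<gamma> 0 = v" by (simp add: dF0)
    moreover have "?\<gamma> 0 = p" by (simp add: F0 chart_inv_map[OF c p])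
    ultimately have "is_exp_geodesic A g c p v ?\<gamma>" unfolding is_exp_geodesic_def using sub by blast
    from exp_map_eq[OF c p this] this show ?thesis unfolding exp_domain_def by auto
  qed
  have "geodesic_ball A g \<nu> c T F p G"
  proof (intro geodesic_ball.intro geodesic_ball_axioms.intro radial_geodesic_map.intro radial_geodesic_map_axioms.intro
      semi_riemannian_manifold_axioms m.local_metric_axioms c p F0 dF0 T(1,2))
    show "t *\<^sub>R x \<in> T" if "x \<in> T" "0 \<le> t" "t \<le> 1" for x t
      using that mult_left_le_one_le[of "norm x" t] by (simp add: T_def)
    show "smooth_on T F" by (rule smooth_on_subset[OF F T(4)])
    show "F ` T \<subseteq> chart_ran c" using Fim T(4) by blast
    show "inj (fder F x)" if "x \<in> T" for x using inj that T(3) by blast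
    show "((\<lambda>t. fder F (t *\<^sub>R x) x) has_vector_derivative
       - christoffel (g c) (F x) (fder F x x) (fder F x x)) (at 1)" if "x \<in> T" for x
    proof -
      have "1 *\<^sub>R x \<in> ball 0 r" using that T(4) by auto
      from geo[OF this] show ?thesis by simp
    qed
    show "v \<in> exp_domain A g c p \<and> exp_map A g c p v = chart_inv c (F v)" if "v \<in> T" for v by (rule exp[OF that])
    show "open (F ` T)"
      unfolding FT by (rule continuous_open_preimage[OF smooth_on_imp_continuous_on[OF G] V T(1)])
    show "homeomorphism T (F ` T) F G" by (rule homeomorphism_of_subsets[OF UV T(3)]) (use FT in auto)
    show "smooth_on (F ` T) G" by (rule smooth_on_subset[OF G]) (use FT in auto)
  qed
  then show thesis by (rule that)
qed

end

context geodesic_ball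
begin

lemma exp_in: "v \<in> T \<Longrightarrow> exp_map A g c p v \<in> chart_dom c"
  using exp_geodesic chart_inv_in[OF c] rad.F_image by auto

lemma chart_map_exp: "v \<in> T \<Longrightarrow> chart_map c (exp_map A g c p v) = F v"
  using exp_geodesic chart_map_inv[OF c] rad.F_image by auto

lemma chart_map_exp_transition: "v \<in> T \<Longrightarrow> chart_map d (exp_map A g c p v) = transition c d (F v)"
  using exp_geodesic by (simp add: transition_def)

lemma pullback_0: "rad.pullback 0 = g c (chart_map c p)"
  by (intro ext) (simp add: rad.pullback_def F_0 fder_F_0)

lemma exp_continuous: "continuous_on T (exp_map A g c p)"
proof -
  have "continuous_on T (\<lambda>v. chart_inv c (F v))"
    by (rule continuous_on_compose2[OF chart_inv_continuous[OF c] smooth_on_imp_continuous_on[OF rad.F_smooth] rad.F_image])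
  then show ?thesis using exp_geodesic by (simp cong: continuous_on_cong)
qed

lemma exp_image_open: "open (exp_map A g c p ` T)"
proof -
  have "exp_map A g c p ` T = chart_inv c ` F ` T"
    unfolding image_image by (rule image_cong) (use exp_geodesic in auto)
  then show ?thesis using chart_inv_image_open[OF c FT_open rad.F_image] by simp
qed

definition seen_from :: "('a, 'e) chart \<Rightarrow> 'e set" where
  "seen_from d = T \<inter> exp_map A g c p -` chart_dom d"

lemma seen_from_open: "d \<in> A \<Longrightarrow> open (seen_from d)"
  unfolding seen_from_def by (rule continuous_open_preimage[OF exp_continuous rad.B_open chart_dom_open])

lemma F_overlap: "v \<in> seen_from d \<Longrightarrow> F v \<in> overlap c d"
  using overlap_iff[OF c exp_in, of v d] by (simp add: seen_from_def chart_map_exp)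

lemma exp_smooth:
  assumes d: "d \<in> A"
  shows "smooth_on (seen_from d) (\<lambda>v. transition c d (F v))"
proof (rule smooth_on_compose[OF seen_from_open[OF d] overlap_open[OF c d] _ transition_smooth'[OF c d]])
  show "F ` seen_from d \<subseteq> overlap c d" using F_overlap by blast
  show "smooth_on (seen_from d) F" by (rule smooth_on_subset[OF rad.F_smooth]) (simp add: seen_from_def)
qed

lemma chart_image_eq:
  "chart_map d ` (exp_map A g c p ` T \<inter> chart_dom d) = (\<lambda>v. transition c d (F v)) ` seen_from d"
proof -
  have "exp_map A g c p ` T \<inter> chart_dom d = exp_map A g c p ` seen_from d" by (auto simp: seen_from_def)
  then show ?thesis
    unfolding image_image by (simp add: image_image chart_map_exp_transition seen_from_def cong: image_cong_simp)
qed

lemma seen_image_open: "d \<in> A \<Longrightarrow> open ((\<lambda>v. transition c d (F v)) ` seen_from d)"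
  unfolding chart_image_eq[symmetric]
  by (rule chart_image_open) (auto intro: open_Int exp_image_open chart_dom_open)

lemma transition_back:
  assumes d: "d \<in> A" and v: "v \<in> seen_from d"
  shows "transition d c (transition c d (F v)) = F v" "transition c d (F v) \<in> overlap d c"
proof -
  have v': "v \<in> T" "exp_map A g c p v \<in> chart_dom d" using v by (auto simp: seen_from_def)
  show "transition d c (transition c d (F v)) = F v"
    using transition_apply[OF d v'(2), of c]
    unfolding chart_map_exp_transition[OF v'(1), of d] chart_map_exp[OF v'(1)] .
  show "transition c d (F v) \<in> overlap d c"
    using overlap_iff[OF d v'(2), of c] exp_in[OF v'(1)] by (simp add: chart_map_exp_transition v')
qed

lemma inverse_smooth:
  assumes d: "d \<in> A"
  shows "smooth_on ((\<lambda>v. transition c d (F v)) ` seen_from d) (\<lambda>y. G (transition d c y))"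
proof (rule smooth_on_compose[OF seen_image_open[OF d] FT_open _ G_smooth])
  show "transition d c ` (\<lambda>v. transition c d (F v)) ` seen_from d \<subseteq> F ` T"
    using transition_back(1)[OF d] by (auto simp: seen_from_def)
  show "smooth_on ((\<lambda>v. transition c d (F v)) ` seen_from d) (transition d c)"
    by (rule smooth_on_subset[OF transition_smooth'[OF d c]]) (use transition_back(2)[OF d] in auto)
qed

lemma G_F: "v \<in> T \<Longrightarrow> G (F v) = v"
  by (rule homeomorphism_apply1[OF F_homeo])

lemma ball_normal_neighborhood: "normal_neighborhood A g c p T"
  unfolding normal_neighborhood_def
proof (intro conjI ballI rad.B_open rad.B_0 exp_image_open)
  show "closed_segment 0 v \<subseteq> T" if "v \<in> T" for v
    using rad.B_star[OF that] by (auto simp: closed_segment_def)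
  show "T \<subseteq> exp_domain A g c p" using exp_geodesic by blast
  show "diffeomorphism_onto_image A T (exp_map A g c p)"
    unfolding diffeomorphism_onto_image_def
  proof (intro exI[of _ "\<lambda>q. G (chart_map c q)"] conjI ballI)
    show "homeomorphism T (exp_map A g c p ` T) (exp_map A g c p) (\<lambda>q. G (chart_map c q))"
    proof (rule homeomorphismI)
      show "continuous_on (exp_map A g c p ` T) (\<lambda>q. G (chart_map c q))"
        by (rule continuous_on_compose2[OF smooth_on_imp_continuous_on[OF G_smooth]
              continuous_on_subset[OF chart_map_continuous[OF c]]])
          (use exp_in chart_map_exp in auto)
    qed (use exp_continuous chart_map_exp G_F in auto)
    fix d assume d: "d \<in> A"
    show "smooth_on (T \<inter> exp_map A g c p -` chart_dom d) (chart_map d \<circ> exp_map A g c p)"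
      using smooth_on_cong[OF seen_from_open[OF d] _ exp_smooth[OF d], of "chart_map d \<circ> exp_map A g c p"]
      by (simp add: seen_from_def chart_map_exp_transition)
    show "smooth_on (chart_map d ` (exp_map A g c p ` T \<inter> chart_dom d)) ((\<lambda>q. G (chart_map c q)) \<circ> chart_inv d)"
      unfolding chart_image_eq using inverse_smooth[OF d] by (simp add: transition_def o_def)
  qed
qed

text \<open>In the chart \<open>d\<close> the exponential map is \<open>F\<close> followed by the
  transition map; its isometry property combines the definition of the pullback with the
  transformation law of the metric.\<close>

lemma exp_parametrization:
  assumes d: "d \<in> A"
  shows "normal_parametrization (seen_from d) rad.pullback (chart_ran d) (g d) (\<lambda>v. transition c d (F v)) T (\<lambda>y. G (transition d c y))"
proof (intro normal_parametrization.intro normal_parametrization_axioms.intro local_isometry.intro local_isometry_axioms.intro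
    rad.normal.normal_coordinates_axioms chart_metric[OF d] restrict_metric[OF rad.pullback_metric] seen_from_open[OF d]
    exp_smooth[OF d] seen_image_open[OF d] inverse_smooth[OF d])
  show "seen_from d \<subseteq> T" "seen_from d \<subseteq> T" by (auto simp: seen_from_def)
  show "(\<lambda>v. transition c d (F v)) ` seen_from d \<subseteq> chart_ran d"
    using transition_back(2)[OF d] overlap_subset by blast
  fix v assume v: "v \<in> seen_from d"
  then have vT: "v \<in> T" by (simp add: seen_from_def)
  show "G (transition d c (transition c d (F v))) = v" by (simp add: transition_back[OF d v] G_F[OF vT])
  fix a b
  have "((\<lambda>v. transition c d (F v)) has_derivative (\<lambda>a. fder (transition c d) (F v) (fder F v a))) (at v)"
    by (rule has_derivative_compose[OF smooth_on_has_derivative[OF rad.F_smooth vT]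
          smooth_on_has_derivative[OF transition_smooth'[OF c d] F_overlap[OF v]]])
  from fder_eqI[OF this] show "rad.pullback v a b = g d (transition c d (F v))
      (fder (\<lambda>v. transition c d (F v)) v a) (fder (\<lambda>v. transition c d (F v)) v b)"
    using metric_transformation[OF c d, of "F v" "fder F v a" "fder F v b"] F_overlap[OF v]
    by (simp add: rad.pullback_def overlap_def)
qed

lemma geodesic_sphere_umbilical:
  assumes K: "\<And>x. x \<in> chart_ran c \<Longrightarrow> local_metric.constant_curvature_at (g c) K x" and r: "r \<noteq> 0"
  shows "totally_umbilical A g (geodesic_sphere A g c p T r)"
  unfolding totally_umbilical_def
proof (intro ballI impI)
  let ?\<Sigma> = "geodesic_sphere A g c p T r"
  fix q d assume q: "q \<in> ?\<Sigma>" and d: "d \<in> A" and qd: "q \<in> chart_dom d"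
  interpret P: normal_parametrization "seen_from d" rad.pullback "chart_ran d" "g d" "\<lambda>v. transition c d (F v)" T "\<lambda>y. G (transition d c y)"
    by (rule exp_parametrization[OF d])
  \<comment> \<open>Constant curvature passes from the chart to normal coordinates along the
    isometry \<open>F\<close>.\<close>
  have KT: "rad.iso.M1.constant_curvature_at K x" if "x \<in> T" for x
    using K rad.iso.constant_curvature_at_iff[OF that] rad.F_image that by blast
  have "?\<Sigma> \<inter> chart_dom d = exp_map A g c p ` {x \<in> seen_from d. rad.pullback 0 x x = r}"
    by (auto simp: geodesic_sphere_def pullback_0 seen_from_def)
  then have N: "chart_map d ` (?\<Sigma> \<inter> chart_dom d) = (\<lambda>v. transition c d (F v)) ` {x \<in> seen_from d. rad.pullback 0 x x = r}"
    by (simp add: image_image chart_map_exp_transition seen_from_def cong: image_cong_simp)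
  obtain x where x: "x \<in> seen_from d" "q = exp_map A g c p x"
    using q qd by (auto simp: geodesic_sphere_def seen_from_def)
  have qx: "chart_map d q = transition c d (F x)" using x by (simp add: chart_map_exp_transition seen_from_def)
  have "unit_normal_field (g d) d ?\<Sigma> ((\<lambda>v. transition c d (F v)) ` seen_from d) (P.radial_field r)"
    by (rule P.radial_field_unit_normal[OF N refl r])
  moreover have "chart_map d q \<in> (\<lambda>v. transition c d (F v)) ` seen_from d" using qx x(1) by blast
  moreover have "\<exists>\<kappa>. shape_operator (g d) (P.radial_field r) (chart_map d q) X = \<kappa> *\<^sub>R X"
    if "X \<in> tangent_space d ?\<Sigma> (chart_map d q)" for X
    unfolding qx by (rule P.sphere_umbilical[OF N KT x(1)]) (use that qx in simp_all)
  ultimately show "\<exists>V \<xi>. unit_normal_field (g d) d ?\<Sigma> V \<xi> \<and> chart_map d q \<in> V \<and>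
     (\<forall>X\<in>tangent_space d ?\<Sigma> (chart_map d q). g d (chart_map d q) X X \<noteq> 0 \<longrightarrow>
        (\<exists>\<kappa>. shape_operator (g d) \<xi> (chart_map d q) X = \<kappa> *\<^sub>R X))" by blast
qed

end

section \<open>Arbitrary normal neighbourhoods\<close>

context semi_riemannian_manifold
begin

text \<open>A geodesic with initial velocity 0, rescaled by the factor 0, is constant and has the
  same initial data.\<close>

lemma exp_map_0:
  assumes c: "c \<in> A" "p \<in> chart_dom c" and 0: "0 \<in> exp_domain A g c p"
  shows "exp_map A g c p 0 = p"
proof -
  obtain \<gamma> where \<gamma>: "is_exp_geodesic A g c p 0 \<gamma>" using 0 unfolding exp_domain_def by blast
  have "is_exp_geodesic A g c p (0 *\<^sub>R 0) (\<lambda>s. \<gamma> (0 * s))"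
    by (rule is_exp_geodesic_rescale[OF c \<gamma>]) simp
  then have "is_exp_geodesic A g c p 0 (\<lambda>s. \<gamma> (0 * s))" by simp
  from exp_map_eq[OF c this] show ?thesis using \<gamma> unfolding is_exp_geodesic_def by simp
qed

lemma exp_map_ray:
  assumes c: "c \<in> A" "p \<in> chart_dom c" and \<gamma>: "is_exp_geodesic A g c p v \<gamma>" and t: "t \<in> {0..1}"
  shows "exp_map A g c p (t *\<^sub>R v) = \<gamma> t"
  using exp_map_eq[OF c is_exp_geodesic_rescale[OF c \<gamma> t]] by simp

text \<open>Here the neighbourhood is given, and the available data are smoothness of the
  exponential map, a smooth inverse and the geodesics behind its values. A radial geodesic map is
  recovered from them on a ball whose image lies in the chart \<open>c\<close>.\<close>

lemma radial_map_of_normal_neighborhood: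
  assumes c: "c \<in> A" and p: "p \<in> chart_dom c" and nn: "normal_neighborhood A g c p T"
  defines "F \<equiv> \<lambda>v. chart_map c (exp_map A g c p v)"
  obtains B where "radial_geodesic_map (chart_ran c) (g c) B F" "B \<subseteq> T" "exp_map A g c p ` B \<subseteq> chart_dom c"
    "F 0 = chart_map c p" "fder F 0 = (\<lambda>v. v)"
proof -
  interpret m: local_metric "chart_ran c" "g c" by (rule chart_metric[OF c])
  let ?e = "exp_map A g c p"
  have T: "open T" "0 \<in> T" "T \<subseteq> exp_domain A g c p"
    using nn unfolding normal_neighborhood_def by blast+
  obtain G where hom: "homeomorphism T (?e ` T) ?e G" and
    sm: "smooth_on (T \<inter> ?e -` chart_dom c) (chart_map c \<circ> ?e)"
        "smooth_on (chart_map c ` (?e ` T \<inter> chart_dom c)) (G \<circ> chart_inv c)"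
    using nn c unfolding normal_neighborhood_def diffeomorphism_onto_image_def by blast
  have e0: "?e 0 = p" using exp_map_0[OF c p] T by blast
  have "open (T \<inter> ?e -` chart_dom c)"
    by (rule continuous_open_preimage[OF homeomorphism_cont1[OF hom] T(1) chart_dom_open[OF c]])
  moreover have "0 \<in> T \<inter> ?e -` chart_dom c" using T e0 p by simp
  ultimately obtain \<epsilon> where \<epsilon>: "\<epsilon> > 0" "ball 0 \<epsilon> \<subseteq> T \<inter> ?e -` chart_dom c" using open_contains_ball by blast
  define B where "B = ball (0 :: 'e) \<epsilon>"
  have B: "open B" "0 \<in> B" "B \<subseteq> T" "?e ` B \<subseteq> chart_dom c" using \<epsilon> by (auto simp: B_def)
  have F_smooth: "smooth_on B F"
    using smooth_on_subset[OF sm(1), of B] \<epsilon>(2) unfolding F_def B_def o_def by blast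
  have F0: "F 0 = chart_map c p" by (simp add: F_def e0)
  have geo: "\<exists>\<gamma>. is_exp_geodesic A g c p v \<gamma>" if "v \<in> B" for v
    using that B(3) T(3) unfolding exp_domain_def by blast
  \<comment> \<open>The chain rule for the inverse that the diffeomorphism supplies gives a left
    inverse of the differential.\<close>
  have inj: "inj (fder F x)" if x: "x \<in> B" for x
  proof -
    let ?W = "chart_map c ` (?e ` T \<inter> chart_dom c)"
    have "F x \<in> ?W" unfolding F_def using x B by blast
    from has_derivative_compose[OF smooth_on_has_derivative[OF F_smooth x] smooth_on_has_derivative[OF sm(2) this]]
    have 1: "((\<lambda>x. (G \<circ> chart_inv c) (F x)) has_derivative (\<lambda>v. fder (G \<circ> chart_inv c) (F x) (fder F x v))) (at x)" .
    have "(G \<circ> chart_inv c) (F y) = y" if y: "y \<in> B" for y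
    proof -
      have "?e y \<in> chart_dom c" "y \<in> T" using y B by blast+
      then show ?thesis by (simp add: F_def chart_inv_map[OF c] homeomorphism_apply1[OF hom])
    qed
    then have "((\<lambda>x. x) has_derivative (\<lambda>v. fder (G \<circ> chart_inv c) (F x) (fder F x v))) (at x)"
      by (intro has_derivative_transform_within_open[OF 1 B(1) x]) auto
    from has_derivative_unique[OF this has_derivative_ident]
    have "fder (G \<circ> chart_inv c) (F x) (fder F x v) = v" for v by (rule fun_cong)
    then show ?thesis by (rule inj_on_inverseI)
  qed
  \<comment> \<open>For small \<open>v\<close> the image of the ray is a geodesic with initial
    velocity \<open>v\<close>; other vectors are reached by scaling below.\<close>
  have d0: "fder F 0 v = v" if v: "v \<in> B" for v
  proof -
    obtain \<gamma> where \<gamma>: "is_exp_geodesic A g c p v \<gamma>" using geo[OF v] by blast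
    then obtain I where I: "geodesic_on A g I \<gamma>" "{0..1} \<subseteq> I" "\<gamma> 0 = p" "velocity c \<gamma> 0 = v"
      unfolding is_exp_geodesic_def by blast
    have "0 \<in> I" "\<gamma> 0 \<in> chart_dom c" using I p by auto
    from eventually_nhds_x_imp_x[OF geodesic_in_chart[OF I(1) c this]]
    have "((\<lambda>s. chart_map c (\<gamma> s)) has_vector_derivative velocity c \<gamma> 0) (at 0)"
      using m.spray_solution_iff[of "\<lambda>s. chart_map c (\<gamma> s)" "velocity c \<gamma>" 0] by blast
    \<comment> \<open>The exponential map is known to follow \<open>\<gamma>\<close> for times in
      [0, 1], so the derivatives at 0 are compared from the right.\<close>
    then have 1: "((\<lambda>s. chart_map c (\<gamma> s)) has_vector_derivative v) (at 0 within {0..1})"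
      unfolding I(4) by (rule has_vector_derivative_at_within)
    have "((\<lambda>s. F (s *\<^sub>R v)) has_vector_derivative fder F (0 *\<^sub>R v) v) (at 0)"
      by (rule smooth_on_ray_derivative[OF F_smooth]) (simp add: B)
    then have 2: "((\<lambda>s. F (s *\<^sub>R v)) has_vector_derivative fder F 0 v) (at 0 within {0..1})"
      by (simp add: has_vector_derivative_at_within)
    have "((\<lambda>s. chart_map c (\<gamma> s)) has_vector_derivative fder F 0 v) (at 0 within {0..1})"
      by (rule has_vector_derivative_transform[OF _ _ 2]) (simp_all add: F_def exp_map_ray[OF c p \<gamma>])
    from vector_derivative_unique_within[OF _ this 1] show ?thesis
      by (simp add: trivial_limit_within islimpt_Icc)
  qed
  have dF0: "fder F 0 = (\<lambda>v. v)"
  proof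
    fix v :: 'e
    have lin: "linear (fder F 0)" by (rule has_derivative_linear[OF smooth_on_has_derivative[OF F_smooth B(2)]])
    define k where "k = \<epsilon> / (norm v + 1)"
    have "norm v + 1 > 0" using norm_ge_zero[of v] by linarith
    then have k: "k > 0" "k * (norm v + 1) = \<epsilon>" using \<epsilon>(1) by (simp_all add: k_def)
    have "k * norm v < \<epsilon>" using k by (simp add: algebra_simps)
    then have "k *\<^sub>R v \<in> B" using k(1) by (simp add: B_def)
    from d0[OF this] have "k *\<^sub>R fder F 0 v = k *\<^sub>R v" by (simp add: linear_scale[OF lin])
    then show "fder F 0 v = v" using k(1) by simp
  qed
  have ray: "((\<lambda>t. fder F (t *\<^sub>R x) x) has_vector_derivative
       - christoffel (g c) (F x) (fder F x x) (fder F x x)) (at 1)" if x: "x \<in> B" for x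
  proof -
    have "\<forall>\<^sub>F t in nhds 1. t *\<^sub>R x \<in> B"
    proof -
      have "continuous_on UNIV (\<lambda>t. t *\<^sub>R x)" by (intro continuous_intros)
      from continuous_open_preimage[OF this open_UNIV B(1)]
      have "\<forall>\<^sub>F t in nhds 1. t \<in> (\<lambda>t. t *\<^sub>R x) -` B"
        by (intro eventually_nhds_in_open) (simp_all add: x)
      then show ?thesis by simp
    qed
    then obtain S where S: "open S" "1 \<in> S" "\<And>t. t \<in> S \<Longrightarrow> t *\<^sub>R x \<in> B" unfolding eventually_nhds by blast
    \<comment> \<open>The geodesic of \<open>x\<close> describes the exponential map on the ray up
      to time 1 only, while a derivative at time 1 looks at both sides. So the geodesic of the
      longer vector \<open>(1 + \<eta>) *\<^sub>R x\<close> is taken and slowed down by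
      \<open>\<sigma>\<close>.\<close>
    then obtain \<eta> where \<eta>: "\<eta> > 0" "cball 1 \<eta> \<subseteq> S" using open_contains_cball by blast
    have "(1 + \<eta>) *\<^sub>R x \<in> B" by (rule S(3)) (use \<eta> in \<open>auto simp: dist_real_def\<close>)
    from geo[OF this] obtain \<gamma> where \<gamma>: "is_exp_geodesic A g c p ((1 + \<eta>) *\<^sub>R x) \<gamma>" by blast
    then obtain I where I: "geodesic_on A g I \<gamma>" "{0..1} \<subseteq> I" unfolding is_exp_geodesic_def by blast
    define \<sigma> where "\<sigma> = 1 / (1 + \<eta>)"
    have \<sigma>: "\<sigma> * (1 + \<eta>) = 1" "\<sigma> > 0" using \<eta>(1) by (auto simp: \<sigma>_def)
    define \<delta> where "\<delta> t = \<gamma> (\<sigma> * t)" for t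
    have \<delta>: "geodesic_on A g ((\<lambda>t. \<sigma> * t) -` I) \<delta>"
      unfolding \<delta>_def by (rule geodesic_rescale(1)[OF I(1)])
    have e\<delta>: "?e (t *\<^sub>R x) = \<delta> t" if "t \<in> {0<..<1 + \<eta>}" for t
    proof -
      have "\<sigma> * t \<le> \<sigma> * (1 + \<eta>)" using that \<sigma>(2) by (intro mult_left_mono) auto
      then have "\<sigma> * t \<in> {0..1}" using that \<sigma> by simp
      from exp_map_ray[OF c p \<gamma> this] have "?e ((\<sigma> * t * (1 + \<eta>)) *\<^sub>R x) = \<delta> t" by (simp add: \<delta>_def)
      moreover have "\<sigma> * t * (1 + \<eta>) = t" using arg_cong[OF \<sigma>(1), of "\<lambda>s. t * s"] by (simp add: ac_simps)
      ultimately show ?thesis by simp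
    qed
    have e1: "?e x = \<delta> 1" using e\<delta>[of 1] \<eta>(1) by simp
    have ev: "\<forall>\<^sub>F t in nhds 1. t \<in> {0<..<1 + \<eta>}"
      by (rule eventually_nhds_in_open) (use \<eta> in auto)
    have evS: "\<forall>\<^sub>F t in nhds 1. t \<in> S" by (rule eventually_nhds_in_open[OF S(1,2)])
    have "\<sigma> \<in> {0..1}" using \<eta>(1) by (simp add: \<sigma>_def)
    then have "1 \<in> (\<lambda>t. \<sigma> * t) -` I" using I(2) by auto
    moreover have "\<delta> 1 \<in> chart_dom c" using e1 x B(4) by force
    ultimately have "\<forall>\<^sub>F s in nhds 1. ((\<lambda>s. (chart_map c (\<delta> s), velocity c \<delta> s)) has_vector_derivative
       m.spray (chart_map c (\<delta> s), velocity c \<delta> s)) (at s)"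
      by (rule eventually_mono[OF geodesic_in_chart[OF \<delta> c]]) blast
    then have sol: "\<forall>\<^sub>F s in nhds 1. ((\<lambda>s. chart_map c (\<delta> s)) has_vector_derivative velocity c \<delta> s) (at s) \<and>
       (velocity c \<delta> has_vector_derivative - christoffel (g c) (chart_map c (\<delta> s)) (velocity c \<delta> s) (velocity c \<delta> s)) (at s)"
      unfolding m.spray_solution_iff[where x = "\<lambda>s. chart_map c (\<delta> s)" and v = "velocity c \<delta>"] .
    have ev': "\<forall>\<^sub>F s in nhds 1. \<forall>\<^sub>F t in nhds s. chart_map c (\<delta> t) = F (t *\<^sub>R x)"
      unfolding eventually_eventually using ev by eventually_elim (simp add: F_def e\<delta>)
    have vel: "\<forall>\<^sub>F s in nhds 1. velocity c \<delta> s = fder F (s *\<^sub>R x) x"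
      using sol ev' evS
    proof eventually_elim
      case (elim s)
      show ?case
        by (rule vector_derivative_unique_at[OF has_vector_derivative_eventually_cong[OF conjunct1[OF elim(1)] elim(2)]
              smooth_on_ray_derivative[OF F_smooth S(3)[OF elim(3)]]])
    qed
    have "velocity c \<delta> 1 = fder F x x" "chart_map c (\<delta> 1) = F x"
      using eventually_nhds_x_imp_x[OF vel] e1 by (simp_all add: F_def)
    with has_vector_derivative_eventually_cong[OF conjunct2[OF eventually_nhds_x_imp_x[OF sol]] vel]
    show ?thesis by simp
  qed
  have "radial_geodesic_map (chart_ran c) (g c) B F"
  proof (intro radial_geodesic_map.intro radial_geodesic_map_axioms.intro m.local_metric_axioms B(1,2) F_smooth inj ray)
    show "t *\<^sub>R x \<in> B" if "x \<in> B" "0 \<le> t" "t \<le> 1" for x t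
      using that mult_left_le_one_le[of "norm x" t] by (simp add: B_def)
    show "F ` B \<subseteq> chart_ran c"
    proof (rule image_subsetI)
      fix v assume "v \<in> B"
      then have "?e v \<in> chart_dom c" using B(4) by blast
      then show "F v \<in> chart_ran c" unfolding F_def by (rule chart_map_in)
    qed
  qed
  then show thesis using B(3,4) F0 dF0 by (rule that)
qed

text \<open>Umbilicity is a condition at each point, so the part of each sphere inside the small
  ball \<open>B\<close> suffices, although the normal field is that of the full sphere in
  \<open>T\<close>.\<close>

lemma umbilical_spheres_imp_constant_curvature:
  assumes dim: "DIM('e) \<ge> 2" and c: "c \<in> A" and p: "p \<in> chart_dom c" and nn: "normal_neighborhood A g c p T"
    and umb: "\<And>r. r \<noteq> 0 \<Longrightarrow> totally_umbilical A g (geodesic_sphere A g c p T r)"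
  shows "\<exists>K. local_metric.constant_curvature_at (g c) K (chart_map c p)"
proof -
  define F where "F v = chart_map c (exp_map A g c p v)" for v
  obtain B where "radial_geodesic_map (chart_ran c) (g c) B F" and BT: "B \<subseteq> T" and Bc: "exp_map A g c p ` B \<subseteq> chart_dom c"
    and F0: "F 0 = chart_map c p" and dF0: "fder F 0 = (\<lambda>v. v)"
    using radial_map_of_normal_neighborhood[OF c p nn] unfolding F_def by metis
  then interpret rad: radial_geodesic_map "chart_ran c" "g c" B F by blast
  have p0: "rad.pullback 0 u v = g c (chart_map c p) u v" for u v by (simp add: rad.pullback_def F0 dF0)
  have "\<exists>K. rad.iso.M1.constant_curvature_at K 0"
  proof (rule rad.normal.umbilical_imp_constant_curvature[OF dim])
    fix x X assume x: "x \<in> B" and r: "rad.pullback 0 x x \<noteq> 0" and xX: "rad.pullback 0 x X = 0" and XX: "rad.pullback x X X \<noteq> 0"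
    define r where "r = rad.pullback 0 x x"
    let ?\<Sigma> = "geodesic_sphere A g c p T r"
    have N: "F ` {x \<in> B. rad.pullback 0 x x = r} \<subseteq> chart_map c ` (?\<Sigma> \<inter> chart_dom c)"
      using BT Bc by (auto simp: F_def p0 geodesic_sphere_def)
    have "exp_map A g c p x \<in> ?\<Sigma>" using x BT by (auto simp: geodesic_sphere_def r_def p0)
    moreover have "exp_map A g c p x \<in> chart_dom c" using x Bc by blast
    moreover have "r \<noteq> 0" using r by (simp add: r_def)
    ultimately obtain V \<xi> where V: "unit_normal_field (g c) c ?\<Sigma> V \<xi>" "F x \<in> V"
      and \<kappa>: "\<And>X. X \<in> tangent_space c ?\<Sigma> (F x) \<Longrightarrow> g c (F x) X X \<noteq> 0 \<Longrightarrow>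
        \<exists>\<kappa>. shape_operator (g c) \<xi> (F x) X = \<kappa> *\<^sub>R X"
      using umb[of r] c unfolding totally_umbilical_def F_def by blast
    have "fder F x X \<in> tangent_space c ?\<Sigma> (F x)"
      by (rule rad.sphere_tangent_vector[OF N x r_def[symmetric] \<open>r \<noteq> 0\<close> xX])
    from \<kappa>[OF this] XX obtain \<kappa> where "shape_operator (g c) \<xi> (F x) (fder F x X) = \<kappa> *\<^sub>R fder F x X"
      by (auto simp: rad.pullback_def)
    from rad.umbilical_sphere_radial[OF N V(1) x r_def[symmetric] \<open>r \<noteq> 0\<close> V(2) xX this]
    show "\<exists>\<mu>. christoffel rad.pullback x X x = \<mu> *\<^sub>R X" .
  qed
  then show ?thesis using rad.iso.constant_curvature_at_iff[OF rad.B_0] F0 by auto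
qed

section \<open>From pointwise to global constancy\<close>

lemma constant_curvature_at_chart_independent:
  assumes c: "c \<in> A" "p \<in> chart_dom c" and d: "d \<in> A" "p \<in> chart_dom d"
  shows "local_metric.constant_curvature_at (g c) K (chart_map c p) \<longleftrightarrow>
    local_metric.constant_curvature_at (g d) K (chart_map d p)"
proof -
  interpret local_isometry "overlap c d" "g c" "chart_ran d" "g d" "transition c d"
    by (rule transition_isometry[OF c(1) d(1)])
  have "chart_map c p \<in> overlap c d" using overlap_iff[OF c] d(2) by blast
  from constant_curvature_at_iff[OF this] show ?thesis by (simp add: transition_apply[OF c])
qed

lemma constant_sectional_curvature_iff:
  assumes "DIM('e) \<ge> 2"
  shows "constant_sectional_curvature A g \<longleftrightarrow>
    (\<exists>K. \<forall>c\<in>A. \<forall>p\<in>chart_dom c. local_metric.constant_curvature_at (g c) K (chart_map c p))"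
  unfolding constant_sectional_curvature_def
  using local_metric.sectional_curvature_constant_iff[OF chart_metric assms chart_map_in]
  by (simp cong: ball_cong)

lemma pointwise_imp_constant_sectional_curvature:
  assumes conn: "connected (UNIV :: 'a set)" and dim: "DIM('e) \<ge> 3"
    and ex: "\<And>c p. c \<in> A \<Longrightarrow> p \<in> chart_dom c \<Longrightarrow> \<exists>K. local_metric.constant_curvature_at (g c) K (chart_map c p)"
  shows "constant_sectional_curvature A g"
proof -
  have dim2: "DIM('e) \<ge> 2" using dim by simp
  have "\<exists>K. \<forall>c\<in>A. p \<in> chart_dom c \<longrightarrow> local_metric.constant_curvature_at (g c) K (chart_map c p)" for p
  proof -
    obtain d where d: "d \<in> A" "p \<in> chart_dom d" using exists_chart by blast
    then show ?thesis using ex[OF d] constant_curvature_at_chart_independent[OF _ _ d] by blast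
  qed
  then obtain K where K: "\<And>c p. c \<in> A \<Longrightarrow> p \<in> chart_dom c \<Longrightarrow> local_metric.constant_curvature_at (g c) (K p) (chart_map c p)"
    by metis
  have "\<forall>\<^sub>F q in nhds p. K p = K q" for p
  proof -
    obtain c where c: "c \<in> A" "p \<in> chart_dom c" using exists_chart by blast
    interpret m: local_metric "chart_ran c" "g c" by (rule chart_metric[OF c(1)])
    obtain e where e: "e > 0" "ball (chart_map c p) e \<subseteq> chart_ran c"
      using chart_ran_open[OF c(1)] chart_map_in[OF c(2)] open_contains_ball by blast
    have Kx: "m.constant_curvature_at (K (chart_inv c x)) x" if "x \<in> chart_ran c" for x
      using K[OF c(1) chart_inv_in[OF c(1) that]] by (simp add: chart_map_inv[OF c(1) that])
    have "((\<lambda>x. K (chart_inv c x)) has_derivative (\<lambda>_. 0)) (at x within ball (chart_map c p) e)"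
      if "x \<in> ball (chart_map c p) e" for x
      by (rule has_derivative_at_withinI[OF m.schur[where K = "\<lambda>x. K (chart_inv c x)", OF dim subsetD[OF e(2) that] Kx]])
    from has_derivative_zero_constant[OF convex_ball this] obtain k where k: "\<And>x. x \<in> ball (chart_map c p) e \<Longrightarrow> K (chart_inv c x) = k" by blast
    have "\<forall>\<^sub>F q in nhds p. q \<in> chart_inv c ` ball (chart_map c p) e"
      by (rule eventually_nhds_in_open[OF chart_inv_image_open[OF c(1) open_ball e(2)]])
        (rule image_eqI[of _ _ "chart_map c p"], simp_all add: chart_inv_map[OF c] e)
    then show ?thesis
    proof eventually_elim
      case (elim q)
      then have "K q = k" using k by auto
      moreover have "K p = k" using k[of "chart_map c p"] e(1) by (simp add: chart_inv_map[OF c])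
      ultimately show ?case by simp
    qed
  qed
  then have loc: "\<forall>p\<in>UNIV. \<forall>\<^sub>F q in at p within UNIV. K p = K q"
    using filter_leD[OF at_within_le_nhds] by blast
  have "K p = K q" for p q
    by (rule connected_local_const[OF conn UNIV_I UNIV_I loc])
  \<comment> \<open>\<open>undefined\<close> merely names some point; the value of \<open>K\<close>
    is the same at all of them.\<close>
  then have "\<forall>c\<in>A. \<forall>p\<in>chart_dom c. local_metric.constant_curvature_at (g c) (K undefined) (chart_map c p)"
    using K by metis
  then show ?thesis unfolding constant_sectional_curvature_iff[OF dim2] by blast
qed

end

theorem theorem9:
  fixes A :: "('a::{t2_space, second_countable_topology}, 'e::euclidean_space) chart set"
    and g :: "('a, 'e) chart \<Rightarrow> 'e \<Rightarrow> 'e \<Rightarrow> 'e \<Rightarrow> real"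
    and m \<nu> :: nat
  assumes "semi_riemannian_manifold A g \<nu>"
    and "connected (UNIV :: 'a set)"
    and "DIM('e) = m + 1" and "m \<ge> 2"
  shows "constant_sectional_curvature A g \<longleftrightarrow>
    (\<forall>p. \<forall>c\<in>A. p \<in> chart_dom c \<longrightarrow>
      (\<exists>T. normal_neighborhood A g c p T \<and>
        (\<forall>R>0. totally_umbilical A g (geodesic_sphere A g c p T (R\<^sup>2)) \<and>
               totally_umbilical A g (geodesic_sphere A g c p T (- (R\<^sup>2))))))"
proof -
  interpret semi_riemannian_manifold A g \<nu> by fact
  \<comment> \<open>The first bound serves the algebra at a point, the second Schur's lemma.\<close>
  have dim: "DIM('e) \<ge> 2" "DIM('e) \<ge> 3" using assms(3,4) by auto
  show ?thesis
  proof (intro iffI allI ballI impI)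
    fix p c assume "constant_sectional_curvature A g" and c: "c \<in> A" "p \<in> chart_dom c"
    then obtain K where K: "\<And>p. p \<in> chart_dom c \<Longrightarrow> local_metric.constant_curvature_at (g c) K (chart_map c p)"
      unfolding constant_sectional_curvature_iff[OF dim(1)] by blast
    obtain T F G where "geodesic_ball A g \<nu> c T F p G" by (rule exists_geodesic_ball[OF c])
    then interpret geodesic_ball A g \<nu> c T F p G .
    have "totally_umbilical A g (geodesic_sphere A g c p T r)" if "r \<noteq> 0" for r
      by (rule geodesic_sphere_umbilical[OF _ that]) (use K in \<open>auto simp: chart_ran_def\<close>)
    then show "\<exists>T. normal_neighborhood A g c p T \<and>
        (\<forall>R>0. totally_umbilical A g (geodesic_sphere A g c p T (R\<^sup>2)) \<and>
               totally_umbilical A g (geodesic_sphere A g c p T (- (R\<^sup>2))))"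
      using ball_normal_neighborhood by (intro exI[of _ T]) auto
  next
    assume umb: "\<forall>p. \<forall>c\<in>A. p \<in> chart_dom c \<longrightarrow>
      (\<exists>T. normal_neighborhood A g c p T \<and>
        (\<forall>R>0. totally_umbilical A g (geodesic_sphere A g c p T (R\<^sup>2)) \<and>
               totally_umbilical A g (geodesic_sphere A g c p T (- (R\<^sup>2)))))"
    show "constant_sectional_curvature A g"
    proof (rule pointwise_imp_constant_sectional_curvature[OF assms(2) dim(2)])
      fix c p assume c: "c \<in> A" "p \<in> chart_dom c"
      then obtain T where T: "normal_neighborhood A g c p T"
        and pos: "\<And>R. R > 0 \<Longrightarrow> totally_umbilical A g (geodesic_sphere A g c p T (R\<^sup>2))"
        and neg: "\<And>R. R > 0 \<Longrightarrow> totally_umbilical A g (geodesic_sphere A g c p T (- (R\<^sup>2)))"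
        using umb by blast
      \<comment> \<open>Every nonzero \<open>r\<close> is the square of a positive number or the
        negative of such a square.\<close>
      have "totally_umbilical A g (geodesic_sphere A g c p T r)" if "r \<noteq> 0" for r
        using pos[of "sqrt r"] neg[of "sqrt (- r)"] that by (cases "r > 0") auto
      from umbilical_spheres_imp_constant_curvature[OF dim(1) c T this]
      show "\<exists>K. local_metric.constant_curvature_at (g c) K (chart_map c p)" .
    qed
  qed
qed

end
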